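(* Let $\Bbbk$ be a separably closed field of characteristic $p>0$ and let $G$ be a cyclic $p$-group. Let $A$ be a commutative and separable ring-object in the stable category $\Bbbk G\text{-}\mathrm{stmod}$ of finitely generated $\Bbbk G$-modules modulo projectives. Then there exist subgroups $H_1,\ldots,H_r\le G$ and an isomorphism of ring-objects $A\simeq \Bbbk(G/H_1)\times\cdots\times\Bbbk(G/H_r)$ in $\Bbbk G\text{-}\mathrm{stmod}$.
   Context: For a finite group $G$ and a field $\Bbbk$, $\Bbbk G\text{-}\mathrm{mod}$ is the category of finitely generated $\Bbbk G$-modules, and $\Bbbk G\text{-}\mathrm{stmod}$ is the category with the same objects and morphisms $\mathrm{Hom}_{\Bbbk G}(M,N)/\mathrm{PHom}_{\Bbbk G}(M,N)$, where $\mathrm{PHom}_{\Bbbk G}(M,N)$ is the space of homomorphisms factoring through a projective module. Both are symmetric monoidal with $\otimes=\otimes_{\Bbbk}$ (diagonal $G$-action) and unit $\mathbb{1}=\Bbbk$ (trivial action). A ring-object in an additive symmetric monoidal category (with $\otimes$ additive in each variable) is a triple $(A,\mu,u)$ with $\mu:A\otimes A\to A$ associative and $u:\mathbb{1}\to A$ a two-sided unit; it is commutative if $\mu\circ(12)=\mu$, where $(12)$ is the swap of factors of $A\otimes A$. It is separable if there exists a morphism $\sigma:A\to A\otimes A$ with $\mu\sigma=1_A$ and $\sigma\mu=(\mu\otimes A)(A\otimes\sigma)=(A\otimes\mu)(\sigma\otimes A)$. For $H\le G$, the permutation module $\Bbbk(G/H)$ is a ring-object with multiplication the $\Bbbk$-linear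 extension of $\mu(x\otimes x)=x$ and $\mu(x\otimes x')=0$ for $x\ne x'$ in $G/H$, and unit $1\mapsto\sum_{x\in G/H}x$. *)

theory Defs
  imports
    "HOL-Algebra.Algebraic_Closure_Type"
    "HOL-Algebra.Elementary_Groups"
    "HOL-Algebra.Left_Coset"
    "HOL-Library.Poly_Mapping"
begin

text \<open>
  The ground field is a type \<open>'k\<close> of class \<open>field\<close>; \<open>ring_of_type_algebra\<close> is the library's
  record for it. The group is a \<open>HOL-Algebra\<close> group.
\<close>

definition separably_closed :: "'k::field itself \<Rightarrow> bool" where
  "separably_closed _ \<longleftrightarrow>
     (\<forall>f :: 'k poly. irreducible f \<and> coprime f (pderiv f) \<longrightarrow> Polynomial.degree f = 1)"


section \<open>Modules over a group algebra\<close>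

text \<open>
  A module over the group algebra is encoded as a \<open>'k\<close>-module with a \<open>'k\<close>-linear action of the
  group. The fields \<open>mult\<close> and \<open>one\<close> that \<open>HOL-Algebra\<close>'s module record inherits from rings are
  never used.
\<close>

record ('g, 'k, 'a) rep = "('k, 'a) module" +
  act :: "'g \<Rightarrow> 'a \<Rightarrow> 'a"

definition kG_module :: "('g, 'z) monoid_scheme \<Rightarrow> ('g, 'k::field, 'a) rep \<Rightarrow> bool" where
  "kG_module G M \<longleftrightarrow>
     group G \<and> Module.module (ring_of_type_algebra :: 'k ring) M \<and>
     (\<forall>g\<in>carrier G. \<forall>x\<in>carrier M. act M g x \<in> carrier M) \<and>
     (\<forall>g\<in>carrier G. \<forall>x\<in>carrier M. \<forall>y\<in>carrier M.
        act M g (x \<oplus>\<^bsub>M\<^esub> y) = act M g x \<oplus>\<^bsub>M\<^esub> act M g y) \<and>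
     (\<forall>g\<in>carrier G. \<forall>c. \<forall>x\<in>carrier M. act M g (c \<odot>\<^bsub>M\<^esub> x) = c \<odot>\<^bsub>M\<^esub> act M g x) \<and>
     (\<forall>x\<in>carrier M. act M \<one>\<^bsub>G\<^esub> x = x) \<and>
     (\<forall>g\<in>carrier G. \<forall>h\<in>carrier G. \<forall>x\<in>carrier M.
        act M (g \<otimes>\<^bsub>G\<^esub> h) x = act M g (act M h x))"

definition kG_submodule ::
    "('g, 'z) monoid_scheme \<Rightarrow> 'a set \<Rightarrow> ('g, 'k::field, 'a) rep \<Rightarrow> bool" where
  "kG_submodule G N M \<longleftrightarrow>
     submodule N (ring_of_type_algebra :: 'k ring) M \<and>
     (\<forall>g\<in>carrier G. \<forall>x\<in>N. act M g x \<in> N)"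

definition fg_kG_module :: "('g, 'z) monoid_scheme \<Rightarrow> ('g, 'k::field, 'a) rep \<Rightarrow> bool" where
  "fg_kG_module G M \<longleftrightarrow>
     kG_module G M \<and>
     (\<exists>S. finite S \<and> S \<subseteq> carrier M \<and>
        (\<forall>N. kG_submodule G N M \<and> S \<subseteq> N \<longrightarrow> N = carrier M))"

text \<open>Homomorphisms are extensional functions, so that equal morphisms are equal functions.\<close>

definition kG_hom ::
    "('g, 'z) monoid_scheme \<Rightarrow> ('g, 'k::field, 'a) rep \<Rightarrow> ('g, 'k, 'b) rep \<Rightarrow> ('a \<Rightarrow> 'b) set" where
  "kG_hom G M N =
     {f \<in> carrier M \<rightarrow>\<^sub>E carrier N.
        (\<forall>x\<in>carrier M. \<forall>y\<in>carrier M. f (x \<oplus>\<^bsub>M\<^esub> y) = f x \<oplus>\<^bsub>N\<^esub> f y) \<and>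
        (\<forall>c. \<forall>x\<in>carrier M. f (c \<odot>\<^bsub>M\<^esub> x) = c \<odot>\<^bsub>N\<^esub> f x) \<and>
        (\<forall>g\<in>carrier G. \<forall>x\<in>carrier M. f (act M g x) = act N g (f x))}"

text \<open>
  For a finite group every finitely generated module has finite dimension over \<open>'k\<close>, hence is
  isomorphic to one carried by a set of coordinate vectors. So quantifying over
  modules with elements in \<^typ>\<open>nat \<Rightarrow> 'k\<close> amounts to quantifying over all of them.
\<close>

type_synonym ('g, 'k) coord_rep = "('g, 'k, nat \<Rightarrow> 'k) rep"

definition projective_kG ::
    "('g, 'z) monoid_scheme \<Rightarrow> ('g, 'k::field, 'a) rep \<Rightarrow> bool" where
  "projective_kG G P \<longleftrightarrow>
     fg_kG_module G P \<and>
     (\<forall>(M :: ('g, 'k) coord_rep) (N :: ('g, 'k) coord_rep). \<forall>e f.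
        fg_kG_module G M \<and> fg_kG_module G N \<and>
        e \<in> kG_hom G M N \<and> e ` carrier M = carrier N \<and> f \<in> kG_hom G P N \<longrightarrow>
        (\<exists>h\<in>kG_hom G P M. compose (carrier P) e h = f))"


section \<open>Tensor products over the ground field\<close>

text \<open>
  The tensor product is the free \<open>'k\<close>-module on the product of the carriers, i.e. the finitely
  supported functions on it, modulo the submodule spanned by the bilinearity relations.
\<close>

definition pm_scale :: "'k::field \<Rightarrow> ('x \<Rightarrow>\<^sub>0 'k) \<Rightarrow> ('x \<Rightarrow>\<^sub>0 'k)" where
  "pm_scale c \<phi> = Poly_Mapping.map ((*) c) \<phi>"

definition free_on :: "'x set \<Rightarrow> ('x \<Rightarrow>\<^sub>0 'k::field) set" where
  "free_on S = {\<phi>. Poly_Mapping.keys \<phi> \<subseteq> S}"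

abbreviation pm_basis :: "'x \<Rightarrow> ('x \<Rightarrow>\<^sub>0 'k::field)" where
  "pm_basis x \<equiv> Poly_Mapping.single x 1"

inductive_set bilinear_relations ::
    "('k::field, 'a, 'y) module_scheme \<Rightarrow> ('k, 'b, 'z) module_scheme \<Rightarrow> ('a \<times> 'b \<Rightarrow>\<^sub>0 'k) set"
  for M :: "('k::field, 'a, 'y) module_scheme" and N :: "('k, 'b, 'z) module_scheme" where
  add_left: "\<lbrakk>x \<in> carrier M; x' \<in> carrier M; y \<in> carrier N\<rbrakk> \<Longrightarrow>
     pm_basis (x \<oplus>\<^bsub>M\<^esub> x', y) - pm_basis (x, y) - pm_basis (x', y) \<in> bilinear_relations M N"
| add_right: "\<lbrakk>x \<in> carrier M; y \<in> carrier N; y' \<in> carrier N\<rbrakk> \<Longrightarrow>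
     pm_basis (x, y \<oplus>\<^bsub>N\<^esub> y') - pm_basis (x, y) - pm_basis (x, y') \<in> bilinear_relations M N"
| smult_left: "\<lbrakk>x \<in> carrier M; y \<in> carrier N\<rbrakk> \<Longrightarrow>
     pm_basis (c \<odot>\<^bsub>M\<^esub> x, y) - pm_scale c (pm_basis (x, y)) \<in> bilinear_relations M N"
| smult_right: "\<lbrakk>x \<in> carrier M; y \<in> carrier N\<rbrakk> \<Longrightarrow>
     pm_basis (x, c \<odot>\<^bsub>N\<^esub> y) - pm_scale c (pm_basis (x, y)) \<in> bilinear_relations M N"
| zero: "0 \<in> bilinear_relations M N"
| plus: "\<lbrakk>\<phi> \<in> bilinear_relations M N; \<psi> \<in> bilinear_relations M N\<rbrakk> \<Longrightarrow>
     \<phi> + \<psi> \<in> bilinear_relations M N"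
| scale: "\<phi> \<in> bilinear_relations M N \<Longrightarrow> pm_scale c \<phi> \<in> bilinear_relations M N"

definition tensor_rel ::
    "('k::field, 'a, 'y) module_scheme \<Rightarrow> ('k, 'b, 'z) module_scheme \<Rightarrow>
     (('a \<times> 'b \<Rightarrow>\<^sub>0 'k) \<times> ('a \<times> 'b \<Rightarrow>\<^sub>0 'k)) set" where
  "tensor_rel M N =
     {(\<phi>, \<psi>). \<phi> \<in> free_on (carrier M \<times> carrier N) \<and> \<psi> \<in> free_on (carrier M \<times> carrier N) \<and>
             \<phi> - \<psi> \<in> bilinear_relations M N}"

definition tensor_module ::
    "('k::field, 'a, 'y) module_scheme \<Rightarrow> ('k, 'b, 'z) module_scheme \<Rightarrow>
     ('k, ('a \<times> 'b \<Rightarrow>\<^sub>0 'k) set) module" where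
  "tensor_module M N =
     \<lparr>carrier = free_on (carrier M \<times> carrier N) // tensor_rel M N,
      monoid.mult = undefined, one = undefined,
      ring.zero = tensor_rel M N `` {0},
      add = (\<lambda>S T. \<Union>\<phi>\<in>S. \<Union>\<psi>\<in>T. tensor_rel M N `` {\<phi> + \<psi>}),
      module.smult = (\<lambda>c S. \<Union>\<phi>\<in>S. tensor_rel M N `` {pm_scale c \<phi>})\<rparr>"

definition pure_tensor ::
    "('k::field, 'a, 'y) module_scheme \<Rightarrow> ('k, 'b, 'z) module_scheme \<Rightarrow> 'a \<Rightarrow> 'b \<Rightarrow>
     ('a \<times> 'b \<Rightarrow>\<^sub>0 'k) set" where
  "pure_tensor M N x y = tensor_rel M N `` {pm_basis (x, y)}"

text \<open>
  The linear map out of the tensor product induced by a bilinear map \<open>b\<close>: it is evaluated on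
  any representative, the value being independent of the choice when \<open>b\<close> is bilinear.
\<close>

definition tensor_lift ::
    "('k::field, 'a, 'y) module_scheme \<Rightarrow> ('k, 'b, 'z) module_scheme \<Rightarrow>
     ('k, 'c, 'w) module_scheme \<Rightarrow> ('a \<Rightarrow> 'b \<Rightarrow> 'c) \<Rightarrow> ('a \<times> 'b \<Rightarrow>\<^sub>0 'k) set \<Rightarrow> 'c" where
  "tensor_lift M N P b =
     (\<lambda>S \<in> carrier (tensor_module M N).
        the_elem ((\<lambda>\<phi>. \<Oplus>\<^bsub>P\<^esub>z\<in>Poly_Mapping.keys \<phi>.
                           Poly_Mapping.lookup \<phi> z \<odot>\<^bsub>P\<^esub> b (fst z) (snd z)) ` S))"

definition tensor ::
    "('g, 'k::field, 'a) rep \<Rightarrow> ('g, 'k, 'b) rep \<Rightarrow> ('g, 'k, ('a \<times> 'b \<Rightarrow>\<^sub>0 'k) set) rep"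
    (infixr \<open>\<otimes>\<^sub>k\<close> 70) where
  "M \<otimes>\<^sub>k N = module.extend (tensor_module M N)
     (rep.fields (\<lambda>g. tensor_lift M N (tensor_module M N)
                         (\<lambda>x y. pure_tensor M N (act M g x) (act N g y))))"

definition unit_rep :: "('g, 'k::field, 'k) rep" (\<open>\<one>\<^sub>k\<close>) where
  "\<one>\<^sub>k = \<lparr>carrier = UNIV, monoid.mult = (*), one = 1, ring.zero = 0, add = (+),
           module.smult = (*), act = (\<lambda>g x. x)\<rparr>"

definition id_hom :: "('g, 'k::field, 'a) rep \<Rightarrow> 'a \<Rightarrow> 'a" where
  "id_hom M = (\<lambda>x \<in> carrier M. x)"

definition tensor_hom ::
    "('g, 'k::field, 'a) rep \<Rightarrow> ('g, 'k, 'b) rep \<Rightarrow> ('g, 'k, 'c) rep \<Rightarrow> ('g, 'k, 'd) rep \<Rightarrow>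
     ('a \<Rightarrow> 'c) \<Rightarrow> ('b \<Rightarrow> 'd) \<Rightarrow> ('a \<times> 'b \<Rightarrow>\<^sub>0 'k) set \<Rightarrow> ('c \<times> 'd \<Rightarrow>\<^sub>0 'k) set" where
  "tensor_hom M N M' N' f g =
     tensor_lift M N (M' \<otimes>\<^sub>k N') (\<lambda>x y. pure_tensor M' N' (f x) (g y))"

definition swap_hom ::
    "('g, 'k::field, 'a) rep \<Rightarrow> ('g, 'k, 'b) rep \<Rightarrow>
     ('a \<times> 'b \<Rightarrow>\<^sub>0 'k) set \<Rightarrow> ('b \<times> 'a \<Rightarrow>\<^sub>0 'k) set" where
  "swap_hom M N = tensor_lift M N (N \<otimes>\<^sub>k M) (\<lambda>x y. pure_tensor N M y x)"

definition assoc_hom where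
  "assoc_hom (L :: ('g, 'k::field, 'a) rep) (M :: ('g, 'k, 'b) rep) (N :: ('g, 'k, 'c) rep) =
     tensor_lift (L \<otimes>\<^sub>k M) N (L \<otimes>\<^sub>k (M \<otimes>\<^sub>k N))
       (\<lambda>t z. tensor_lift L M (L \<otimes>\<^sub>k (M \<otimes>\<^sub>k N))
                (\<lambda>x y. pure_tensor L (M \<otimes>\<^sub>k N) x (pure_tensor M N y z)) t)"

definition assoc_inv_hom where
  "assoc_inv_hom (L :: ('g, 'k::field, 'a) rep) (M :: ('g, 'k, 'b) rep) (N :: ('g, 'k, 'c) rep) =
     tensor_lift L (M \<otimes>\<^sub>k N) ((L \<otimes>\<^sub>k M) \<otimes>\<^sub>k N)
       (\<lambda>x t. tensor_lift M N ((L \<otimes>\<^sub>k M) \<otimes>\<^sub>k N)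
                (\<lambda>y z. pure_tensor (L \<otimes>\<^sub>k M) N (pure_tensor L M x y) z) t)"

definition left_unit_hom ::
    "('g, 'k::field, 'a) rep \<Rightarrow> ('k \<times> 'a \<Rightarrow>\<^sub>0 'k) set \<Rightarrow> 'a" where
  "left_unit_hom M = tensor_lift (\<one>\<^sub>k :: ('g, 'k, 'k) rep) M M (\<lambda>c x. c \<odot>\<^bsub>M\<^esub> x)"

definition right_unit_hom ::
    "('g, 'k::field, 'a) rep \<Rightarrow> ('a \<times> 'k \<Rightarrow>\<^sub>0 'k) set \<Rightarrow> 'a" where
  "right_unit_hom M = tensor_lift M (\<one>\<^sub>k :: ('g, 'k, 'k) rep) M (\<lambda>x c. c \<odot>\<^bsub>M\<^esub> x)"


section \<open>The stable category\<close>

definition kG_phom ::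
    "('g, 'z) monoid_scheme \<Rightarrow> ('g, 'k::field, 'a) rep \<Rightarrow> ('g, 'k, 'b) rep \<Rightarrow> ('a \<Rightarrow> 'b) set" where
  "kG_phom G M N =
     {f \<in> kG_hom G M N. \<exists>P :: ('g, 'k) coord_rep. projective_kG G P \<and>
        (\<exists>a\<in>kG_hom G M P. \<exists>b\<in>kG_hom G P N. f = compose (carrier M) b a)}"

definition st_rel ::
    "('g, 'z) monoid_scheme \<Rightarrow> ('g, 'k::field, 'a) rep \<Rightarrow> ('g, 'k, 'b) rep \<Rightarrow>
     (('a \<Rightarrow> 'b) \<times> ('a \<Rightarrow> 'b)) set" where
  "st_rel G M N =
     {(f, g). f \<in> kG_hom G M N \<and> g \<in> kG_hom G M N \<and>
              (\<lambda>x \<in> carrier M. f x \<ominus>\<^bsub>N\<^esub> g x) \<in> kG_phom G M N}"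

definition st_hom ::
    "('g, 'z) monoid_scheme \<Rightarrow> ('g, 'k::field, 'a) rep \<Rightarrow> ('g, 'k, 'b) rep \<Rightarrow> ('a \<Rightarrow> 'b) set set"
  where
  "st_hom G M N = kG_hom G M N // st_rel G M N"

definition st_class ::
    "('g, 'z) monoid_scheme \<Rightarrow> ('g, 'k::field, 'a) rep \<Rightarrow> ('g, 'k, 'b) rep \<Rightarrow>
     ('a \<Rightarrow> 'b) \<Rightarrow> ('a \<Rightarrow> 'b) set" where
  "st_class G M N f = st_rel G M N `` {f}"

text \<open>\<open>st_comp G M P \<beta> \<alpha>\<close> is the composite \<open>\<beta> \<circ> \<alpha>\<close>, with source \<open>M\<close> and target \<open>P\<close>.\<close>

definition st_comp ::
    "('g, 'z) monoid_scheme \<Rightarrow> ('g, 'k::field, 'a) rep \<Rightarrow> ('g, 'k, 'c) rep \<Rightarrow>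
     ('b \<Rightarrow> 'c) set \<Rightarrow> ('a \<Rightarrow> 'b) set \<Rightarrow> ('a \<Rightarrow> 'c) set" where
  "st_comp G M P \<beta> \<alpha> = (\<Union>g\<in>\<beta>. \<Union>f\<in>\<alpha>. st_class G M P (compose (carrier M) g f))"

definition st_tensor ::
    "('g, 'z) monoid_scheme \<Rightarrow> ('g, 'k::field, 'a) rep \<Rightarrow> ('g, 'k, 'b) rep \<Rightarrow>
     ('g, 'k, 'c) rep \<Rightarrow> ('g, 'k, 'd) rep \<Rightarrow> ('a \<Rightarrow> 'c) set \<Rightarrow> ('b \<Rightarrow> 'd) set \<Rightarrow>
     (('a \<times> 'b \<Rightarrow>\<^sub>0 'k) set \<Rightarrow> ('c \<times> 'd \<Rightarrow>\<^sub>0 'k) set) set" where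
  "st_tensor G M N M' N' \<alpha> \<beta> =
     (\<Union>f\<in>\<alpha>. \<Union>g\<in>\<beta>. st_class G (M \<otimes>\<^sub>k N) (M' \<otimes>\<^sub>k N') (tensor_hom M N M' N' f g))"

definition st_id ::
    "('g, 'z) monoid_scheme \<Rightarrow> ('g, 'k::field, 'a) rep \<Rightarrow> ('a \<Rightarrow> 'a) set" where
  "st_id G M = st_class G M M (id_hom M)"


section \<open>Ring-objects in the stable category\<close>

definition st_ring_object ::
    "('g, 'z) monoid_scheme \<Rightarrow> ('g, 'k::field, 'a) rep \<Rightarrow>
     (('a \<times> 'a \<Rightarrow>\<^sub>0 'k) set \<Rightarrow> 'a) set \<Rightarrow> ('k \<Rightarrow> 'a) set \<Rightarrow> bool" where
  "st_ring_object G A \<mu> u \<longleftrightarrow>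
     fg_kG_module G A \<and> \<mu> \<in> st_hom G (A \<otimes>\<^sub>k A) A \<and> u \<in> st_hom G \<one>\<^sub>k A \<and>
     st_comp G ((A \<otimes>\<^sub>k A) \<otimes>\<^sub>k A) A \<mu> (st_tensor G (A \<otimes>\<^sub>k A) A A A \<mu> (st_id G A)) =
       st_comp G ((A \<otimes>\<^sub>k A) \<otimes>\<^sub>k A) A \<mu>
         (st_comp G ((A \<otimes>\<^sub>k A) \<otimes>\<^sub>k A) (A \<otimes>\<^sub>k A)
           (st_tensor G A (A \<otimes>\<^sub>k A) A A (st_id G A) \<mu>)
           (st_class G ((A \<otimes>\<^sub>k A) \<otimes>\<^sub>k A) (A \<otimes>\<^sub>k (A \<otimes>\<^sub>k A)) (assoc_hom A A A))) \<and>
     st_comp G (\<one>\<^sub>k \<otimes>\<^sub>k A) A \<mu> (st_tensor G \<one>\<^sub>k A A A u (st_id G A)) =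
       st_class G (\<one>\<^sub>k \<otimes>\<^sub>k A) A (left_unit_hom A) \<and>
     st_comp G (A \<otimes>\<^sub>k \<one>\<^sub>k) A \<mu> (st_tensor G A \<one>\<^sub>k A A (st_id G A) u) =
       st_class G (A \<otimes>\<^sub>k \<one>\<^sub>k) A (right_unit_hom A)"

definition st_commutative ::
    "('g, 'z) monoid_scheme \<Rightarrow> ('g, 'k::field, 'a) rep \<Rightarrow>
     (('a \<times> 'a \<Rightarrow>\<^sub>0 'k) set \<Rightarrow> 'a) set \<Rightarrow> bool" where
  "st_commutative G A \<mu> \<longleftrightarrow>
     st_comp G (A \<otimes>\<^sub>k A) A \<mu> (st_class G (A \<otimes>\<^sub>k A) (A \<otimes>\<^sub>k A) (swap_hom A A)) = \<mu>"

definition st_separable ::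
    "('g, 'z) monoid_scheme \<Rightarrow> ('g, 'k::field, 'a) rep \<Rightarrow>
     (('a \<times> 'a \<Rightarrow>\<^sub>0 'k) set \<Rightarrow> 'a) set \<Rightarrow> bool" where
  "st_separable G A \<mu> \<longleftrightarrow>
     (\<exists>\<sigma>\<in>st_hom G A (A \<otimes>\<^sub>k A).
        st_comp G A A \<mu> \<sigma> = st_id G A \<and>
        st_comp G (A \<otimes>\<^sub>k A) (A \<otimes>\<^sub>k A) \<sigma> \<mu> =
          st_comp G (A \<otimes>\<^sub>k A) (A \<otimes>\<^sub>k A)
            (st_tensor G (A \<otimes>\<^sub>k A) A A A \<mu> (st_id G A))
            (st_comp G (A \<otimes>\<^sub>k A) ((A \<otimes>\<^sub>k A) \<otimes>\<^sub>k A)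
              (st_class G (A \<otimes>\<^sub>k (A \<otimes>\<^sub>k A)) ((A \<otimes>\<^sub>k A) \<otimes>\<^sub>k A) (assoc_inv_hom A A A))
              (st_tensor G A A A (A \<otimes>\<^sub>k A) (st_id G A) \<sigma>)) \<and>
        st_comp G (A \<otimes>\<^sub>k A) (A \<otimes>\<^sub>k A) \<sigma> \<mu> =
          st_comp G (A \<otimes>\<^sub>k A) (A \<otimes>\<^sub>k A)
            (st_tensor G A (A \<otimes>\<^sub>k A) A A (st_id G A) \<mu>)
            (st_comp G (A \<otimes>\<^sub>k A) (A \<otimes>\<^sub>k (A \<otimes>\<^sub>k A))
              (st_class G ((A \<otimes>\<^sub>k A) \<otimes>\<^sub>k A) (A \<otimes>\<^sub>k (A \<otimes>\<^sub>k A)) (assoc_hom A A A))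
              (st_tensor G A A (A \<otimes>\<^sub>k A) A \<sigma> (st_id G A))))"

definition st_ring_isomorphic ::
    "('g, 'z) monoid_scheme \<Rightarrow>
     ('g, 'k::field, 'a) rep \<Rightarrow> (('a \<times> 'a \<Rightarrow>\<^sub>0 'k) set \<Rightarrow> 'a) set \<Rightarrow> ('k \<Rightarrow> 'a) set \<Rightarrow>
     ('g, 'k, 'b) rep \<Rightarrow> (('b \<times> 'b \<Rightarrow>\<^sub>0 'k) set \<Rightarrow> 'b) set \<Rightarrow> ('k \<Rightarrow> 'b) set \<Rightarrow> bool" where
  "st_ring_isomorphic G A \<mu> u B \<nu> v \<longleftrightarrow>
     (\<exists>f\<in>st_hom G A B. \<exists>g\<in>st_hom G B A.
        st_comp G A A g f = st_id G A \<and> st_comp G B B f g = st_id G B \<and>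
        st_comp G (A \<otimes>\<^sub>k A) B f \<mu> = st_comp G (A \<otimes>\<^sub>k A) B \<nu> (st_tensor G A A B B f f) \<and>
        st_comp G \<one>\<^sub>k B f u = v)"


section \<open>Permutation modules and finite products\<close>

definition perm_rep ::
    "('g, 'z) monoid_scheme \<Rightarrow> 'g set \<Rightarrow> ('g, 'k::field, 'g set \<Rightarrow>\<^sub>0 'k) rep" where
  "perm_rep G H =
     \<lparr>carrier = free_on (lcosets\<^bsub>G\<^esub> H), monoid.mult = undefined, one = undefined,
      ring.zero = 0, add = (+), module.smult = pm_scale,
      act = (\<lambda>g \<phi>. \<Sum>S\<in>Poly_Mapping.keys \<phi>.
               Poly_Mapping.single (g <#\<^bsub>G\<^esub> S) (Poly_Mapping.lookup \<phi> S))\<rparr>"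

definition perm_mult ::
    "('g, 'z) monoid_scheme \<Rightarrow> 'g set \<Rightarrow>
     (('g set \<Rightarrow>\<^sub>0 'k) \<times> ('g set \<Rightarrow>\<^sub>0 'k) \<Rightarrow>\<^sub>0 'k) set \<Rightarrow> ('g set \<Rightarrow>\<^sub>0 'k::field)" where
  "perm_mult G H =
     tensor_lift (perm_rep G H :: ('g, 'k, _) rep) (perm_rep G H :: ('g, 'k, _) rep)
       (perm_rep G H :: ('g, 'k, _) rep)
       (\<lambda>\<phi> \<psi>. \<Sum>S\<in>Poly_Mapping.keys \<phi>. \<Sum>T\<in>Poly_Mapping.keys \<psi>.
          pm_scale (Poly_Mapping.lookup \<phi> S * Poly_Mapping.lookup \<psi> T)
            (if S = T then pm_basis S else 0))"

definition perm_unit ::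
    "('g, 'z) monoid_scheme \<Rightarrow> 'g set \<Rightarrow> 'k \<Rightarrow> ('g set \<Rightarrow>\<^sub>0 'k::field)" where
  "perm_unit G H = (\<lambda>c. \<Sum>S\<in>lcosets\<^bsub>G\<^esub> H. pm_scale c (pm_basis S))"

definition prod_rep ::
    "'i set \<Rightarrow> ('i \<Rightarrow> ('g, 'k::field, 'a) rep) \<Rightarrow> ('g, 'k, 'i \<Rightarrow> 'a) rep" where
  "prod_rep I M =
     \<lparr>carrier = (\<Pi>\<^sub>E i\<in>I. carrier (M i)), monoid.mult = undefined, one = undefined,
      ring.zero = (\<lambda>i\<in>I. \<zero>\<^bsub>M i\<^esub>),
      add = (\<lambda>x y. \<lambda>i\<in>I. x i \<oplus>\<^bsub>M i\<^esub> y i),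
      module.smult = (\<lambda>c x. \<lambda>i\<in>I. c \<odot>\<^bsub>M i\<^esub> x i),
      act = (\<lambda>g x. \<lambda>i\<in>I. act (M i) g (x i))\<rparr>"

definition proj_hom ::
    "'i set \<Rightarrow> ('i \<Rightarrow> ('g, 'k::field, 'a) rep) \<Rightarrow> 'i \<Rightarrow> ('i \<Rightarrow> 'a) \<Rightarrow> 'a" where
  "proj_hom I M i = (\<lambda>x \<in> carrier (prod_rep I M). x i)"

text \<open>
  The structure maps of a product of ring-objects are given componentwise. They are
  formed on honest homomorphisms, before passing to stable classes: the quotient functor to the
  stable category preserves finite products and tensor products.
\<close>

definition prod_mult ::
    "'i set \<Rightarrow> ('i \<Rightarrow> ('g, 'k::field, 'a) rep) \<Rightarrow> ('i \<Rightarrow> ('a \<times> 'a \<Rightarrow>\<^sub>0 'k) set \<Rightarrow> 'a) \<Rightarrow>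
     (('i \<Rightarrow> 'a) \<times> ('i \<Rightarrow> 'a) \<Rightarrow>\<^sub>0 'k) set \<Rightarrow> 'i \<Rightarrow> 'a" where
  "prod_mult I M m =
     (\<lambda>t \<in> carrier (prod_rep I M \<otimes>\<^sub>k prod_rep I M). \<lambda>i\<in>I.
        m i (tensor_hom (prod_rep I M) (prod_rep I M) (M i) (M i)
               (proj_hom I M i) (proj_hom I M i) t))"

definition prod_unit :: "'i set \<Rightarrow> ('i \<Rightarrow> 'k \<Rightarrow> 'a) \<Rightarrow> 'k \<Rightarrow> 'i \<Rightarrow> 'a" where
  "prod_unit I e = (\<lambda>c. \<lambda>i\<in>I. e i c)"

end

(* A map of modules is zero in the stable category iff it is a transfer x |-> sum_t t theta(t^-1 x)
of a linear map theta, so in coordinates a stable ring-object is a finite-dimensional space with an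
automorphism h and a bilinear product that obeys the axioms only up to transfers.

For the subgroup <h> of order p with p odd, put X = h - 1 and let e be the value of sigma at the unit.
The element z = e(a, X b) has a multiplication operator of trace zero, since tr(F^p) = tr(F)^p kills the
traces of nilpotent operators; hence z lies in the image of X, the (p-1)-st power of z acts as a
transfer, and X itself is stably zero. A second trace argument, with a functional that separates a
non-free orbit sum from the transfers, shows that every summand on which h acts non-trivially is free.
For p = 2 the same conclusion comes from squaring fixed points modulo transfers in the subgroup of
order 4. Once the largest projective summand is split off, the subgroup of order p acts trivially, so
all transfers vanish and an honest commutative separable algebra remains. By separability it is spanned by p-th
powers, so over a separably closed field it has a basis of orthogonal idempotents; h permutes them, and
the stabilisers of the orbits are the subgroups H_i. *)

theory Submission
  imports Defs "HOL-Library.Nat_Bijection"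
begin

text \<open>The obstacle throughout is that identities hold only up to transfers, so composites of
  multiplication operators are controlled only stably. Traces survive this, because the trace of a
  transfer is a multiple of the group order and that order is zero in the field. On a Jordan block
  of size i of an element of order p, X is stably zero exactly when i is 1, p - 1 or p. Stable
  vanishing of X therefore leaves one intruder, the block of size p - 1, a syzygy of the trivial
  module. The swap of two copies of it is stably -1, so for odd p commutativity makes products of
  such vectors stably zero, whereas the identity of that block has trace p - 1, which is not zero.
  The second trace argument is this contradiction. In characteristic two the sign is invisible, and
  over a group of order 2 every block is trivial or free. The first block to be excluded has size 3
  and lives over the group of order 4.\<close>

abbreviation "single \<equiv> Poly_Mapping.single"
abbreviation "keys \<equiv> Poly_Mapping.keys"

type_synonym 'k fvec = "nat \<Rightarrow>\<^sub>0 'k"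

section \<open>Prime-order symmetry, traces and the Frobenius identity for traces\<close>

section \<open>Linear maps and traces on finitely supported vectors\<close>

abbreviation lookup :: "('x \<Rightarrow>\<^sub>0 'k::zero) => 'x => 'k" where
 "lookup \<equiv> Poly_Mapping.lookup"

lemma lookup_pm_scale [simp]: "lookup (pm_scale c \<phi>) x = c * lookup \<phi> x"
 by (auto simp: pm_scale_def Poly_Mapping.map.rep_eq when_def)

interpretation pm: vector_space pm_scale
 by unfold_locales (auto intro!: poly_mapping_eqI simp: lookup_add algebra_simps)

lemma pm_scale_single [simp]: "pm_scale c (single i a) = single i (c * a)"
 by (rule poly_mapping_eqI) (auto simp: lookup_single when_def)

interpretation fs: vector_space "(*) :: 'k::field => 'k => 'k"
 by unfold_locales (auto simp: algebra_simps)

section \<open>Frobenius and cyclic rotation\<close>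

lemma funpow_coprime_fixed:
 assumes "(r ^^ a) x = x" "(r ^^ p) x = x" "coprime a (p::nat)"
 shows "r x = x"
proof (cases "p = 0 \<or> a = 0")
 case True
 then show ?thesis using assms by auto
next
 case False
 have it: "(r ^^ (n * k)) x = x" if "(r ^^ n) x = x" for n k
  using that by (induction k) (auto simp: funpow_add)
 obtain u v where uv: "a * u = p * v + 1"
  using bezout_nat[of a p] False assms(3) by (auto simp: coprime_iff_gcd_eq_1)
 have "x = (r ^^ (a * u)) x" using it[OF assms(1)] by simp
 also have "... = r ((r ^^ (p * v)) x)" by (simp only: uv) (simp add: funpow_swap1)
 also have "... = r x" using it[OF assms(2)] by simp
 finally show ?thesis by simp
qed

text \<open>A non-fixed orbit has exactly \<open>p\<close> elements, so an invariant function
  contributes \<open>p\<close> equal terms, which add up to zero. Such orbits are removed one at a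
  time by induction on the set. The target is any group killed by \<open>p\<close>, because both
  scalar and vector values occur later.\<close>

lemma sum_prime_order_action:
 fixes f :: "'x => 'w::ab_group_add"
 assumes "finite S" "r ` S \<subseteq> S" "!!x. x \<in> S ==> (r ^^ p) x = x" "prime p"
  and "!!x. x \<in> S ==> f (r x) = f x" and char: "!!w::'w. (\<Sum>j<p. w) = 0"
 shows "sum f S = sum f {x \<in> S. r x = x}"
 using assms(1-3,5)
proof (induction S rule: finite_psubset_induct)
 case (psubset S)
 show ?case
 proof (cases "\<forall>x\<in>S. r x = x")
  case True
  then have "{x \<in> S. r x = x} = S" by auto
  then show ?thesis by simp
 next
  case False
  then obtain x where x: "x \<in> S" "r x \<noteq> x" by auto
  define Ob where "Ob = (%j. (r ^^ j) x) ` {..<p}"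
  have p0: "p > 1" using \<open>prime p\<close> prime_gt_1_nat by auto
  have inS: "(r ^^ j) x \<in> S" for j using psubset(3) x by (induction j) auto
  have f_const: "f ((r ^^ j) x) = f x" for j
   by (induction j) (use psubset(5) inS in auto)
  have inj: "inj_on (%j. (r ^^ j) x) {..<p}"
  proof (rule linorder_inj_onI)
   fix i j assume ij: "i < j" "i \<in> {..<p}" "j \<in> {..<p}"
   show "(r ^^ i) x \<noteq> (r ^^ j) x"
   proof
    assume e: "(r ^^ i) x = (r ^^ j) x"
    have "(r ^^ (p - i + i)) x = (r ^^ (p - i + j)) x"
     using e by (simp only: funpow_add o_apply)
    then have "x = (r ^^ (p - i + j)) x" using ij psubset(4)[OF x(1)] by simp
    also have "... = (r ^^ (j - i + p)) x" using ij by (intro arg_cong[of _ _ "%n. (r ^^ n) x"]) auto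
    also have "... = (r ^^ (j - i)) x" using psubset(4)[OF x(1)] by (simp add: funpow_add)
    finally have "(r ^^ (j - i)) x = x" by simp
    moreover have "coprime (j - i) p"
     using ij \<open>prime p\<close> by (subst coprime_commute) (auto intro!: prime_imp_coprime dest: dvd_imp_le)
    ultimately show False using funpow_coprime_fixed psubset(4)[OF x(1)] x(2) by metis
   qed
  qed auto
  have r_Ob: "r y \<in> Ob" if y: "y \<in> Ob" for y
  proof -
   obtain j where j: "j < p" "y = (r ^^ j) x" using y by (auto simp: Ob_def)
   show ?thesis
   proof (cases "Suc j < p")
    case True then show ?thesis using j by (auto simp: Ob_def intro!: image_eqI[of _ _ "Suc j"])
   next
    case False
    then have "Suc j = p" using j by simp
    then have "r y = x" using j psubset(4)[OF x(1)] by (metis comp_apply funpow.simps(2))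
    then show ?thesis using p0 by (auto simp: Ob_def intro!: image_eqI[of _ _ 0])
   qed
  qed
  have r_Ob': "y \<in> Ob" if "y \<in> S" "r y \<in> Ob" for y
  proof -
   have "(r ^^ j) (r y) \<in> Ob" for j using that r_Ob by (induction j) auto
   from this[of "p - 1"] show ?thesis using psubset(4)[OF that(1)] p0
    by (metis Suc_diff_1 comp_apply funpow_Suc_right gr_implies_not0 less_numeral_extra(3) neq0_conv)
  qed
  have OS: "Ob \<subseteq> S" using inS by (auto simp: Ob_def)
  have nofix: "r y \<noteq> y" if y: "y \<in> Ob" for y
  proof
   assume ry: "r y = y"
   obtain j where j: "j < p" "y = (r ^^ j) x" using y by (auto simp: Ob_def)
   have fx: "(r ^^ i) y = y" for i using ry by (induction i) auto
   have "(r ^^ (p - j)) y = x" using j psubset(4)[OF x(1)]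
    by (simp flip: funpow_add[THEN fun_cong, unfolded o_apply])
   then have "y = x" using fx by simp
   then show False using ry x by simp
  qed
  have "sum f S = sum f Ob + sum f (S - Ob)"
   using OS psubset(1) by (metis sum.subset_diff add.commute)
  also have "sum f Ob = (\<Sum>j<p. f x)"
   unfolding Ob_def using f_const by (subst sum.reindex[OF inj]) auto
  also have "... = 0" by (rule char)
  also have "sum f (S - Ob) = sum f {x \<in> S - Ob. r x = x}"
  proof (rule psubset(2))
   show "S - Ob \<subset> S" using x p0 OS by (auto simp: Ob_def)
   show "r ` (S - Ob) \<subseteq> S - Ob" using psubset(3) r_Ob' by auto
  qed (use psubset in auto)
  also have "{x \<in> S - Ob. r x = x} = {x \<in> S. r x = x}" using nofix by auto
  finally show ?thesis by simp
 qed
qed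

abbreviation words :: "nat => 'i set => 'i list set" where
 "words n I \<equiv> {w. set w \<subseteq> I \<and> length w = n}"

lemma sum_words_Suc:
 assumes "finite I"
 shows "sum f (words (Suc n) I) = (\<Sum>i\<in>I. \<Sum>w\<in>words n I. f (i # w))"
proof -
 have "sum f (words (Suc n) I) = sum f ((%(i, w). i # w) ` (I \<times> words n I))"
  by (rule arg_cong[of _ _ "sum f"]) (auto simp: length_Suc_conv)
 also have "... = (\<Sum>(i, w)\<in>I \<times> words n I. f (i # w))"
  by (subst sum.reindex) (auto simp: inj_on_def case_prod_beta)
 finally show ?thesis by (simp add: sum.cartesian_product)
qed

lemma sum_words_0 [simp]: "sum f (words 0 I) = f []"
proof -
 have "words 0 I = {[]}" by auto
 then show ?thesis by simp
qed

text \<open>Rotation acts on words of length \<open>p\<close> with order dividing \<open>p\<close>,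
  and its fixed words are the constant ones. All Frobenius identities below, for traces and for
  powers in a commutative algebra, reduce to this count.\<close>

lemma sum_rotation_invariant:
 fixes f :: "'i list => 'w::ab_group_add"
 assumes "finite I" "prime p"
  and inv: "!!i w. i \<in> I ==> set w \<subseteq> I ==> f (w @ [i]) = f (i # w)"
  and char: "!!w::'w. (\<Sum>j<p. w) = 0"
 shows "sum f (words p I) = (\<Sum>i\<in>I. f (replicate p i))"
proof -
 have p0: "p > 0" using \<open>prime p\<close> prime_gt_0_nat by auto
 have "sum f (words p I) = sum f {w \<in> words p I. rotate1 w = w}"
 proof (rule sum_prime_order_action[OF _ _ _ \<open>prime p\<close> _ char])
  show "finite (words p I)" using finite_lists_length_eq[OF \<open>finite I\<close>] by auto
  show "(rotate1 ^^ p) w = w" if "w \<in> words p I" for w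
   using that rotate_length01 by (metis (mono_tags, lifting) mem_Collect_eq rotate_def rotate_id mod_self)
  show "f (rotate1 w) = f w" if "w \<in> words p I" for w
   using that inv by (cases w) auto
 qed auto
 also have "{w \<in> words p I. rotate1 w = w} = (%i. replicate p i) ` I"
 proof -
  have "w \<in> (%i. replicate p i) ` I" if w: "w \<in> words p I" "rotate1 w = w" for w
  proof -
   have nth: "w ! j = w ! 0" if "j < p" for j
    using that
   proof (induction j)
    case (Suc j)
    then have "w ! Suc j = rotate1 w ! j" using w by (subst nth_rotate1) auto
    then show ?case using Suc w by simp
   qed simp
   define a where "a = w ! 0"
   have "w = replicate p a"
   proof (rule nth_equalityI)
    fix j assume "j < length w"
    then show "w ! j = replicate p a ! j" using w nth[of j] by (simp add: a_def)
   qed (use w in simp)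
   moreover have "a \<in> I" using w p0 nth_mem[of 0 w] by (auto simp: a_def)
   ultimately show ?thesis by blast
  qed
  moreover have "rotate1 (replicate p i) = replicate p i" for i :: 'i
   using p0 by (cases p) (auto simp: replicate_append_same)
  ultimately show ?thesis by auto
 qed
 also have "sum f ... = (\<Sum>i\<in>I. f (replicate p i))"
  using p0 by (subst sum.reindex) (auto simp: inj_on_def)
 finally show ?thesis .
qed

section \<open>Linear maps and traces\<close>

abbreviation lin :: "('k::field => 'v::ab_group_add => 'v) => ('k => 'w::ab_group_add => 'w) => ('v => 'w) => bool" where
 "lin s t f \<equiv> Vector_Spaces.linear s t f"

lemma lin_def: "lin (s :: 'k::field => _) t f \<longleftrightarrow> vector_space s \<and> vector_space t \<and> (\<forall>x y. f (x + y) = f x + f y) \<and> (\<forall>a x. f (s a x) = t a (f x))"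
 by (auto simp: Vector_Spaces.linear_iff)

lemma lin_props:
 assumes "lin s t f"
 shows "f (x + y) = f x + f y" "f (s a x) = t a (f x)" "f 0 = 0" "f (- x) = - f x" "f (x - y) = f x - f y"
  "f (sum g I) = (\<Sum>i\<in>I. f (g i))"
proof -
 interpret Vector_Spaces.linear s t f by (rule assms)
 show "f (x + y) = f x + f y" "f (s a x) = t a (f x)" "f 0 = 0" "f (- x) = - f x" "f (x - y) = f x - f y"
  "f (sum g I) = (\<Sum>i\<in>I. f (g i))"
  by (auto simp: add scale zero neg diff sum)
qed

lemma lin_comp: "lin s t f ==> lin t r g ==> lin s r (%x. g (f x))"
 by (auto simp: lin_def)

lemma lin_id: "vector_space s ==> lin s s (%x. x)"
 by (auto simp: lin_def)

lemma lin_zero: "vector_space s ==> vector_space t ==> lin s t (%x. 0)"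
 by (auto simp: lin_def module.scale_zero_right module_iff_vector_space)

lemma lin_add: "lin s t f ==> lin s t g ==> lin s t (%x. f x + g x)"
 by (auto simp: lin_def vector_space.vector_space_assms(1) algebra_simps)

lemma lin_neg: "lin s t f ==> lin s t (%x. - f x)"
 using module.scale_minus_right[of t] by (auto simp: lin_def module_iff_vector_space)

lemma lin_diff: "lin s t f ==> lin s t g ==> lin s t (%x. f x - g x)"
 using lin_add[of s t f "%x. - g x"] lin_neg[of s t g] by simp

lemma lin_scale: "lin s t f ==> lin s t (%x. t a (f x))"
 using module.scale_left_commute[of t] by (auto simp: lin_def vector_space.vector_space_assms(1) module_iff_vector_space)

lemma lin_scale_left: "lin s (*) f ==> vector_space t ==> lin s t (%x. t (f x) v)"
 by (auto simp: lin_def vector_space.vector_space_assms)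

lemma lin_sum: "(!!i. i \<in> I ==> lin s t (f i)) ==> vector_space s ==> vector_space t ==> lin s t (%x. \<Sum>i\<in>I. f i x)"
proof (induction I rule: infinite_finite_induct)
 case (insert x F)
 then have "lin s t (f x)" "lin s t (%x. \<Sum>i\<in>F. f i x)" by auto
 then show ?case using insert lin_add by (simp add: lin_add)
qed (auto simp: lin_zero)

lemma lin_funpow: "lin s s f ==> lin s s (f ^^ n)"
proof (induction n)
 case 0
 then show ?case by (auto simp: lin_def)
next
 case (Suc n)
 then show ?case by (auto simp: lin_def)
qed

lemma vs_pm [simp]: "vector_space (pm_scale :: 'k::field => ('x \<Rightarrow>\<^sub>0 'k) => _)" by (rule pm.vector_space_axioms)
lemma vs_fs [simp]: "vector_space ((*) :: 'k::field => 'k => 'k)" by (rule fs.vector_space_axioms)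

abbreviation "linV \<equiv> lin pm_scale pm_scale"
abbreviation "linF \<equiv> lin pm_scale (*)"

lemma lin_lookup [simp]: "linF (%x. lookup x i)"
 by (auto simp: lin_def lookup_add)

text \<open>Vectors have infinitely many coordinates, so this is the trace of the upper left corner
  of size \<open>d\<close>.\<close>

definition trc :: "nat => ('k fvec => 'k fvec) => 'k::field" where
 "trc d f = (\<Sum>i<d. lookup (f (pm_basis i)) i)"

text \<open>Every module is later carried by the first \<open>d\<close> coordinates of one fixed
  type; \<open>cut d\<close> then plays the role of the identity of the module.\<close>

definition cut :: "nat => 'k fvec => ('k::field) fvec" where
 "cut d x = (\<Sum>i<d. pm_scale (lookup x i) (pm_basis i))"

lemma lookup_cut: "lookup (cut d x) i = (if i < d then lookup x i else 0)"
 by (auto simp: cut_def lookup_sum lookup_single when_def if_distrib cong: if_cong)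

lemma cut_lin [simp]: "linV (cut d)"
 by (auto simp: lin_def lookup_cut lookup_add intro!: poly_mapping_eqI)

lemma cut_cut [simp]: "cut d (cut d x) = cut d x"
 by (auto simp: lookup_cut intro!: poly_mapping_eqI)

lemma cut_basis [simp]: "i < d ==> cut d (pm_basis i) = pm_basis i"
 by (auto simp: lookup_cut lookup_single when_def intro!: poly_mapping_eqI)

lemma lin_cut_expand:
 assumes "lin pm_scale s f"
 shows "f (cut d x) = (\<Sum>i<d. s (lookup x i) (f (pm_basis i)))"
 unfolding cut_def lin_props(6)[OF assms] lin_props(2)[OF assms] ..

lemma trc_sum: "trc d (%x. \<Sum>i\<in>I. f i x) = (\<Sum>i\<in>I. trc d (f i))"
 unfolding trc_def lookup_sum by (rule sum.swap)

text \<open>Compatibility of \<open>g\<close> with \<open>cut\<close> confines the intermediate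
  index to the first \<open>d\<close> coordinates in both products, after which the two double sums
  differ only in their order.\<close>

lemma trc_commute:
 assumes f: "linV f" and g: "linV g" and gc: "!!x. g (cut d x) = cut d (g x)"
 shows "trc d (%x. f (g x)) = trc d (%x. g (f x))"
proof -
 have "trc d (%x. f (g x)) = (\<Sum>i<d. lookup (f (cut d (g (pm_basis i)))) i)"
  unfolding trc_def by (intro sum.cong refl) (simp add: gc[symmetric])
 also have "... = (\<Sum>i<d. \<Sum>j<d. lookup (g (pm_basis i)) j * lookup (f (pm_basis j)) i)"
  by (simp add: lin_cut_expand[OF f] lookup_sum)
 also have "... = (\<Sum>j<d. \<Sum>i<d. lookup (f (pm_basis j)) i * lookup (g (pm_basis i)) j)"
  by (subst sum.swap) (simp add: mult.commute)
 also have "... = (\<Sum>j<d. lookup (g (cut d (f (pm_basis j)))) j)"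
  by (simp add: lin_cut_expand[OF g] lookup_sum)
 also have "... = trc d (%x. g (f x))"
  unfolding trc_def by (intro sum.cong refl) (simp add: gc lookup_cut)
 finally show ?thesis .
qed

text \<open>The weight of the path from \<open>i\<close> through the listed vertices to
  \<open>k\<close>; entries of matrix powers are sums of such weights.\<close>

fun pathw :: "('i => 'i => 'k::comm_ring_1) => 'i => 'i list => 'i => 'k" where
 "pathw A i [] k = A i k"
| "pathw A i (j # w) k = A i j * pathw A j w k"

lemma pathw_append: "pathw A i (w @ [l]) k = pathw A i w l * A l k"
 by (induction w arbitrary: i) (auto simp: mult.assoc)

lemma pathw_replicate: "pathw A i (replicate n i) i = A i i ^ Suc n"
 by (induction n) auto

lemma lookup_funpow_path:
 assumes F: "linV F" and PF: "!!x. cut d (F x) = F x" 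
 shows "lookup ((F ^^ Suc n) (pm_basis i)) k = (\<Sum>w\<in>words n {..<d}. pathw (%i j. lookup (F (pm_basis i)) j) i w k)"
proof (induction n arbitrary: i)
 case 0
 show ?case by (subst sum_words_0) simp
next
 case (Suc n)
 have "(F ^^ Suc (Suc n)) (pm_basis i) = (F ^^ Suc n) (cut d (F (pm_basis i)))"
  by (simp only: PF) (simp add: funpow_swap1)
 also have "lookup ... k = (\<Sum>j<d. lookup (F (pm_basis i)) j * lookup ((F ^^ Suc n) (pm_basis j)) k)"
  by (subst lin_cut_expand[OF lin_funpow[OF F]]) (simp add: lookup_sum)
 finally show ?case using Suc by (simp add: sum_words_Suc sum_distrib_left)
qed

text \<open>The trace of \<open>F ^^ p\<close> is the sum of the weights of closed paths of length
  \<open>p\<close>, and these weights do not depend on the base point. Only constant paths survive,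
  and they contribute the \<open>p\<close>-th powers of the diagonal entries.\<close>

lemma trc_frobenius:
 fixes F :: "('k::field) fvec => _"
 assumes F: "linV F" and PF: "!!x. cut d (F x) = F x" and p: "prime p" "CHAR('k) = p"
 shows "trc d (F ^^ p) = trc d F ^ p"
proof -
 obtain n where n: "p = Suc n" using prime_gt_0_nat[OF p(1)] by (cases p) auto
 define A where "A = (%i j. lookup (F (pm_basis i)) j)"
 define cyc where "cyc = (%w::nat list. case w of [] => 0 | i # w => pathw A i w i)"
 have "trc d (F ^^ p) = (\<Sum>i<d. \<Sum>w\<in>words n {..<d}. pathw A i w i)"
  unfolding trc_def n lookup_funpow_path[OF F PF] A_def ..
 also have "... = sum cyc (words p {..<d})"
  unfolding n by (subst sum_words_Suc) (auto simp: cyc_def)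
 also have "... = (\<Sum>i<d. cyc (replicate p i))"
 proof (rule sum_rotation_invariant[OF _ p(1)])
  show "cyc (w @ [i]) = cyc (i # w)" for i w
   by (cases w) (auto simp: cyc_def pathw_append)
  show "(\<Sum>j<p. w) = 0" for w :: 'k using of_nat_CHAR[where 'a='k] p(2) by simp
 qed auto
 also have "... = (\<Sum>i<d. A i i ^ p)"
  by (simp add: n cyc_def pathw_replicate)
 also have "... = (\<Sum>i<d. A i i) ^ p"
  by (subst freshmans_dream_sum[where 'a='k and n=p]) (use p in auto)
 finally show ?thesis by (simp add: trc_def A_def)
qed

section \<open>Operators annihilated by traces\<close>

abbreviation bilS :: "('k::field => 'w::ab_group_add => 'w) => ('k fvec => 'k fvec => 'w) => bool" where
 "bilS s \<beta> \<equiv> (\<forall>x. lin pm_scale s (\<beta> x)) \<and> (\<forall>y. lin pm_scale s (%x. \<beta> x y))"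

abbreviation "bil \<equiv> bilS pm_scale"

abbreviation tri :: "(('k::field) fvec => 'k fvec => 'k fvec => 'k fvec) => bool" where
 "tri f \<equiv> (\<forall>y z. linV (%x. f x y z)) \<and> (\<forall>x z. linV (%y. f x y z)) \<and> (\<forall>x y. linV (%z. f x y z))"

lemma bil_props:
 assumes "bilS s \<beta>"
 shows "\<beta> (x + x') y = \<beta> x y + \<beta> x' y" "\<beta> x (y + y') = \<beta> x y + \<beta> x y'"
  "\<beta> (pm_scale a x) y = s a (\<beta> x y)" "\<beta> x (pm_scale a y) = s a (\<beta> x y)"
  "\<beta> (x - x') y = \<beta> x y - \<beta> x' y" "\<beta> x (y - y') = \<beta> x y - \<beta> x y'"
  "\<beta> (- x) y = - \<beta> x y" "\<beta> x (- y) = - \<beta> x y" "\<beta> 0 y = 0" "\<beta> x 0 = 0"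
  "\<beta> (sum g I) y = (\<Sum>i\<in>I. \<beta> (g i) y)" "\<beta> x (sum g I) = (\<Sum>i\<in>I. \<beta> x (g i))"
 using lin_props[OF assms[THEN conjunct1, rule_format, of x]]
  lin_props[OF assms[THEN conjunct2, rule_format, of y]] by auto

lemma sum_reindex_period:
 fixes f :: "nat => 'w::ab_group_add"
 assumes "f Q = f 0"
 shows "(\<Sum>s<Q. f (Suc s)) = (\<Sum>s<Q. f s)"
 using assms sum.lessThan_Suc_shift[of f Q] by (simp add: add.commute)


text \<open>Evaluation of a polynomial at an operator by Horner's scheme. It transports identities
  between polynomials, such as the binomial formula in characteristic \<open>p\<close>, to
  operators.\<close>

definition pev :: "(('x \<Rightarrow>\<^sub>0 'k) => ('x \<Rightarrow>\<^sub>0 'k)) => 'k::field poly => ('x \<Rightarrow>\<^sub>0 'k) => ('x \<Rightarrow>\<^sub>0 'k)" where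
 "pev h f = fold_coeffs (%a r x. pm_scale a x + h (r x)) f (%x. 0)"

context
 fixes h :: "('x \<Rightarrow>\<^sub>0 'k) => ('x \<Rightarrow>\<^sub>0 'k::field)"
 assumes h: "linV h"
begin

lemma pev_0 [simp]: "pev h 0 x = 0"
 by (simp add: pev_def)

lemma pev_pCons [simp]: "pev h (pCons a f) x = pm_scale a x + h (pev h f x)"
proof -
 have "(%a r x. pm_scale a x + h (r x)) 0 (%x. 0) = (%x. 0)" by (simp add: lin_props[OF h])
 then show ?thesis by (cases "f = 0 \<and> a = 0") (auto simp: pev_def lin_props[OF h])
qed

lemma pev_add: "pev h (f + g) x = pev h f x + pev h g x"
 by (induction f g rule: poly_induct2) (auto simp: pm.scale_left_distrib lin_props[OF h] algebra_simps)

lemma pev_smult: "pev h (smult a f) x = pm_scale a (pev h f x)"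
 by (induction f) (auto simp: pm.scale_right_distrib lin_props[OF h] algebra_simps)

lemma pev_mult: "pev h (f * g) x = pev h f (pev h g x)"
 by (induction f) (auto simp: pev_add pev_smult lin_props[OF h])

lemma pev_diff: "pev h (f - g) x = pev h f x - pev h g x"
 using pev_add[of "f - g" g x] by (simp add: algebra_simps)

lemma pev_1 [simp]: "pev h 1 x = x"
 by (simp add: one_pCons lin_props[OF h])

lemma pev_power: "pev h (f ^ n) x = (pev h f ^^ n) x"
 by (induction n) (auto simp: pev_mult)

lemma pev_sum: "pev h (sum f I) x = (\<Sum>i\<in>I. pev h (f i) x)"
 by (induction I rule: infinite_finite_induct) (auto simp: pev_add)

lemma pev_X [simp]: "pev h [:0, 1:] x = h x"
 by (simp add: lin_props[OF h])

lemma pev_X1: "pev h [:-1, 1:] x = h x - x"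
 by (simp add: lin_props[OF h])

lemma X0: "pev h [:0, 1:] = h" by (rule ext) (rule pev_X)

lemma X1: "pev h [:-1, 1:] = (%x. h x - x)" by (rule ext) (rule pev_X1)

lemma funpow_minus_one_char:
 assumes "prime p" "CHAR('k) = p"
 shows "((%x. h x - x) ^^ (p ^ n)) x = (h ^^ (p ^ n)) x - x"
proof -
 have t: "[:-1, 1:] + 1 = ([:0, 1:] :: 'k poly)" by (simp add: one_pCons)
 have e: "([:-1, 1:] + 1 :: 'k poly) ^ (p ^ n) = [:-1, 1:] ^ (p ^ n) + 1 ^ (p ^ n)"
  by (rule freshmans_dream'[where n = n]) (use assms in simp_all)
 have "([:-1, 1:] :: 'k poly) ^ (p ^ n) = [:0, 1:] ^ (p ^ n) - 1"
  using e unfolding t power_one by simp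
 from arg_cong[OF this, of "%f. pev h f x"] show ?thesis
  by (simp only: pev_power pev_diff pev_1 X1 X0)
qed

text \<open>Dividing \<open>(t - 1) ^ (p ^ n) = t ^ (p ^ n) - 1\<close> by \<open>t - 1\<close>
  identifies the norm with a power of \<open>h - 1\<close>, so that vanishing of the norm becomes a
  bound on nilpotency.\<close>

lemma funpow_minus_one_char_sum:
 assumes "prime p" "CHAR('k) = p"
 shows "((%x. h x - x) ^^ (p ^ n - 1)) x = (\<Sum>s<p ^ n. (h ^^ s) x)"
proof -
 define t where "t = ([:0, 1:] :: 'k poly)"
 have t1: "t - 1 = [:-1, 1:]" "t - 1 \<noteq> 0" by (auto simp: t_def one_pCons)
 have q: "p ^ n > 0" using prime_gt_0_nat[OF assms(1)] by simp
 have e: "((t - 1) + 1) ^ (p ^ n) = (t - 1) ^ (p ^ n) + 1 ^ (p ^ n)"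
  by (rule freshmans_dream'[where n = n]) (use assms in simp_all)
 have "(t - 1) * (t - 1) ^ (p ^ n - 1) = (t - 1) ^ (p ^ n)"
  using q by (metis Suc_diff_1 power_Suc)
 also have "... = t ^ (p ^ n) - 1" using e by (simp add: algebra_simps)
 also have "... = (t - 1) * (\<Sum>s<p ^ n. t ^ s)" by (rule power_diff_1_eq)
 finally have "(t - 1) ^ (p ^ n - 1) = (\<Sum>s<p ^ n. t ^ s)"
  using t1(2) by simp
 from arg_cong[OF this, of "%f. pev h f x"] show ?thesis
  by (simp only: pev_power pev_sum t1(1)[unfolded t_def] X1 X0 t_def)
qed

end

text \<open>Converts membership in an image into the value of a functional, which can then be
  computed as a trace.\<close>

lemma funct_separation:
 fixes S :: "('x \<Rightarrow>\<^sub>0 'k::field) set"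
 assumes S: "pm.subspace S" and x: "x \<notin> S"
 shows "\<exists>\<phi>. linF \<phi> \<and> (\<forall>y\<in>S. \<phi> y = 0) \<and> \<phi> x = 1"
proof -
 interpret vp: vector_space_pair pm_scale "(*) :: 'k => 'k => 'k" by unfold_locales
 obtain B where B: "B \<subseteq> S" "pm.independent B" "S \<subseteq> pm.span B"
  using pm.maximal_independent_subset by blast
 have sp: "pm.span B = S" using B S by (metis pm.span_minimal subset_antisym)
 have ind: "pm.independent (insert x B)" using B sp x by (intro pm.independent_insertI) auto
 have xB: "x \<notin> B" using B x by auto
 obtain \<phi> where \<phi>: "linF \<phi>" "\<forall>b\<in>insert x B. \<phi> b = (if b = x then 1 else 0)"
  using vp.linear_independent_extend[OF ind, of "%b. if b = x then 1 else 0"] by auto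
 have "\<phi> y = 0" if "y \<in> S" for y
 proof (rule vp.linear_eq_0_on_span[OF \<phi>(1)])
  show "y \<in> pm.span B" using that sp by simp
 qed (use \<phi>(2) xB in auto)
 then show ?thesis using \<phi> by auto
qed

lemma subspace_range_lin: "linV f ==> pm.subspace (range f)"
 unfolding pm.subspace_def
 by (auto simp: lin_props(1,2)[of pm_scale pm_scale f, symmetric] intro: rev_image_eqI[of 0] dest: lin_props(3))

lemma of_nat_power_CHAR:
 assumes "prime p" "CHAR('k::field) = p"
 shows "(of_nat j :: 'k) ^ p = of_nat j"
proof (induction j)
 case 0
 then show ?case using prime_gt_0_nat[OF assms(1)] by simp
next
 case (Suc j)
 have "(of_nat j + 1 :: 'k) ^ p = of_nat j ^ p + 1 ^ p"
  by (rule freshmans_dream) (use assms in simp_all)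
 then show ?case using Suc by (simp add: add.commute)
qed

text \<open>For \<open>s < p - 1\<close> the differences of \<open>j ^ Suc s\<close> telescope to
  zero; by induction their binomial expansion leaves only \<open>Suc s\<close> times the sum in
  question, and \<open>Suc s\<close> is invertible. For \<open>s = p - 1\<close> Fermat's theorem
  gives \<open>p - 1\<close> ones. The convention \<open>0 ^ 0 = 1\<close> makes the case
  \<open>s = 0\<close> equal to \<open>p\<close>, that is zero.\<close>

lemma power_sum_CHAR:
 assumes "prime p" "CHAR('k::field) = p" "s < p"
 shows "(\<Sum>j<p. (of_nat j :: 'k) ^ s) = (if s = p - 1 then -1 else 0)"
proof (cases "s = p - 1")
 case True
 have p: "p > 1" using assms(1) prime_gt_1_nat by auto
 have "(of_nat j :: 'k) ^ (p - 1) = 1" if "j \<in> {1..<p}" for j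
 proof -
  have "of_nat j \<noteq> (0::'k)" using that assms by (auto simp: of_nat_eq_0_iff_char_dvd dest: dvd_imp_le)
  moreover have "of_nat j * of_nat j ^ (p - 1) = (of_nat j :: 'k)"
   using of_nat_power_CHAR[OF assms(1,2), of j] p by (metis Suc_diff_1 power_Suc less_trans zero_less_one)
  ultimately show ?thesis by simp
 qed
 then have "(\<Sum>j\<in>{1..<p}. (of_nat j :: 'k) ^ (p - 1)) = (\<Sum>j\<in>{1..<p}. 1)" by (intro sum.cong) auto
 moreover have "(\<Sum>j<p. (of_nat j :: 'k) ^ (p - 1)) = 0 ^ (p - 1) + (\<Sum>j\<in>{1..<p}. (of_nat j :: 'k) ^ (p - 1))"
  using p by (simp add: lessThan_atLeast0 sum.atLeast_Suc_lessThan)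
 moreover have "of_nat p = (0::'k)" using assms by (simp add: of_nat_eq_0_iff_char_dvd)
 ultimately show ?thesis using True p by (simp add: of_nat_diff)
next
 case False
 then have "s < p - 1" using assms by simp
 then have "(\<Sum>j<p. (of_nat j :: 'k) ^ s) = 0"
 proof (induction s rule: less_induct)
  case (less s)
  define S where "S = (%i. \<Sum>j<p. (of_nat j :: 'k) ^ i)"
  have p0: "of_nat p = (0::'k)" using assms by (simp add: of_nat_eq_0_iff_char_dvd)
  have "(\<Sum>j<p. (of_nat (Suc j) :: 'k) ^ Suc s - of_nat j ^ Suc s) = of_nat p ^ Suc s - of_nat 0 ^ Suc s"
   by (rule sum_lessThan_telescope)
  then have "0 = (\<Sum>j<p. (of_nat j + 1 :: 'k) ^ Suc s - of_nat j ^ Suc s)"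
   by (simp only: p0) (simp add: add.commute)
  also have "... = (\<Sum>j<p. \<Sum>i\<le>s. of_nat (Suc s choose i) * of_nat j ^ i)"
   by (intro sum.cong refl) (subst binomial_ring, simp)
  also have "... = (\<Sum>i\<le>s. of_nat (Suc s choose i) * S i)"
   by (subst sum.swap) (simp add: S_def sum_distrib_left)
  also have "... = of_nat (Suc s choose s) * S s"
   using less by (subst sum.remove[of _ s]) (auto simp: S_def intro!: sum.neutral)
  finally have "of_nat (Suc s) * S s = 0" by (simp del: of_nat_Suc)
  moreover have "of_nat (Suc s) \<noteq> (0::'k)"
   using less.prems assms by (auto simp: of_nat_eq_0_iff_char_dvd simp del: of_nat_Suc dest: dvd_imp_le)
  ultimately show ?case by (simp add: S_def)
 qed
 then show ?thesis using False by simp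
qed

section \<open>Transfers, stable congruence and stable algebras in coordinates\<close>

section \<open>Transfer from the trivial group\<close>

text \<open>The generator is the identity outside the first \<open>d\<close> coordinates, which is
  the content of \<open>cut_X\<close>. This makes \<open>h\<close> invertible on the whole type, so
  that no carrier sets occur in the linear algebra.\<close>

locale cyc =
 fixes d Q :: nat and h hi :: "('k::field) fvec => 'k fvec"
 assumes h_lin: "linV h" and hi_lin: "linV hi"
  and h_hi [simp]: "h (hi x) = x" and hi_h [simp]: "hi (h x) = x"
  and h_order: "(h ^^ Q) x = x"
  and h_cut: "h (cut d x) = cut d (h x)"
  and cut_X: "cut d (h x - x) = h x - x"
begin

lemmas h_props = lin_props[OF h_lin]
lemmas hi_props = lin_props[OF hi_lin]

lemma H_lin: "linV (h ^^ s)" by (rule lin_funpow[OF h_lin])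
lemma Hi_lin: "linV (hi ^^ s)" by (rule lin_funpow[OF hi_lin])
lemmas H_props = lin_props[OF H_lin]
lemma hi_cut: "hi (cut d x) = cut d (hi x)"
 using h_cut[of "hi x"] by (metis hi_h h_hi)

lemma H_cut: "(h ^^ s) (cut d x) = cut d ((h ^^ s) x)"
 by (induction s) (auto simp: h_cut)

lemma Hi_cut: "(hi ^^ s) (cut d x) = cut d ((hi ^^ s) x)"
 by (induction s) (auto simp: hi_cut)

lemma H_Hi [simp]: "(h ^^ s) ((hi ^^ s) x) = x"
 by (induction s arbitrary: x) (auto simp: funpow_swap1)

lemma Hi_H [simp]: "(hi ^^ s) ((h ^^ s) x) = x"
 by (induction s arbitrary: x) (auto simp: funpow_swap1)

lemma Hi_order: "(hi ^^ Q) x = x"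
 by (metis Hi_H h_order)

lemma trc_conj:
 assumes "linV \<theta>"
 shows "trc d (%x. (h ^^ s) (\<theta> ((hi ^^ s) x))) = trc d \<theta>"
proof -
 have "trc d (%x. (h ^^ s) (\<theta> ((hi ^^ s) x))) = trc d (%x. (%x. \<theta> ((hi ^^ s) x)) ((h ^^ s) x))"
  by (rule trc_commute[symmetric]) (auto intro: lin_comp[OF Hi_lin assms] H_lin simp: H_cut)
 then show ?thesis by simp
qed

definition eqv :: "('k fvec => 'k fvec) => bool" where
 "eqv f \<longleftrightarrow> linV f \<and> (\<forall>x. f (h x) = h (f x))"

definition eqv2 :: "('k fvec => 'k fvec => 'k fvec) => bool" where
 "eqv2 f \<longleftrightarrow> bil f \<and> (\<forall>x y. f (h x) (h y) = h (f x y))"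

lemma eqv_lin: "eqv f ==> linV f" by (simp add: eqv_def)
lemma eqv_h: "eqv f ==> f (h x) = h (f x)" by (simp add: eqv_def)
lemma eqv_hi: "eqv f ==> f (hi x) = hi (f x)" by (metis eqv_def h_hi hi_h)
lemma eqv_H: "eqv f ==> f ((h ^^ s) x) = (h ^^ s) (f x)" by (induction s) (auto simp: eqv_h)
lemma eqv_Hi: "eqv f ==> f ((hi ^^ s) x) = (hi ^^ s) (f x)" by (induction s) (auto simp: eqv_hi)
lemma eqv_id: "eqv (%x. x)" by (auto simp: eqv_def lin_id)
lemma eqv_cut: "eqv (cut d)" by (auto simp: eqv_def h_cut)
lemma eqv_h_self: "eqv h" by (auto simp: eqv_def h_lin)
lemma eqv_comp: "eqv f ==> eqv g ==> eqv (%x. f (g x))" by (auto simp: eqv_def intro: lin_comp)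
lemma eqv_diff: "eqv f ==> eqv g ==> eqv (%x. f x - g x)" by (auto simp: eqv_def h_props intro: lin_diff)
lemma eqv_X: "eqv (%x. h x - x)" by (intro eqv_diff eqv_h_self eqv_id)
lemma eqv_funpow: "eqv f ==> eqv (f ^^ n)"
proof (induction n)
 case 0 then show ?case using eqv_id by (simp add: id_def)
next
 case (Suc n) then show ?case using eqv_comp[of f "f ^^ n"] by (simp add: o_def)
qed

lemma eqv2_bil: "eqv2 f ==> bil f" by (simp add: eqv2_def)
lemma eqv2_h: "eqv2 f ==> f (h x) (h y) = h (f x y)" by (simp add: eqv2_def)
lemma eqv2_hi: "eqv2 f ==> f (hi x) (hi y) = hi (f x y)" by (metis eqv2_def h_hi hi_h)
lemma eqv2_H: "eqv2 f ==> f ((h ^^ s) x) ((h ^^ s) y) = (h ^^ s) (f x y)"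
 by (induction s) (auto simp: eqv2_h)
lemma eqv2_Hi: "eqv2 f ==> f ((hi ^^ s) x) ((hi ^^ s) y) = (hi ^^ s) (f x y)"
 by (induction s) (auto simp: eqv2_hi)
lemma eqv2_H1: "eqv2 f ==> f x ((h ^^ s) y) = (h ^^ s) (f ((hi ^^ s) x) y)"
 by (metis H_Hi eqv2_H)
lemma eqv2_H2: "eqv2 f ==> f ((h ^^ s) x) y = (h ^^ s) (f x ((hi ^^ s) y))"
 by (metis H_Hi eqv2_H)

text \<open>\<open>SZ0\<close>, \<open>SZ1\<close>, \<open>SZ2\<close>, \<open>SZ3\<close> are the images of the transfer from the trivial group on
 vectors and on linear, bilinear and trilinear maps: the maps that vanish in the stable category.\<close>

definition SZ0 :: "'k fvec => bool" where
 "SZ0 w \<longleftrightarrow> (\<exists>v. w = (\<Sum>s<Q. (h ^^ s) v))"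

definition SZ1 :: "('k fvec => 'k fvec) => bool" where
 "SZ1 f \<longleftrightarrow> (\<exists>\<theta>. linV \<theta> \<and> (\<forall>x. f x = (\<Sum>s<Q. (h ^^ s) (\<theta> ((hi ^^ s) x)))))"

definition SZ2 :: "('k fvec => 'k fvec => 'k fvec) => bool" where
 "SZ2 f \<longleftrightarrow> (\<exists>\<theta>. bil \<theta> \<and> (\<forall>x y. f x y = (\<Sum>s<Q. (h ^^ s) (\<theta> ((hi ^^ s) x) ((hi ^^ s) y)))))"

definition SZ3 :: "('k fvec => 'k fvec => 'k fvec => 'k fvec) => bool" where
 "SZ3 f \<longleftrightarrow> (\<exists>\<theta>. tri \<theta> \<and> (\<forall>x y z. f x y z = (\<Sum>s<Q. (h ^^ s) (\<theta> ((hi ^^ s) x) ((hi ^^ s) y) ((hi ^^ s) z)))))"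

lemma SZ1I: "linV \<theta> ==> (!!x. f x = (\<Sum>s<Q. (h ^^ s) (\<theta> ((hi ^^ s) x)))) ==> SZ1 f"
 unfolding SZ1_def by blast
lemma SZ2I: "bil \<theta> ==> (!!x y. f x y = (\<Sum>s<Q. (h ^^ s) (\<theta> ((hi ^^ s) x) ((hi ^^ s) y)))) ==> SZ2 f"
 unfolding SZ2_def by blast
lemma SZ3I: "tri \<theta> ==> (!!x y z. f x y z = (\<Sum>s<Q. (h ^^ s) (\<theta> ((hi ^^ s) x) ((hi ^^ s) y) ((hi ^^ s) z)))) ==> SZ3 f"
 unfolding SZ3_def by blast

lemma SZ1_lin:
 assumes "SZ1 f" shows "linV f"
proof -
 obtain \<theta> where th: "linV \<theta>" "!!x. f x = (\<Sum>s<Q. (h ^^ s) (\<theta> ((hi ^^ s) x)))"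
  using assms unfolding SZ1_def by blast
 have "linV (%x. \<Sum>s<Q. (h ^^ s) (\<theta> ((hi ^^ s) x)))"
  by (intro lin_sum vs_pm lin_comp[OF Hi_lin lin_comp[OF th(1) H_lin]])
 then show ?thesis using th(2) by presburger
qed

lemma SZ1_add: assumes "SZ1 f" "SZ1 g" shows "SZ1 (%x. f x + g x)"
proof -
 obtain \<theta> where th: "linV \<theta>" "!!x. f x = (\<Sum>s<Q. (h ^^ s) (\<theta> ((hi ^^ s) x)))"
  using assms(1) unfolding SZ1_def by blast
 obtain \<eta> where et: "linV \<eta>" "!!x. g x = (\<Sum>s<Q. (h ^^ s) (\<eta> ((hi ^^ s) x)))"
  using assms(2) unfolding SZ1_def by blast
 show ?thesis
  by (rule SZ1I[OF lin_add[OF th(1) et(1)]]) (simp add: th(2) et(2) H_props sum.distrib)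
qed

lemma SZ1_comp_left: assumes "SZ1 f" "eqv g" shows "SZ1 (%x. g (f x))"
proof -
 obtain \<theta> where th: "linV \<theta>" "!!x. f x = (\<Sum>s<Q. (h ^^ s) (\<theta> ((hi ^^ s) x)))"
  using assms(1) unfolding SZ1_def by blast
 show ?thesis
  by (rule SZ1I[OF lin_comp[OF th(1) eqv_lin[OF assms(2)]]])
   (simp add: th(2) lin_props[OF eqv_lin[OF assms(2)]] eqv_H[OF assms(2)])
qed

lemma SZ1_comp_right: assumes "SZ1 f" "eqv g" shows "SZ1 (%x. f (g x))"
proof -
 obtain \<theta> where th: "linV \<theta>" "!!x. f x = (\<Sum>s<Q. (h ^^ s) (\<theta> ((hi ^^ s) x)))"
  using assms(1) unfolding SZ1_def by blast
 show ?thesis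
  by (rule SZ1I[OF lin_comp[OF eqv_lin[OF assms(2)] th(1)]])
   (simp add: th(2) eqv_Hi[OF assms(2)])
qed

lemma eqv_scale: "eqv (pm_scale a)"
 by (auto simp: eqv_def h_props lin_def pm.scale_right_distrib mult.commute)

lemma SZ1_scale: "SZ1 f ==> SZ1 (%x. pm_scale a (f x))"
 by (rule SZ1_comp_left[OF _ eqv_scale])

lemma SZ1_neg: "SZ1 f ==> SZ1 (%x. - f x)"
 using SZ1_scale[of f "-1"] by simp

lemma SZ1_diff: "SZ1 f ==> SZ1 g ==> SZ1 (%x. f x - g x)"
 using SZ1_add[OF _ SZ1_neg] by (simp add: algebra_simps)

lemma SZ1_zero: "SZ1 (%x. 0)"
 by (rule SZ1I[of "%x. 0"]) (auto simp: lin_zero H_props)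

text \<open>Conjugation preserves traces, so a transfer has \<open>Q\<close> times the trace of
  \<open>\<theta>\<close>.\<close>

lemma trc_SZ1:
 assumes "SZ1 f" "of_nat Q = (0::'k)"
 shows "trc d f = 0"
proof -
 obtain \<theta> where th: "linV \<theta>" "!!x. f x = (\<Sum>s<Q. (h ^^ s) (\<theta> ((hi ^^ s) x)))"
  using assms(1) unfolding SZ1_def by blast
 have "f = (%x. \<Sum>s<Q. (h ^^ s) (\<theta> ((hi ^^ s) x)))" using th(2) by auto
 then show ?thesis using assms(2) by (simp add: trc_sum trc_conj[OF th(1)])
qed

definition eq1 (infix "\<sim>1" 50) where "f \<sim>1 g \<longleftrightarrow> SZ1 (%x. f x - g x)"
definition eq3 (infix "\<sim>3" 50) where "f \<sim>3 g \<longleftrightarrow> SZ3 (%x y z. f x y z - g x y z)"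

lemma eq1_refl: "f \<sim>1 f" using SZ1_zero by (simp add: eq1_def)
lemma eq1_sym: "f \<sim>1 g ==> g \<sim>1 f" unfolding eq1_def using SZ1_neg by fastforce
lemma eq1_trans [trans]: "f \<sim>1 g ==> g \<sim>1 k ==> f \<sim>1 k"
 unfolding eq1_def using SZ1_add by fastforce
lemma eq1_subst [trans]: "f = g ==> g \<sim>1 k ==> f \<sim>1 k" "f \<sim>1 g ==> g = k ==> f \<sim>1 k" by simp_all
lemma eq1_left: "f \<sim>1 g ==> eqv k ==> (%x. k (f x)) \<sim>1 (%x. k (g x))"
 unfolding eq1_def using SZ1_comp_left[of "%x. f x - g x" k] by (simp add: lin_props[OF eqv_lin])
lemma eq1_right: "f \<sim>1 g ==> eqv k ==> (%x. f (k x)) \<sim>1 (%x. g (k x))"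
 unfolding eq1_def using SZ1_comp_right[of "%x. f x - g x" k] by simp
lemma eq1_0: "f \<sim>1 (%x. 0) \<longleftrightarrow> SZ1 f" by (simp add: eq1_def)

lemma SZ3_add: assumes "SZ3 f" "SZ3 g" shows "SZ3 (%x y z. f x y z + g x y z)"
proof -
 obtain \<theta> where th: "tri \<theta>" "!!x y z. f x y z = (\<Sum>s<Q. (h ^^ s) (\<theta> ((hi ^^ s) x) ((hi ^^ s) y) ((hi ^^ s) z)))"
  using assms(1) unfolding SZ3_def by blast
 obtain \<eta> where et: "tri \<eta>" "!!x y z. g x y z = (\<Sum>s<Q. (h ^^ s) (\<eta> ((hi ^^ s) x) ((hi ^^ s) y) ((hi ^^ s) z)))"
  using assms(2) unfolding SZ3_def by blast
 show ?thesis
  by (rule SZ3I[of "%x y z. \<theta> x y z + \<eta> x y z"])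
   (use th(1) et(1) in \<open>auto intro!: lin_add simp: th(2) et(2) H_props sum.distrib\<close>)
qed

lemma SZ3_map:
 assumes "SZ3 f" "eqv k" "eqv a" "eqv b" "eqv c"
 shows "SZ3 (%x y z. k (f (a x) (b y) (c z)))"
proof -
 obtain \<theta> where th: "tri \<theta>" "!!x y z. f x y z = (\<Sum>s<Q. (h ^^ s) (\<theta> ((hi ^^ s) x) ((hi ^^ s) y) ((hi ^^ s) z)))"
  using assms(1) unfolding SZ3_def by blast
 have l: "linV (%x. \<theta> x y z)" "linV (%y. \<theta> x y z)" "linV (%z. \<theta> x y z)" for x y z
  using th(1) by blast+
 show ?thesis
 proof (rule SZ3I[of "%x y z. k (\<theta> (a x) (b y) (c z))"])
  show "tri (%x y z. k (\<theta> (a x) (b y) (c z)))"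
   using lin_comp[OF lin_comp[OF eqv_lin[OF assms(3)] l(1)] eqv_lin[OF assms(2)]]
    lin_comp[OF lin_comp[OF eqv_lin[OF assms(4)] l(2)] eqv_lin[OF assms(2)]]
    lin_comp[OF lin_comp[OF eqv_lin[OF assms(5)] l(3)] eqv_lin[OF assms(2)]]
   by blast
 qed (simp add: th(2) lin_props[OF eqv_lin[OF assms(2)]] eqv_H[OF assms(2)] eqv_Hi[OF assms(3)] eqv_Hi[OF assms(4)] eqv_Hi[OF assms(5)])
qed

lemma SZ3_neg: "SZ3 f ==> SZ3 (%x y z. - f x y z)"
 using SZ3_map[OF _ eqv_scale[of "-1"] eqv_id eqv_id eqv_id, of f] by simp

lemma eq3_sym: "f \<sim>3 g ==> g \<sim>3 f" unfolding eq3_def using SZ3_neg by fastforce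
lemma eq3_trans [trans]: "f \<sim>3 g ==> g \<sim>3 k ==> f \<sim>3 k"
 unfolding eq3_def using SZ3_add by fastforce
lemma eq3_map: "f \<sim>3 g ==> eqv k ==> eqv a ==> eqv b ==> eqv c ==>
  (%x y z. k (f (a x) (b y) (c z))) \<sim>3 (%x y z. k (g (a x) (b y) (c z)))"
 unfolding eq3_def using SZ3_map[of "%x y z. f x y z - g x y z" k a b c] by (simp add: lin_props[OF eqv_lin])

lemma SZ3_rot: "SZ3 f ==> SZ3 (%x y z. f y z x)"
proof -
 assume "SZ3 f"
 then obtain \<theta> where th: "tri \<theta>" "!!x y z. f x y z = (\<Sum>s<Q. (h ^^ s) (\<theta> ((hi ^^ s) x) ((hi ^^ s) y) ((hi ^^ s) z)))"
  unfolding SZ3_def by blast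
 then show ?thesis by (intro SZ3I[of "%x y z. \<theta> y z x"]) auto
qed

lemma SZ3_swap: "SZ3 f ==> SZ3 (%x y z. f y x z)"
proof -
 assume "SZ3 f"
 then obtain \<theta> where th: "tri \<theta>" "!!x y z. f x y z = (\<Sum>s<Q. (h ^^ s) (\<theta> ((hi ^^ s) x) ((hi ^^ s) y) ((hi ^^ s) z)))"
  unfolding SZ3_def by blast
 then show ?thesis by (intro SZ3I[of "%x y z. \<theta> y x z"]) auto
qed

lemma eq3_rot: "f \<sim>3 g ==> (%x y z. f y z x) \<sim>3 (%x y z. g y z x)"
 unfolding eq3_def by (rule SZ3_rot)
lemma eq3_swap: "f \<sim>3 g ==> (%x y z. f y x z) \<sim>3 (%x y z. g y x z)"
 unfolding eq3_def by (rule SZ3_swap)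

text \<open>Projection formula: applying an equivariant product to a transfer in one argument gives
  a transfer again, with the inverse powers of \<open>h\<close> moved to the other argument.\<close>

lemma SZ3_inner: assumes "SZ2 f" "eqv2 m" shows "SZ3 (%x y z. m x (f y z))"
proof -
 obtain \<theta> where th: "bil \<theta>" "!!x y. f x y = (\<Sum>s<Q. (h ^^ s) (\<theta> ((hi ^^ s) x) ((hi ^^ s) y)))"
  using assms(1) unfolding SZ2_def by blast
 note mb = eqv2_bil[OF assms(2)]
 have l: "linV (%x. m x y)" "linV (m x)" "linV (%x. \<theta> x y)" "linV (\<theta> x)" for x y using th(1) mb by blast+
 show ?thesis
 proof (rule SZ3I[of "%x y z. m x (\<theta> y z)"])
  show "tri (%x y z. m x (\<theta> y z))"
   using l(1) lin_comp[OF l(3) l(2)] lin_comp[OF l(4) l(2)] by blast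
 qed (simp add: th(2) bil_props[OF mb] eqv2_H1[OF assms(2)])
qed

lemma eqv2_swap: "eqv2 m ==> eqv2 (%x y. m y x)" by (simp add: eqv2_def)

lemma SZ3_outer: assumes "SZ2 f" "eqv2 m" shows "SZ3 (%x y z. m (f x y) z)"
 using SZ3_rot[OF SZ3_rot[OF SZ3_inner[OF assms(1) eqv2_swap[OF assms(2)]]]] .

lemma SZ2_fix:
 assumes "SZ2 f" "h w = w" "eqv k"
 shows "SZ1 (%x. f (k x) w)" "SZ1 (%x. f w (k x))"
proof -
 obtain \<theta> where th: "bil \<theta>" "!!x y. f x y = (\<Sum>s<Q. (h ^^ s) (\<theta> ((hi ^^ s) x) ((hi ^^ s) y)))"
  using assms(1) unfolding SZ2_def by blast
 have w: "(hi ^^ s) w = w" for s by (induction s) (auto, metis assms(2) hi_h)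
 have l: "linV (%x. \<theta> x y)" "linV (\<theta> x)" for x y using th(1) by blast+
 show "SZ1 (%x. f (k x) w)"
  by (rule SZ1I[OF lin_comp[OF eqv_lin[OF assms(3)] l(1)], of _ w]) (simp add: th(2) w eqv_Hi[OF assms(3)])
 show "SZ1 (%x. f w (k x))"
  by (rule SZ1I[OF lin_comp[OF eqv_lin[OF assms(3)] l(2)], of _ w]) (simp add: th(2) w eqv_Hi[OF assms(3)])
qed

lemma SZ0_mult: assumes "SZ0 w" "eqv2 m" "eqv k" shows "SZ1 (%x. m (k x) w)"
proof -
 obtain v where v: "w = (\<Sum>s<Q. (h ^^ s) v)" using assms(1) unfolding SZ0_def by blast
 note mb = eqv2_bil[OF assms(2)]
 have "linV (%x. m x v)" using mb by blast
 from lin_comp[OF eqv_lin[OF assms(3)] this] show ?thesis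
  by (rule SZ1I) (simp add: v bil_props[OF mb] eqv2_H1[OF assms(2)] eqv_Hi[OF assms(3)])
qed

end

text \<open>\<open>ee\<close> lists the coordinates of an invariant element of the tensor square.
  Invariance is tested on scalar bilinear forms, which keeps the tensor product itself out of the
  coordinate theory.\<close>

locale cyc_tensor = cyc d Q h hi for d Q :: nat and h hi :: "('k::field) fvec => 'k fvec" +
 fixes ee :: "nat => nat => 'k"
 assumes ee_inv: "!!\<beta>. bilS (*) \<beta> ==> (\<Sum>i<d. \<Sum>j<d. ee i j * \<beta> (h (pm_basis i)) (h (pm_basis j))) = (\<Sum>i<d. \<Sum>j<d. ee i j * \<beta> (pm_basis i) (pm_basis j))"
begin

text \<open>Contraction with the tensor: the bilinear map is summed over its two legs
  \<open>a\<close> and \<open>b\<close>. The scaling is a parameter because scalar and vector values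
  both occur.\<close>

definition E :: "('k => 'w => 'w) => ('k fvec => 'k fvec => 'w) => 'w::ab_group_add" where
 "E s \<beta> = (\<Sum>i<d. \<Sum>j<d. s (ee i j) (\<beta> (pm_basis i) (pm_basis j)))"

abbreviation "EV \<equiv> E pm_scale"
abbreviation "ES \<equiv> E ((*) :: 'k => 'k => 'k)"

lemma E_apply: "lin s t f ==> f (E s \<beta>) = E t (%a b. f (\<beta> a b))"
 by (simp add: E_def lin_props)

lemma E_lin: "(!!a b. lin r s (%x. \<beta> x a b)) ==> lin r s (%x. E s (\<beta> x))"
proof -
 assume a: "!!a b. lin r s (%x. \<beta> x a b)"
 then have v: "vector_space r" "vector_space s" by (auto simp: lin_def)
 show ?thesis unfolding E_def by (intro lin_sum lin_scale a v)
qed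

lemma E_diff: "vector_space s ==> E s (%a b. \<beta> a b - \<gamma> a b) = E s \<beta> - E s \<gamma>"
 by (simp add: E_def module.scale_right_diff_distrib flip: module_iff_vector_space sum_subtractf)

lemma E_sum: "vector_space s ==> E s (%a b. \<Sum>i\<in>I. \<beta> i a b) = (\<Sum>i\<in>I. E s (\<beta> i))"
proof -
 assume "vector_space s"
 then interpret vector_space s .
 show ?thesis
  unfolding E_def scale_sum_right
  by (subst sum.swap[of _ "I" "{..<d}"]) (intro sum.cong refl sum.swap)
qed

lemma E_cong: "(!!a b. a = cut d a ==> b = cut d b ==> \<beta> a b = \<gamma> a b) ==> E s \<beta> = E s \<gamma>"
 unfolding E_def by (intro sum.cong refl arg_cong2[of _ _ _ _ s]) (simp)

lemma E_inv_S: "bilS (*) \<beta> ==> ES (%a b. \<beta> (h a) (h b)) = ES \<beta>"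
 unfolding E_def by (rule ee_inv)

lemma E_inv_V: assumes "bil \<beta>" shows "EV (%a b. \<beta> (h a) (h b)) = EV \<beta>"
proof (rule poly_mapping_eqI)
 fix i
 have "bilS (*) (%x y. lookup (\<beta> x y) i)"
  using assms lin_comp[OF _ lin_lookup] by fast
 from E_inv_S[OF this] show "lookup (EV (%a b. \<beta> (h a) (h b))) i = lookup (EV \<beta>) i"
  using E_apply[OF lin_lookup, of _ i] by simp
qed

lemma E_inv_hi_S: assumes "bilS (*) \<beta>" shows "ES (%a b. \<beta> (hi a) (hi b)) = ES \<beta>"
proof -
 have "bilS (*) (%x y. \<beta> (hi x) (hi y))" using assms lin_comp[OF hi_lin] by fast
 from E_inv_S[OF this] show ?thesis by simp
qed

lemma E_inv_hi_V: assumes "bil \<beta>" shows "EV (%a b. \<beta> (hi a) (hi b)) = EV \<beta>"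
proof -
 have "bil (%x y. \<beta> (hi x) (hi y))" using assms lin_comp[OF hi_lin] by fast
 from E_inv_V[OF this] show ?thesis by simp
qed

lemma E_inv_Hi_V: "bil \<beta> ==> EV (%a b. \<beta> ((hi ^^ s) a) ((hi ^^ s) b)) = EV \<beta>"
proof (induction s arbitrary: \<beta>)
 case (Suc s)
 have "bil (%x y. \<beta> (hi x) (hi y))" using Suc(2) lin_comp[OF hi_lin] by fast
 from Suc(1)[OF this] show ?case using E_inv_hi_V[OF Suc(2)] by simp
qed simp

lemma E_inv_Hi_S: "bilS (*) \<beta> ==> ES (%a b. \<beta> ((hi ^^ s) a) ((hi ^^ s) b)) = ES \<beta>"
proof (induction s arbitrary: \<beta>)
 case (Suc s)
 have "bilS (*) (%x y. \<beta> (hi x) (hi y))" using Suc(2) lin_comp[OF hi_lin] by fast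
 from Suc(1)[OF this] show ?case using E_inv_hi_S[OF Suc(2)] by simp
qed simp

lemma E_fixed: assumes "eqv2 \<beta>" shows "h (EV \<beta>) = EV \<beta>"
 using E_inv_V[OF eqv2_bil[OF assms]] by (simp add: E_apply[OF h_lin] eqv2_h[OF assms])

text \<open>As the tensor is invariant, contracting two slots of a trilinear transfer yields the
  transfer of the contracted map. Stable trilinear identities may therefore be evaluated on the
  tensor, with equivariant maps applied to its legs.\<close>

lemma plug:
 assumes "f \<sim>3 g" "eqv \<alpha>" "eqv \<beta>"
 shows "(%x. EV (%a b. f x (\<alpha> a) (\<beta> b))) \<sim>1 (%x. EV (%a b. g x (\<alpha> a) (\<beta> b)))"
proof -
 obtain \<theta> where th: "tri \<theta>" "!!x y z. f x y z - g x y z = (\<Sum>s<Q. (h ^^ s) (\<theta> ((hi ^^ s) x) ((hi ^^ s) y) ((hi ^^ s) z)))"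
  using assms(1) unfolding SZ3_def eq3_def by blast
 have l: "linV (%x. \<theta> x y z)" "linV (%y. \<theta> x y z)" "linV (%z. \<theta> x y z)" for x y z
  using th(1) by blast+
 have b: "bil (%a b. \<theta> x (\<alpha> a) (\<beta> b))" for x
  using lin_comp[OF eqv_lin[OF assms(2)] l(2)] lin_comp[OF eqv_lin[OF assms(3)] l(3)] by blast
 show ?thesis unfolding eq1_def
 proof (rule SZ1I[of "%x. EV (%a b. \<theta> x (\<alpha> a) (\<beta> b))"])
  show "linV (%x. EV (%a b. \<theta> x (\<alpha> a) (\<beta> b)))" by (intro E_lin l)
  fix x
  have "EV (%a b. f x (\<alpha> a) (\<beta> b)) - EV (%a b. g x (\<alpha> a) (\<beta> b))
   = (\<Sum>s<Q. EV (%a b. (h ^^ s) (\<theta> ((hi ^^ s) x) (\<alpha> ((hi ^^ s) a)) (\<beta> ((hi ^^ s) b)))))"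
   by (simp add: th(2) E_sum eqv_Hi[OF assms(2)] eqv_Hi[OF assms(3)] flip: E_diff[OF vs_pm])
  also have "... = (\<Sum>s<Q. (h ^^ s) (EV (%a b. \<theta> ((hi ^^ s) x) (\<alpha> ((hi ^^ s) a)) (\<beta> ((hi ^^ s) b)))))"
   by (simp add: E_apply[OF H_lin])
  also have "... = (\<Sum>s<Q. (h ^^ s) (EV (%a b. \<theta> ((hi ^^ s) x) (\<alpha> a) (\<beta> b))))"
   using E_inv_Hi_V[OF b] by simp
  finally show "EV (%a b. f x (\<alpha> a) (\<beta> b)) - EV (%a b. g x (\<alpha> a) (\<beta> b)) = ..." .
 qed
qed

end

lemma bil_expand:
 assumes "bilS s \<beta>"
 shows "\<beta> (cut d x) (cut d y) = (\<Sum>k<d. \<Sum>l<d. s (lookup x k * lookup y l) (\<beta> (pm_basis k) (pm_basis l)))"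
proof -
 have l: "lin pm_scale s (%x. \<beta> x y)" "lin pm_scale s (\<beta> x)" for x y using assms by blast+
 then interpret vector_space s by (auto simp: lin_def)
 show ?thesis
  by (simp add: lin_cut_expand[OF l(1)] lin_cut_expand[OF l(2)] scale_sum_right) (subst sum.swap, simp add: mult.commute)
qed

text \<open>A commutative separable ring-object in coordinates. The tensor \<open>ee\<close> is the
  value of the separability morphism at the unit: \<open>mE\<close> says that its product is the
  unit up to a transfer, and \<open>sep\<close> that \<open>x e\<close> and \<open>e x\<close>
  differ by a transfer from the algebra to its tensor square. There \<open>\<Theta>\<close> lists
  the coordinates of the map being transferred, and the functionals \<open>\<phi>\<close> and
  \<open>\<psi>\<close> read off the two legs.\<close>

locale salg = cyc_tensor d Q h hi ee for d Q :: nat and h hi :: "('k::field) fvec => 'k fvec"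
  and ee :: "nat => nat => 'k" +
 fixes m :: "'k fvec => 'k fvec => 'k fvec" and u :: "'k fvec"
 assumes m_eqv2: "eqv2 m" and m_cut: "m (cut d x) (cut d y) = m x y" and cut_m [simp]: "cut d (m x y) = m x y"
  and cut_u: "cut d u = u" and h_u: "h u = u"
  and assoc: "(%x y z. m (m x y) z) \<sim>3 (%x y z. m x (m y z))"
  and comm: "SZ2 (%x y. m x y - m y x)"
  and unit: "m u \<sim>1 cut d"
  and mE: "SZ0 (EV m - u)"
  and sep: "\<exists>\<Theta>. (\<forall>i j. linF (\<Theta> i j)) \<and> (\<forall>x \<phi> \<psi>. linF \<phi> \<longrightarrow> linF \<psi> \<longrightarrow>
    ES (%a b. \<phi> (m x a) * \<psi> b) - ES (%a b. \<phi> a * \<psi> (m b x)) =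
    (\<Sum>s<Q. \<Sum>i<d. \<Sum>j<d. \<Theta> i j ((hi ^^ s) x) * (\<phi> ((h ^^ s) (pm_basis i)) * \<psi> ((h ^^ s) (pm_basis j)))))"
begin

lemmas m_bil = eqv2_bil[OF m_eqv2]
lemmas m_props = bil_props[OF m_bil]
lemma m_lin1: "linV (%x. m x y)" using m_bil by blast
lemma m_lin2: "linV (m x)" using m_bil by blast
lemmas m_h = eqv2_h[OF m_eqv2]

lemma m_cut1 [simp]: "m (cut d x) y = m x y" by (metis m_cut cut_cut)
lemma m_cut2 [simp]: "m x (cut d y) = m x y" by (metis m_cut cut_cut)

lemma eqv_mult_fixed: "h w = w ==> eqv (m w)" "h w = w ==> eqv (%x. m x w)"
 unfolding eqv_def using m_h m_lin1 m_lin2 by metis+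

lemma m_comm_inner: "(%x y z. m x (m y z)) \<sim>3 (%x y z. m x (m z y))"
 using SZ3_inner[OF comm m_eqv2] by (simp add: eq3_def m_props)

lemma m_comm_outer: "(%x y z. m (m x y) z) \<sim>3 (%x y z. m (m y x) z)"
 using SZ3_outer[OF comm m_eqv2] by (simp add: eq3_def m_props)

lemma left_comm: "(%x y z. m x (m y z)) \<sim>3 (%x y z. m y (m x z))"
proof -
 note eq3_sym[OF assoc]
 also note m_comm_outer
 also have "(%x y z. m (m y x) z) \<sim>3 (%x y z. m y (m x z))" using eq3_swap[OF assoc] .
 finally show ?thesis .
qed

lemma right_comm: "(%x a w. m (m x a) w) \<sim>3 (%x a w. m (m x w) a)"
proof -
 note assoc
 also note m_comm_inner
 also have "(%x y z. m x (m z y)) \<sim>3 (%x y z. m (m x z) y)"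
  using eq3_rot[OF eq3_rot[OF eq3_swap[OF eq3_sym[OF assoc]]]] .
 finally show ?thesis .
qed

text \<open>A vector-valued bilinear map is a combination of products of coordinate functionals, so
  the scalar form of \<open>sep\<close> applies to each of them. Equivariance of
  \<open>\<beta>\<close> then moves the powers of \<open>h\<close> outside and exhibits a
  transfer.\<close>

lemma sepV:
 assumes "eqv2 \<beta>"
 shows "(%x. EV (%a b. \<beta> (m x a) b)) \<sim>1 (%x. EV (%a b. \<beta> a (m b x)))"
proof -
 obtain \<Theta> where T: "!!i j. linF (\<Theta> i j)" "!!x \<phi> \<psi>. linF \<phi> ==> linF \<psi> ==>
    ES (%a b. \<phi> (m x a) * \<psi> b) - ES (%a b. \<phi> a * \<psi> (m b x)) =
    (\<Sum>s<Q. \<Sum>i<d. \<Sum>j<d. \<Theta> i j ((hi ^^ s) x) * (\<phi> ((h ^^ s) (pm_basis i)) * \<psi> ((h ^^ s) (pm_basis j))))"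
  using sep by blast
 note bb = eqv2_bil[OF assms]
 have sl: "lin (*) pm_scale (%c. pm_scale c v)" for v :: "'k fvec"
  by (simp add: lin_def pm.scale_left_distrib)
 have ex: "EV (%a b. \<beta> (f a b) (g a b)) = (\<Sum>k<d. \<Sum>l<d. pm_scale (ES (%a b. lookup (f a b) k * lookup (g a b) l)) (\<beta> (pm_basis k) (pm_basis l)))"
  if "!!a b. a = cut d a ==> b = cut d b ==> f a b = cut d (f a b) \<and> g a b = cut d (g a b)" for f g
 proof -
  have "EV (%a b. \<beta> (f a b) (g a b)) = EV (%a b. \<beta> (cut d (f a b)) (cut d (g a b)))"
   by (rule E_cong) (use that in metis)
  also have "... = (\<Sum>k<d. \<Sum>l<d. EV (%a b. pm_scale (lookup (f a b) k * lookup (g a b) l) (\<beta> (pm_basis k) (pm_basis l))))"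
   by (simp add: bil_expand[OF bb] E_sum)
  finally show ?thesis by (simp add: E_apply[OF sl])
 qed
 show ?thesis unfolding eq1_def
 proof (rule SZ1I[of "%x. \<Sum>i<d. \<Sum>j<d. pm_scale (\<Theta> i j x) (\<beta> (pm_basis i) (pm_basis j))"])
  show "linV (%x. \<Sum>i<d. \<Sum>j<d. pm_scale (\<Theta> i j x) (\<beta> (pm_basis i) (pm_basis j)))"
   by (intro lin_sum vs_pm lin_scale_left T(1))
  fix x
  have "EV (%a b. \<beta> (m x a) b) - EV (%a b. \<beta> a (m b x)) =
   (\<Sum>k<d. \<Sum>l<d. pm_scale (ES (%a b. lookup (m x a) k * lookup b l) - ES (%a b. lookup a k * lookup (m b x) l)) (\<beta> (pm_basis k) (pm_basis l)))"
   by (subst ex, simp, subst ex, simp) (simp add: pm.scale_left_diff_distrib flip: sum_subtractf)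
  also have "... = (\<Sum>k<d. \<Sum>l<d. \<Sum>s<Q. \<Sum>i<d. \<Sum>j<d. pm_scale (\<Theta> i j ((hi ^^ s) x) * (lookup ((h ^^ s) (pm_basis i)) k * lookup ((h ^^ s) (pm_basis j)) l)) (\<beta> (pm_basis k) (pm_basis l)))"
   by (simp add: T(2)[OF lin_lookup lin_lookup] pm.scale_sum_left)
  also have "... = (\<Sum>s<Q. \<Sum>i<d. \<Sum>j<d. \<Sum>k<d. \<Sum>l<d. pm_scale (\<Theta> i j ((hi ^^ s) x) * (lookup ((h ^^ s) (pm_basis i)) k * lookup ((h ^^ s) (pm_basis j)) l)) (\<beta> (pm_basis k) (pm_basis l)))"
  proof -
   have a: "(\<Sum>k<d. \<Sum>l<d. \<Sum>s<Q. F k l s) = (\<Sum>s<Q. \<Sum>k<d. \<Sum>l<d. F k l s)" for F :: "nat => nat => nat => 'k fvec" and Q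
    by (rule trans[OF sum.cong[OF refl sum.swap] sum.swap])
   show ?thesis
    by (rule trans[OF a], rule sum.cong[OF refl], rule trans[OF a], rule sum.cong[OF refl], rule a)
  qed
  also have "... = (\<Sum>s<Q. \<Sum>i<d. \<Sum>j<d. pm_scale (\<Theta> i j ((hi ^^ s) x)) (\<beta> (cut d ((h ^^ s) (pm_basis i))) (cut d ((h ^^ s) (pm_basis j)))))"
   by (simp add: bil_expand[OF bb] pm.scale_sum_right)
  also have "... = (\<Sum>s<Q. \<Sum>i<d. \<Sum>j<d. pm_scale (\<Theta> i j ((hi ^^ s) x)) ((h ^^ s) (\<beta> (pm_basis i) (pm_basis j))))"
   by (simp add: eqv2_H[OF assms] flip: H_cut)
  also have "... = (\<Sum>s<Q. (h ^^ s) (\<Sum>i<d. \<Sum>j<d. pm_scale (\<Theta> i j ((hi ^^ s) x)) (\<beta> (pm_basis i) (pm_basis j))))"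
   by (simp add: H_props)
  finally show "EV (%a b. \<beta> (m x a) b) - EV (%a b. \<beta> a (m b x)) = ..." .
 qed
qed

abbreviation \<Delta> :: "'k fvec => 'k fvec" where "\<Delta> x \<equiv> h x - x"

definition Tr :: "'k fvec => 'k fvec" where "Tr x = (\<Sum>s<Q. (h ^^ s) x)"

lemma Tr_lin: "linV Tr" unfolding Tr_def by (intro lin_sum H_lin vs_pm)

lemma h_Tr: "h (Tr x) = Tr x"
 unfolding Tr_def h_props using sum_reindex_period[of "%s. (h ^^ s) x" Q] by (simp add: h_order)

lemma comm_fixed: "h w = w ==> eqv k ==> (%x. m (k x) w) \<sim>1 (%x. m w (k x))"
 unfolding eq1_def using SZ2_fix(1)[OF comm] by simp

end

section \<open>Order \<open>p\<close> with \<open>p\<close> odd: the operator \<open>h - 1\<close>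
  is stably zero\<close>

locale salg_p = salg d Q h hi ee m u for d Q :: nat and h hi :: "('k::field) fvec => 'k fvec"
  and ee :: "nat => nat => 'k" and m :: "'k fvec => 'k fvec => 'k fvec" and u :: "'k fvec" +
 fixes p :: nat
 assumes p: "prime p" "CHAR('k) = p" "p > 2" and Q: "Q = p"
begin

lemma p0: "of_nat p = (0::'k)" using p(2) by (simp add: of_nat_eq_0_iff_char_dvd)

lemma X_power: "(\<Delta> ^^ p) x = 0"
 using funpow_minus_one_char[OF h_lin p(1,2), of 1 x] h_order Q by simp

lemma X_lin: "linV \<Delta>" using eqv_lin[OF eqv_X] .
lemmas X_props = lin_props[OF X_lin]

text \<open>For an honest product of copies of the field permuted by \<open>h\<close>,
  \<open>\<xi>\<close> is the indicator of the fixed points and \<open>z\<close> is minus the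
  indicator of the moved ones. What follows shows that stably no point is moved.\<close>

definition \<xi> where "\<xi> = EV (%a b. m a (h b))"
definition z where "z = EV (%a b. m a (\<Delta> b))"

lemma eqv2_m_map: "eqv f ==> eqv g ==> eqv2 (%a b. m (f a) (g b))"
 unfolding eqv2_def by (auto simp: eqv_h m_h intro: lin_comp[OF _ m_lin1] lin_comp[OF _ m_lin2] eqv_lin)

lemma h_\<xi>: "h \<xi> = \<xi>" unfolding \<xi>_def by (intro E_fixed eqv2_m_map eqv_id eqv_h_self)
lemma h_z: "h z = z" unfolding z_def by (intro E_fixed eqv2_m_map eqv_id eqv_X)
lemma \<xi>_split: "\<xi> = EV m + z" unfolding \<xi>_def z_def by (simp add: m_props E_diff)

text \<open>Separability moves \<open>x\<close> from the first leg of the tensor to the second,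
  where the twist turns it into \<open>h x\<close>: the term \<open>x a h(b)\<close> becomes
  \<open>a h(b x) = a h(b) h(x)\<close>. Hence \<open>\<xi>\<close> stably annihilates every
  \<open>h x - x\<close>.\<close>

lemma twist: "(%x. m x \<xi>) \<sim>1 (%x. m (h x) \<xi>)"
proof -
 have "(%x. m x \<xi>) = (%x. EV (%a b. m x (m a (h b))))"
  by (simp add: \<xi>_def E_apply[OF m_lin2])
 also have "... \<sim>1 (%x. EV (%a b. m (m x a) (h b)))"
  by (rule eq1_sym[OF plug[OF assoc eqv_id eqv_h_self]])
 also have "... \<sim>1 (%x. EV (%a b. m a (h (m b x))))"
  by (rule sepV[OF eqv2_m_map[OF eqv_id eqv_h_self]])
 also have "... = (%x. EV (%a b. m a (m (h b) (h x))))" by (simp add: m_h)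
 also have "... \<sim>1 (%x. EV (%a b. m (m a (h b)) (h x)))"
  using eq1_right[OF plug[OF eq3_sym[OF eq3_rot[OF assoc]] eqv_id eqv_h_self] eqv_h_self] .
 also have "... = (%x. m \<xi> (h x))" by (simp add: \<xi>_def E_apply[OF m_lin1])
 also have "... \<sim>1 (%x. m (h x) \<xi>)" by (rule eq1_sym[OF comm_fixed[OF h_\<xi> eqv_h_self]])
 finally show ?thesis .
qed

text \<open>By \<open>\<xi>_split\<close>, multiplication by \<open>\<xi>\<close> is stably the
  identity plus multiplication by \<open>z\<close> on the image of \<open>\<Delta>\<close>, and by
  \<open>twist\<close> it is stably zero there. As \<open>z\<close> is fixed by \<open>h\<close>,
  multiplication by it commutes with \<open>\<Delta>\<close>.\<close>

lemma X_Lz: "\<Delta> \<sim>1 (%x. - \<Delta> (m z x))"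
proof -
 have a: "(%x. m (\<Delta> x) \<xi>) \<sim>1 (%x. 0)"
  using eq1_sym[OF twist] by (simp add: eq1_def m_props)
 have b: "(%x. m (\<Delta> x) (EV m)) \<sim>1 (%x. m (\<Delta> x) u)"
  using SZ0_mult[OF mE m_eqv2 eqv_X] by (simp add: eq1_def m_props)
 have c: "(%x. m (\<Delta> x) u) \<sim>1 \<Delta>"
 proof -
  have "(%x. m (\<Delta> x) u) \<sim>1 (%x. m u (\<Delta> x))" by (rule comm_fixed[OF h_u eqv_X])
  also have "... \<sim>1 (%x. cut d (\<Delta> x))" by (rule eq1_right[OF unit eqv_X])
  also have "... = \<Delta>" by (simp add: cut_X)
  finally show ?thesis .
 qed
 have d: "(%x. m (\<Delta> x) z) \<sim>1 (%x. \<Delta> (m z x))"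
 proof -
  have "(%x. m (\<Delta> x) z) \<sim>1 (%x. m z (\<Delta> x))" by (rule comm_fixed[OF h_z eqv_X])
  also have "... = (%x. \<Delta> (m z x))" using m_h[of z] by (simp add: h_z m_props)
  finally show ?thesis .
 qed
 have "SZ1 (%x. m (\<Delta> x) \<xi> - ((m (\<Delta> x) (EV m) - m (\<Delta> x) u) + ((m (\<Delta> x) u - \<Delta> x) + (m (\<Delta> x) z - \<Delta> (m z x)))))"
  using SZ1_diff[OF _ SZ1_add[OF b[unfolded eq1_def] SZ1_add[OF c[unfolded eq1_def] d[unfolded eq1_def]]]] a
  by (simp add: eq1_def)
 moreover have "(%x. m (\<Delta> x) \<xi> - ((m (\<Delta> x) (EV m) - m (\<Delta> x) u) + ((m (\<Delta> x) u - \<Delta> x) + (m (\<Delta> x) z - \<Delta> (m z x))))) = (%x. \<Delta> x - - \<Delta> (m z x))"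
  by (simp add: \<xi>_split m_props fun_eq_iff algebra_simps)
 ultimately show ?thesis unfolding eq1_def by simp
qed

lemma X_Lz_power: "\<Delta> \<sim>1 (%x. pm_scale ((-1) ^ n) (\<Delta> ((m z ^^ n) x)))"
proof (induction n)
 case 0
 then show ?case by (simp add: eq1_refl)
next
 case (Suc n)
 have e: "eqv (m z ^^ n)" by (intro eqv_funpow eqv_mult_fixed h_z)
 note Suc
 also have "(%x. pm_scale ((-1) ^ n) (\<Delta> ((m z ^^ n) x))) \<sim>1 (%x. pm_scale ((-1) ^ n) (- \<Delta> (m z ((m z ^^ n) x))))"
  by (rule eq1_left[OF eq1_right[OF X_Lz e] eqv_scale])
 also have "(%x. pm_scale ((-1) ^ n) (- \<Delta> (m z ((m z ^^ n) x)))) = (%x. pm_scale ((-1) ^ Suc n) (\<Delta> ((m z ^^ Suc n) x)))"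
  by (rule ext) (simp only: funpow.simps o_apply power_Suc mult_minus1 pm.scale_minus_left pm.scale_minus_right)
 finally show ?case .
qed

text \<open>A functional \<open>\<tau>\<close> killing the image of \<open>\<Delta>\<close> is
  invariant, so \<open>F w\<close>, the sum of \<open>\<tau> (a w) b\<close>, commutes with
  \<open>h\<close>. Then \<open>\<Delta>\<close> composed with \<open>F\<close> is nilpotent and has
  trace zero by the Frobenius identity; computed directly, this trace is
  \<open>\<tau> z\<close>.\<close>

lemma z_in_range: "\<exists>c. z = \<Delta> c"
proof (rule ccontr)
 assume "\<nexists>c. z = \<Delta> c"
 then have "z \<notin> range \<Delta>" by auto
 then obtain \<tau> where \<tau>: "linF \<tau>" "!!y. \<tau> (\<Delta> y) = 0" "\<tau> z = 1"
  using funct_separation[OF subspace_range_lin[OF X_lin], of z] by blast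
 have \<tau>h: "\<tau> (h y) = \<tau> y" for y using \<tau>(2)[of y] by (simp add: lin_props[OF \<tau>(1)])
 define F where "F = (%w. EV (%a b. pm_scale (\<tau> (m a w)) b))"
 have F_lin: "linV F" unfolding F_def
  by (intro E_lin lin_scale_left lin_comp[OF m_lin2 \<tau>(1)] vs_pm)
 have F_h: "F (h w) = h (F w)" for w
 proof -
  have b: "bil (%a b. pm_scale (\<tau> (m a (h w))) b)"
   using lin_scale_left[OF lin_comp[OF m_lin1 \<tau>(1)] vs_pm] lin_scale[OF lin_id[OF vs_pm]] by fast
  have "F (h w) = EV (%a b. pm_scale (\<tau> (m (h a) (h w))) (h b))"
   unfolding F_def by (rule E_inv_V[OF b, symmetric])
  also have "... = h (F w)" by (simp add: F_def m_h \<tau>h E_apply[OF h_lin] h_props)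
  finally show ?thesis .
 qed
 have F_eqv: "eqv F" using F_lin F_h by (simp add: eqv_def)
 have XF_lin: "linV (%x. \<Delta> (F x))" by (rule lin_comp[OF F_lin X_lin])
 have pow: "((%x. \<Delta> (F x)) ^^ n) x = (\<Delta> ^^ n) ((F ^^ n) x)" for n x
 proof (induction n)
  case (Suc n)
  have "F ((\<Delta> ^^ n) y) = (\<Delta> ^^ n) (F y)" for y
   by (induction n) (auto simp: lin_props[OF F_lin] F_h)
  then show ?case using Suc by simp
 qed simp
 have "trc d ((%x. \<Delta> (F x)) ^^ p) = 0"
  by (simp add: trc_def pow X_power)
 then have "trc d (%x. \<Delta> (F x)) = 0"
  using trc_frobenius[OF XF_lin cut_X p(1,2)] by simp
 moreover have "trc d (%x. \<Delta> (F x)) = \<tau> z"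
 proof -
  have "\<Delta> (F w) = EV (%a b. pm_scale (\<tau> (m a w)) (\<Delta> b))" for w
   unfolding F_def by (subst E_apply[OF X_lin]) (simp only: X_props(2))
  then have "trc d (%x. \<Delta> (F x)) = (\<Sum>l<d. ES (%a b. \<tau> (m a (pm_basis l)) * lookup (\<Delta> b) l))"
   unfolding trc_def by (simp add: E_apply[OF lin_lookup])
  also have "... = ES (%a b. \<Sum>l<d. lookup (\<Delta> b) l * \<tau> (m a (pm_basis l)))"
   by (simp add: E_sum mult.commute)
  also have "... = ES (%a b. \<tau> (m a (cut d (\<Delta> b))))"
   by (simp only: lin_cut_expand[OF lin_comp[OF m_lin2 \<tau>(1)]])
  also have "... = \<tau> z" by (simp only: cut_X z_def E_apply[OF \<tau>(1)])
  finally show ?thesis .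
 qed
 ultimately show False using \<tau>(3) by simp
qed

text \<open>Left multiplications commute only up to transfers, so the intermediate coefficients stay
  unspecified; the sum over the prime field will isolate the top one.\<close>

lemma noncomm_power:
 fixes A B :: "'k fvec => 'k fvec"
 assumes A: "linV A" and B: "linV B"
 shows "\<exists>C. (\<forall>t x. ((%x. A x + pm_scale t (B x)) ^^ n) x = (\<Sum>s\<le>n. pm_scale (t ^ s) (C s x))) \<and> C n = (B ^^ n)"
proof (induction n)
 case 0
 show ?case by (rule exI[where x="%_. id"]) auto
next
 case (Suc n)
 then obtain C where C: "!!t x. ((%x. A x + pm_scale t (B x)) ^^ n) x = (\<Sum>s\<le>n. pm_scale (t ^ s) (C s x))" "C n = (B ^^ n)"
  by auto
 define D where "D = (%s x. (if s \<le> n then A (C s x) else 0) + (if s > 0 then B (C (s - 1) x) else 0))"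
 have "((%x. A x + pm_scale t (B x)) ^^ Suc n) x = (\<Sum>s\<le>Suc n. pm_scale (t ^ s) (D s x))" for t x
 proof -
  have "((%x. A x + pm_scale t (B x)) ^^ Suc n) x = (\<Sum>s\<le>n. pm_scale (t ^ s) (A (C s x))) + (\<Sum>s\<le>n. pm_scale (t ^ Suc s) (B (C s x)))"
   by (simp add: C lin_props[OF A] lin_props[OF B] pm.scale_sum_right)
  also have "(\<Sum>s\<le>n. pm_scale (t ^ s) (A (C s x))) = (\<Sum>s\<le>Suc n. pm_scale (t ^ s) (if s \<le> n then A (C s x) else 0))"
   by simp
  also have "(\<Sum>s\<le>n. pm_scale (t ^ Suc s) (B (C s x))) = (\<Sum>s\<le>Suc n. pm_scale (t ^ s) (if s > 0 then B (C (s - 1) x) else 0))"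
   by (subst sum.atMost_Suc_shift) simp
  finally show ?thesis by (simp add: D_def pm.scale_right_distrib flip: sum.distrib)
 qed
 moreover have "D (Suc n) = (B ^^ Suc n)" using C(2) by (auto simp: D_def)
 ultimately show ?case by (intro exI[of _ D]) auto
qed

text \<open>The sum of \<open>(A + j B)\<^sup>p\<^sup>-\<^sup>1\<close> over the prime field only sees the coefficient of \<open>j\<^sup>p\<^sup>-\<^sup>1\<close>.\<close>

lemma Lz_power_SZ1: "SZ1 (m z ^^ (p - 1))"
proof -
 obtain c where c: "z = \<Delta> c" using z_in_range by blast
 have hc: "h c = c + z" using c by simp
 have Hc: "(h ^^ j) c = c + pm_scale (of_nat j) z" for j
 proof (induction j)
  case (Suc j)
  then show ?case by (simp add: h_props h_z hc pm.scale_left_distrib)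
 qed simp
 obtain C where C: "!!t x. ((%x. m c x + pm_scale t (m z x)) ^^ (p - 1)) x = (\<Sum>s\<le>p - 1. pm_scale (t ^ s) (C s x))" "C (p - 1) = (m z ^^ (p - 1))"
  using noncomm_power[OF m_lin2 m_lin2, where n="p - 1"] by meson
 have mm: "m (c + pm_scale t z) = (%x. m c x + pm_scale t (m z x))" for t
  by (simp add: m_props fun_eq_iff)
 have conj: "(h ^^ j) ((m c ^^ n) ((hi ^^ j) x)) = (m ((h ^^ j) c) ^^ n) x" for j n x
  by (induction n arbitrary: x) (auto simp flip: eqv2_H[OF m_eqv2])
 show ?thesis
 \<comment> \<open>The sign cancels the value -1 of the power sum with exponent
   \<open>p - 1\<close>.\<close>
 proof (rule SZ1I[of "%x. - (m c ^^ (p - 1)) x"])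
  show "linV (%x. - (m c ^^ (p - 1)) x)" by (intro lin_neg lin_funpow m_lin2)
  fix x
  have "(\<Sum>j<p. (h ^^ j) (- (m c ^^ (p - 1)) ((hi ^^ j) x))) = - (\<Sum>j<p. ((%x. m c x + pm_scale (of_nat j) (m z x)) ^^ (p - 1)) x)"
   by (simp add: H_props conj Hc mm sum_negf)
  also have "... = - (\<Sum>s\<le>p - 1. pm_scale (\<Sum>j<p. of_nat j ^ s) (C s x))"
   unfolding C by (subst sum.swap) (simp add: pm.scale_sum_left)
  also have "(\<Sum>s\<le>p - 1. pm_scale (\<Sum>j<p. of_nat j ^ s) (C s x)) = (\<Sum>s\<le>p - 1. if s = p - 1 then - C s x else 0)"
   using p(3) by (intro sum.cong refl) (subst power_sum_CHAR[OF p(1,2)], auto)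
  also have "- ... = (m z ^^ (p - 1)) x" using C(2) by simp
  finally show "(m z ^^ (p - 1)) x = (\<Sum>j<Q. (h ^^ j) (- (m c ^^ (p - 1)) ((hi ^^ j) x)))" by (simp add: Q)
 qed
qed

theorem X_SZ1: "SZ1 \<Delta>"
proof -
 have "SZ1 (%x. pm_scale ((-1) ^ (p - 1)) (\<Delta> ((m z ^^ (p - 1)) x)))"
  by (rule SZ1_scale[OF SZ1_comp_left[OF Lz_power_SZ1 eqv_X]])
 then show ?thesis using X_Lz_power[of "p - 1"] eq1_trans unfolding eq1_0[symmetric] by blast
qed

end

section \<open>Order \<open>p\<close> with \<open>p\<close> odd: exclusion of the blocks of size
  \<open>p - 1\<close>\<close>

section \<open>Odd characteristic\<close>

lemma trc_rank1: "linF \<phi> ==> trc d (%x. pm_scale (\<phi> x) v) = \<phi> (cut d v)"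
 by (simp add: trc_def lin_cut_expand mult.commute)

lemma sum_shift_period:
 fixes f :: "nat => 'w::ab_group_add"
 assumes "!!l. f (l + Q) = f l"
 shows "(\<Sum>t<Q. f (s + t)) = (\<Sum>t<Q. f t)"
proof (induction s)
 case (Suc s)
 have "(\<Sum>t<Q. f (Suc s + t)) = (\<Sum>t<Q. f (s + Suc t))" by simp
 also have "... = (\<Sum>t<Q. f (s + t))"
  by (rule sum_reindex_period[of "%t. f (s + t)"]) (use assms[of s] in simp)
 finally show ?case using Suc by simp
qed simp

context salg
begin

lemma Hi_sum_Tr: "(\<Sum>l<Q. (hi ^^ l) v) = Tr v"
proof -
 have e: "(hi ^^ l) v = (h ^^ Suc (Q - Suc l)) v" if "l < Q" for l
 proof -
  have "(h ^^ l) ((h ^^ Suc (Q - Suc l)) v) = (h ^^ (l + Suc (Q - Suc l))) v"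
   by (simp only: funpow_add o_apply)
  also have "l + Suc (Q - Suc l) = Q" using that by simp
  finally show ?thesis using h_order by (metis Hi_H)
 qed
 have "(\<Sum>l<Q. (hi ^^ l) v) = (\<Sum>l<Q. (%i. (h ^^ Suc i) v) (Q - Suc l))"
  using e by (intro sum.cong refl) simp
 also have "... = (\<Sum>l<Q. (h ^^ Suc l) v)" by (rule sum.nat_diff_reindex)
 also have "... = Tr v" unfolding Tr_def
  using sum_reindex_period[of "%s. (h ^^ s) v" Q] by (simp add: h_order)
 finally show ?thesis .
qed

lemma H_period: "(h ^^ (l + Q)) v = (h ^^ l) v"
 by (simp add: funpow_add h_order)

text \<open>In an honest commutative separable algebra the tensor is dual to the trace form, and
  then multiplication by the sum of \<open>\<pi>(b) a\<close> has the trace of \<open>\<pi>\<close>.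
  Here commutativity, separability and the unit law each cost a transfer, but every transfer
  contributes a multiple of \<open>Q\<close> to the trace.\<close>

lemma trc_mult_contraction:
 assumes pi: "eqv \<pi>" "!!x. cut d (\<pi> x) = \<pi> x" and Q0: "of_nat Q = (0::'k)"
 shows "trc d (m (EV (%a b. m (\<pi> b) a))) = trc d \<pi>"
proof -
 \<comment> \<open>Contracting two slots with the tensor and taking the trace in the third kills
   trilinear transfers, so \<open>DT\<close> depends only on the stable class.\<close>
 define DT where "DT = (%f :: _ => _ => _ => 'k fvec. ES (%a b. trc d (f (\<pi> b) a)))"
 have DT0: "DT f = 0" if f: "SZ3 f" for f
 proof -
  obtain \<theta> where th: "tri \<theta>" "!!x y z. f x y z = (\<Sum>s<Q. (h ^^ s) (\<theta> ((hi ^^ s) x) ((hi ^^ s) y) ((hi ^^ s) z)))"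
   using f unfolding SZ3_def by blast
  have l: "linV (%x. \<theta> x y z)" "linV (%y. \<theta> x y z)" "linV (\<theta> x y)" for x y z
   using th(1) by blast+
  have b: "bilS (*) (%a b. trc d (\<theta> (\<pi> b) a))"
   unfolding trc_def using lin_comp[OF l(2) lin_lookup] lin_comp[OF lin_comp[OF eqv_lin[OF pi(1)] l(1)] lin_lookup]
   by (intro conjI allI lin_sum vs_pm vs_fs) blast+
  have "DT f = ES (%a b. \<Sum>s<Q. trc d (\<theta> ((hi ^^ s) (\<pi> b)) ((hi ^^ s) a)))"
  proof -
   have "trc d (f x y) = (\<Sum>s<Q. trc d (\<theta> ((hi ^^ s) x) ((hi ^^ s) y)))" for x y
   proof -
    have "f x y = (%z. \<Sum>s<Q. (h ^^ s) (\<theta> ((hi ^^ s) x) ((hi ^^ s) y) ((hi ^^ s) z)))"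
     by (rule ext) (rule th(2))
    then show ?thesis by (simp add: trc_sum trc_conj[OF l(3)])
   qed
   then show ?thesis unfolding DT_def by simp
  qed
  also have "... = (\<Sum>s<Q. ES (%a b. trc d (\<theta> (\<pi> ((hi ^^ s) b)) ((hi ^^ s) a))))"
   by (simp add: E_sum eqv_Hi[OF pi(1)])
  also have "... = (\<Sum>s<Q. ES (%a b. trc d (\<theta> (\<pi> b) a)))"
   using E_inv_Hi_S[OF b] by simp
  finally show ?thesis using Q0 by simp
 qed
 have DT_eq: "DT f = DT g" if "f \<sim>3 g" for f g
 proof -
  have "trc d (%z. f x y z - g x y z) = trc d (f x y) - trc d (g x y)" for x y
   by (simp add: trc_def lookup_minus sum_subtractf)
  then show ?thesis
   using DT0[OF that[unfolded eq3_def]] by (simp add: DT_def E_diff)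
 qed
 have "trc d (m (EV (%a b. m (\<pi> b) a))) = DT (%x a w. m (m x a) w)"
  unfolding DT_def trc_def by (simp add: E_apply[OF m_lin1] E_apply[OF lin_lookup] E_sum)
 also have "... = DT (%x a w. m (m x w) a)" by (rule DT_eq[OF right_comm])
 also have "... = (\<Sum>k<d. \<Sum>l<d. ES (%a b. lookup (m (m (pm_basis l) (pm_basis k)) a) k * lookup (\<pi> b) l))"
 proof -
  have "lookup (m (m (\<pi> b) w) a) k = (\<Sum>l<d. lookup (m (m (pm_basis l) w) a) k * lookup (\<pi> b) l)" for a b w k
  proof -
   have "linF (%v. lookup (m (m v w) a) k)" by (rule lin_comp[OF lin_comp[OF m_lin1 m_lin1] lin_lookup])
   from lin_cut_expand[OF this, of d "\<pi> b"] show ?thesis by (simp add: pi(2) mult.commute)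
  qed
  then show ?thesis unfolding DT_def trc_def by (simp add: E_sum)
 qed
 also have "... = (\<Sum>k<d. \<Sum>l<d. ES (%a b. lookup a k * lookup (\<pi> (m b (m (pm_basis l) (pm_basis k)))) l))"
 proof -
  obtain \<Theta> where T: "!!i j. linF (\<Theta> i j)" "!!x \<phi> \<psi>. linF \<phi> ==> linF \<psi> ==>
    ES (%a b. \<phi> (m x a) * \<psi> b) - ES (%a b. \<phi> a * \<psi> (m b x)) =
    (\<Sum>s<Q. \<Sum>i<d. \<Sum>j<d. \<Theta> i j ((hi ^^ s) x) * (\<phi> ((h ^^ s) (pm_basis i)) * \<psi> ((h ^^ s) (pm_basis j))))"
   using sep by blast
  have pl: "linF (%x. lookup (\<pi> x) l)" for l by (rule lin_comp[OF eqv_lin[OF pi(1)] lin_lookup])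
  have "(\<Sum>k<d. \<Sum>l<d. ES (%a b. lookup (m (m (pm_basis l) (pm_basis k)) a) k * lookup (\<pi> b) l)) -
   (\<Sum>k<d. \<Sum>l<d. ES (%a b. lookup a k * lookup (\<pi> (m b (m (pm_basis l) (pm_basis k)))) l)) =
   (\<Sum>k<d. \<Sum>l<d. \<Sum>s<Q. \<Sum>i<d. \<Sum>j<d. \<Theta> i j ((hi ^^ s) (m (pm_basis l) (pm_basis k))) *
    (lookup ((h ^^ s) (pm_basis i)) k * lookup (\<pi> ((h ^^ s) (pm_basis j))) l))"
   using T(2)[OF lin_lookup pl] by (simp flip: sum_subtractf)
  also have "... = (\<Sum>s<Q. \<Sum>i<d. \<Sum>j<d. \<Sum>k<d. \<Sum>l<d. \<Theta> i j ((hi ^^ s) (m (pm_basis l) (pm_basis k))) *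
    (lookup ((h ^^ s) (pm_basis i)) k * lookup (\<pi> ((h ^^ s) (pm_basis j))) l))"
  proof -
   have a: "(\<Sum>k<d. \<Sum>l<d. \<Sum>s<Q. F k l s) = (\<Sum>s<Q. \<Sum>k<d. \<Sum>l<d. F k l s)" for F :: "nat => nat => nat => 'k" and Q
    by (rule trans[OF sum.cong[OF refl sum.swap] sum.swap])
   show ?thesis
    by (rule trans[OF a], rule sum.cong[OF refl], rule trans[OF a], rule sum.cong[OF refl], rule a)
  qed
  \<comment> \<open>The error term of \<open>sep\<close> loses its dependence on \<open>s\<close>:
    equivariance of \<open>\<pi>\<close> and of the product absorbs the powers of \<open>h\<close>.
    The \<open>Q\<close> equal summands then cancel.\<close>
  also have "... = (\<Sum>s<Q. \<Sum>i<d. \<Sum>j<d. \<Theta> i j (m (\<pi> (pm_basis j)) (pm_basis i)))"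
  proof (intro sum.cong refl)
   fix s i j assume ij: "i \<in> {..<d}" "j \<in> {..<d}"
   have b: "bilS (*) (%x y. \<Theta> i j ((hi ^^ s) (m y x)))"
    using lin_comp[OF m_lin1 lin_comp[OF Hi_lin T(1)]] lin_comp[OF m_lin2 lin_comp[OF Hi_lin T(1)]] by fast
   have "(\<Sum>k<d. \<Sum>l<d. \<Theta> i j ((hi ^^ s) (m (pm_basis l) (pm_basis k))) *
    (lookup ((h ^^ s) (pm_basis i)) k * lookup (\<pi> ((h ^^ s) (pm_basis j))) l)) =
    \<Theta> i j ((hi ^^ s) (m (cut d (\<pi> ((h ^^ s) (pm_basis j)))) (cut d ((h ^^ s) (pm_basis i)))))"
    using bil_expand[OF b, of d "\<pi> ((h ^^ s) (pm_basis j))" "(h ^^ s) (pm_basis i)"] by (simp only: mult.commute)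
   also have "... = \<Theta> i j (m (\<pi> (pm_basis j)) (pm_basis i))"
    by (simp add: eqv_H[OF pi(1)] eqv2_H[OF m_eqv2])
   finally show "(\<Sum>k<d. \<Sum>l<d. \<Theta> i j ((hi ^^ s) (m (pm_basis l) (pm_basis k))) *
    (lookup ((h ^^ s) (pm_basis i)) k * lookup (\<pi> ((h ^^ s) (pm_basis j))) l)) = ..." .
  qed
  also have "... = 0" using Q0 by simp
  finally show ?thesis by simp
 qed
 also have "... = trc d (%x. \<pi> (EV (%a b. m b (m x a))))"
 proof -
  have "trc d (%x. \<pi> (EV (%a b. m b (m x a)))) = (\<Sum>l<d. ES (%a b. lookup (\<pi> (m b (m (pm_basis l) (cut d a)))) l))"
   unfolding trc_def by (simp add: E_apply[OF eqv_lin[OF pi(1)]] E_apply[OF lin_lookup])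
  also have "... = (\<Sum>l<d. \<Sum>k<d. ES (%a b. lookup a k * lookup (\<pi> (m b (m (pm_basis l) (pm_basis k)))) l))"
   by (simp only: lin_cut_expand[OF lin_comp[OF m_lin2 lin_comp[OF m_lin2 lin_comp[OF eqv_lin[OF pi(1)] lin_lookup]]]] E_sum vs_fs)
  finally show ?thesis by (subst sum.swap) simp
 qed
 also have "... = trc d \<pi>"
 proof -
  have "(%x. EV (%a b. m b (m x a))) \<sim>1 (%x. EV (%a b. m x (m a b)))"
   by (rule plug[OF eq3_trans[OF eq3_rot[OF eq3_rot[OF left_comm]] eq3_sym[OF m_comm_inner]] eqv_id eqv_id])
  also have "... = (%x. m x (EV m))" by (simp add: E_apply[OF m_lin2])
  also have "... \<sim>1 (%x. m x u)"
   using SZ0_mult[OF mE m_eqv2 eqv_id] by (simp add: eq1_def m_props)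
  also have "... \<sim>1 m u" using comm_fixed[OF h_u eqv_id] .
  also have "m u \<sim>1 cut d" by (rule unit)
  finally have "(%x. \<pi> (EV (%a b. m b (m x a)))) \<sim>1 (%x. \<pi> (cut d x))"
   by (rule eq1_left[OF _ pi(1)])
  then have "trc d (%x. \<pi> (EV (%a b. m b (m x a))) - \<pi> (cut d x)) = 0"
   unfolding eq1_def by (rule trc_SZ1[OF _ Q0])
  then show ?thesis by (simp add: trc_def lookup_minus sum_subtractf)
 qed
 finally show ?thesis .
qed

text \<open>The principle of \<open>plug\<close> with two copies of the tensor inserted, as required
  for the square of a contracted operator.\<close>

lemma plug4:
 assumes F: "!!x a b a' b'. \<Phi> x a b a' b' = (\<Sum>s<Q. (h ^^ s) (\<Theta> ((hi ^^ s) x) ((hi ^^ s) a) ((hi ^^ s) b) ((hi ^^ s) a') ((hi ^^ s) b')))"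
  and l: "!!a b a' b'. linV (%x. \<Theta> x a b a' b')" and b: "!!x a' b'. bil (%a b. \<Theta> x a b a' b')" "!!x a b. bil (\<Theta> x a b)"
 shows "SZ1 (%x. EV (%a b. EV (%a' b'. \<Phi> x a b a' b')))"
proof (rule SZ1I[of "%x. EV (%a b. EV (%a' b'. \<Theta> x a b a' b'))"])
 show "linV (%x. EV (%a b. EV (%a' b'. \<Theta> x a b a' b')))" by (intro E_lin l)
 fix x
 have b': "bil (%a b. EV (%a' b'. \<Theta> x a b a' b'))" for x
  using b(1) by (intro conjI allI E_lin) blast+
 have "EV (%a b. EV (%a' b'. \<Phi> x a b a' b')) = (\<Sum>s<Q. EV (%a b. EV (%a' b'. (h ^^ s) (\<Theta> ((hi ^^ s) x) ((hi ^^ s) a) ((hi ^^ s) b) ((hi ^^ s) a') ((hi ^^ s) b')))))"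
  by (simp add: F E_sum)
 also have "... = (\<Sum>s<Q. (h ^^ s) (EV (%a b. EV (%a' b'. \<Theta> ((hi ^^ s) x) ((hi ^^ s) a) ((hi ^^ s) b) ((hi ^^ s) a') ((hi ^^ s) b')))))"
  by (simp add: E_apply[OF H_lin])
 also have "... = (\<Sum>s<Q. (h ^^ s) (EV (%a b. EV (%a' b'. \<Theta> ((hi ^^ s) x) a b a' b'))))"
  using E_inv_Hi_V[OF b(2)] E_inv_Hi_V[OF b'] by simp
 finally show "EV (%a b. EV (%a' b'. \<Phi> x a b a' b')) = ..." .
qed

end

context salg_p
begin

lemma Tr_p: "Tr x = (\<Sum>s<p. (h ^^ s) x)" unfolding Tr_def unfolding Q ..

text \<open>Differentiating the norm, which is \<open>\<Delta> ^^ (p - 1)\<close>, shows that this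
  operator is \<open>\<Delta> ^^ (p - 2)\<close> up to sign and a factor \<open>h\<close>. Applied
  to vectors of norm zero it yields the fixed vectors contributed by blocks of size
  \<open>p - 1\<close>.\<close>

definition Z where "Z x = (\<Sum>j<p. pm_scale (of_nat j) ((h ^^ j) x))"

lemma Delta_Z: "\<Delta> (Z x) = - Tr x"
proof -
 define F where "F = (%j. pm_scale (of_nat j - 1) ((h ^^ j) x))"
 have "(h ^^ p) x = x" using h_order Q by simp
 then have "F p = F 0" by (simp add: F_def p0)
 from sum_reindex_period[of F, OF this] have "(\<Sum>j<p. F (Suc j)) = (\<Sum>j<p. F j)" .
 then have "h (Z x) = (\<Sum>j<p. F j)" by (simp add: F_def Z_def h_props)
 also have "... = Z x - Tr x"
  by (simp add: F_def Z_def Tr_p pm.scale_left_diff_distrib sum_subtractf)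
 finally show ?thesis by simp
qed

context
 fixes \<eta> :: "'k fvec => 'k" and y
 assumes \<eta>: "linF \<eta>" "!!v. \<eta> (Tr v) = 0" and y: "cut d y = y" "Tr y = 0"
begin

text \<open>Viewed as a function of \<open>k\<close>, the family \<open>cf k v\<close> is translated
  by \<open>h\<close> up to a constant, so \<open>\<eta>\<close> gives an equivariant map to
  functions on the group modulo constants. As \<open>Tr y = 0\<close>, constants act on
  \<open>y\<close> as zero; hence \<open>pr\<close> is equivariant and factors through this
  indecomposable module of dimension \<open>p - 1\<close>.\<close>

definition cf :: "nat => 'k fvec => 'k" where "cf k v = - (\<Sum>l<k. \<eta> ((hi ^^ l) v))"
definition pr :: "'k fvec => 'k fvec" where "pr v = (\<Sum>k<p. pm_scale (cf k v) ((h ^^ k) y))"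

lemma cf_lin: "linF (cf k)"
 unfolding cf_def by (intro lin_neg lin_sum vs_pm vs_fs lin_comp[OF Hi_lin \<eta>(1)])

lemma cf_add: "cf (s + t) v - cf s v = cf t ((hi ^^ s) v)"
proof (induction t)
 case (Suc t)
 have e: "(hi ^^ (s + t)) v = (hi ^^ t) ((hi ^^ s) v)"
  by (subst add.commute) (simp only: funpow_add o_apply)
 show ?case using Suc by (simp add: cf_def e)
qed (simp add: cf_def)

lemma cf_p: "cf p v = 0"
proof -
 have "(\<Sum>l<p. \<eta> ((hi ^^ l) v)) = \<eta> (\<Sum>l<Q. (hi ^^ l) v)" by (simp add: Q lin_props[OF \<eta>(1)])
 then show ?thesis by (simp add: cf_def Hi_sum_Tr \<eta>(2))
qed

lemma cf_period: "cf (k + p) v = cf k v"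
 using cf_add[of k p v] by (simp add: cf_p)

lemma cf_Suc_h: "cf (Suc k) (h v) = cf k v - \<eta> (h v)"
 unfolding cf_def by (subst sum.lessThan_Suc_shift) (simp add: funpow_swap1)

lemma pr_lin: "linV pr"
 unfolding pr_def by (intro lin_sum vs_pm lin_scale_left cf_lin)

lemma pr_eqv: "eqv pr"
 unfolding eqv_def
proof (intro conjI allI pr_lin)
 fix v
 have "(\<Sum>k<p. pm_scale (cf (Suc k) (h v)) ((h ^^ Suc k) y)) = pr (h v)"
  unfolding pr_def
  by (rule sum_reindex_period[of "%k. pm_scale (cf k (h v)) ((h ^^ k) y)" p]) (unfold cf_p, simp add: cf_def)
 then have "pr (h v) = (\<Sum>k<p. pm_scale (cf k v - \<eta> (h v)) ((h ^^ Suc k) y))" by (simp add: cf_Suc_h)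
 also have "... = h (pr v) - pm_scale (\<eta> (h v)) (h (Tr y))"
  by (simp add: pr_def h_props pm.scale_left_diff_distrib sum_subtractf pm.scale_sum_right Tr_p)
 finally show "pr (h v) = h (pr v)" by (simp add: y h_props pm.scale_zero_right)
qed

lemma cut_pr: "cut d (pr v) = pr v"
 unfolding pr_def lin_props[OF cut_lin] by (simp add: y flip: H_cut)

text \<open>The trace is a sum of partial sums of the values of \<open>\<eta>\<close> on the orbit
  of \<open>y\<close>. Abel summation turns it into the sum weighted by the index, and the boundary
  term carries the factor \<open>p\<close>.\<close>

lemma trc_pr: "trc d pr = \<eta> (Z y)"
proof -
 define a where "a = (%r. \<eta> ((h ^^ r) y))"
 define S where "S = (%k. \<Sum>i<k. a (Suc i))"
 have "trc d pr = (\<Sum>k<p. cf k (cut d ((h ^^ k) y)))"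
  unfolding pr_def by (simp add: trc_sum trc_rank1[OF cf_lin])
 also have "... = (\<Sum>k<p. - S k)"
 proof (intro sum.cong refl)
  fix k
  have e: "(hi ^^ l) ((h ^^ k) y) = (h ^^ Suc (k - Suc l)) y" if "l < k" for l
  proof -
   have "(h ^^ k) y = (h ^^ l) ((h ^^ Suc (k - Suc l)) y)"
    using that by (metis Suc_diff_Suc add_diff_inverse_nat comp_apply funpow_add less_imp_not_less)
   then show ?thesis by simp
  qed
  have "cf k (cut d ((h ^^ k) y)) = - (\<Sum>l<k. a (Suc (k - Suc l)))"
   unfolding cf_def a_def using e by (simp add: y flip: H_cut)
  also have "... = - S k" unfolding S_def by (subst sum.nat_diff_reindex) simp
  finally show "cf k (cut d ((h ^^ k) y)) = - S k" .
 qed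
 also have "... = (\<Sum>r<p. of_nat r * a r)"
 proof -
  have "(\<Sum>k<n. S k) + (\<Sum>r<n. of_nat r * a r) = of_nat n * (S n - a n)" for n
   by (induction n) (auto simp: S_def algebra_simps)
  from this[of p] show ?thesis by (simp add: p0 sum_negf add_eq_0_iff)
 qed
 also have "... = \<eta> (Z y)" by (simp add: Z_def a_def lin_props[OF \<eta>(1)])
 finally show ?thesis .
qed

text \<open>The symmetric square of functions modulo constants is projective. Concretely, the rows
  of \<open>B\<close> sum to zero, so the symmetrized product is -1/2 times the sum of all
  \<open>G w w' x k l\<close>. Since differences of \<open>cf\<close> are translated exactly, this
  sum splits into free orbits of pairs under diagonal translation and is a transfer. The
  antisymmetrized product is a transfer by \<open>left_comm\<close>, and 2 is invertible.\<close>

lemma pr_anticommutes: "SZ3 (%w w' x. m (pr w) (m (pr w') x))"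
proof -
 define N where "N = (%w w' x. m (pr w) (m (pr w') x))"
 define B where "B = (%k l x. m ((h ^^ k) y) (m ((h ^^ l) y) x) + m ((h ^^ l) y) (m ((h ^^ k) y) x))"
 define G where "G = (%w w' x k l. pm_scale ((cf k w - cf l w) * (cf k w' - cf l w')) (B k l x))"
 have two: "(2::'k) \<noteq> 0"
  using p of_nat_eq_0_iff_char_dvd[where 'a='k, of 2] by (auto dest: dvd_imp_le)
 have N_add: "N w w' x + N w' w x = (\<Sum>k<p. \<Sum>l<p. pm_scale (cf k w * cf l w') (B k l x))" for w w' x
 proof -
  have n: "N w w' x = (\<Sum>k<p. \<Sum>l<p. pm_scale (cf k w * cf l w') (m ((h ^^ k) y) (m ((h ^^ l) y) x)))" for w w'
   unfolding N_def pr_def m_props pm.scale_sum_right pm.scale_scale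
   by (subst sum.swap) (simp add: mult.commute)
  have "N w' w x = (\<Sum>k<p. \<Sum>l<p. pm_scale (cf k w * cf l w') (m ((h ^^ l) y) (m ((h ^^ k) y) x)))"
   unfolding n by (subst sum.swap) (simp add: mult.commute)
  then show ?thesis unfolding n B_def by (simp add: pm.scale_right_distrib sum.distrib)
 qed
 have B_sum: "(\<Sum>l<p. B k l x) = 0" for k x
 proof -
  have "(\<Sum>l<p. B k l x) = m ((h ^^ k) y) (m (Tr y) x) + m (Tr y) (m ((h ^^ k) y) x)"
   by (simp add: B_def m_props Tr_p sum.distrib)
  then show ?thesis by (simp add: y m_props)
 qed
 have B_comm: "B k l x = B l k x" for k l x by (simp add: B_def add.commute)
 have sumG: "(\<Sum>k<p. \<Sum>l<p. G w w' x k l) = pm_scale (- 2) (N w w' x + N w' w x)" for w w' x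
 proof -
  have z1: "(\<Sum>k<p. \<Sum>l<p. pm_scale (cf k w * cf k w') (B k l x)) = 0"
   by (simp add: B_sum flip: pm.scale_sum_right)
  have z2: "(\<Sum>k<p. \<Sum>l<p. pm_scale (cf l w * cf l w') (B k l x)) = 0"
  proof -
   have "(\<Sum>k<p. B k l x) = (\<Sum>k<p. B l k x)" for l by (intro sum.cong refl B_comm)
   then show ?thesis by (subst sum.swap) (simp add: B_sum flip: pm.scale_sum_right)
  qed
  have z3: "(\<Sum>k<p. \<Sum>l<p. pm_scale (cf l w * cf k w') (B k l x)) = (\<Sum>k<p. \<Sum>l<p. pm_scale (cf k w * cf l w') (B k l x))"
   by (subst sum.swap, intro sum.cong refl) (subst B_comm, rule refl)
  have "(\<Sum>k<p. \<Sum>l<p. G w w' x k l) = (\<Sum>k<p. \<Sum>l<p. pm_scale (cf k w * cf k w') (B k l x)) + (\<Sum>k<p. \<Sum>l<p. pm_scale (cf l w * cf l w') (B k l x))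
   - (\<Sum>k<p. \<Sum>l<p. pm_scale (cf k w * cf l w') (B k l x)) - (\<Sum>k<p. \<Sum>l<p. pm_scale (cf l w * cf k w') (B k l x))"
   by (simp add: G_def ring_distribs pm.scale_left_distrib pm.scale_left_diff_distrib sum.distrib sum_subtractf)
  then show ?thesis unfolding z1 z2 z3 N_add[symmetric] by (simp add: pm.scale_left_distrib[of 1 1, simplified])
 qed
 have Gs: "(h ^^ s) (G ((hi ^^ s) w) ((hi ^^ s) w') ((hi ^^ s) x) 0 t) = G w w' x s (s + t)" for s t w w' x
 proof -
  have c: "cf 0 ((hi ^^ s) v) - cf t ((hi ^^ s) v) = cf s v - cf (s + t) v" for v
  proof -
   have "cf 0 ((hi ^^ s) v) = 0" by (simp add: cf_def)
   then show ?thesis by (simp flip: cf_add)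
  qed
  have "(h ^^ s) (B 0 t ((hi ^^ s) x)) = B s (s + t) x"
   by (simp add: B_def H_props funpow_add flip: eqv2_H[OF m_eqv2])
  then show ?thesis by (simp add: G_def c H_props)
 qed
 have Gp: "G w w' x k (l + p) = G w w' x k l" for w w' x k l
  using H_period[of l y, unfolded Q] by (simp add: G_def B_def cf_period)
 \<comment> \<open>The pairs \<open>(0, t)\<close> represent the orbits of diagonal translation on
   pairs of indices.\<close>
 define \<theta> where "\<theta> = (%w w' x. pm_scale (- (1/2)) (\<Sum>t<p. G w w' x 0 t))"
 have "SZ3 (%w w' x. N w w' x + N w' w x)"
 proof (rule SZ3I[of \<theta>])
  have Bl: "linV (B k l)" for k l
   unfolding B_def by (intro lin_add lin_comp[OF m_lin2 m_lin2])
  have cl: "linF (%w. (cf k w - cf l w) * c)" "linF (%w. c * (cf k w - cf l w))" for k l c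
  proof -
   show "linF (%w. c * (cf k w - cf l w))" by (intro lin_scale lin_diff cf_lin)
   then show "linF (%w. (cf k w - cf l w) * c)" by (simp only: mult.commute)
  qed
  show "tri \<theta>" unfolding \<theta>_def G_def
   by (intro conjI allI lin_scale lin_sum vs_pm lin_scale_left cl Bl)
  fix w w' x
  have "(\<Sum>s<Q. (h ^^ s) (\<theta> ((hi ^^ s) w) ((hi ^^ s) w') ((hi ^^ s) x))) = pm_scale (- (1/2)) (\<Sum>s<p. \<Sum>t<p. G w w' x s (s + t))"
   by (simp add: \<theta>_def H_props Gs Q pm.scale_sum_right)
  also have "(\<Sum>s<p. \<Sum>t<p. G w w' x s (s + t)) = (\<Sum>s<p. \<Sum>t<p. G w w' x s t)"
   by (intro sum.cong refl sum_shift_period[of "G w w' x _" p] Gp)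
  also have "pm_scale (- (1/2)) ... = N w w' x + N w' w x"
   unfolding sumG using two by simp
  finally show "N w w' x + N w' w x = (\<Sum>s<Q. (h ^^ s) (\<theta> ((hi ^^ s) w) ((hi ^^ s) w') ((hi ^^ s) x)))" by simp
 qed
 moreover have "SZ3 (%w w' x. N w w' x - N w' w x)"
  using eq3_map[OF left_comm eqv_id pr_eqv pr_eqv eqv_id] unfolding eq3_def N_def .
 ultimately have "SZ3 (%w w' x. (N w w' x + N w' w x) + (N w w' x - N w' w x))"
  by (rule SZ3_add)
 from SZ3_map[OF this eqv_scale[of "1/2"] eqv_id eqv_id eqv_id]
 have "SZ3 (%w w' x. pm_scale (1/2) (N w w' x + N w w' x))" by simp
 moreover have "pm_scale (1/2) (v + v) = v" for v :: "'k fvec"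
 proof -
  have "pm_scale (1/2) (v + v) = pm_scale (1/2 + 1/2) v" by (simp only: pm.scale_right_distrib pm.scale_left_distrib)
  moreover have "1/2 + 1/2 = (1::'k)" using two by (simp add: field_simps)
  ultimately show ?thesis by simp
 qed
 ultimately show ?thesis by (simp add: N_def)
qed

text \<open>Multiplication by the sum of \<open>pr(b) a\<close> has trace
  \<open>\<eta> (Z y)\<close>, while its square contains two factors from the image of
  \<open>pr\<close> and is stably zero. The Frobenius identity applies to nilpotency up to transfers
  as well, because transfers have trace zero.\<close>

lemma eta_Z: "\<eta> (Z y) = 0"
proof -
 define L where "L = m (EV (%a b. m (pr b) a))"
 define M where "M = (%x. EV (%a b. m a (m (pr b) x)))"
 have trL: "trc d L = \<eta> (Z y)"
  unfolding L_def using trc_mult_contraction[OF pr_eqv cut_pr] p0 Q trc_pr by simp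
 have "eqv2 (%b a. m (pr b) a)"
  using eqv2_m_map[OF pr_eqv eqv_id] .
 then have "h (EV (%a b. m (pr b) a)) = EV (%a b. m (pr b) a)"
  by (rule E_fixed[OF eqv2_swap])
 then have L_eqv: "eqv L" unfolding L_def by (rule eqv_mult_fixed)
 have LM: "L \<sim>1 M"
 proof -
  have "(%b a x. m (m b a) x) \<sim>3 (%b a x. m a (m b x))"
   using eq3_trans[OF m_comm_outer eq3_swap[OF assoc]] .
  from plug[OF eq3_rot[OF eq3_swap[OF this]] eqv_id pr_eqv]
  have "(%x. EV (%a b. m (m (pr b) a) x)) \<sim>1 M" unfolding M_def .
  moreover have "L = (%x. EV (%a b. m (m (pr b) a) x))"
   by (simp add: L_def E_apply[OF m_lin1] fun_eq_iff)
  ultimately show ?thesis by simp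
 qed
 have M_eqv: "eqv M"
  unfolding eqv_def
 proof (intro conjI allI)
  show "linV M" unfolding M_def by (intro E_lin lin_comp[OF m_lin2 m_lin2])
  fix x
  have b: "bil (%a b. m a (m (pr b) (h x)))"
   using m_lin1 lin_comp[OF lin_comp[OF pr_lin m_lin1] m_lin2] by fast
  have "M (h x) = EV (%a b. m (h a) (m (pr (h b)) (h x)))"
   unfolding M_def by (rule E_inv_V[OF b, symmetric])
  also have "... = h (M x)"
   by (simp add: M_def eqv_h[OF pr_eqv] m_h E_apply[OF h_lin])
  finally show "M (h x) = h (M x)" .
 qed
 have MM: "SZ1 (%x. M (M x))"
 proof -
  have e: "M (M x) = EV (%a b. EV (%a' b'. m a (m (pr b) (m a' (m (pr b') x)))))" for x
   unfolding M_def by (simp add: E_apply[OF m_lin2])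
  obtain \<theta> where th: "tri \<theta>" "!!x y z. m x (m y z) - m y (m x z) = (\<Sum>s<Q. (h ^^ s) (\<theta> ((hi ^^ s) x) ((hi ^^ s) y) ((hi ^^ s) z)))"
   using left_comm unfolding SZ3_def eq3_def by blast
  have l: "linV (%x. \<theta> x y z)" "linV (%y. \<theta> x y z)" "linV (\<theta> x y)" for x y z
   using th(1) by blast+
  \<comment> \<open>Interchanging \<open>pr b\<close> with \<open>a'\<close> brings both factors
    from the image of \<open>pr\<close> next to \<open>x\<close>, where
    \<open>pr_anticommutes\<close> applies.\<close>
  have "SZ1 (%x. EV (%a b. EV (%a' b'. m a (m (pr b) (m a' (m (pr b') x)) - m a' (m (pr b) (m (pr b') x))))))"
  proof (rule plug4[of _ "%x a b a' b'. m a (\<theta> (pr b) a' (m (pr b') x))"])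
   show "linV (%x. m a (\<theta> (pr b) a' (m (pr b') x)))" for a b a' b'
    by (rule lin_comp[OF lin_comp[OF m_lin2 l(3)] m_lin2])
   show "bil (%a b. m a (\<theta> (pr b) a' (m (pr b') x)))" for x a' b'
    using m_lin1 lin_comp[OF lin_comp[OF pr_lin l(1)] m_lin2] by fast
   show "bil (%a' b'. m a (\<theta> (pr b) a' (m (pr b') x)))" for x a b
    using lin_comp[OF l(2) m_lin2] lin_comp[OF lin_comp[OF lin_comp[OF pr_lin m_lin1] l(3)] m_lin2] by fast
  qed (simp add: th(2) m_props eqv2_H1[OF m_eqv2] eqv_Hi[OF pr_eqv] flip: eqv2_Hi[OF m_eqv2])
  moreover obtain \<theta>' where th': "tri \<theta>'" "!!w w' x. m (pr w) (m (pr w') x) = (\<Sum>s<Q. (h ^^ s) (\<theta>' ((hi ^^ s) w) ((hi ^^ s) w') ((hi ^^ s) x)))"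
   using pr_anticommutes unfolding SZ3_def by blast
  have l': "linV (%x. \<theta>' x y z)" "linV (%y. \<theta>' x y z)" "linV (\<theta>' x y)" for x y z
   using th'(1) by blast+
  have "SZ1 (%x. EV (%a b. EV (%a' b'. m a (m a' (m (pr b) (m (pr b') x))))))"
  proof (rule plug4[of _ "%x a b a' b'. m a (m a' (\<theta>' b b' x))"])
   show "linV (%x. m a (m a' (\<theta>' b b' x)))" for a b a' b'
    by (rule lin_comp[OF lin_comp[OF l'(3) m_lin2] m_lin2])
   show "bil (%a b. m a (m a' (\<theta>' b b' x)))" for x a' b'
    using m_lin1 lin_comp[OF lin_comp[OF l'(1) m_lin2] m_lin2] by fast
   show "bil (%a' b'. m a (m a' (\<theta>' b b' x)))" for x a b
    using lin_comp[OF m_lin1 m_lin2] lin_comp[OF lin_comp[OF l'(2) m_lin2] m_lin2] by fast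
  qed (simp add: th'(2) m_props eqv2_H1[OF m_eqv2])
  ultimately have "SZ1 (%x. EV (%a b. EV (%a' b'. m a (m (pr b) (m a' (m (pr b') x)) - m a' (m (pr b) (m (pr b') x)))))
    + EV (%a b. EV (%a' b'. m a (m a' (m (pr b) (m (pr b') x))))))"
   by (rule SZ1_add)
  then show ?thesis by (simp add: e m_props E_diff)
 qed
 have "(%x. L (L x)) \<sim>1 (%x. M (L x))" by (rule eq1_right[OF LM L_eqv])
 also have "... \<sim>1 (%x. M (M x))" by (rule eq1_left[OF LM M_eqv])
 also have "... \<sim>1 (%x. 0)" using MM by (simp add: eq1_0)
 finally have LL: "SZ1 (%x. L (L x))" by (simp add: eq1_0)
 have "SZ1 (%x. (L ^^ (p - 2)) (L (L x)))"
  by (rule SZ1_comp_left[OF LL eqv_funpow[OF L_eqv]])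
 moreover have "(%x. (L ^^ (p - 2)) (L (L x))) = L ^^ p"
 proof -
  have "p = Suc (Suc (p - 2))" using p by simp
  then have "L ^^ p = L ^^ (Suc (Suc (p - 2)))" by simp
  also have "... = (%x. (L ^^ (p - 2)) (L (L x)))" by (simp only: funpow_Suc_right) (simp add: o_def)
  finally show ?thesis by simp
 qed
 ultimately have "trc d (L ^^ p) = 0" using trc_SZ1 p0 Q by simp
 moreover have "trc d (L ^^ p) = trc d L ^ p"
  by (rule trc_frobenius[OF eqv_lin[OF L_eqv] _ p(1,2)]) (simp add: L_def)
 ultimately show ?thesis using trL by simp
qed

end

theorem Z_in_range_Tr:
 assumes "cut d y = y" "Tr y = 0"
 shows "\<exists>v. Z y = Tr v"
proof (rule ccontr)
 assume "\<nexists>v. Z y = Tr v"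
 then have "Z y \<notin> range Tr" by auto
 then obtain \<eta> where "linF \<eta>" "!!v. \<eta> (Tr v) = 0" "\<eta> (Z y) = 1"
  using funct_separation[OF subspace_range_lin[OF Tr_lin], of "Z y"] by blast
 then show False using eta_Z[of \<eta> y] assms by simp
qed

text \<open>With \<open>\<Delta>\<close> written as the transfer of \<open>\<theta>\<close> and
  \<open>a = \<Delta> c\<close>, the relation \<open>(hi ^^ s) c = c - s a\<close> gives
  \<open>a = Tr (\<theta> c) - Z (\<theta> a)\<close>. The last term is fixed by \<open>h\<close>,
  so \<open>\<theta> a\<close> has norm zero and \<open>Z_in_range_Tr\<close> applies. In terms of
  Jordan blocks, the sizes from 2 to \<open>p - 1\<close> do not occur.\<close>

theorem fixed_image_in_range_Tr:
 assumes "\<Delta> (\<Delta> c) = 0"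
 shows "\<exists>v. \<Delta> c = Tr v"
proof -
 have "SZ1 (%x. cut d (\<Delta> x))" by (rule SZ1_comp_left[OF X_SZ1 eqv_cut])
 obtain \<theta>0 where th0: "linV \<theta>0" "!!x. \<Delta> x = (\<Sum>s<Q. (h ^^ s) (\<theta>0 ((hi ^^ s) x)))"
  using X_SZ1 unfolding SZ1_def by blast
 define \<theta> where "\<theta> = (%x. cut d (\<theta>0 x))"
 have th: "linV \<theta>" unfolding \<theta>_def by (rule lin_comp[OF th0(1) cut_lin])
 have th': "\<Delta> x = (\<Sum>s<Q. (h ^^ s) (\<theta> ((hi ^^ s) x)))" for x
  using arg_cong[OF th0(2)[of x], of "cut d"] cut_X[of x] by (simp add: \<theta>_def lin_props[OF cut_lin] H_cut)
 define a where "a = \<Delta> c"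
 have ha: "h a = a" "hi a = a" using assms by (auto simp: a_def) (metis hi_h eq_iff_diff_eq_0)
 have hic: "(hi ^^ s) c = c - pm_scale (of_nat s) a" for s
 proof (induction s)
  case (Suc s)
  have "hi c = c - a"
  proof -
   have "h c = c + a" by (simp add: a_def)
   then have "c = hi c + a" by (metis hi_h hi_props(1) ha(2))
   then show ?thesis by (metis add_diff_cancel_right')
  qed
  then show ?case using Suc by (simp add: hi_props ha pm.scale_left_distrib)
 qed simp
 have a_eq: "a = Tr (\<theta> c) - Z (\<theta> a)"
 proof -
  have "a = (\<Sum>s<Q. (h ^^ s) (\<theta> ((hi ^^ s) c)))" using th'[of c] by (simp only: a_def)
  also have "... = (\<Sum>s<p. (h ^^ s) (\<theta> c) - pm_scale (of_nat s) ((h ^^ s) (\<theta> a)))"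
   by (simp only: hic lin_props[OF th] H_props Q)
  finally show ?thesis by (simp only: Tr_p Z_def sum_subtractf)
 qed
 have ze: "Z (\<theta> a) = Tr (\<theta> c) - a" using a_eq by (simp add: algebra_simps)
 have "h (Z (\<theta> a)) = Z (\<theta> a)" unfolding ze by (simp only: h_props h_Tr ha)
 then have "Tr (\<theta> a) = 0" using Delta_Z[of "\<theta> a"] by simp
 then obtain v where "Z (\<theta> a) = Tr v"
  using Z_in_range_Tr[of "\<theta> a"] by (auto simp: \<theta>_def)
 then have "a = Tr (\<theta> c - v)" using a_eq by (simp add: lin_props[OF Tr_lin])
 then show ?thesis by (auto simp: a_def)
qed

end

section \<open>Splitting of honest commutative separable algebras over separably closed
  fields\<close>

section \<open>Honest commutative separable algebras\<close>

section \<open>Polynomials over separably closed fields\<close>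

lemma exists_irreducible_divisor:
 fixes f :: "'k::field poly"
 assumes "Polynomial.degree f > 0"
 shows "\<exists>g. irreducible g \<and> g dvd f"
 using assms
proof (induction "Polynomial.degree f" arbitrary: f rule: less_induct)
 case less
 have f1: "f \<noteq> 0" using less.prems by auto
 then have f0: "f \<noteq> 0" "\<not> f dvd 1" using less.prems is_unit_iff_degree[of f] by auto
 show ?case
 proof (cases "irreducible f")
  case False
  then obtain a b where ab: "f = a * b" "\<not> a dvd 1" "\<not> b dvd 1"
   using f0 by (auto simp: irreducible_def)
  have n0: "a \<noteq> 0" "b \<noteq> 0" using ab f0 by auto
  have "Polynomial.degree a > 0" "Polynomial.degree b > 0"
   using ab n0 by (auto simp: is_unit_iff_degree)
  moreover have "Polynomial.degree f = Polynomial.degree a + Polynomial.degree b"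
   using ab n0 by (simp add: degree_mult_eq)
  ultimately obtain g where "irreducible g" "g dvd a" using less.hyps[of a] by auto
  then show ?thesis using ab by auto
 qed auto
qed

lemma CHAR_power_inj:
 fixes a b :: "'k::field"
 assumes "prime p" "CHAR('k) = p" "a ^ (p ^ t) = b ^ (p ^ t)"
 shows "a = b"
proof -
 have "((a - b) + b) ^ (p ^ t) = (a - b) ^ (p ^ t) + b ^ (p ^ t)"
  by (rule freshmans_dream'[where n=t]) (use assms in simp_all)
 then show ?thesis using assms(3) by simp
qed

abbreviation frob_prod :: "nat => 'k::field set => 'k poly" where
 "frob_prod n C \<equiv> (\<Prod>c\<in>C. Polynomial.monom 1 n - [:c:])"

lemma frob_prod_power:
 fixes C :: "'k::field set"
 assumes "prime p" "CHAR('k) = p"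
 shows "frob_prod (p ^ N) C ^ (p ^ t) = frob_prod (p ^ (N + t)) ((%c. c ^ (p ^ t)) ` C)"
proof -
 have "(Polynomial.monom 1 (p ^ N) - [:c:]) ^ (p ^ t) = Polynomial.monom 1 (p ^ (N + t)) - [:c ^ (p ^ t):]" for c :: 'k
 proof -
  have "((Polynomial.monom 1 (p ^ N) - [:c:]) + [:c:]) ^ (p ^ t) = (Polynomial.monom 1 (p ^ N) - [:c:]) ^ (p ^ t) + [:c:] ^ (p ^ t)"
   by (rule freshmans_dream'[where n=t]) (use assms in simp_all)
  then show ?thesis
   by (simp add: monom_power poly_const_pow power_add algebra_simps)
 qed
 moreover have "inj_on (%c. c ^ (p ^ t)) C"
  using CHAR_power_inj[OF assms] by (auto intro: inj_onI)
 ultimately show ?thesis by (simp add: prod.reindex prod_power_distrib)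
qed

text \<open>Raising to a power of \<open>p\<close> keeps the shape of the product, which brings
  annihilators with different exponents to a common one.\<close>

lemma frob_prod_raise:
 fixes C :: "'k::field set"
 assumes "prime p" "CHAR('k) = p" "finite C" "f dvd frob_prod (p ^ N) C"
 shows "\<exists>C'. finite C' \<and> f dvd frob_prod (p ^ (N + t)) C'"
proof (intro exI[of _ "(%c. c ^ (p ^ t)) ` C"] conjI)
 have "frob_prod (p ^ N) C dvd frob_prod (p ^ N) C ^ (p ^ t)"
  using prime_gt_0_nat[OF assms(1)] by (intro dvd_power) simp
 then show "f dvd frob_prod (p ^ (N + t)) ((%c. c ^ (p ^ t)) ` C)"
  using dvd_trans[OF assms(4)] unfolding frob_prod_power[OF assms(1,2)] by blast
qed (use assms in auto)

lemma pcompose_monom': "pcompose (Polynomial.monom a i) q = smult a (q ^ i)"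
 by (induction i) (auto simp: monom_0 monom_Suc pcompose_pCons mult_smult_right)

lemma pderiv_0_pcompose:
 fixes g :: "'k::field poly"
 assumes "prime p" "CHAR('k) = p" "pderiv g = 0" "Polynomial.degree g > 0"
 shows "\<exists>h. g = pcompose h (Polynomial.monom 1 p) \<and> Polynomial.degree h < Polynomial.degree g"
proof -
 have p: "p > 1" using assms(1) prime_gt_1_nat by auto
 have c0: "Polynomial.coeff g i = 0" if "\<not> p dvd i" for i
 proof -
  have "i > 0" using that by (auto intro: Nat.gr0I)
  then have "of_nat i * Polynomial.coeff g i = 0"
   using arg_cong[OF assms(3), of "%f. Polynomial.coeff f (i - 1)"] by (simp add: coeff_pderiv)
  then show ?thesis using that assms(2) by (auto simp: of_nat_eq_0_iff_char_dvd)
 qed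
 define n where "n = Polynomial.degree g"
 define h where "h = (\<Sum>i\<le>n. Polynomial.monom (Polynomial.coeff g (p * i)) i)"
 have ch: "Polynomial.coeff h i = (if i \<le> n then Polynomial.coeff g (p * i) else 0)" for i
  by (simp add: h_def coeff_sum)
 have ch': "Polynomial.coeff h i = Polynomial.coeff g (p * i)" for i
 proof (cases "i \<le> n")
  case False
  then have "n < 1 * i" by simp
  also have "... \<le> p * i" using p by (intro mult_le_mono1) simp
  finally have "p * i > n" .
  then show ?thesis using False by (simp add: ch n_def coeff_eq_0)
 qed (simp add: ch)
 have "g = pcompose h (Polynomial.monom 1 p)"
 proof -
  have "pcompose h (Polynomial.monom 1 p) = (\<Sum>i\<le>n. Polynomial.monom (Polynomial.coeff g (p * i)) (p * i))"
  proof -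
   have "pcompose (Polynomial.monom a i) (Polynomial.monom 1 p) = Polynomial.monom a (p * i)" for a :: 'k and i
    by (simp add: pcompose_monom' monom_power smult_monom)
   then show ?thesis by (simp add: h_def pcompose_sum)
  qed
  also have "... = g"
  proof (rule poly_eqI)
   fix k
   show "Polynomial.coeff (\<Sum>i\<le>n. Polynomial.monom (Polynomial.coeff g (p * i)) (p * i)) k = Polynomial.coeff g k"
   proof (cases "p dvd k")
    case True
    then obtain i where i: "k = p * i" by auto
    have "Polynomial.coeff (\<Sum>i\<le>n. Polynomial.monom (Polynomial.coeff g (p * i)) (p * i)) k = (\<Sum>j\<le>n. if j = i then Polynomial.coeff g k else 0)"
     unfolding coeff_sum using i p by (intro sum.cong refl) (auto simp: )
    also have "... = Polynomial.coeff g k"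
     using ch[of i] ch'[of i] i by (auto split: if_splits)
    finally show ?thesis .
   next
    case False
    then show ?thesis using c0 by (auto simp: coeff_sum intro!: sum.neutral)
   qed
  qed
  finally show ?thesis by simp
 qed
 moreover have "Polynomial.degree h < Polynomial.degree g"
 proof -
  have "Polynomial.coeff g (p * Polynomial.degree h) \<noteq> 0 \<or> h = 0" using ch'[of "Polynomial.degree h"] by force
  then have "p * Polynomial.degree h \<le> Polynomial.degree g \<or> h = 0" using le_degree by blast
  moreover have "Polynomial.degree h < p * Polynomial.degree h" if "Polynomial.degree h > 0"
   using p that by simp
  moreover have "h = 0 ==> Polynomial.degree h = 0" by simp
  ultimately show ?thesis using assms(4) by (cases "Polynomial.degree h > 0") (linarith, simp)
 qed
 ultimately show ?thesis by blast
qed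

lemma pcompose_frob_prod:
 fixes C :: "'k::field set"
 shows "pcompose (frob_prod n C) (Polynomial.monom 1 p) = frob_prod (p * n) C"
proof -
 have "pcompose (Polynomial.monom 1 n) (Polynomial.monom 1 p) = (Polynomial.monom 1 (p * n) :: 'k poly)"
  by (simp add: pcompose_monom' monom_power)
 then show ?thesis by (simp add: pcompose_prod pcompose_diff)
qed

text \<open>An irreducible factor is either separable, hence linear, or a polynomial in the
  \<open>p\<close>-th power of the variable, and induction on the degree applies. The roots are
  purely inseparable over the field; after passing to \<open>p ^ N\<close>-th powers they lie in the
  field itself.\<close>

lemma separably_closed_dvd_frob_prod:
 fixes f :: "'k::field poly"
 assumes sc: "separably_closed TYPE('k)" and p: "prime p" "CHAR('k) = p" and f: "f \<noteq> 0"
 shows "\<exists>N C. finite C \<and> f dvd frob_prod (p ^ N) C"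
 using f
proof (induction "Polynomial.degree f" arbitrary: f rule: less_induct)
 case less
 show ?case
 proof (cases "Polynomial.degree f = 0")
  case True
  then have "f dvd 1" using less.prems by (simp add: is_unit_iff_degree)
  then show ?thesis by (intro exI[of _ 0] exI[of _ "{}"]) simp
 next
  case False
  then obtain g where g: "irreducible g" "g dvd f" using exists_irreducible_divisor by blast
  then obtain f' where f': "f = g * f'" by auto
  have n0: "g \<noteq> 0" "f' \<noteq> 0" using f' less.prems by auto
  have dg: "Polynomial.degree g > 0" using g n0 by (auto simp: irreducible_def is_unit_iff_degree)
  have df: "Polynomial.degree f = Polynomial.degree g + Polynomial.degree f'"
   using f' n0 by (simp add: degree_mult_eq)
  obtain N2 C2 where 2: "finite C2" "f' dvd frob_prod (p ^ N2) C2"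
   using less.hyps[of f'] df dg n0 by auto
  obtain N1 C1 where 1: "finite C1" "g dvd frob_prod (p ^ N1) C1"
  proof (cases "coprime g (pderiv g)")
   case True
   then have "Polynomial.degree g = 1" using sc g by (auto simp: separably_closed_def)
   then obtain a b where ab: "g = [:a, b:]" "b \<noteq> 0"
    by (metis degree_pCons_eq_if degree_eq_zeroE pCons_cases One_nat_def Suc_inject n0(1) zero_neq_one pCons_0_0 degree_pCons_0)
   have "frob_prod (p ^ 0) {- a / b} = smult (1 / b) g"
    using ab by (simp add: monom_altdef)
   then have "g dvd frob_prod (p ^ 0) {- a / b}" using dvd_smult[of g g "1 / b"] by (simp only: dvd_refl)
   then show ?thesis using that by blast
  next
   case False
   then obtain r where r: "r dvd g" "r dvd pderiv g" "\<not> r dvd 1" by (auto simp: coprime_def)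
   then obtain s where s: "g = r * s" by auto
   then have "s dvd 1" using g r by (auto simp: irreducible_def)
   then have "g dvd r" using s by (metis dvd_mult_unit_iff dvd_refl mult.commute)
   then have "g dvd pderiv g" using r by auto
   moreover have "Polynomial.degree (pderiv g) < Polynomial.degree g"
   proof -
    have "Polynomial.degree (pderiv g) \<le> Polynomial.degree g - 1"
     by (rule degree_le) (use dg in \<open>auto simp: coeff_pderiv coeff_eq_0\<close>)
    then show ?thesis using dg by linarith
   qed
   ultimately have "pderiv g = 0" using dvd_imp_degree_le by force
   then obtain h where h: "g = pcompose h (Polynomial.monom 1 p)" "Polynomial.degree h < Polynomial.degree g"
    using pderiv_0_pcompose[OF p _ dg] by blast
   have "h \<noteq> 0" using h n0 by auto
   then obtain N C where NC: "finite C" "h dvd frob_prod (p ^ N) C"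
    using less.hyps[of h] h df by auto
   then obtain k where "frob_prod (p ^ N) C = h * k" by auto
   then have "frob_prod (p ^ Suc N) C = g * pcompose k (Polynomial.monom 1 p)"
    using pcompose_frob_prod[of "p ^ N" C p] h(1) by (simp add: pcompose_mult)
   then show ?thesis using that[of C "Suc N"] NC by (metis dvd_triv_left)
  qed
  define N where "N = N1 + N2"
  obtain D1 where D1: "finite D1" "g dvd frob_prod (p ^ N) D1"
   using frob_prod_raise[OF p 1, of N2] by (auto simp: N_def)
  obtain D2 where D2: "finite D2" "f' dvd frob_prod (p ^ N) D2"
   using frob_prod_raise[OF p 2, of N1] by (auto simp: N_def add.commute)
  have "frob_prod (p ^ N) D1 dvd frob_prod (p ^ N) (D1 \<union> D2)" "frob_prod (p ^ N) D2 dvd frob_prod (p ^ N) (D1 \<union> D2)"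
   using D1 D2 by (auto intro!: prod_dvd_prod_subset)
  \<comment> \<open>Constants common to both factors would have multiplicity two. They are covered
    by the \<open>p\<close>-th power, which is again a product over distinct constants.\<close>
  then have "f dvd frob_prod (p ^ N) (D1 \<union> D2) ^ 2"
   unfolding f' power2_eq_square using D1 D2 by (meson dvd_trans mult_dvd_mono)
  also have "... dvd frob_prod (p ^ N) (D1 \<union> D2) ^ (p ^ 1)"
   using prime_ge_2_nat[OF p(1)] by (intro le_imp_power_dvd) simp
  also have "... = frob_prod (p ^ (N + 1)) ((%c. c ^ (p ^ 1)) ` (D1 \<union> D2))"
   by (rule frob_prod_power[OF p])
  finally show ?thesis using D1 D2 by (meson finite_UnI finite_imageI)
 qed
qed

section \<open>Split commutative separable algebras\<close>

text \<open>The algebra is the image of the projection \<open>\<pi>\<close>, and all identities are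
  exact. The trivial group serves to make the contraction \<open>E\<close> available.\<close>

locale halg = cyc_tensor d 1 "%x. x" "%x. x" ee for d :: nat and ee :: "nat => nat => 'k::field" +
 fixes \<pi> :: "'k fvec => 'k fvec" and m :: "'k fvec => 'k fvec => 'k fvec" and u :: "'k fvec"
  and p :: nat
 assumes pi_lin: "linV \<pi>" and pi_pi [simp]: "\<pi> (\<pi> x) = \<pi> x" and cut_pi [simp]: "cut d (\<pi> x) = \<pi> x"
  and pi_cut [simp]: "\<pi> (cut d x) = \<pi> x"
  and m_bil: "bil m" and m_pi1 [simp]: "m (\<pi> x) y = m x y" and pi_m [simp]: "\<pi> (m x y) = m x y"
  and pi_u [simp]: "\<pi> u = u"
  and m_comm: "m x y = m y x" and m_assoc: "m (m x y) z = m x (m y z)" and m_u [simp]: "m u x = \<pi> x"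
  and mE: "EV m = u"
  and sep: "linF \<phi> ==> linF \<psi> ==> ES (%a b. \<phi> (m x a) * \<psi> (\<pi> b)) = ES (%a b. \<phi> (\<pi> a) * \<psi> (m b x))"
  and p: "prime p" "CHAR('k) = p"
begin

lemmas m_props = bil_props[OF m_bil]
lemmas pi_props = lin_props[OF pi_lin]
lemma m_lin1: "linV (%x. m x y)" using m_bil by blast
lemma m_lin2: "linV (m x)" using m_bil by blast
lemma m_pi2 [simp]: "m x (\<pi> y) = m x y" by (metis m_comm m_pi1)
lemma m_u2 [simp]: "m x u = \<pi> x" by (metis m_comm m_u)
lemma m_left_comm: "m x (m y z) = m y (m x z)" by (metis m_assoc m_comm)
lemma cut_m [simp]: "cut d (m x y) = m x y" by (metis cut_pi pi_m)
lemma m_cut1: "m (cut d x) y = m x y" by (metis m_pi1 pi_cut)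
lemma m_cut2: "m x (cut d y) = m x y" by (metis m_pi2 pi_cut)

text \<open>The tensor is dual to the trace form. Separability moves the factor \<open>x v\<close>
  of each diagonal term from the first leg to the second, where the sum over the basis reassembles
  \<open>x\<close> times the product of the tensor.\<close>

lemma trace_form: "EV (%a b. pm_scale (trc d (m (m x a))) (\<pi> b)) = \<pi> x"
proof (rule poly_mapping_eqI)
 fix l
 have pl: "linF (%x. lookup (\<pi> x) l)" by (rule lin_comp[OF pi_lin lin_lookup])
 have ll: "linF (%c. lookup (m b (m x c)) l)" for b
  by (rule lin_comp[OF lin_comp[OF m_lin2 m_lin2] lin_lookup])
 have "lookup (EV (%a b. pm_scale (trc d (m (m x a))) (\<pi> b))) l = ES (%a b. trc d (m (m x a)) * lookup (\<pi> b) l)"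
  by (simp add: E_apply[OF lin_lookup])
 also have "... = (\<Sum>k<d. ES (%a b. lookup (m (m x (pm_basis k)) a) k * lookup (\<pi> b) l))"
 proof -
  have "m (m x a) v = m (m x v) a" for a v by (metis m_assoc m_comm)
  then show ?thesis by (simp add: trc_def sum_distrib_right E_sum)
 qed
 also have "... = (\<Sum>k<d. ES (%a b. lookup (\<pi> a) k * lookup (m b (m x (pm_basis k))) l))"
  by (intro sum.cong refl) (use sep[OF lin_lookup pl] in simp)
 also have "... = ES (%a b. lookup (m b (m x (cut d (\<pi> a)))) l)"
  unfolding lin_cut_expand[OF ll] by (simp add: E_sum)
 also have "... = lookup (m x (EV m)) l"
  by (simp add: E_apply[OF m_lin2] E_apply[OF lin_lookup] m_assoc m_comm m_left_comm)
 finally show "lookup (EV (%a b. pm_scale (trc d (m (m x a))) (\<pi> b))) l = lookup (\<pi> x) l" by (simp add: mE)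
qed

primrec pw :: "'k fvec => nat => 'k fvec" where
 "pw x 0 = u"
| "pw x (Suc n) = m x (pw x n)"

primrec pl :: "('i => 'k fvec) => 'i list => 'k fvec" where
 "pl f [] = u"
| "pl f (i # w) = m (f i) (pl f w)"

lemma pi_pl [simp]: "\<pi> (pl f w) = pl f w" by (cases w) auto
lemma pi_pw [simp]: "\<pi> (pw x n) = pw x n" by (cases n) auto
lemma pl_append: "pl f (w @ [i]) = pl f (i # w)" by (induction w) (auto simp: m_left_comm)
lemma pl_replicate: "pl f (replicate n i) = pw (f i) n" by (induction n) auto

lemma char_sum: "(\<Sum>j<p. w :: 'k fvec) = 0"
proof (rule poly_mapping_eqI)
 fix i
 have "of_nat p = (0::'k)" using p by (simp add: of_nat_eq_0_iff_char_dvd)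
 then show "lookup (\<Sum>j<p. w) i = lookup 0 i" by (simp only: lookup_sum) simp
qed

lemma pw_sum_words: "finite I ==> pw (\<Sum>i\<in>I. f i) n = (\<Sum>w\<in>words n I. pl f w)"
proof (induction n)
 case 0
 show ?case by (subst sum_words_0) simp
next
 case (Suc n)
 then show ?case by (subst sum_words_Suc) (simp_all add: m_props, subst sum.swap, simp)
qed

lemma pw_sum: "finite I ==> pw (\<Sum>i\<in>I. f i) p = (\<Sum>i\<in>I. pw (f i) p)"
proof -
 assume "finite I"
 then have "pw (\<Sum>i\<in>I. f i) p = (\<Sum>i\<in>I. pl f (replicate p i))"
  unfolding pw_sum_words[OF \<open>finite I\<close>]
  by (intro sum_rotation_invariant p char_sum) (auto simp: pl_append)
 then show ?thesis by (simp add: pl_replicate)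
qed

lemma pw_scale: "pw (pm_scale c x) n = pm_scale (c ^ n) (pw x n)"
 by (induction n) (auto simp: m_props)

lemma pw_add_exp: "pw x (a + b) = m (pw x a) (pw x b)"
 by (induction a) (auto simp: m_assoc)

lemma pw_mult_exp: "pw (pw x a) b = pw x (a * b)"
 by (induction b) (auto simp: pw_add_exp)

text \<open>The sum is the power of the tensor with exponent \<open>Suc n\<close>, paired with the
  trace form; the tensor is an idempotent of the tensor square, so every power acts like the tensor
  itself. Each step peels off one copy and collapses it by \<open>mE\<close>. Indexing by words
  prepares the rotation argument.\<close>

lemma words_trace_form:
 defines "I \<equiv> {..<d} \<times> {..<d}"
 shows "(\<Sum>w\<in>words (Suc n) I. pm_scale (prod_list (map (case_prod ee) w) * trc d (m (m x (pl (pm_basis \<circ> fst) w)))) (m y (pl (pm_basis \<circ> snd) w))) = m x y"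
proof -
 have fI: "finite I" by (simp add: I_def)
 show ?thesis
proof (induction n arbitrary: x y)
 case 0
 have "(\<Sum>w\<in>words (Suc 0) I. pm_scale (prod_list (map (case_prod ee) w) * trc d (m (m x (pl (pm_basis \<circ> fst) w)))) (m y (pl (pm_basis \<circ> snd) w)))
  = (\<Sum>i\<in>I. pm_scale (case_prod ee i * trc d (m (m x (pm_basis (fst i))))) (m y (pm_basis (snd i))))"
  unfolding sum_words_Suc[OF fI] sum_words_0 by simp
 also have "... = m y (EV (%a b. pm_scale (trc d (m (m x a))) (\<pi> b)))"
  by (simp add: E_apply[OF m_lin2]) (simp add: E_def m_props I_def sum.cartesian_product case_prod_beta)
 also have "... = m x y" unfolding trace_form using m_comm by simp
 finally show ?case .
next
 case (Suc n)
 have "(\<Sum>w\<in>words (Suc (Suc n)) I. pm_scale (prod_list (map (case_prod ee) w) * trc d (m (m x (pl (pm_basis \<circ> fst) w)))) (m y (pl (pm_basis \<circ> snd) w)))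
  = (\<Sum>i\<in>I. pm_scale (case_prod ee i) (\<Sum>w\<in>words (Suc n) I. pm_scale (prod_list (map (case_prod ee) w) * trc d (m (m (m x (pm_basis (fst i))) (pl (pm_basis \<circ> fst) w)))) (m (m y (pm_basis (snd i))) (pl (pm_basis \<circ> snd) w))))"
  unfolding sum_words_Suc[OF fI, of _ "Suc n"] pm.scale_sum_right pm.scale_scale
  by (rule sum.cong[OF refl], rule sum.cong[OF refl])
   (simp only: list.map prod_list.Cons pl.simps m_assoc mult.assoc o_apply m_left_comm[of y])
 also have "... = (\<Sum>i\<in>I. pm_scale (case_prod ee i) (m (m x (pm_basis (fst i))) (m y (pm_basis (snd i)))))"
  by (simp only: Suc)
 also have "... = m (m x y) (EV m)"
  by (simp add: E_def m_props I_def sum.cartesian_product case_prod_beta m_assoc m_left_comm)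
 also have "... = m x y" by (simp add: mE)
 finally show ?case .
qed
qed

text \<open>The separability idempotent equals its own \<open>p\<close>-th power, which by the Frobenius identity
 is assembled from the \<open>p\<close>-th powers of its components.\<close>

lemma span_frobenius: "\<pi> x \<in> pm.span ((%j. pw (pm_basis j) p) ` {..<d})"
proof -
 define I where "I = {..<d} \<times> {..<d}"
 define f where "f = (%w. pm_scale (prod_list (map (case_prod ee) w) * trc d (m (m x (pl (pm_basis \<circ> fst) w)))) (pl (pm_basis \<circ> snd) w))"
 obtain n where n: "p = Suc n" using prime_gt_0_nat[OF p(1)] by (cases p) auto
 have "\<pi> x = (\<Sum>w\<in>words p I. f w)"
 proof -
  have fe: "f w = pm_scale (prod_list (map (case_prod ee) w) * trc d (m (m x (pl (pm_basis \<circ> fst) w)))) (m u (pl (pm_basis \<circ> snd) w))" for w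
   by (simp add: f_def)
  show ?thesis unfolding fe n I_def words_trace_form by simp
 qed
 also have "... = (\<Sum>i\<in>I. f (replicate p i))"
 proof (intro sum_rotation_invariant p char_sum)
  show "f (w @ [i]) = f (i # w)" for w i
   unfolding f_def pl_append by (intro arg_cong2[of _ _ _ _ pm_scale] arg_cong2[of _ _ _ _ "(*)"] refl) simp
  show "finite I" by (simp add: I_def)
 qed
 also have "... \<in> pm.span ((%j. pw (pm_basis j) p) ` {..<d})"
  unfolding f_def pl_replicate
  by (intro pm.span_sum pm.span_scale, rule pm.span_base) (auto simp: I_def)
 finally show ?thesis .
qed

text \<open>The \<open>p\<close>-th power map is additive and semilinear, so
  \<open>span_frobenius\<close> can be iterated: a combination of powers is raised to the
  \<open>p\<close>-th power termwise.\<close>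

lemma span_frobenius_power: "\<pi> x \<in> pm.span ((%j. pw (pm_basis j) (p ^ N)) ` {..<d})"
proof (induction N arbitrary: x)
 case 0
 have "\<pi> x = \<pi> (cut d x)" by simp
 also have "... = (\<Sum>i<d. pm_scale (lookup x i) (\<pi> (pm_basis i)))" by (rule lin_cut_expand[OF pi_lin])
 also have "... \<in> pm.span ((%j. pw (pm_basis j) (p ^ 0)) ` {..<d})"
  by (intro pm.span_sum pm.span_scale pm.span_base) auto
 finally show ?case .
next
 case (Suc N)
 have "pw (pm_basis j) p \<in> pm.span ((%j. pw (pm_basis j) (p ^ Suc N)) ` {..<d})" for j
 proof -
  have "\<pi> (pm_basis j) \<in> pm.span ((%j. pw (pm_basis j) (p ^ N)) ` {..<d})" by (rule Suc)
  then obtain c where c: "\<pi> (pm_basis j) = (\<Sum>v\<in>(%j. pw (pm_basis j) (p ^ N)) ` {..<d}. pm_scale (c v) v)"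
   by (subst (asm) pm.span_finite) auto
  have "pw (pm_basis j) p = pw (\<pi> (pm_basis j)) p"
  proof -
   have "pw (\<pi> y) n = pw y n" for y n by (induction n) auto
   then show ?thesis by simp
  qed
  also have "... = (\<Sum>v\<in>(%j. pw (pm_basis j) (p ^ N)) ` {..<d}. pm_scale (c v ^ p) (pw v p))"
   unfolding c by (subst pw_sum) (simp_all add: pw_scale)
  also have "... \<in> pm.span ((%j. pw (pm_basis j) (p ^ Suc N)) ` {..<d})"
   by (intro pm.span_sum pm.span_scale pm.span_base) (auto simp: pw_mult_exp mult.commute)
  finally show ?thesis .
 qed
 then have "pm.span ((%j. pw (pm_basis j) p) ` {..<d}) \<subseteq> pm.span ((%j. pw (pm_basis j) (p ^ Suc N)) ` {..<d})"
  by (intro pm.span_minimal) auto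
 then show ?case using span_frobenius by blast
qed

end

context halg
begin

lemma pev_u: "pev (m x) f (m y w) = m y (pev (m x) f w)"
 by (induction f) (auto simp: lin_props[OF m_lin2] pev_pCons[OF m_lin2] pev_0[OF m_lin2] m_props m_left_comm)

lemma pi_pev [simp]: "\<pi> (pev (m x) f u) = pev (m x) f u"
 by (induction f) (auto simp: pev_pCons[OF m_lin2] pev_0[OF m_lin2] pi_props)

lemma pev_mult_alg: "pev (m x) (f * g) u = m (pev (m x) f u) (pev (m x) g u)"
proof -
 have "pev (m x) (f * g) u = pev (m x) f (m (pev (m x) g u) u)"
  by (simp add: pev_mult[OF m_lin2])
 also have "... = m (pev (m x) g u) (pev (m x) f u)" by (rule pev_u)
 finally show ?thesis by (simp add: m_comm)
qed

lemma pev_const: "pev (m x) [:c:] u = pm_scale c u"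
 by (simp add: pev_pCons[OF m_lin2] pev_0[OF m_lin2] m_props)

lemma pev_monom: "pev (m x) (Polynomial.monom 1 n) u = pw x n"
 by (induction n) (auto simp: monom_0 monom_Suc pev_pCons[OF m_lin2] pev_0[OF m_lin2] m_props)

lemma pev_frob_prod: "finite C ==> pev (m x) (frob_prod n C) u = pev (m (pw x n)) (frob_prod 1 C) u"
 by (induction C rule: finite_induct)
  (simp_all add: pev_1[OF m_lin2] pev_mult_alg pev_diff[OF m_lin2] pev_const pev_monom)

lemma exists_annihilator: "\<exists>f. f \<noteq> 0 \<and> pev (m x) f u = 0"
proof -
 define S where "S = (%i. pm_basis i :: 'k fvec) ` {..<d}"
 have inS: "y \<in> pm.span S" if y: "y = cut d y" for y
 proof -
  have "cut d y \<in> pm.span S" unfolding cut_def S_def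
   by (intro pm.span_sum pm.span_scale pm.span_base) auto
  then show ?thesis using y by simp
 qed
 define v where "v = pw x"
 have v: "v n \<in> pm.span S" for n by (rule inS) (metis v_def cut_pi pi_pw)
 have pm: "pev (m x) (Polynomial.monom a n) u = pm_scale a (v n)" for a n
  using pev_smult[OF m_lin2, of x a "Polynomial.monom 1 n" u] by (simp add: smult_monom pev_monom v_def)
 show ?thesis
 proof (cases "inj_on v {..d}")
  case False
  then obtain i j where ij: "i \<noteq> j" "v i = v j" by (auto simp: inj_on_def)
  define f where "f = Polynomial.monom 1 i - (Polynomial.monom 1 j :: 'k poly)"
  have "Polynomial.coeff f i = 1" using ij by (simp add: f_def)
  then have "f \<noteq> 0" by auto
  moreover have "pev (m x) f u = 0" using ij by (simp add: f_def pev_diff[OF m_lin2] pm)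
  ultimately show ?thesis by blast
 next
  case True
  have "card (v ` {..d}) = Suc d" using True by (simp add: card_image)
  moreover have "card S \<le> d" unfolding S_def using card_image_le[of "{..<d}"] by simp
  ultimately have "pm.dependent (v ` {..d})"
   using pm.independent_span_bound[of S "v ` {..d}"] v by (fastforce simp: S_def)
  then obtain c where c: "\<exists>w\<in>v ` {..d}. c w \<noteq> 0" "(\<Sum>w\<in>v ` {..d}. pm_scale (c w) w) = 0"
   by (subst (asm) pm.dependent_finite) auto
  define f where "f = (\<Sum>i\<le>d. Polynomial.monom (c (v i)) i)"
  have "Polynomial.coeff f i = c (v i)" if "i \<le> d" for i
   using that by (simp add: f_def coeff_sum)
  then have "f \<noteq> 0" using c(1) by force
  moreover have "pev (m x) f u = 0"
   using c(2) by (simp add: f_def pev_sum[OF m_lin2] pm sum.reindex[OF True])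
  ultimately show ?thesis by blast
 qed
qed

definition idem_family :: "'k fvec set => bool" where
 "idem_family F \<longleftrightarrow> finite F \<and> (\<forall>\<xi>\<in>F. \<xi> \<noteq> 0 \<and> \<pi> \<xi> = \<xi> \<and> m \<xi> \<xi> = \<xi>) \<and>
   (\<forall>\<xi>\<in>F. \<forall>\<xi>'\<in>F. \<xi> \<noteq> \<xi>' \<longrightarrow> m \<xi> \<xi>' = 0) \<and> (\<Sum>\<xi>\<in>F. \<xi>) = u"

lemma idem_family_mult:
 assumes "finite F" "!!\<xi>. \<xi> \<in> F ==> m \<xi> \<xi> = \<xi>" "!!\<xi> \<xi>'. \<xi> \<in> F ==> \<xi>' \<in> F ==> \<xi> \<noteq> \<xi>' ==> m \<xi> \<xi>' = 0" "\<xi> \<in> F"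
 shows "m \<xi> (\<Sum>\<eta>\<in>F. pm_scale (c \<eta>) \<eta>) = pm_scale (c \<xi>) \<xi>"
proof -
 have "m \<xi> (\<Sum>\<eta>\<in>F. pm_scale (c \<eta>) \<eta>) = (\<Sum>\<eta>\<in>F. if \<eta> = \<xi> then pm_scale (c \<xi>) \<xi> else 0)"
  unfolding m_props using assms by (intro sum.cong refl) auto
 then show ?thesis using assms by simp
qed

lemma idem_family_card: "idem_family F ==> card F \<le> d"
proof -
 assume F: "idem_family F"
 have "pm.independent F"
 proof (rule pm.independent_if_scalars_zero)
  fix c \<xi> assume c: "(\<Sum>\<eta>\<in>F. pm_scale (c \<eta>) \<eta>) = 0" and e: "\<xi> \<in> F"
  have "pm_scale (c \<xi>) \<xi> = m \<xi> (\<Sum>\<eta>\<in>F. pm_scale (c \<eta>) \<eta>)"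
   by (rule idem_family_mult[symmetric]) (use F e in \<open>auto simp: idem_family_def\<close>)
  then show "c \<xi> = 0" using c e F by (auto simp: m_props idem_family_def)
 qed (use F in \<open>auto simp: idem_family_def\<close>)
 moreover have "F \<subseteq> pm.span ((%i. pm_basis i) ` {..<d})"
 proof
  fix \<xi> assume "\<xi> \<in> F"
  then have "\<xi> = cut d \<xi>" using F by (metis cut_pi idem_family_def)
  moreover have "cut d \<xi> \<in> pm.span ((%i. pm_basis i) ` {..<d})" unfolding cut_def
   by (intro pm.span_sum pm.span_scale pm.span_base) auto
  ultimately show "\<xi> \<in> pm.span ((%i. pm_basis i) ` {..<d})" by metis
 qed
 ultimately have "card F \<le> card ((%i. pm_basis i :: 'k fvec) ` {..<d})"
  using pm.independent_span_bound by blast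
 also have "... \<le> d" using card_image_le[of "{..<d}"] by simp
 finally show ?thesis .
qed

text \<open>The witness is the product of \<open>(y - c) / (c0 - c)\<close> over the other roots,
  applied to \<open>\<xi>\<close>. On it \<open>y\<close> acts as \<open>c0\<close>, hence every
  polynomial in \<open>y\<close> acts as its value at \<open>c0\<close>, which makes it idempotent.
  The last conjunct lets a minimal choice of \<open>C\<close> force it to be nonzero.\<close>

lemma lagrange:
 assumes "finite C" "c0 \<in> C" "pev (m y) (frob_prod 1 C) u = u0 \<or> True"
  and y: "m (pev (m y) (frob_prod 1 C) u) \<xi> = 0" and e: "m \<xi> \<xi> = \<xi>" "\<pi> \<xi> = \<xi>"
 shows "\<exists>\<delta>. \<pi> \<delta> = \<delta> \<and> m \<xi> \<delta> = \<delta> \<and> m \<delta> \<delta> = \<delta> \<and> m y \<delta> = pm_scale c0 \<delta> \<and>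
  (\<exists>a\<noteq>0. m (pev (m y) (frob_prod 1 (C - {c0})) u) \<xi> = pm_scale a \<delta>)"
proof -
 define g where "g = frob_prod 1 (C - {c0})"
 define a where "a = (\<Prod>c\<in>C - {c0}. c0 - c)"
 define w where "w = m (pev (m y) g u) \<xi>"
 have a0: "a \<noteq> 0" using assms(1) by (auto simp: a_def prod_zero_iff)
 have ga: "poly g c0 = a" by (simp add: g_def a_def poly_prod poly_monom)
 have g': "frob_prod 1 C = (Polynomial.monom 1 1 - [:c0:]) * g"
  unfolding g_def using assms(1,2) by (rule prod.remove)
 have yw: "m y w = pm_scale c0 w"
 proof -
  have "m (m (pev (m y) (Polynomial.monom 1 1 - [:c0:]) u) (pev (m y) g u)) \<xi> = 0"
   using y unfolding g' pev_mult_alg .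
  moreover have "pev (m y) (Polynomial.monom 1 1 - [:c0:]) u = \<pi> y - pm_scale c0 u"
   using pev_monom[of y 1] by (simp add: pev_diff[OF m_lin2] pev_const)
  ultimately have "m y w - pm_scale c0 w = 0"
   by (simp add: w_def m_props m_assoc)
  then show ?thesis by simp
 qed
 have fw: "m (pev (m y) f u) w = pm_scale (poly f c0) w" for f
  by (induction f) (auto simp: pev_pCons[OF m_lin2] pev_0[OF m_lin2] m_props yw[unfolded w_def] m_assoc pm.scale_left_distrib w_def mult.commute)
 define \<delta> where "\<delta> = pm_scale (1 / a) w"
 have ew: "m \<xi> w = w" using e by (simp add: w_def) (metis m_assoc m_comm)
 have ww: "m w w = pm_scale a w"
 proof -
  have "m w w = m (pev (m y) g u) (m \<xi> w)" by (simp add: w_def m_assoc)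
  then show ?thesis by (simp add: ew fw ga)
 qed
 show ?thesis
 proof (intro exI[of _ \<delta>] conjI exI[of _ a] a0)
  show "\<pi> \<delta> = \<delta>" by (simp add: \<delta>_def pi_props w_def)
  show "m \<xi> \<delta> = \<delta>" by (simp add: \<delta>_def m_props ew)
  show "m \<delta> \<delta> = \<delta>" using a0 by (simp add: \<delta>_def m_props ww)
  show "m y \<delta> = pm_scale c0 \<delta>" by (simp add: \<delta>_def m_props yw mult.commute)
  show "m (pev (m y) (frob_prod 1 (C - {c0})) u) \<xi> = pm_scale a \<delta>"
   using a0 by (simp add: \<delta>_def w_def g_def)
 qed
qed

text \<open>For a minimal set of roots whose product kills \<open>\<xi>\<close>, the Lagrange
  idempotent \<open>\<delta>\<close> is nonzero. A family of maximal size cannot be refined by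
  replacing \<open>\<xi>\<close> with \<open>\<delta>\<close> and \<open>\<xi> - \<delta>\<close>,
  so \<open>\<delta> = \<xi>\<close> and \<open>y\<close> acts on it as a scalar.\<close>

lemma maximal_family_scalar:
 assumes F: "idem_family F" and max: "!!F'. idem_family F' ==> card F' \<le> card F"
  and e: "\<xi> \<in> F" and C: "finite C" "pev (m y) (frob_prod 1 C) u = 0"
 shows "\<exists>c. m y \<xi> = pm_scale c \<xi>"
proof -
 have fin: "finite F" and e0: "\<xi> \<noteq> 0" "\<pi> \<xi> = \<xi>" "m \<xi> \<xi> = \<xi>" using F e by (auto simp: idem_family_def)
 define P where "P = (%D. D \<subseteq> C \<and> m (pev (m y) (frob_prod 1 D) u) \<xi> = 0)"
 have "P C" using C by (simp add: P_def m_props)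
 then obtain D where D: "P D" "!!D'. P D' ==> card D \<le> card D'"
  using ex_has_least_nat[of P C card] by blast
 have fD: "finite D" using D C finite_subset by (auto simp: P_def)
 have "D \<noteq> {}" using D e0 by (auto simp: P_def pev_1[OF m_lin2])
 then obtain c0 where c0: "c0 \<in> D" by auto
 obtain \<delta> a where de: "\<pi> \<delta> = \<delta>" "m \<xi> \<delta> = \<delta>" "m \<delta> \<delta> = \<delta>" "m y \<delta> = pm_scale c0 \<delta>" "a \<noteq> 0"
  "m (pev (m y) (frob_prod 1 (D - {c0})) u) \<xi> = pm_scale a \<delta>"
  using lagrange[OF fD c0, of y u \<xi>] D e0 by (auto simp: P_def)
 have d0: "\<delta> \<noteq> 0"
 proof
  assume "\<delta> = 0"
  then have "P (D - {c0})" using D de by (auto simp: P_def)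
  then show False using D(2)[of "D - {c0}"] c0 fD by (metis card_Diff1_less leD)
 qed
 have "\<delta> = \<xi>"
 proof (rule ccontr)
  assume ne: "\<delta> \<noteq> \<xi>"
  have md: "m \<eta> \<delta> = 0" if "\<eta> \<in> F" "\<eta> \<noteq> \<xi>" for \<eta>
   using that F e de(2) by (metis idem_family_def m_assoc m_props(9))
  define F' where "F' = insert \<delta> (insert (\<xi> - \<delta>) (F - {\<xi>}))"
  have n1: "\<delta> \<notin> F - {\<xi>}" using md[of \<delta>] de d0 ne by auto
  have n2: "\<xi> - \<delta> \<notin> F - {\<xi>}"
  proof
   assume a: "\<xi> - \<delta> \<in> F - {\<xi>}"
   then have "m (\<xi> - \<delta>) \<xi> = 0" using F e by (auto simp: idem_family_def)
   then show False using e0 de ne m_comm by (simp add: m_props)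
  qed
  have n3: "\<delta> \<noteq> \<xi> - \<delta>"
  proof
   assume "\<delta> = \<xi> - \<delta>"
   then have "m \<delta> \<delta> = m \<delta> \<xi> - m \<delta> \<delta>" by (metis m_props(6))
   moreover have "m \<delta> \<xi> = \<delta>" using de(2) by (metis m_comm)
   ultimately have "\<delta> = 0" using de(3) by (metis diff_self)
   then show False using d0 by simp
  qed
  have ort: "m \<delta> (\<xi> - \<delta>) = 0" "m (\<xi> - \<delta>) \<delta> = 0" using de m_comm by (auto simp: m_props)
  have idm: "m (\<xi> - \<delta>) (\<xi> - \<delta>) = \<xi> - \<delta>" using de e0 m_comm[of \<delta> \<xi>] by (simp add: m_props)
  have me: "m \<eta> \<xi> = 0" if "\<eta> \<in> F" "\<eta> \<noteq> \<xi>" for \<eta> using that F e by (auto simp: idem_family_def)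
  have md': "m \<delta> \<eta> = 0" "m \<xi> \<eta> = 0" if "\<eta> \<in> F" "\<eta> \<noteq> \<xi>" for \<eta>
   using md[OF that] me[OF that] m_comm by auto
  have "idem_family F'"
   unfolding idem_family_def
  proof (intro conjI)
   show "finite F'" using fin by (simp add: F'_def)
   show "\<forall>\<xi>\<in>F'. \<xi> \<noteq> 0 \<and> \<pi> \<xi> = \<xi> \<and> m \<xi> \<xi> = \<xi>"
    using F de e0 d0 ne idm by (auto simp: F'_def idem_family_def pi_props)
   show "\<forall>\<xi>\<in>F'. \<forall>\<xi>'\<in>F'. \<xi> \<noteq> \<xi>' \<longrightarrow> m \<xi> \<xi>' = 0"
    using F ort md me md' by (auto simp: F'_def idem_family_def m_props)
   have "sum (%x. x) F' = \<delta> + ((\<xi> - \<delta>) + (\<Sum>\<eta>\<in>F - {\<xi>}. \<eta>))"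
    unfolding F'_def using n1 n2 n3 fin by simp
   also have "... = (\<Sum>\<eta>\<in>F. \<eta>)" using e fin by (simp add: sum.remove)
   finally show "sum (%x. x) F' = u" using F by (simp add: idem_family_def)
  qed
  moreover have "card F' = Suc (card F)"
   unfolding F'_def using n1 n2 n3 fin e card_Suc_Diff1[OF fin e] by simp
  ultimately show False using max[of F'] by simp
 qed
 then show ?thesis using de by blast
qed

text \<open>The \<open>p ^ N\<close>-th powers of the basis vectors satisfy polynomials with
  distinct roots in the field, and by \<open>span_frobenius_power\<close> these powers still span
  the algebra. They act by scalars on every member of a family of maximal size, so that family
  spans.\<close>

theorem split_idempotents:
 assumes sc: "separably_closed TYPE('k)"
 shows "\<exists>F. idem_family F \<and> (\<forall>x. \<exists>c. \<pi> x = (\<Sum>\<xi>\<in>F. pm_scale (c \<xi>) \<xi>))"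
proof -
 have "\<exists>N C. finite C \<and> pev (m (pm_basis j)) (frob_prod (p ^ N) C) u = 0" for j
 proof -
  obtain f where f: "f \<noteq> 0" "pev (m (pm_basis j)) f u = 0" using exists_annihilator by blast
  obtain N C where NC: "finite C" "f dvd frob_prod (p ^ N) C"
   using separably_closed_dvd_frob_prod[OF sc p f(1)] by blast
  then obtain g where "frob_prod (p ^ N) C = f * g" by auto
  then show ?thesis using NC f by (auto simp: pev_mult_alg m_props intro!: exI[of _ N] exI[of _ C])
 qed
 then obtain N0 C0 where NC0: "!!j. finite (C0 j)" "!!j. pev (m (pm_basis j)) (frob_prod (p ^ N0 j) (C0 j)) u = 0"
  by metis
 define N where "N = (\<Sum>j<d. N0 j)"
 have "\<exists>C. finite C \<and> pev (m (pw (pm_basis j) (p ^ N))) (frob_prod 1 C) u = 0" if j: "j < d" for j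
 proof -
  have "N0 j \<le> N" unfolding N_def using j by (intro member_le_sum) auto
  then obtain t where t: "N = N0 j + t" using le_Suc_ex by blast
  obtain C where C: "finite C" "frob_prod (p ^ N0 j) (C0 j) dvd frob_prod (p ^ N) C"
   using frob_prod_raise[OF p NC0(1), of "frob_prod (p ^ N0 j) (C0 j)" "N0 j" j t] t by auto
  then obtain g where "frob_prod (p ^ N) C = frob_prod (p ^ N0 j) (C0 j) * g" by auto
  then have "pev (m (pm_basis j)) (frob_prod (p ^ N) C) u = 0" using NC0(2)[of j] by (simp add: pev_mult_alg m_props)
  then show ?thesis using C pev_frob_prod by metis
 qed
 then obtain C where C: "!!j. j < d ==> finite (C j) \<and> pev (m (pw (pm_basis j) (p ^ N))) (frob_prod 1 (C j)) u = 0"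
  by metis
 have "\<exists>F. idem_family F"
 proof (cases "u = 0")
  case True
  then show ?thesis unfolding idem_family_def by (intro exI[of _ "{}"]) simp
 next
  case False
  then show ?thesis by (intro exI[of _ "{u}"]) (simp add: idem_family_def)
 qed
 then obtain F where F: "idem_family F" and max: "!!F'. idem_family F' ==> card F' \<le> card F"
  using ex_has_greatest_nat[of idem_family _ card "Suc d"] idem_family_card by (metis le_imp_less_Suc)
 have "\<exists>c. m (pw (pm_basis j) (p ^ N)) \<xi> = pm_scale c \<xi>" if "j < d" "\<xi> \<in> F" for j \<xi>
  by (rule maximal_family_scalar[OF F max that(2)]) (use C[OF that(1)] in auto)
 then obtain c where c: "!!j \<xi>. j < d ==> \<xi> \<in> F ==> m (pw (pm_basis j) (p ^ N)) \<xi> = pm_scale (c j \<xi>) \<xi>"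
  by metis
 have "pw (pm_basis j) (p ^ N) \<in> pm.span F" if "j < d" for j
 proof -
  have "pw (pm_basis j) (p ^ N) = m (pw (pm_basis j) (p ^ N)) (\<Sum>\<xi>\<in>F. \<xi>)"
   using F by (simp add: idem_family_def)
  also have "... = (\<Sum>\<xi>\<in>F. pm_scale (c j \<xi>) \<xi>)" using c[OF that] by (simp add: m_props)
  also have "... \<in> pm.span F" by (intro pm.span_sum pm.span_scale pm.span_base)
  finally show ?thesis .
 qed
 then have "pm.span ((%j. pw (pm_basis j) (p ^ N)) ` {..<d}) \<subseteq> pm.span F"
  by (intro pm.span_minimal) auto
 then have "\<pi> x \<in> pm.span F" for x using span_frobenius_power by blast
 then have "\<exists>c. \<pi> x = (\<Sum>\<xi>\<in>F. pm_scale (c \<xi>) \<xi>)" for x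
  using pm.span_finite[of F] F by (auto simp: idem_family_def)
 then show ?thesis using F by blast
qed

text \<open>An algebra automorphism permutes the members of \<open>F\<close>, because they are exactly the
 nonzero idempotents on whose ideal every element acts as a scalar.\<close>

lemma idem_family_eq:
 assumes F: "idem_family F" and span: "!!x. \<exists>c. \<pi> x = (\<Sum>\<xi>\<in>F. pm_scale (c \<xi>) \<xi>)"
 shows "F = {\<xi>. \<xi> \<noteq> 0 \<and> \<pi> \<xi> = \<xi> \<and> m \<xi> \<xi> = \<xi> \<and> (\<forall>x. \<exists>c. m x \<xi> = pm_scale c \<xi>)}"
proof (rule subset_antisym; rule subsetI)
 have mult: "m \<xi> (\<Sum>\<eta>\<in>F. pm_scale (c \<eta>) \<eta>) = pm_scale (c \<xi>) \<xi>" if "\<xi> \<in> F" for \<xi> c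
  by (rule idem_family_mult) (use F that in \<open>auto simp: idem_family_def\<close>)
 show "\<xi> \<in> {\<xi>. \<xi> \<noteq> 0 \<and> \<pi> \<xi> = \<xi> \<and> m \<xi> \<xi> = \<xi> \<and> (\<forall>x. \<exists>c. m x \<xi> = pm_scale c \<xi>)}" if "\<xi> \<in> F" for \<xi>
 proof -
  have "\<exists>c. m x \<xi> = pm_scale c \<xi>" for x
   using span[of x] mult[OF that] by (metis m_comm m_pi1)
  then show ?thesis using F that by (auto simp: idem_family_def)
 qed
 fix \<eta> assume "\<eta> \<in> {\<xi>. \<xi> \<noteq> 0 \<and> \<pi> \<xi> = \<xi> \<and> m \<xi> \<xi> = \<xi> \<and> (\<forall>x. \<exists>c. m x \<xi> = pm_scale c \<xi>)}"
 then have eta: "\<eta> \<noteq> 0" "\<pi> \<eta> = \<eta>" "m \<eta> \<eta> = \<eta>" "!!x. \<exists>c. m x \<eta> = pm_scale c \<eta>" by auto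
 obtain c where c: "\<eta> = (\<Sum>\<xi>\<in>F. pm_scale (c \<xi>) \<xi>)" using span[of \<eta>] eta by auto
 obtain \<xi> where e: "\<xi> \<in> F" "c \<xi> \<noteq> 0" using c eta by (metis (mono_tags, lifting) pm.scale_eq_0_iff sum.neutral)
 have 1: "m \<xi> \<eta> = pm_scale (c \<xi>) \<xi>" using mult[OF e(1), of c] c by simp
 obtain t where t: "m \<xi> \<eta> = pm_scale t \<eta>" using eta by blast
 have e': "m \<xi> \<xi> = \<xi>" "\<xi> \<noteq> 0" using F e by (auto simp: idem_family_def)
 have "pm_scale (t / c \<xi>) \<eta> = \<xi>" using 1 t e by (metis pm.scale_scale divide_inverse mult.commute pm.scale_one right_inverse)
 moreover from this have "t / c \<xi> = 1"
 proof -
  define r where "r = t / c \<xi>"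
  have r: "pm_scale r \<eta> = \<xi>" using \<open>pm_scale (t / c \<xi>) \<eta> = \<xi>\<close> by (simp add: r_def)
  then have "pm_scale (r * r) \<eta> = pm_scale r \<eta>" using e'(1) eta(3) by (metis m_props(3,4) pm.scale_scale)
  then have "r * r = r" using eta(1) by simp
  moreover have "r \<noteq> 0" using r e' by auto
  ultimately have "r = 1" by simp
  then show ?thesis by (simp only: r_def)
 qed
 ultimately show "\<eta> \<in> F" using e by simp
qed

lemma automorphism_permutes:
 assumes F: "idem_family F" and span: "!!x. \<exists>c. \<pi> x = (\<Sum>\<xi>\<in>F. pm_scale (c \<xi>) \<xi>)"
  and g: "linV g" "!!x y. g (m x y) = m (g x) (g y)" "!!x. g (\<pi> x) = \<pi> (g x)" "!!y. \<exists>x. g x = y"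
  and g_inj: "!!x. g x = 0 ==> x = 0"
  and e: "\<xi> \<in> F"
 shows "g \<xi> \<in> F"
proof -
 have "\<exists>c. m x (g \<xi>) = pm_scale c (g \<xi>)" for x
 proof -
  obtain y where y: "g y = x" using g(4) by blast
  obtain c where "m y \<xi> = pm_scale c \<xi>" using e idem_family_eq[OF F span] by blast
  then have "m x (g \<xi>) = pm_scale c (g \<xi>)" using g(2)[of y \<xi>] y by (simp add: lin_props[OF g(1)])
  then show ?thesis by blast
 qed
 moreover have "g \<xi> \<noteq> 0" "\<pi> (g \<xi>) = g \<xi>" "m (g \<xi>) (g \<xi>) = g \<xi>"
  using g_inj g(2)[of \<xi> \<xi>] g(3)[of \<xi>] e F by (auto simp: idem_family_def)
 ultimately show ?thesis using idem_family_eq[OF F span] by blast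
qed

end

section \<open>Restriction to subgroups and the largest projective summand\<close>

section \<open>Splitting off projective summands\<close>

section \<open>Restriction to subgroups and removal of projective summands\<close>

lemma sum_lessThan_mult:
 fixes F :: "nat => 'w::comm_monoid_add"
 shows "(\<Sum>s<r * Q. F s) = (\<Sum>a<Q. \<Sum>t<r. F (a * r + t))"
proof -
 have "sum F {a * r..<a * r + r} = (\<Sum>t<r. F (a * r + t))" for a
  using sum.shift_bounds_nat_ivl[of F 0 "a * r" r] by (simp add: add.commute lessThan_atLeast0)
 then show ?thesis using sum.nat_group[of F r Q] by (simp add: mult.commute)
qed

text \<open>The sum consists of \<open>p\<close> equal blocks of length \<open>r\<close>. This is
  the reason why transfers vanish wherever the subgroup of order \<open>p\<close> acts
  trivially.\<close>

lemma sum_periodic_zero: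
 fixes F :: "nat => 'w::ab_group_add"
 assumes per: "!!j. F (j + r) = F j" and char: "!!w::'w. (\<Sum>j<p. w) = 0"
 shows "(\<Sum>s<r * p. F s) = 0"
proof -
 have "F (a * r + t) = F t" for a t
  by (induction a) (simp, metis (no_types) per add.commute add.left_commute mult_Suc)
 then show ?thesis unfolding sum_lessThan_mult by (simp add: char)
qed

lemma char_sum_k:
 assumes "CHAR('k::field) = p" shows "(\<Sum>j<p. w :: 'k) = 0"
 using assms of_nat_CHAR[where 'a='k] by simp

lemma char_sum_pm:
 assumes "CHAR('k::field) = p" shows "(\<Sum>j<p. w :: 'x \<Rightarrow>\<^sub>0 'k) = 0"
 by (rule poly_mapping_eqI) (simp only: lookup_sum lookup_zero char_sum_k[OF assms])

lemma (in cyc) cyc_power: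
 assumes "Q = r * Q'" shows "cyc d Q' (h ^^ r) (hi ^^ r)"
proof (rule cyc.intro, goal_cases)
 case (7 x)
 have "cut d ((h ^^ s) x - x) = (h ^^ s) x - x" for s
 proof (induction s)
  case 0 then show ?case by (simp add: lin_props[OF cut_lin])
 next
  case (Suc s)
  have "(h ^^ Suc s) x - x = (h ((h ^^ s) x) - (h ^^ s) x) + ((h ^^ s) x - x)" by simp
  then show ?case using Suc cut_X by (simp only: lin_props[OF cut_lin])
 qed
 then show ?case .
next
 case (5 x)
 then show ?case using h_order assms by (simp add: funpow_mult mult.commute)
qed (auto simp: H_lin Hi_lin H_cut)

lemma (in cyc) H_split: "(h ^^ (a * r + t)) x = ((h ^^ r) ^^ a) ((h ^^ t) x)"
 by (simp add: funpow_add funpow_mult mult.commute)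

lemma (in cyc) Hi_split: "(hi ^^ (a * r + t)) x = (hi ^^ t) (((hi ^^ r) ^^ a) x)"
 by (metis add.commute comp_apply funpow_add funpow_mult mult.commute)

context cyc
begin

text \<open>Transfer in stages: the sum over the whole group is the transfer, over the subgroup
  generated by \<open>h ^^ r\<close>, of the partial sum over coset representatives. The same
  regrouping gives the versions for linear, bilinear and trilinear maps.\<close>

lemma SZ0_restrict: assumes "Q = r * Q'" "SZ0 w" shows "cyc.SZ0 Q' (h ^^ r) w"
proof -
 interpret c: cyc d Q' "h ^^ r" "hi ^^ r" by (rule cyc_power[OF assms(1)])
 obtain v where "w = (\<Sum>s<Q. (h ^^ s) v)" using assms(2) unfolding SZ0_def by blast
 then have "w = (\<Sum>a<Q'. ((h ^^ r) ^^ a) (\<Sum>t<r. (h ^^ t) v))"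
  by (simp add: assms(1) sum_lessThan_mult H_split c.H_props)
 then show ?thesis unfolding c.SZ0_def by blast
qed

lemma SZ1_restrict: assumes "Q = r * Q'" "SZ1 f" shows "cyc.SZ1 Q' (h ^^ r) (hi ^^ r) f"
proof -
 interpret c: cyc d Q' "h ^^ r" "hi ^^ r" by (rule cyc_power[OF assms(1)])
 obtain \<theta> where th: "linV \<theta>" "!!x. f x = (\<Sum>s<Q. (h ^^ s) (\<theta> ((hi ^^ s) x)))"
  using assms(2) unfolding SZ1_def by blast
 show ?thesis
 proof (rule c.SZ1I[of "%x. \<Sum>t<r. (h ^^ t) (\<theta> ((hi ^^ t) x))"])
  show "linV (%x. \<Sum>t<r. (h ^^ t) (\<theta> ((hi ^^ t) x)))"
   by (intro lin_sum vs_pm lin_comp[OF Hi_lin lin_comp[OF th(1) H_lin]])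
 qed (simp add: th(2) assms(1) sum_lessThan_mult H_split Hi_split c.H_props)
qed

lemma SZ2_restrict: assumes "Q = r * Q'" "SZ2 f" shows "cyc.SZ2 Q' (h ^^ r) (hi ^^ r) f"
proof -
 interpret c: cyc d Q' "h ^^ r" "hi ^^ r" by (rule cyc_power[OF assms(1)])
 obtain \<theta> where th: "bil \<theta>" "!!x y. f x y = (\<Sum>s<Q. (h ^^ s) (\<theta> ((hi ^^ s) x) ((hi ^^ s) y)))"
  using assms(2) unfolding SZ2_def by blast
 have l: "linV (%x. \<theta> x y)" "linV (\<theta> x)" for x y using th(1) by blast+
 show ?thesis
 proof (rule c.SZ2I[of "%x y. \<Sum>t<r. (h ^^ t) (\<theta> ((hi ^^ t) x) ((hi ^^ t) y))"])
  show "bil (%x y. \<Sum>t<r. (h ^^ t) (\<theta> ((hi ^^ t) x) ((hi ^^ t) y)))"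
   by (intro conjI allI lin_sum vs_pm lin_comp[OF Hi_lin lin_comp[OF l(1) H_lin]] lin_comp[OF Hi_lin lin_comp[OF l(2) H_lin]])
 qed (simp add: th(2) assms(1) sum_lessThan_mult H_split Hi_split c.H_props)
qed

lemma SZ3_restrict: assumes "Q = r * Q'" "SZ3 f" shows "cyc.SZ3 Q' (h ^^ r) (hi ^^ r) f"
proof -
 interpret c: cyc d Q' "h ^^ r" "hi ^^ r" by (rule cyc_power[OF assms(1)])
 obtain \<theta> where th: "tri \<theta>" "!!x y z. f x y z = (\<Sum>s<Q. (h ^^ s) (\<theta> ((hi ^^ s) x) ((hi ^^ s) y) ((hi ^^ s) z)))"
  using assms(2) unfolding SZ3_def by blast
 have l: "linV (%x. \<theta> x y z)" "linV (%y. \<theta> x y z)" "linV (\<theta> x y)" for x y z using th(1) by blast+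
 show ?thesis
 proof (rule c.SZ3I[of "%x y z. \<Sum>t<r. (h ^^ t) (\<theta> ((hi ^^ t) x) ((hi ^^ t) y) ((hi ^^ t) z))"])
  show "tri (%x y z. \<Sum>t<r. (h ^^ t) (\<theta> ((hi ^^ t) x) ((hi ^^ t) y) ((hi ^^ t) z)))"
   by (intro conjI allI lin_sum vs_pm lin_comp[OF Hi_lin lin_comp[OF l(1) H_lin]] lin_comp[OF Hi_lin lin_comp[OF l(2) H_lin]]
    lin_comp[OF Hi_lin lin_comp[OF l(3) H_lin]])
 qed (simp add: th(2) assms(1) sum_lessThan_mult H_split Hi_split c.H_props)
qed

lemma eqv2_power: assumes "Q = r * Q'" "eqv2 f" shows "cyc.eqv2 (h ^^ r) f"
 unfolding cyc.eqv2_def[OF cyc_power[OF assms(1)]] using eqv2_bil[OF assms(2)] eqv2_H[OF assms(2)] by blast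

end

text \<open>Transfer in stages restricts the stable axioms to the subgroup. For \<open>sep\<close>
  the partial transfer of \<open>\<Theta>\<close> must be expanded again in coordinates, since
  translates of basis vectors are not basis vectors; this is the definition of
  \<open>\<Theta>'\<close>.\<close>

lemma (in salg) salg_power:
 assumes Q': "Q = r * Q'" shows "salg d Q' (h ^^ r) (hi ^^ r) ee m u"
proof -
 interpret c: cyc d Q' "h ^^ r" "hi ^^ r" by (rule cyc_power[OF Q'])
 interpret c: cyc_tensor d Q' "h ^^ r" "hi ^^ r" ee
 proof unfold_locales
  fix \<beta> :: "'k fvec => 'k fvec => 'k" assume b: "bilS (*) \<beta>"
  have b': "bilS (*) (%a b. \<beta> ((h ^^ r) a) ((h ^^ r) b))" using b lin_comp[OF H_lin] by fast
  from E_inv_Hi_S[OF this, of r]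
  have "ES \<beta> = ES (%a b. \<beta> ((h ^^ r) a) ((h ^^ r) b))" by simp
  then show "(\<Sum>i<d. \<Sum>j<d. ee i j * \<beta> ((h ^^ r) (pm_basis i)) ((h ^^ r) (pm_basis j))) = (\<Sum>i<d. \<Sum>j<d. ee i j * \<beta> (pm_basis i) (pm_basis j))"
   by (simp add: E_def)
 qed
 show ?thesis
 proof (unfold_locales, goal_cases)
  case 1 then show ?case by (rule eqv2_power[OF Q' m_eqv2])
 next
  case 5
  have "(h ^^ s) u = u" for s by (induction s) (simp_all add: h_u)
  then show ?case .
 next
  case 6 then show ?case using SZ3_restrict[OF Q' assoc[unfolded eq3_def]] by (simp add: c.eq3_def)
 next
  case 7 then show ?case by (rule SZ2_restrict[OF Q' comm])
 next
  case 8 then show ?case using SZ1_restrict[OF Q' unit[unfolded eq1_def]] by (simp add: c.eq1_def)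
 next
  case 9 then show ?case using SZ0_restrict[OF Q' mE] .
 next
  case 10
  obtain \<Theta> where T: "!!i j. linF (\<Theta> i j)" "!!x \<phi> \<psi>. linF \<phi> ==> linF \<psi> ==>
    ES (%a b. \<phi> (m x a) * \<psi> b) - ES (%a b. \<phi> a * \<psi> (m b x)) =
    (\<Sum>s<Q. \<Sum>i<d. \<Sum>j<d. \<Theta> i j ((hi ^^ s) x) * (\<phi> ((h ^^ s) (pm_basis i)) * \<psi> ((h ^^ s) (pm_basis j))))"
   using sep by blast
  define \<Theta>' where "\<Theta>' = (%i j x. \<Sum>t<r. \<Sum>k<d. \<Sum>l<d. \<Theta> k l ((hi ^^ t) x) * (lookup ((h ^^ t) (pm_basis k)) i * lookup ((h ^^ t) (pm_basis l)) j))"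
  show ?case
  proof (intro exI[of _ \<Theta>'] conjI allI impI)
   show "linF (\<Theta>' i j)" for i j
    unfolding \<Theta>'_def by (intro lin_sum vs_pm vs_fs lin_scale_left lin_comp[OF Hi_lin T(1)])
   fix x and \<phi> \<psi> :: "'k fvec => 'k" assume lf: "linF \<phi>" "linF \<psi>"
   have ex: "\<phi> (((h ^^ r) ^^ a) ((h ^^ t) (pm_basis k))) * \<psi> (((h ^^ r) ^^ a) ((h ^^ t) (pm_basis l))) =
     (\<Sum>i<d. \<Sum>j<d. (lookup ((h ^^ t) (pm_basis k)) i * lookup ((h ^^ t) (pm_basis l)) j) * (\<phi> (((h ^^ r) ^^ a) (pm_basis i)) * \<psi> (((h ^^ r) ^^ a) (pm_basis j))))"
    if "k < d" "l < d" for a t k l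
   proof -
    have "bilS (*) (%x y. \<phi> (((h ^^ r) ^^ a) x) * \<psi> (((h ^^ r) ^^ a) y))"
     using lin_scale_left[OF lin_comp[OF c.H_lin lf(1)] vs_fs] lin_scale[OF lin_comp[OF c.H_lin lf(2)]] by fast
    from bil_expand[OF this, of d "(h ^^ t) (pm_basis k)" "(h ^^ t) (pm_basis l)"] show ?thesis
     using that by (simp flip: H_cut)
   qed
   have "ES (%a b. \<phi> (m x a) * \<psi> b) - ES (%a b. \<phi> a * \<psi> (m b x)) =
    (\<Sum>a<Q'. \<Sum>t<r. \<Sum>k<d. \<Sum>l<d. \<Theta> k l ((hi ^^ t) (((hi ^^ r) ^^ a) x)) *
     (\<Sum>i<d. \<Sum>j<d. (lookup ((h ^^ t) (pm_basis k)) i * lookup ((h ^^ t) (pm_basis l)) j) * (\<phi> (((h ^^ r) ^^ a) (pm_basis i)) * \<psi> (((h ^^ r) ^^ a) (pm_basis j)))))"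
    unfolding T(2)[OF lf] Q' sum_lessThan_mult H_split Hi_split
    by (intro sum.cong refl) (subst ex, auto)
   also have "... = (\<Sum>a<Q'. \<Sum>i<d. \<Sum>j<d. \<Theta>' i j (((hi ^^ r) ^^ a) x) * (\<phi> (((h ^^ r) ^^ a) (pm_basis i)) * \<psi> (((h ^^ r) ^^ a) (pm_basis j))))"
   proof (rule sum.cong[OF refl])
    fix a
    have s5: "(\<Sum>t<r. \<Sum>k<d. \<Sum>l<d. \<Sum>i<d. \<Sum>j<d. F t k l i j) = (\<Sum>i<d. \<Sum>j<d. \<Sum>t<r. \<Sum>k<d. \<Sum>l<d. F t k l i j)"
     for F :: "nat => nat => nat => nat => nat => 'k"
    proof -
     have a: "(\<Sum>t<q. \<Sum>i<d. \<Sum>j<d. F t i j) = (\<Sum>i<d. \<Sum>j<d. \<Sum>t<q. F t i j)" for F :: "nat => nat => nat => 'k" and q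
      by (rule trans[OF sum.swap sum.cong[OF refl sum.swap]])
     have b: "(\<Sum>k<d. \<Sum>l<d. \<Sum>i<d. \<Sum>j<d. F k l i j) = (\<Sum>i<d. \<Sum>j<d. \<Sum>k<d. \<Sum>l<d. F k l i j)" for F :: "nat => nat => nat => nat => 'k"
      by (rule trans[OF sum.cong[OF refl a] a])
     show ?thesis by (rule trans[OF sum.cong[OF refl b] a])
    qed
    show "(\<Sum>t<r. \<Sum>k<d. \<Sum>l<d. \<Theta> k l ((hi ^^ t) (((hi ^^ r) ^^ a) x)) *
     (\<Sum>i<d. \<Sum>j<d. (lookup ((h ^^ t) (pm_basis k)) i * lookup ((h ^^ t) (pm_basis l)) j) * (\<phi> (((h ^^ r) ^^ a) (pm_basis i)) * \<psi> (((h ^^ r) ^^ a) (pm_basis j))))) =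
     (\<Sum>i<d. \<Sum>j<d. \<Theta>' i j (((hi ^^ r) ^^ a) x) * (\<phi> (((h ^^ r) ^^ a) (pm_basis i)) * \<psi> (((h ^^ r) ^^ a) (pm_basis j))))"
     unfolding \<Theta>'_def sum_distrib_left sum_distrib_right s5 by (simp only: mult.assoc)
   qed
   finally show "ES (%a b. \<phi> (m x a) * \<psi> b) - ES (%a b. \<phi> a * \<psi> (m b x)) = ..." .
  qed
 qed (auto simp: m_cut cut_u)
qed

lemma linear_generalized_inverse:
 fixes T :: "('x \<Rightarrow>\<^sub>0 'k::field) => ('y \<Rightarrow>\<^sub>0 'k)"
 assumes T: "linV T"
 shows "\<exists>\<theta>. linV \<theta> \<and> (\<forall>x. T (\<theta> (T x)) = T x)"
proof -
 interpret vp: vector_space_pair "pm_scale :: 'k => ('y \<Rightarrow>\<^sub>0 'k) => _" "pm_scale :: 'k => ('x \<Rightarrow>\<^sub>0 'k) => _" by unfold_locales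
 obtain B where B: "B \<subseteq> range T" "pm.independent B" "range T \<subseteq> pm.span B"
  using pm.maximal_independent_subset by blast
 obtain \<theta> where th: "linV \<theta>" "\<forall>b\<in>B. \<theta> b = (SOME x. T x = b)"
  using vp.linear_independent_extend[OF B(2), of "%b. SOME x. T x = b"] by blast
 have "T (\<theta> b) = b" if "b \<in> B" for b
 proof -
  have "T (SOME x. T x = b) = b" by (rule someI_ex) (use that B in auto)
  then show ?thesis using th that by simp
 qed
 moreover have l: "linV (%y. T (\<theta> y))" by (rule lin_comp[OF th(1) T])
 ultimately have "T (\<theta> y) = y" if "y \<in> range T" for y
 proof -
  interpret vq: vector_space_pair "pm_scale :: 'k => ('y \<Rightarrow>\<^sub>0 'k) => _" "pm_scale :: 'k => ('y \<Rightarrow>\<^sub>0 'k) => _" by unfold_locales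
  show ?thesis
   by (rule vq.linear_eq_on[OF l lin_id[OF vs_pm], of y B]) (use that B \<open>!!b. b \<in> B ==> T (\<theta> b) = b\<close> in auto)
 qed
 then show ?thesis using th(1) by blast
qed

context cyc
begin

text \<open>With \<open>\<theta>\<close> a reflexive generalized inverse of the norm, the transfer \<open>\<rho>\<^sub>0\<close> of \<open>\<theta>\<close> is, up to nilpotents,
 a projection onto a maximal free summand, and \<open>\<rho>\<^sub>0\<^sup>Q\<close> is an honest one.\<close>

lemma strip_projective:
 assumes p: "prime p" "CHAR('k) = p" and Q: "Q = p ^ n"
 shows "\<exists>\<pi>. eqv \<pi> \<and> (\<forall>x. \<pi> (\<pi> x) = \<pi> x \<and> cut d (\<pi> x) = \<pi> x \<and> \<pi> (cut d x) = \<pi> x) \<and>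
  SZ1 (%x. cut d x - \<pi> x) \<and> (\<forall>x. (\<Sum>s<Q. (h ^^ s) (\<pi> x)) = 0)"
proof -
 define T where "T = (%x. \<Sum>s<Q. (h ^^ s) (cut d x))"
 have T_lin: "linV T" unfolding T_def by (intro lin_sum vs_pm lin_comp[OF cut_lin H_lin])
 obtain \<theta>0 where th0: "linV \<theta>0" "!!x. T (\<theta>0 (T x)) = T x"
  using linear_generalized_inverse[OF T_lin] by blast
 \<comment> \<open>The sandwich makes the inverse reflexive: besides \<open>T \<theta> T = T\<close>
   it satisfies \<open>\<theta> T \<theta> = \<theta>\<close>, on which the estimate
   \<open>base\<close> rests.\<close>
 define \<theta> where "\<theta> = (%x. cut d (\<theta>0 (T (\<theta>0 (cut d x)))))"
 have cT: "T (cut d x) = T x" "cut d (T x) = T x" for x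
  by (simp_all add: T_def lin_props(6)[OF cut_lin] flip: H_cut)
 have th_lin: "linV \<theta>" unfolding \<theta>_def
  by (intro lin_comp[OF lin_comp[OF lin_comp[OF lin_comp[OF cut_lin th0(1)] T_lin] th0(1)] cut_lin])
 have TthT: "T (\<theta> (T x)) = T x" for x by (simp add: \<theta>_def cT th0(2))
 have thTth: "\<theta> (T (\<theta> x)) = \<theta> x" for x by (simp add: \<theta>_def cT th0(2))
 have c_th: "cut d (\<theta> x) = \<theta> x" "\<theta> (cut d x) = \<theta> x" for x by (simp_all add: \<theta>_def)
 have hT: "(h ^^ s) (T x) = T x" "(hi ^^ s) (T x) = T x" for s x
 proof -
  have "h (T x) = T x"
   unfolding T_def h_props using sum_reindex_period[of "%s. (h ^^ s) (cut d x)" Q] by (simp add: h_order)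
  then show *: "(h ^^ s) (T x) = T x" by (induction s) auto
  then show "(hi ^^ s) (T x) = T x" by (metis Hi_H)
 qed
 define \<rho>0 where "\<rho>0 = (%x. \<Sum>s<Q. (h ^^ s) (\<theta> ((hi ^^ s) x)))"
 have r_SZ: "SZ1 \<rho>0" by (rule SZ1I[OF th_lin]) (simp add: \<rho>0_def)
 have r_lin: "linV \<rho>0" by (rule SZ1_lin[OF r_SZ])
 have r_eqv: "eqv \<rho>0"
  unfolding eqv_def
 proof (intro conjI allI r_lin)
  fix x
  have per: "(%s. (h ^^ s) (\<theta> ((hi ^^ s) (h x)))) Q = (%s. (h ^^ s) (\<theta> ((hi ^^ s) (h x)))) 0"
   by (simp add: h_order Hi_order)
  have "\<rho>0 (h x) = (\<Sum>s<Q. (h ^^ Suc s) (\<theta> ((hi ^^ Suc s) (h x))))"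
   unfolding \<rho>0_def using sum_reindex_period[OF per] by simp
  also have "... = h (\<rho>0 x)" by (simp add: \<rho>0_def h_props funpow_swap1)
  finally show "\<rho>0 (h x) = h (\<rho>0 x)" .
 qed
 have r_cut: "\<rho>0 (cut d x) = \<rho>0 x" "cut d (\<rho>0 x) = \<rho>0 x" for x
  by (simp_all add: \<rho>0_def Hi_cut c_th lin_props(6)[OF cut_lin] flip: H_cut)
 have rT: "\<rho>0 (T x) = T x" for x
 proof -
  have "T y = (\<Sum>s<Q. (h ^^ s) (cut d y))" for y by (simp add: T_def)
  from this[of "\<theta> (T x)"] have "\<rho>0 (T x) = T (\<theta> (T x))" by (simp only: \<rho>0_def hT c_th)
  then show ?thesis by (simp add: TthT)
 qed
 define \<nu> where "\<nu> = (%x. \<rho>0 x - x)"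
 have nu_eqv: "eqv \<nu>" unfolding \<nu>_def by (intro eqv_diff r_eqv eqv_id)
 note nu_lin = eqv_lin[OF nu_eqv]
 define F where "F = pm.span {(h ^^ s) (\<theta> w) | s w. True}"
 define \<Delta> where "\<Delta> = (%x. h x - x)"
 have D_lin: "linV \<Delta>" unfolding \<Delta>_def by (rule eqv_lin[OF eqv_X])
 have hth: "(h ^^ t) (\<theta> y) \<in> F" for t y unfolding F_def by (intro pm.span_base) blast
 \<comment> \<open>Reflexivity writes \<open>\<theta> w\<close> as the sum of all
   \<open>\<theta> (y t)\<close>, while \<open>\<rho>0\<close> sums the same terms after applying
   \<open>h ^^ t\<close>. Each difference telescopes into an element of the image of
   \<open>\<Delta>\<close>.\<close>
 have base: "\<exists>v\<in>F. \<nu> (\<theta> w) = \<Delta> v" for w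
 proof -
  define y where "y = (%t. (hi ^^ t) (\<theta> w))"
  have HiT: "(\<Sum>t<Q. (hi ^^ t) v) = (\<Sum>t<Q. (h ^^ t) v)" for v
  proof -
   have e: "(hi ^^ l) v = (h ^^ Suc (Q - Suc l)) v" if "l < Q" for l
   proof -
    have "(h ^^ l) ((h ^^ Suc (Q - Suc l)) v) = (h ^^ (l + Suc (Q - Suc l))) v"
     by (simp only: funpow_add o_apply)
    also have "l + Suc (Q - Suc l) = Q" using that by simp
    finally show ?thesis using h_order by (metis Hi_H)
   qed
   have "(\<Sum>l<Q. (hi ^^ l) v) = (\<Sum>l<Q. (%i. (h ^^ Suc i) v) (Q - Suc l))"
    using e by (intro sum.cong refl) simp
   also have "... = (\<Sum>l<Q. (h ^^ Suc l) v)" by (rule sum.nat_diff_reindex)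
   also have "... = (\<Sum>l<Q. (h ^^ l) v)"
    using sum_reindex_period[of "%s. (h ^^ s) v" Q] by (simp add: h_order)
   finally show ?thesis .
  qed
  have "\<theta> w = \<theta> (T (\<theta> w))" by (simp add: thTth)
  also have "T (\<theta> w) = (\<Sum>t<Q. y t)" by (simp add: T_def c_th y_def HiT)
  finally have 1: "\<theta> w = (\<Sum>t<Q. \<theta> (y t))" by (simp add: lin_props(6)[OF th_lin])
  have tel: "(h ^^ t) v - v = \<Delta> (\<Sum>l<t. (h ^^ l) v)" for t v
   using sum_lessThan_telescope[of "%l. (h ^^ l) v" t] by (simp add: \<Delta>_def h_props sum_subtractf)
  have "\<nu> (\<theta> w) = (\<Sum>t<Q. (h ^^ t) (\<theta> (y t)) - \<theta> (y t))"
  proof -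
   have "\<rho>0 (\<theta> w) = (\<Sum>t<Q. (h ^^ t) (\<theta> (y t)))" by (simp add: \<rho>0_def y_def)
   then show ?thesis by (simp only: \<nu>_def sum_subtractf 1[symmetric])
  qed
  also have "... = \<Delta> (\<Sum>t<Q. \<Sum>l<t. (h ^^ l) (\<theta> (y t)))"
   by (simp add: tel lin_props(6)[OF D_lin])
  finally have "\<nu> (\<theta> w) = \<Delta> (\<Sum>t<Q. \<Sum>l<t. (h ^^ l) (\<theta> (y t)))" .
  moreover have "(\<Sum>t<Q. \<Sum>l<t. (h ^^ l) (\<theta> (y t))) \<in> F"
   using hth unfolding F_def by (intro pm.span_sum) 
  ultimately show ?thesis by blast
 qed
 have h_F: "(h ^^ t) v \<in> F" if v: "v \<in> F" for t v
  using v unfolding F_def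
 proof (induction rule: pm.span_induct_alt)
  case base then show ?case by (simp add: H_props pm.span_zero)
 next
  case (step c x y)
  then obtain s w where "x = (h ^^ s) (\<theta> w)" by auto
  then have "(h ^^ t) x = (h ^^ (t + s)) (\<theta> w)" by (simp add: funpow_add)
  then have "(h ^^ t) x \<in> pm.span {(h ^^ s) (\<theta> w) | s w. True}" by (intro pm.span_base) blast
  then show ?case using step by (simp add: H_props pm.span_add pm.span_scale)
 qed
 have step: "\<exists>v'\<in>F. \<nu> v = \<Delta> v'" if v: "v \<in> F" for v
  using v unfolding F_def
 proof (induction rule: pm.span_induct_alt)
  case base
  show ?case by (rule bexI[of _ 0]) (simp_all only: lin_props(3)[OF nu_lin] lin_props(3)[OF D_lin] pm.span_zero)
 next
  case (step c x y)
  then obtain s w where x: "x = (h ^^ s) (\<theta> w)" by auto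
  obtain v1 where v1: "v1 \<in> F" "\<nu> (\<theta> w) = \<Delta> v1" using base by blast
  have "\<nu> x = \<Delta> ((h ^^ s) v1)" by (simp add: x eqv_H[OF nu_eqv] v1 \<Delta>_def H_props funpow_swap1)
  moreover obtain v2 where v2: "v2 \<in> F" "\<nu> y = \<Delta> v2" using step by (auto simp: F_def)
  ultimately have "\<nu> (pm_scale c x + y) = \<Delta> (pm_scale c ((h ^^ s) v1) + v2)"
   by (simp add: lin_props[OF nu_lin] lin_props[OF D_lin])
  moreover have "pm_scale c ((h ^^ s) v1) + v2 \<in> F"
   using h_F[OF v1(1), of s] v2 unfolding F_def by (intro pm.span_add pm.span_scale)
  ultimately show ?case unfolding F_def by blast
 qed
 have nu_D: "\<nu> ((\<Delta> ^^ j) v) = (\<Delta> ^^ j) (\<nu> v)" for j v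
  by (induction j) (auto simp: \<Delta>_def lin_props[OF nu_lin] eqv_h[OF nu_eqv])
 have steps: "\<exists>v'\<in>F. (\<nu> ^^ j) v = (\<Delta> ^^ j) v'" if v: "v \<in> F" for j v
 proof (induction j)
  case (Suc j)
  then obtain v1 where v1: "v1 \<in> F" "(\<nu> ^^ j) v = (\<Delta> ^^ j) v1" by blast
  obtain v2 where v2: "v2 \<in> F" "\<nu> v1 = \<Delta> v2" using step[OF v1(1)] by blast
  have "(\<nu> ^^ Suc j) v = (\<Delta> ^^ Suc j) v2" by (simp add: v1 nu_D v2 funpow_swap1)
  then show ?case using v2 by blast
 qed (use v in auto)
 have DQ: "(\<Delta> ^^ Q) v = 0" for v
  using funpow_minus_one_char[OF h_lin p, of n v] h_order by (simp add: \<Delta>_def Q)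
 have r_F: "\<rho>0 x \<in> F" for x
  unfolding \<rho>0_def using hth unfolding F_def by (intro pm.span_sum)
 \<comment> \<open>Iterating \<open>\<nu> = \<rho>0 - 1\<close> on the image of
   \<open>\<rho>0\<close> gains one power of \<open>\<Delta>\<close> each time, so
   \<open>\<nu> ^^ Q\<close> vanishes there. In characteristic \<open>p\<close> this says that
   \<open>\<rho>0 ^^ Q\<close> is the identity on that image.\<close>
 have rQ: "(\<rho>0 ^^ Q) (\<rho>0 x) = \<rho>0 x" for x
 proof -
  obtain v' where "(\<nu> ^^ Q) (\<rho>0 x) = (\<Delta> ^^ Q) v'" using steps[OF r_F] by blast
  then have "(\<nu> ^^ Q) (\<rho>0 x) = 0" by (simp add: DQ)
  then show ?thesis using funpow_minus_one_char[OF r_lin p, of n "\<rho>0 x"] by (simp add: \<nu>_def Q)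
 qed
 define \<rho> where "\<rho> = \<rho>0 ^^ Q"
 have Q0: "Q = Suc (Q - 1)" using prime_gt_0_nat[OF p(1)] Q by simp
 have rho: "\<rho> x = \<rho>0 ((\<rho>0 ^^ (Q - 1)) x)" for x
  unfolding \<rho>_def by (subst Q0) simp
 have rho_eqv: "eqv \<rho>" unfolding \<rho>_def by (rule eqv_funpow[OF r_eqv])
 have rho_idem: "\<rho> (\<rho> x) = \<rho> x" for x
 proof -
  have "\<rho> (\<rho> x) = (\<rho>0 ^^ Q) (\<rho>0 ((\<rho>0 ^^ (Q - 1)) x))"
   by (simp only: rho[of x]) (simp only: \<rho>_def)
  also have "... = \<rho> x" by (simp only: rQ rho[of x])
  finally show ?thesis .
 qed
 have rho_cut: "cut d (\<rho> x) = \<rho> x" "\<rho> (cut d x) = \<rho> x" for x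
 proof -
  show "cut d (\<rho> x) = \<rho> x" by (simp add: rho r_cut)
  have "(\<rho>0 ^^ Suc j) (cut d x) = (\<rho>0 ^^ Suc j) x" for j by (induction j) (auto simp: r_cut)
  then show "\<rho> (cut d x) = \<rho> x" unfolding \<rho>_def by (metis Q0)
 qed
 have rho_SZ: "SZ1 \<rho>"
  using SZ1_comp_right[OF r_SZ eqv_funpow[OF r_eqv, of "Q - 1"]] unfolding rho[symmetric] .
 have rho_T: "\<rho> (T x) = T x" for x
  unfolding \<rho>_def by (induction Q) (auto simp: rT)
 define \<pi> where "\<pi> = (%x. cut d x - \<rho> x)"
 show ?thesis
 proof (intro exI[of _ \<pi>] conjI allI)
  show "eqv \<pi>" unfolding \<pi>_def by (intro eqv_diff eqv_cut rho_eqv)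
  show "\<pi> (\<pi> x) = \<pi> x" "cut d (\<pi> x) = \<pi> x" "\<pi> (cut d x) = \<pi> x" for x
   by (simp_all add: \<pi>_def lin_props[OF cut_lin] lin_props[OF eqv_lin[OF rho_eqv]] rho_cut rho_idem)
  show "SZ1 (%x. cut d x - \<pi> x)" using rho_SZ by (simp add: \<pi>_def)
  fix x
  have "(\<Sum>s<Q. (h ^^ s) (\<pi> x)) = T x - \<rho> (T x)"
   by (simp add: \<pi>_def H_props sum_subtractf T_def lin_props(6)[OF eqv_lin[OF rho_eqv]] eqv_H[OF rho_eqv] rho_cut)
  then show "(\<Sum>s<Q. (h ^^ s) (\<pi> x)) = 0" by (simp add: rho_T)
 qed
qed

end

text \<open>If a vector is killed by \<open>D\<close> to the power \<open>e + f\<close> only when its image under the \<open>e\<close>-th power is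
 divisible by a higher power \<open>e'\<close>, then descending induction kills the \<open>e\<close>-th power.\<close>

lemma nilpotency_descent:
 assumes step: "!!c. c \<in> A ==> (D ^^ (e + f)) c = 0 ==> \<exists>v\<in>A. (D ^^ e) c = (D ^^ e') v"
  and A: "!!c. c \<in> A ==> D c \<in> A" and D0: "D 0 = (0 :: 'v::ab_group_add)"
  and top: "!!c. c \<in> A ==> (D ^^ (f - 1 + e')) c = 0" and fe: "f \<ge> 1" "e' > e"
  and a: "a \<in> A"
 shows "(D ^^ e) a = 0"
proof -
 have A': "(D ^^ j) c \<in> A" if "c \<in> A" for j c using that A by (induction j) auto
 have z: "(D ^^ (i + j)) c = 0" if "(D ^^ j) c = 0" for i j c
  using that by (induction i) (auto simp: D0)
 have z': "(D ^^ k) c = 0" if "(D ^^ j) c = 0" "k \<ge> j" for j k c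
  using z[OF that(1), of "k - j"] that(2) by simp
 have add: "(D ^^ i) ((D ^^ j) c) = (D ^^ (i + j)) c" for i j c by (simp add: funpow_add)
 have "\<forall>c\<in>A. (D ^^ j) c = 0" if "e \<le> j" for j
 proof (cases "j \<le> f - 1 + e'")
  case False
  then show ?thesis using z'[OF top] by auto
 next
  case True
  then show ?thesis using that
  proof (induction rule: inc_induct)
   case base
   then show ?case using top by blast
  next
   case (step j)
   show ?case
   proof
    fix c assume c: "c \<in> A"
    have IH: "(D ^^ Suc j) w = 0" if "w \<in> A" for w using step that by auto
    show "(D ^^ j) c = 0"
    \<comment> \<open>For large \<open>j\<close> the hypothesis is applied to a power of
      \<open>D\<close> at \<open>c\<close>, chosen so that \<open>f - 1\<close> further powers
      remain and \<open>top\<close> finishes. For small \<open>j\<close> it is applied to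
      \<open>c\<close> itself, and the exponent grows because \<open>e' > e\<close>.\<close>
    proof (cases "Suc j \<ge> e + f")
     case True
     define w where "w = (D ^^ (Suc j - (e + f))) c"
     have w: "w \<in> A" unfolding w_def by (rule A'[OF c])
     have "(D ^^ (e + f)) w = 0" unfolding w_def add using True IH[OF c] by simp
     then obtain v where v: "v \<in> A" "(D ^^ e) w = (D ^^ e') v" using assms(1)[OF w] by blast
     have "(D ^^ j) c = (D ^^ (f - 1)) ((D ^^ e) w)"
      unfolding w_def add using True fe by simp
     then show ?thesis using v top by (simp add: add)
    next
     case False
     have "(D ^^ (e + f)) c = 0" using z'[OF IH[OF c]] False by simp
     then obtain v where v: "v \<in> A" "(D ^^ e) c = (D ^^ e') v" using assms(1)[OF c] by blast
     have "(D ^^ j) c = (D ^^ (j - e)) ((D ^^ e) c)" unfolding add using step by simp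
     also have "... = (D ^^ (j - e + e')) v" by (simp add: v add)
     also have "... = 0" using z'[OF IH[OF v(1)]] fe step by simp
     finally show ?thesis .
    qed
   qed
  qed
 qed
 then show ?thesis using a by blast
qed

section \<open>Compression to the core, where transfers vanish\<close>

section \<open>Characteristic two and the splitting of stable algebras\<close>

context salg
begin

lemma SZ1_outer: assumes "SZ1 f" shows "SZ3 (%x y z. m (f (m x y)) z)" "SZ3 (%x y z. m x (f (m y z)))"
proof -
 obtain \<theta> where th: "linV \<theta>" "!!x. f x = (\<Sum>s<Q. (h ^^ s) (\<theta> ((hi ^^ s) x)))"
  using assms unfolding SZ1_def by blast
 show "SZ3 (%x y z. m (f (m x y)) z)"
 proof (rule SZ3I[of "%x y z. m (\<theta> (m x y)) z"])
  show "tri (%x y z. m (\<theta> (m x y)) z)"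
   using lin_comp[OF lin_comp[OF m_lin1 th(1)] m_lin1] lin_comp[OF lin_comp[OF m_lin2 th(1)] m_lin1] m_lin2 by blast
 qed (simp add: th(2) m_props eqv2_H2[OF m_eqv2] eqv2_Hi[OF m_eqv2])
 show "SZ3 (%x y z. m x (f (m y z)))"
 proof (rule SZ3I[of "%x y z. m x (\<theta> (m y z))"])
  show "tri (%x y z. m x (\<theta> (m y z)))"
   using lin_comp[OF lin_comp[OF m_lin1 th(1)] m_lin2] lin_comp[OF lin_comp[OF m_lin2 th(1)] m_lin2] m_lin1 by blast
 qed (simp add: th(2) m_props eqv2_H1[OF m_eqv2] eqv2_Hi[OF m_eqv2])
qed

lemma E_SZ1: assumes "SZ1 f" "eqv2 \<beta>" shows "SZ0 (EV (%a b. \<beta> (f a) b))"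
proof -
 obtain \<theta> where th: "linV \<theta>" "!!x. f x = (\<Sum>s<Q. (h ^^ s) (\<theta> ((hi ^^ s) x)))"
  using assms unfolding SZ1_def by blast
 note bb = eqv2_bil[OF assms(2)]
 have b: "bil (%a b. \<beta> (\<theta> a) b)" using bb lin_comp[OF th(1)] by fast
 have "EV (%a b. \<beta> (f a) b) = (\<Sum>s<Q. (h ^^ s) (EV (%a b. \<beta> (\<theta> ((hi ^^ s) a)) ((hi ^^ s) b))))"
  by (simp add: th(2) bil_props[OF bb] E_sum eqv2_H2[OF assms(2)] E_apply[OF H_lin])
 then show ?thesis unfolding SZ0_def E_inv_Hi_V[OF b] by blast
qed

end

text \<open>\<open>\<pi>\<close> projects onto the core: the complement is stably zero, and the
  subgroup of order \<open>p\<close>, generated by \<open>h ^^ r\<close>, acts trivially on the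
  image.\<close>

locale salg_split = salg d Q h hi ee m u for d Q :: nat and h hi :: "('k::field) fvec => 'k fvec"
  and ee :: "nat => nat => 'k" and m :: "'k fvec => 'k fvec => 'k fvec" and u :: "'k fvec" +
 fixes \<pi> :: "'k fvec => 'k fvec" and p r :: nat
 assumes p: "prime p" "CHAR('k) = p" and Qpr: "Q = r * p"
  and pi_eqv: "eqv \<pi>" and pi_pi [simp]: "\<pi> (\<pi> x) = \<pi> x" and cut_pi [simp]: "cut d (\<pi> x) = \<pi> x"
  and pi_cut [simp]: "\<pi> (cut d x) = \<pi> x"
  and pi_SZ: "SZ1 (%x. cut d x - \<pi> x)" and pi_per: "(h ^^ r) (\<pi> x) = \<pi> x"
begin

lemmas pi_lin = eqv_lin[OF pi_eqv]
lemmas pi_props = lin_props[OF pi_lin]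

lemma H_pi_per: "(h ^^ (j + r)) (\<pi> x) = (h ^^ j) (\<pi> x)" by (simp add: funpow_add pi_per)
lemma Hi_pi_per: "(hi ^^ (j + r)) (\<pi> x) = (hi ^^ j) (\<pi> x)"
proof -
 have "(hi ^^ r) (\<pi> x) = \<pi> x" by (metis Hi_H pi_per)
 then show ?thesis by (simp add: funpow_add)
qed

text \<open>After compression by \<open>\<pi>\<close> the terms of a transfer repeat with period
  \<open>r\<close> and so occur in \<open>p\<close> equal copies. The next three lemmas apply the
  same count to maps.\<close>

lemma vanish0: assumes "SZ0 w" shows "\<pi> w = 0"
proof -
 obtain v where "w = (\<Sum>s<Q. (h ^^ s) v)" using assms unfolding SZ0_def by blast
 then have "\<pi> w = (\<Sum>s<r * p. (h ^^ s) (\<pi> v))" by (simp add: pi_props eqv_H[OF pi_eqv] Qpr)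
 also have "... = 0" by (rule sum_periodic_zero[OF _ char_sum_pm[OF p(2)]]) (rule H_pi_per)
 finally show ?thesis .
qed

lemma vanish1: assumes "SZ1 f" shows "\<pi> (f (\<pi> x)) = 0"
proof -
 obtain \<theta> where th: "linV \<theta>" "!!x. f x = (\<Sum>s<Q. (h ^^ s) (\<theta> ((hi ^^ s) x)))"
  using assms unfolding SZ1_def by blast
 have "\<pi> (f (\<pi> x)) = (\<Sum>s<r * p. (h ^^ s) (\<pi> (\<theta> ((hi ^^ s) (\<pi> x)))))"
  by (simp add: th(2) pi_props eqv_H[OF pi_eqv] Qpr)
 also have "... = 0"
  by (rule sum_periodic_zero[OF _ char_sum_pm[OF p(2)]]) (simp only: H_pi_per Hi_pi_per)
 finally show ?thesis .
qed

lemma vanish2: assumes "SZ2 f" shows "\<pi> (f (\<pi> x) (\<pi> y)) = 0"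
proof -
 obtain \<theta> where th: "bil \<theta>" "!!x y. f x y = (\<Sum>s<Q. (h ^^ s) (\<theta> ((hi ^^ s) x) ((hi ^^ s) y)))"
  using assms unfolding SZ2_def by blast
 have "\<pi> (f (\<pi> x) (\<pi> y)) = (\<Sum>s<r * p. (h ^^ s) (\<pi> (\<theta> ((hi ^^ s) (\<pi> x)) ((hi ^^ s) (\<pi> y)))))"
  by (simp add: th(2) pi_props eqv_H[OF pi_eqv] Qpr)
 also have "... = 0"
  by (rule sum_periodic_zero[OF _ char_sum_pm[OF p(2)]]) (simp only: H_pi_per Hi_pi_per)
 finally show ?thesis .
qed

lemma vanish3: assumes "SZ3 f" shows "\<pi> (f (\<pi> x) (\<pi> y) (\<pi> z)) = 0"
proof -
 obtain \<theta> where th: "tri \<theta>" "!!x y z. f x y z = (\<Sum>s<Q. (h ^^ s) (\<theta> ((hi ^^ s) x) ((hi ^^ s) y) ((hi ^^ s) z)))"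
  using assms unfolding SZ3_def by blast
 have "\<pi> (f (\<pi> x) (\<pi> y) (\<pi> z)) = (\<Sum>s<r * p. (h ^^ s) (\<pi> (\<theta> ((hi ^^ s) (\<pi> x)) ((hi ^^ s) (\<pi> y)) ((hi ^^ s) (\<pi> z)))))"
  by (simp add: th(2) pi_props eqv_H[OF pi_eqv] Qpr)
 also have "... = 0"
  by (rule sum_periodic_zero[OF _ char_sum_pm[OF p(2)]]) (simp only: H_pi_per Hi_pi_per)
 finally show ?thesis .
qed

definition m0 where "m0 x y = \<pi> (m (\<pi> x) (\<pi> y))"
definition u0 where "u0 = \<pi> u"

lemma m0_comm: "m0 x y = m0 y x"
 using vanish2[OF comm, of x y] by (simp add: m0_def pi_props)

text \<open>The inner projection may be inserted because \<open>cut d\<close> and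
  \<open>\<pi>\<close> differ by a transfer, and \<open>SZ1_outer\<close> carries this difference
  through the products. Stable associativity then becomes exact, since compressed transfers
  vanish.\<close>

lemma m0_assoc: "m0 (m0 x y) z = m0 x (m0 y z)"
proof -
 have 1: "\<pi> (m (\<pi> (m (\<pi> x) (\<pi> y))) (\<pi> z)) = \<pi> (m (m (\<pi> x) (\<pi> y)) (\<pi> z))"
  using vanish3[OF SZ1_outer(1)[OF pi_SZ], of x y z] by (simp add: pi_props m_props)
 have 2: "\<pi> (m (\<pi> x) (\<pi> (m (\<pi> y) (\<pi> z)))) = \<pi> (m (\<pi> x) (m (\<pi> y) (\<pi> z)))"
  using vanish3[OF SZ1_outer(2)[OF pi_SZ], of x y z] by (simp add: pi_props m_props)
 show ?thesis
  using vanish3[OF assoc[unfolded eq3_def], of x y z] by (simp add: m0_def pi_props 1 2)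
qed

lemma m0_unit: "m0 u0 x = \<pi> x"
proof -
 obtain \<theta> where th: "linV \<theta>" "!!x. cut d x - \<pi> x = (\<Sum>s<Q. (h ^^ s) (\<theta> ((hi ^^ s) x)))"
  using pi_SZ unfolding SZ1_def by blast
 have "(hi ^^ s) u = u" for s by (induction s) (auto, metis h_u hi_h)
 then have "SZ0 (u - \<pi> u)" using th(2)[of u] by (auto simp: SZ0_def cut_u)
 from vanish1[OF SZ0_mult[OF this eqv2_swap[OF m_eqv2] eqv_id], of x]
 have "\<pi> (m (\<pi> u) (\<pi> x)) = \<pi> (m u (\<pi> x))" by (simp add: m_props pi_props)
 also have "... = \<pi> x" using vanish1[OF unit[unfolded eq1_def], of x] by (simp add: pi_props)
 finally show ?thesis by (simp add: m0_def u0_def)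
qed

lemma m0_bil: "bil m0"
 unfolding m0_def using lin_comp[OF lin_comp[OF pi_lin m_lin2] pi_lin] lin_comp[OF lin_comp[OF pi_lin m_lin1] pi_lin] by fast

lemma m0_E: "EV m0 = u0"
proof -
 have e2: "eqv2 (%a b. m (\<pi> a) b)"
  unfolding eqv2_def using lin_comp[OF pi_lin m_lin1] m_lin2 by (simp add: eqv_h[OF pi_eqv] m_h)
 have 1: "\<pi> (EV m) = u0" using vanish0[OF mE] by (simp add: pi_props u0_def)
 have 2: "\<pi> (EV (%a b. m (\<pi> a) b)) = \<pi> (EV m)"
  using vanish0[OF E_SZ1[OF pi_SZ m_eqv2]] by (simp add: m_props E_diff pi_props)
 obtain \<theta> where th: "linV \<theta>" "!!x. cut d x - \<pi> x = (\<Sum>s<Q. (h ^^ s) (\<theta> ((hi ^^ s) x)))"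
  using pi_SZ unfolding SZ1_def by blast
 have b: "bil (%a b. m (\<pi> a) (\<theta> b))" using lin_comp[OF pi_lin m_lin1] lin_comp[OF th(1) m_lin2] by fast
 have "EV (%a b. m (\<pi> a) b) - EV (%a b. m (\<pi> a) (\<pi> b)) = EV (%a b. m (\<pi> a) (cut d b - \<pi> b))"
  by (simp add: m_props E_diff)
 also have "... = (\<Sum>s<Q. (h ^^ s) (EV (%a b. m (\<pi> ((hi ^^ s) a)) (\<theta> ((hi ^^ s) b)))))"
  by (simp add: th(2) m_props(12) E_sum eqv2_H1[OF m_eqv2] E_apply[OF H_lin] eqv_Hi[OF pi_eqv])
 also have "... = (\<Sum>s<Q. (h ^^ s) (EV (%a b. m (\<pi> a) (\<theta> b))))" using E_inv_Hi_V[OF b] by simp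
 finally have "SZ0 (EV (%a b. m (\<pi> a) b) - EV (%a b. m (\<pi> a) (\<pi> b)))" unfolding SZ0_def by blast
 from vanish0[OF this] have "\<pi> (EV (%a b. m (\<pi> a) (\<pi> b))) = u0" using 1 2 by (simp add: pi_props)
 moreover have "m0 = (%a b. \<pi> (m (\<pi> a) (\<pi> b)))" by (simp add: m0_def fun_eq_iff)
 ultimately show ?thesis by (simp add: E_apply[OF pi_lin])
qed

text \<open>Allows the projection to be inserted on the leg of the tensor that meets the product.
  Invariance of the tensor gives the terms of the difference period \<open>r\<close>.\<close>

lemma ES_vanish:
 assumes l: "linF \<phi>" "linF \<psi>"
 shows "ES (%a b. \<phi> (\<pi> (m (\<pi> x) (cut d a - \<pi> a))) * \<psi> (\<pi> b)) = 0"
  "ES (%a b. \<phi> (\<pi> a) * \<psi> (\<pi> (m (cut d b - \<pi> b) (\<pi> x)))) = 0"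
proof -
 obtain \<theta> where th: "linV \<theta>" "!!x. cut d x - \<pi> x = (\<Sum>s<Q. (h ^^ s) (\<theta> ((hi ^^ s) x)))"
  using pi_SZ unfolding SZ1_def by blast
 have b: "bilS (*) (%a b. \<phi> ((h ^^ s) (\<pi> (m y (\<theta> a)))) * \<psi> ((h ^^ s) (\<pi> b)))"
  "bilS (*) (%a b. \<phi> ((h ^^ s) (\<pi> a)) * \<psi> ((h ^^ s) (\<pi> (m (\<theta> b) y))))" for s y
  using lin_scale_left[OF lin_comp[OF lin_comp[OF lin_comp[OF lin_comp[OF th(1) m_lin2] pi_lin] H_lin] l(1)] vs_fs]
   lin_scale[OF lin_comp[OF lin_comp[OF pi_lin H_lin] l(2)]]
   lin_scale_left[OF lin_comp[OF lin_comp[OF pi_lin H_lin] l(1)] vs_fs]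
   lin_scale[OF lin_comp[OF lin_comp[OF lin_comp[OF lin_comp[OF th(1) m_lin1] pi_lin] H_lin] l(2)]]
  by fast+
 have "ES (%a b. \<phi> (\<pi> (m (\<pi> x) (cut d a - \<pi> a))) * \<psi> (\<pi> b)) =
  (\<Sum>s<Q. ES (%a b. \<phi> ((h ^^ s) (\<pi> (m ((hi ^^ s) (\<pi> x)) (\<theta> ((hi ^^ s) a))))) * \<psi> ((h ^^ s) (\<pi> ((hi ^^ s) b)))))"
  by (simp add: th(2) m_props(12) pi_props(6) lin_props(6)[OF l(1)] sum_distrib_right E_sum eqv2_H1[OF m_eqv2] eqv_H[OF pi_eqv] eqv_Hi[OF pi_eqv])
 also have "... = (\<Sum>s<r * p. ES (%a b. \<phi> ((h ^^ s) (\<pi> (m ((hi ^^ s) (\<pi> x)) (\<theta> a)))) * \<psi> ((h ^^ s) (\<pi> b))))"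
  using E_inv_Hi_S[OF b(1)] by (simp add: Qpr)
 also have "... = 0"
  by (rule sum_periodic_zero[OF _ char_sum_k[OF p(2)]]) (simp only: H_pi_per Hi_pi_per)
 finally show "ES (%a b. \<phi> (\<pi> (m (\<pi> x) (cut d a - \<pi> a))) * \<psi> (\<pi> b)) = 0" .
 have "ES (%a b. \<phi> (\<pi> a) * \<psi> (\<pi> (m (cut d b - \<pi> b) (\<pi> x)))) =
  (\<Sum>s<Q. ES (%a b. \<phi> ((h ^^ s) (\<pi> ((hi ^^ s) a))) * \<psi> ((h ^^ s) (\<pi> (m (\<theta> ((hi ^^ s) b)) ((hi ^^ s) (\<pi> x)))))))"
  by (simp add: th(2) m_props(11) pi_props(6) lin_props(6)[OF l(2)] sum_distrib_left E_sum eqv2_H2[OF m_eqv2] eqv_H[OF pi_eqv] eqv_Hi[OF pi_eqv])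
 also have "... = (\<Sum>s<r * p. ES (%a b. \<phi> ((h ^^ s) (\<pi> a)) * \<psi> ((h ^^ s) (\<pi> (m (\<theta> b) ((hi ^^ s) (\<pi> x)))))))"
  using E_inv_Hi_S[OF b(2)] by (simp add: Qpr)
 also have "... = 0"
  by (rule sum_periodic_zero[OF _ char_sum_k[OF p(2)]]) (simp only: H_pi_per Hi_pi_per)
 finally show "ES (%a b. \<phi> (\<pi> a) * \<psi> (\<pi> (m (cut d b - \<pi> b) (\<pi> x)))) = 0" .
qed

lemma m0_sep:
 assumes l: "linF \<phi>" "linF \<psi>"
 shows "ES (%a b. \<phi> (m0 x a) * \<psi> (\<pi> b)) = ES (%a b. \<phi> (\<pi> a) * \<psi> (m0 b x))"
proof -
 obtain \<Theta> where T: "!!i j. linF (\<Theta> i j)" "!!x \<phi> \<psi>. linF \<phi> ==> linF \<psi> ==>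
    ES (%a b. \<phi> (m x a) * \<psi> b) - ES (%a b. \<phi> a * \<psi> (m b x)) =
    (\<Sum>s<Q. \<Sum>i<d. \<Sum>j<d. \<Theta> i j ((hi ^^ s) x) * (\<phi> ((h ^^ s) (pm_basis i)) * \<psi> ((h ^^ s) (pm_basis j))))"
  using sep by blast
 have 1: "ES (%a b. \<phi> (m0 x a) * \<psi> (\<pi> b)) = ES (%a b. \<phi> (\<pi> (m (\<pi> x) a)) * \<psi> (\<pi> b))"
  using ES_vanish(1)[OF l, of x] by (simp add: m_props pi_props lin_props[OF l(1)] left_diff_distrib E_diff m0_def)
 have 2: "ES (%a b. \<phi> (\<pi> a) * \<psi> (m0 b x)) = ES (%a b. \<phi> (\<pi> a) * \<psi> (\<pi> (m b (\<pi> x))))"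
  using ES_vanish(2)[OF l, of x] by (simp add: m_props pi_props lin_props[OF l(2)] right_diff_distrib E_diff m0_def)
 have "ES (%a b. \<phi> (\<pi> (m (\<pi> x) a)) * \<psi> (\<pi> b)) - ES (%a b. \<phi> (\<pi> a) * \<psi> (\<pi> (m b (\<pi> x)))) =
  (\<Sum>s<r * p. \<Sum>i<d. \<Sum>j<d. \<Theta> i j ((hi ^^ s) (\<pi> x)) * (\<phi> ((h ^^ s) (\<pi> (pm_basis i))) * \<psi> ((h ^^ s) (\<pi> (pm_basis j)))))"
  using T(2)[OF lin_comp[OF pi_lin l(1)] lin_comp[OF pi_lin l(2)], of "\<pi> x"] by (simp add: Qpr eqv_H[OF pi_eqv])
 also have "... = 0"
  by (rule sum_periodic_zero[OF _ char_sum_k[OF p(2)]]) (simp only: H_pi_per Hi_pi_per)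
 finally show ?thesis using 1 2 by simp
qed

lemma halg: "halg d ee \<pi> m0 u0 p"
proof -
 interpret c: cyc d 1 "%x. x" "%x. x"
  by (rule cyc.intro) (auto simp: lin_id lin_props[OF cut_lin])
 interpret c: cyc_tensor d 1 "%x. x" "%x. x" ee by unfold_locales simp
 show ?thesis
  by unfold_locales
   (rule m0_bil | rule m0_assoc | rule m0_comm | rule m0_unit | rule m0_E | (rule m0_sep, assumption, assumption)
    | simp add: pi_props m0_def u0_def p)+
qed

end

section \<open>Characteristic two: the cyclic group of order 4\<close>

section \<open>The case of characteristic two\<close>

locale salg4 = salg d Q h hi ee m u for d Q :: nat and h hi :: "('k::field) fvec => 'k fvec"
  and ee :: "nat => nat => 'k" and m :: "'k fvec => 'k fvec => 'k fvec" and u :: "'k fvec" +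
 assumes char2: "CHAR('k) = 2" and Q4: "Q = 4"
begin

lemma two_V: "x + x = (0 :: 'k fvec)"
 using char_sum_pm[OF char2, of x] by (simp add: numeral_2_eq_2)

lemma neg_V: "- x = (x :: 'k fvec)" using two_V[of x] by (simp add: minus_unique)

lemma minus_V: "x - y = (x + y :: 'k fvec)" by (metis diff_conv_add_uminus neg_V)

lemma cancel_V: "x + (x + y) = (y :: 'k fvec)" by (metis two_V add.assoc add_0)

text \<open>In characteristic two \<open>D\<close> is \<open>h - 1\<close>, and its square
  \<open>K\<close> is at once \<open>h ^^ 2 - 1\<close> and the norm of the subgroup of order
  two.\<close>

definition D where "D x = h x + x"
definition K where "K x = x + h (h x)"

lemma D_lin: "linV D" unfolding D_def by (intro lin_add h_lin lin_id vs_pm)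
lemma K_lin: "linV K" unfolding K_def by (intro lin_add lin_comp[OF h_lin h_lin] lin_id vs_pm)
lemmas D_props = lin_props[OF D_lin]
lemmas K_props = lin_props[OF K_lin]
lemma DD: "D (D x) = K x" by (simp add: D_def K_def h_props ac_simps cancel_V)
lemma h4: "h (h (h (h x))) = x" using h_order[of x] by (simp add: Q4 numeral_eq_Suc)
lemma hK: "h (K x) = K (h x)" by (simp add: K_def h_props)
lemma Kfix: "K x = 0 \<longleftrightarrow> h (h x) = x"
 unfolding K_def by (metis add.commute cancel_V two_V add.right_neutral)

lemma m_K1: "h (h z) = z ==> m (K v) z = K (m v z)"
 by (simp add: K_def m_props flip: m_h)
lemma m_K2: "h (h z) = z ==> m z (K v) = K (m z v)"
 by (simp add: K_def m_props flip: m_h)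

text \<open>The class of \<open>D a\<close> modulo the image of \<open>D ^^ 3\<close> is the
  obstruction to changing \<open>a\<close> by an element of the image of \<open>K\<close> into a
  vector fixed by \<open>h\<close>. Squaring kills it: \<open>D (m a a)\<close> equals
  \<open>K s''\<close> for a vector \<open>s''\<close> whose own \<open>D s''\<close> again lies in
  the image of \<open>K\<close>.\<close>

lemma square_lifts:
 assumes a: "h (h a) = a" and s: "D a = K s"
 shows "\<exists>w. D (m a a) = D (D (D w))"
proof -
 define b where "b = D a"
 have hb: "h b = b" using a by (simp add: b_def D_def h_props add.commute)
 have ha: "h a = a + b" by (simp add: b_def D_def ac_simps cancel_V)
 have bs: "b = K s" using s by (simp add: b_def)
 have trs: "s + h s + h (h s) + h (h (h s)) = 0"
 proof -
  have "D (K s) = 0" using hb by (simp add: D_def two_V flip: bs)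
  then show ?thesis by (simp add: D_def K_def h_props ac_simps)
 qed
 \<comment> \<open>Products with vectors fixed by \<open>h ^^ 2\<close> are linear over
   \<open>K\<close>, so \<open>a b + b a + b b\<close> with \<open>b = K s\<close> becomes
   \<open>K s''\<close>.\<close>
 define s'' where "s'' = m a s + m s a + m s b"
 have Dm: "D (m a a) = K s''"
 proof -
  have "D (m a a) = m a b + m b a + m b b"
   by (simp add: D_def ha m_props ac_simps cancel_V flip: m_h)
  also have "... = K s''"
   using m_K1[of b s] m_K2[OF a, of s] m_K1[OF a, of s] hb by (simp add: s''_def K_props flip: bs)
  finally show ?thesis .
 qed
 have DsK: "h (h (D s)) = D s"
  using arg_cong[OF bs, of D] hb DD[of "D s"] Kfix[of "D s"] by (metis DD D_def two_V)
 \<comment> \<open>Commutativity enters here: on arguments fixed by \<open>h ^^ 2\<close>, a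
   bilinear transfer over the group of order 4 takes values in the image of
   \<open>K\<close>.\<close>
 have comm_part: "\<exists>w. m a (D s) + m (D s) a = K w"
 proof -
  obtain \<theta> where th: "bil \<theta>" "!!x y. m x y - m y x = (\<Sum>s<Q. (h ^^ s) (\<theta> ((hi ^^ s) x) ((hi ^^ s) y)))"
   using comm unfolding SZ2_def by blast
  have hi2: "hi (hi x) = x" if "h (h x) = x" for x using that by (metis hi_h)
  have "m a (D s) + m (D s) a = (\<Sum>j<4. (h ^^ j) (\<theta> ((hi ^^ j) a) ((hi ^^ j) (D s))))"
   using th(2)[of a "D s"] by (simp add: minus_V Q4)
  also have "... = \<theta> a (D s) + h (\<theta> (hi a) (hi (D s))) + h (h (\<theta> a (D s))) + h (h (h (\<theta> (hi a) (hi (D s)))))"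
   by (simp add: numeral_eq_Suc hi2[OF a] hi2[OF DsK] ac_simps)
  also have "... = K (\<theta> a (D s) + h (\<theta> (hi a) (hi (D s))))"
   by (simp add: K_def h_props ac_simps)
  finally show ?thesis by blast
 qed
 then obtain w1 where w1: "m a (D s) + m (D s) a = K w1" by blast
 \<comment> \<open>For this part the vanishing norm of \<open>s\<close>, recorded in
   \<open>trs\<close>, takes the place of commutativity.\<close>
 have rest: "m b (h s) + m s b = K (m s (h (h (h s))))"
 proof -
  have b': "b = s + h (h s)" by (simp add: bs K_def)
  have e: "h (h s) = s + h s + h (h (h s))"
   using trs by (metis (no_types, lifting) add.assoc add.commute cancel_V add.right_neutral)
  have k1: "m (h (h s)) (h s) = h (h (m s (h (h (h s)))))" by (simp add: h4 flip: m_h)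
  have "m b (h s) + m s b = m s (h s) + h (h (m s (h (h (h s))))) + m s s + m s (h (h s))"
   by (simp add: b' m_props k1 ac_simps)
  moreover have "m s (h s) + m s s = m s (h (h s)) + m s (h (h (h s)))"
  proof -
   have "m s (s + h s + h (h s) + h (h (h s))) = 0" unfolding trs by (simp add: m_props)
   then have "m s s + m s (h s) + m s (h (h s)) + m s (h (h (h s))) = 0" by (simp add: m_props)
   then show ?thesis by (metis (no_types, lifting) add.assoc add.commute cancel_V add.right_neutral)
  qed
  ultimately have "m b (h s) + m s b = h (h (m s (h (h (h s))))) + m s (h (h (h s)))"
   by (metis (no_types, lifting) add.assoc add.commute cancel_V)
  then show ?thesis by (simp add: K_def add.commute)
 qed
 have "D s'' = (m a (D s) + m (D s) a) + (m b (h s) + m s b)"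
 proof -
  have "h s'' = (m a (h s) + m b (h s)) + (m (h s) a + m (h s) b) + m (h s) b"
   by (simp add: s''_def h_props ha hb m_props add.assoc flip: m_h)
  then have "D s'' = (m a (h s) + m b (h s)) + (m (h s) a + m (h s) b) + m (h s) b + (m a s + m s a + m s b)"
   by (simp only: D_def s''_def)
  then show ?thesis by (simp only: D_def m_props ac_simps cancel_V two_V add_0_right add_0_left)
 qed
 also have "... = K (w1 + m s (h (h (h s))))" by (simp only: w1 rest K_props)
 finally have "D (m a a) = D (D (D (w1 + m s (h (h (h s))))))" by (simp only: Dm DD[symmetric])
 then show ?thesis by blast
qed

text \<open>Over the subgroup of order two the core is an honest algebra whose idempotents are
  permuted by the involution induced by \<open>h\<close>. A functional \<open>\<tau>\<close>
  detecting the obstruction of \<open>b = D c\<close> becomes a sum over these idempotents: moved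
  ones cancel in pairs, and fixed ones contribute nothing by \<open>square_lifts\<close>. In terms
  of Jordan blocks, size 3 is excluded.\<close>

theorem D2_divisible:
 assumes sc: "separably_closed TYPE('k)" and c: "D (D (D c)) = 0"
 shows "\<exists>v. D (D c) = D (D (D v))"
proof (rule ccontr)
 assume neg: "\<nexists>v. D (D c) = D (D (D v))"
 have p2: "prime (2::nat)" by simp
 interpret k: salg d 2 "h ^^ 2" "hi ^^ 2" ee m u by (rule salg_power) (simp add: Q4)
 have h2: "(h ^^ 2) x = h (h x)" "(hi ^^ 2) x = hi (hi x)" for x by (simp_all add: numeral_2_eq_2)
 obtain \<pi> where pi: "k.eqv \<pi>" "!!x. \<pi> (\<pi> x) = \<pi> x" "!!x. cut d (\<pi> x) = \<pi> x" "!!x. \<pi> (cut d x) = \<pi> x"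
  "k.SZ1 (%x. cut d x - \<pi> x)" "!!x. (\<Sum>s<2. ((h ^^ 2) ^^ s) (\<pi> x)) = 0"
  using k.strip_projective[OF p2 char2, of 1] by auto
 have pi_fix: "h (h (\<pi> x)) = \<pi> x" for x
  using pi(6)[of x] Kfix[of "\<pi> x"] by (simp add: numeral_2_eq_2 K_def)
 interpret s: salg_split d 2 "h ^^ 2" "hi ^^ 2" ee m u \<pi> 2 1
  by unfold_locales (use pi char2 pi_fix h2 in auto)
 interpret a: halg d ee \<pi> s.m0 s.u0 2 by (rule s.halg)
 obtain F where F: "a.idem_family F" and span: "!!x. \<exists>c. \<pi> x = (\<Sum>\<xi>\<in>F. pm_scale (c \<xi>) \<xi>)"
  using a.split_idempotents[OF sc] by blast
 have pK: "\<pi> (K v) = 0" for v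
 proof (rule s.vanish0)
  have "K v = (\<Sum>s<2. ((h ^^ 2) ^^ s) v)" by (simp add: numeral_2_eq_2 K_def)
  then show "k.SZ0 (K v)" unfolding k.SZ0_def by blast
 qed
 have kf: "\<exists>v. w = \<pi> w + K v" if "h (h w) = w" "cut d w = w" for w
 proof -
  obtain \<theta> where th: "!!x. cut d x - \<pi> x = (\<Sum>s<2. ((h ^^ 2) ^^ s) (\<theta> (((hi ^^ 2) ^^ s) x)))"
   using pi(5) unfolding k.SZ1_def by blast
  have "hi (hi w) = w" using that by (metis hi_h)
  then have "w - \<pi> w = K (\<theta> w)" using th[of w] that by (simp add: numeral_2_eq_2 K_def)
  then show ?thesis by (metis add.commute diff_add_cancel)
 qed
 have cut_h: "cut d (h (\<pi> x)) = h (\<pi> x)" for x by (simp add: pi(3) flip: h_cut)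
 have pih: "\<pi> (h (\<pi> w)) = \<pi> (h w)" if w: "h (h w) = w" "cut d w = w" for w
 proof -
  obtain v where v: "w = \<pi> w + K v" using kf[OF w] by blast
  have "\<pi> (h w) = \<pi> (h (\<pi> w + K v))" using v by simp
  then show ?thesis by (simp add: h_props s.pi_props hK pK)
 qed
 \<comment> \<open>\<open>h\<close> preserves the core only modulo the image of \<open>K\<close>, so
   the induced map is compressed by \<open>\<pi>\<close>. Adding \<open>x - \<pi> x\<close> makes it
   an involution of the whole type.\<close>
 define \<sigma> where "\<sigma> = (%x. \<pi> (h (\<pi> x)) + (x - \<pi> x))"
 have sg_lin: "linV \<sigma>" unfolding \<sigma>_def
  by (intro lin_add lin_diff lin_comp[OF lin_comp[OF s.pi_lin h_lin] s.pi_lin] lin_id vs_pm s.pi_lin)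
 have psg: "\<pi> (\<sigma> x) = \<pi> (h (\<pi> x))" for x by (simp add: \<sigma>_def s.pi_props)
 have sgp: "\<sigma> (\<pi> x) = \<pi> (h (\<pi> x))" for x by (simp add: \<sigma>_def s.pi_props)
 have inv1: "\<pi> (h (\<pi> (h (\<pi> x)))) = \<pi> x" for x
  using pih[of "h (\<pi> x)"] pi_fix cut_h by (simp add: pi)
 have sg_inv: "\<sigma> (\<sigma> x) = x" for x
 proof -
  have "\<sigma> (\<sigma> x) = \<pi> (h (\<pi> (\<sigma> x))) + (\<sigma> x - \<pi> (\<sigma> x))" by (simp only: \<sigma>_def)
  also have "... = \<pi> x + (\<sigma> x - \<pi> (h (\<pi> x)))" by (simp only: psg inv1)
  also have "... = x" by (simp add: \<sigma>_def)
  finally show ?thesis .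
 qed
 have sg_mult: "\<sigma> (s.m0 x y) = s.m0 (\<sigma> x) (\<sigma> y)" for x y
 proof -
  define w x' y' where "w = m (\<pi> x) (\<pi> y)" and "x' = h (\<pi> x)" and "y' = h (\<pi> y)"
  have w: "h (h w) = w" "cut d w = w" by (simp_all add: w_def pi_fix flip: m_h)
  have x': "h (h x') = x'" "h (h y') = y'" by (simp_all add: x'_def y'_def pi_fix)
  obtain v1 where v1: "x' = \<pi> x' + K v1" using kf[of x'] x' cut_h by (auto simp: x'_def)
  obtain v2 where v2: "y' = \<pi> y' + K v2" using kf[of y'] x' cut_h by (auto simp: y'_def)
  have "\<sigma> (s.m0 x y) = \<pi> (h (\<pi> w))" by (simp add: s.m0_def sgp w_def)
  also have "... = \<pi> (m x' y')" unfolding pih[OF w] by (simp add: w_def x'_def y'_def flip: m_h)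
  also have "m x' y' = m (\<pi> x' + K v1) (\<pi> y' + K v2)" using v1 v2 by simp
  also have "... = m (\<pi> x') (\<pi> y') + K (m (\<pi> x') v2) + K (m v1 y')"
  proof -
   have "m (K v1) (\<pi> y') + m (K v1) (K v2) = m (K v1) (\<pi> y' + K v2)" by (simp only: m_props)
   also have "... = K (m v1 y')" using v2 m_K1[OF x'(2), of v1] by simp
   finally show ?thesis using m_K2[OF pi_fix, of x' v2] by (simp add: m_props add.assoc)
  qed
  also have "\<pi> ... = \<pi> (m (\<pi> x') (\<pi> y'))" by (simp add: s.pi_props pK)
  also have "... = s.m0 (\<sigma> x) (\<sigma> y)" by (simp add: s.m0_def psg x'_def y'_def)
  finally show ?thesis .
 qed
 have sg_F: "\<sigma> \<xi> \<in> F" if "\<xi> \<in> F" for \<xi>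
 proof (rule a.automorphism_permutes[OF F span sg_lin sg_mult _ _ _ that])
  show "\<sigma> (\<pi> x) = \<pi> (\<sigma> x)" for x by (simp add: sgp psg)
  show "\<exists>x. \<sigma> x = y" for y using sg_inv by blast
  show "x = 0" if "\<sigma> x = 0" for x using sg_inv[of x] that lin_props(3)[OF sg_lin] by simp
 qed
 define b where "b = D c"
 have Kb: "h (h b) = b" using c Kfix[of b] by (simp add: b_def flip: DD)
 have cb: "cut d b = b" using cut_X[of c] by (simp add: b_def D_def minus_V)
 obtain v0 where v0: "b = \<pi> b + K v0" using kf[OF Kb cb] by blast
 obtain co where co: "\<pi> b = (\<Sum>\<xi>\<in>F. pm_scale (co \<xi>) \<xi>)" using span by blast
 have sgb: "\<sigma> (\<pi> b) = \<pi> b"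
 proof -
  have "\<sigma> (\<pi> b) = \<pi> (h b)" by (simp add: sgp pih[OF Kb cb])
  also have "h b = b + K c" by (simp add: b_def DD[symmetric] D_def[of "D c"] ac_simps cancel_V)
  finally show ?thesis by (simp add: s.pi_props pK)
 qed
 have Fp: "finite F" "!!\<xi>. \<xi> \<in> F ==> \<xi> \<noteq> 0 \<and> \<pi> \<xi> = \<xi> \<and> s.m0 \<xi> \<xi> = \<xi>"
  using F by (auto simp: a.idem_family_def)
 have mult: "s.m0 \<xi> (\<pi> b) = pm_scale (co \<xi>) \<xi>" if "\<xi> \<in> F" for \<xi>
  unfolding co by (rule a.idem_family_mult) (use F that in \<open>auto simp: a.idem_family_def\<close>)
 have co_inv: "co (\<sigma> \<xi>) = co \<xi>" if e: "\<xi> \<in> F" for \<xi>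
 proof -
  have "pm_scale (co \<xi>) (\<sigma> \<xi>) = \<sigma> (s.m0 \<xi> (\<pi> b))" by (simp only: mult[OF e] lin_props(2)[OF sg_lin])
  also have "... = pm_scale (co (\<sigma> \<xi>)) (\<sigma> \<xi>)" by (simp only: sg_mult sgb mult[OF sg_F[OF e]])
  finally show ?thesis using Fp(2)[OF sg_F[OF e]] by simp
 qed
 have "D b \<notin> range (%v. D (D (D v)))" using neg by (auto simp: b_def)
 then obtain \<tau> where tau: "linF \<tau>" "!!v. \<tau> (D (D (D v))) = 0" "\<tau> (D b) = 1"
  using funct_separation[OF subspace_range_lin[OF lin_comp[OF D_lin lin_comp[OF D_lin D_lin]]], of "D b"] by blast
 have tauDK: "\<tau> (D (K v)) = 0" for v using tau(2) by (simp add: DD)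
 define f where "f = (%\<xi>. co \<xi> * \<tau> (D \<xi>))"
 have e_decomp: "\<exists>v. h \<xi> = \<sigma> \<xi> + K v" if e: "\<xi> \<in> F" for \<xi>
 proof -
  have pe: "\<pi> \<xi> = \<xi>" using Fp(2)[OF e] by simp
  obtain v where "h (\<pi> \<xi>) = \<pi> (h (\<pi> \<xi>)) + K v" using kf[of "h (\<pi> \<xi>)"] pi_fix cut_h by metis
  then show ?thesis using sgp[of \<xi>] pe by auto
 qed
 have f_inv: "f (\<sigma> \<xi>) = f \<xi>" if e: "\<xi> \<in> F" for \<xi>
 proof -
  obtain v where v: "h \<xi> = \<sigma> \<xi> + K v" using e_decomp[OF e] by blast
  have "D (h \<xi>) = D \<xi>"
   using pi_fix[of \<xi>] Fp(2)[OF e] by (simp add: D_def add.commute)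
  moreover have "\<tau> (D (h \<xi>)) = \<tau> (D (\<sigma> \<xi>))"
   unfolding v by (simp only: D_props(1) lin_props(1)[OF tau(1)] tauDK add_0_right)
  ultimately have "\<tau> (D \<xi>) = \<tau> (D (\<sigma> \<xi>))" by simp
  then show ?thesis by (simp add: f_def co_inv[OF e])
 qed
 have f_fix: "f \<xi> = 0" if e: "\<xi> \<in> F" "\<sigma> \<xi> = \<xi>" for \<xi>
 proof -
  have e': "h (h \<xi>) = \<xi>" "\<pi> \<xi> = \<xi>" using pi_fix[of \<xi>] Fp(2)[OF e(1)] by auto
  obtain v where v: "h \<xi> = \<xi> + K v" using e_decomp[OF e(1)] e(2) by auto
  \<comment> \<open>A fixed idempotent meets the hypotheses of \<open>square_lifts\<close>. It
    agrees with its own square modulo the image of \<open>K\<close>, on which \<open>\<tau>\<close>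
    composed with \<open>D\<close> vanishes.\<close>
  have "D \<xi> = K v" by (simp add: D_def v ac_simps cancel_V two_V)
  then obtain w where w: "D (m \<xi> \<xi>) = D (D (D w))" using square_lifts[OF e'(1)] by blast
  obtain v' where v': "m \<xi> \<xi> = \<pi> (m \<xi> \<xi>) + K v'"
   using kf[of "m \<xi> \<xi>"] e' by (auto simp flip: m_h)
  have "\<pi> (m \<xi> \<xi>) = s.m0 \<xi> \<xi>" by (simp add: s.m0_def e'(2))
  then have "\<pi> (m \<xi> \<xi>) = \<xi>" using Fp(2)[OF e(1)] by simp
  then have "D (D (D w)) = D \<xi> + D (K v')" using w v' by (metis D_props(1))
  then have "\<tau> (D \<xi>) = 0" using tau(2)[of w] by (simp add: lin_props[OF tau(1)] tauDK)
  then show ?thesis by (simp add: f_def)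
 qed
 have "sum f F = sum f {\<xi> \<in> F. \<sigma> \<xi> = \<xi>}"
 proof (rule sum_prime_order_action[OF Fp(1) _ _ p2])
  show "(\<sigma> ^^ 2) x = x" for x by (simp add: numeral_2_eq_2 sg_inv)
  show "(\<Sum>j<(2::nat). w) = 0" for w :: 'k by (rule char_sum_k[OF char2])
 qed (use sg_F f_inv in auto)
 also have "... = 0" by (intro sum.neutral) (use f_fix in auto)
 finally have "\<tau> (D (\<pi> b)) = 0"
  by (simp add: co D_props lin_props[OF tau(1)] f_def)
 then have "\<tau> (D b) = 0" using arg_cong[OF v0, of "%x. \<tau> (D x)"] by (simp add: D_props lin_props[OF tau(1)] tauDK)
 then show False using tau(3) by simp
qed

end

section \<open>The core of a stable algebra and its permuted idempotents\<close>

section \<open>The structure of commutative separable algebras in the stable category\<close>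

context salg
begin

text \<open>On the core the norm vanishes, that is \<open>E1 ^^ (Q - 1) = 0\<close>. As
  \<open>h ^^ r - 1\<close> is \<open>E1 ^^ r\<close>, the results for the subgroup of order
  \<open>p\<close>, or of order 4 when \<open>p = 2\<close>, say that a vector killed by a certain
  power of \<open>E1\<close> has its image under a lower power inside the image of a higher one.
  \<open>nilpotency_descent\<close> turns this into \<open>E1 ^^ r = 0\<close>.\<close>

lemma trivial_on_core:
 assumes sc: "separably_closed TYPE('k)" and p: "prime p" "CHAR('k) = p" and Q: "Q = r * p" "r = p ^ n"
  and pi: "eqv \<pi>" "!!x. \<pi> (\<pi> x) = \<pi> x" "!!x. (\<Sum>s<Q. (h ^^ s) (\<pi> x)) = 0"
 shows "(h ^^ r) (\<pi> x) = \<pi> x"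
proof -
 define E1 where "E1 = (%x. h x - x)"
 have E1_lin: "linV E1" unfolding E1_def by (rule eqv_lin[OF eqv_X])
 have E1_pi: "(E1 ^^ j) (\<pi> x) = \<pi> ((E1 ^^ j) x)" for j x
  by (induction j) (simp_all add: E1_def lin_props[OF eqv_lin[OF pi(1)]] eqv_h[OF pi(1)])
 have pow: "(E1 ^^ (p ^ j)) x = (h ^^ (p ^ j)) x - x" for j x
  unfolding E1_def by (rule funpow_minus_one_char[OF h_lin p])
 have top: "(E1 ^^ (Q - 1)) c = 0" if "c \<in> range \<pi>" for c
  using funpow_minus_one_char_sum[OF h_lin p, of "Suc n"] pi(3) Q that by (auto simp: E1_def mult.commute)
 have rpos: "r \<ge> 1" using Q prime_gt_0_nat[OF p(1)] by (simp add: Suc_leI)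
 have stepI: "\<exists>v\<in>range \<pi>. (E1 ^^ i) c = (E1 ^^ j) v" if "c \<in> range \<pi>" "(E1 ^^ i) c = (E1 ^^ j) v" for i j c v
 proof -
  have "\<pi> c = c" using that pi(2) by auto
  then have "(E1 ^^ i) c = (E1 ^^ j) (\<pi> v)" using that(2) E1_pi by metis
  then show ?thesis by blast
 qed
 have EA: "E1 c \<in> range \<pi>" if "c \<in> range \<pi>" for c
  using that E1_pi[of 1] by auto
 have "(E1 ^^ r) (\<pi> x) = 0"
 proof (cases "p = 2")
  case False
  then have p3: "p > 2" using prime_ge_2_nat[OF p(1)] by simp
  interpret k: salg d p "h ^^ r" "hi ^^ r" ee m u by (rule salg_power[OF Q(1)])
  interpret k: salg_p d p "h ^^ r" "hi ^^ r" ee m u p by unfold_locales (use p p3 in auto)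
  have kD: "(%x. (h ^^ r) x - x) = (E1 ^^ r)" using pow[of n] Q by auto
  have r2: "r * (p - 1) > r" using p3 rpos by simp
  have Qe: "r - 1 + r * (p - 1) = Q - 1"
   using Q(1) rpos p3 by (cases p) auto
  show ?thesis
  proof (rule nilpotency_descent[where A="range \<pi>" and e=r and f=r and e'="r * (p - 1)", OF _ EA _ _ rpos r2])
   fix c assume c: "c \<in> range \<pi>" "(E1 ^^ (r + r)) c = 0"
   have "(h ^^ r) ((h ^^ r) c - c) - ((h ^^ r) c - c) = 0"
    using c(2) fun_cong[OF kD] by (metis comp_apply funpow_add)
   from k.fixed_image_in_range_Tr[OF this] obtain v where "(h ^^ r) c - c = k.Tr v" by blast
   then have "(E1 ^^ r) c = (\<Sum>s<p ^ 1. ((h ^^ r) ^^ s) v)" using fun_cong[OF kD, of c] by (simp add: k.Tr_def)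
   also have "... = ((E1 ^^ r) ^^ (p ^ 1 - 1)) v"
    using funpow_minus_one_char_sum[OF H_lin[of r] p, of 1 v] kD by simp
   also have "... = (E1 ^^ (r * (p - 1))) v" by (simp add: funpow_mult mult.commute)
   finally show "\<exists>v\<in>range \<pi>. (E1 ^^ r) c = (E1 ^^ (r * (p - 1))) v" by (rule stepI[OF c(1)])
  qed (use top Qe lin_props[OF E1_lin] in auto)
 next
  case True
  show ?thesis
  proof (cases n)
   \<comment> \<open>For a group of order two the norm is \<open>E1\<close> itself.\<close>
   case 0
   then have "Q - 1 = r" using Q True by simp
   then show ?thesis using top[of "\<pi> x"] by auto
  next
   case (Suc n')
   define r' where "r' = p ^ n'"
   have r': "r = 2 * r'" "Q = r' * 4" "r' \<ge> 1" using Q Suc True by (auto simp: r'_def)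
   interpret k: salg d 4 "h ^^ r'" "hi ^^ r'" ee m u by (rule salg_power[OF r'(2)])
   interpret k: salg4 d 4 "h ^^ r'" "hi ^^ r'" ee m u by unfold_locales (use p True in auto)
   have kD: "k.D = (E1 ^^ r')" by (rule ext) (simp only: k.D_def pow[of n', folded r'_def] k.minus_V)
   have Qe: "r' - 1 + 3 * r' = Q - 1" using r' by simp
   have "(E1 ^^ (2 * r')) (\<pi> x) = 0"
   proof (rule nilpotency_descent[where A="range \<pi>" and e="2 * r'" and f=r' and e'="3 * r'", OF _ EA _ _ r'(3)])
    fix c assume c: "c \<in> range \<pi>" "(E1 ^^ (2 * r' + r')) c = 0"
    have 3: "(E1 ^^ (3 * r')) w = k.D (k.D (k.D w))" for w
     unfolding kD by (simp add: numeral_eq_Suc funpow_add add.assoc)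
    have 2: "(E1 ^^ (2 * r')) w = k.D (k.D w)" for w
     unfolding kD by (simp add: numeral_eq_Suc funpow_add)
    have "k.D (k.D (k.D c)) = 0" using c(2) 3[of c] by simp
    then obtain v where "k.D (k.D c) = k.D (k.D (k.D v))" using k.D2_divisible[OF sc] by blast
    then have "(E1 ^^ (2 * r')) c = (E1 ^^ (3 * r')) v" by (simp only: 2 3)
    then show "\<exists>v\<in>range \<pi>. (E1 ^^ (2 * r')) c = (E1 ^^ (3 * r')) v" by (rule stepI[OF c(1)])
   qed (use top Qe r' lin_props[OF E1_lin] in auto)
   then show ?thesis by (simp add: r')
  qed
 qed
 then show ?thesis using pow[of n "\<pi> x"] Q by simp
qed

text \<open>The interface to the module category: afterwards the algebra enters only through the
  projection and the permutation of \<open>F\<close>.\<close>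

theorem permuted_idempotents:
 assumes sc: "separably_closed TYPE('k)" and p: "prime p" "CHAR('k) = p" and Q: "Q = p ^ n"
 shows "\<exists>\<pi> F. eqv \<pi> \<and> (\<forall>x. \<pi> (\<pi> x) = \<pi> x \<and> cut d (\<pi> x) = \<pi> x \<and> \<pi> (cut d x) = \<pi> x) \<and>
  SZ1 (%x. cut d x - \<pi> x) \<and> finite F \<and> (\<forall>\<xi>\<in>F. \<xi> \<noteq> 0 \<and> \<pi> \<xi> = \<xi> \<and> h \<xi> \<in> F) \<and>
  (\<forall>\<xi>\<in>F. \<forall>\<xi>'\<in>F. \<pi> (m \<xi> \<xi>') = (if \<xi> = \<xi>' then \<xi> else 0)) \<and> (\<Sum>\<xi>\<in>F. \<xi>) = \<pi> u \<and>
  (\<forall>x. \<exists>c. \<pi> x = (\<Sum>\<xi>\<in>F. pm_scale (c \<xi>) \<xi>))"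
proof -
 obtain \<pi> where pi: "eqv \<pi>" "!!x. \<pi> (\<pi> x) = \<pi> x" "!!x. cut d (\<pi> x) = \<pi> x" "!!x. \<pi> (cut d x) = \<pi> x"
  "SZ1 (%x. cut d x - \<pi> x)" "!!x. (\<Sum>s<Q. (h ^^ s) (\<pi> x)) = 0"
  using strip_projective[OF p Q] by auto
 show ?thesis
 proof (cases n)
  \<comment> \<open>Over the trivial group every module is projective, so the core is zero and the
    family empty.\<close>
  case 0
  then have "\<pi> x = 0" for x using pi(6)[of x] Q by simp
  then show ?thesis using pi by (intro exI[of _ \<pi>] exI[of _ "{}"]) auto
 next
  case (Suc n')
  define r where "r = p ^ n'"
  have r: "Q = r * p" using Q Suc by (simp add: r_def)
  interpret s: salg_split d Q h hi ee m u \<pi> p r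
   by unfold_locales (use pi p r trivial_on_core[OF sc p r r_def pi(1,2,6)] in auto)
  interpret a: halg d ee \<pi> s.m0 s.u0 p by (rule s.halg)
  obtain F where F: "a.idem_family F" and span: "!!x. \<exists>c. \<pi> x = (\<Sum>\<xi>\<in>F. pm_scale (c \<xi>) \<xi>)"
   using a.split_idempotents[OF sc] by blast
  have hF: "h \<xi> \<in> F" if "\<xi> \<in> F" for \<xi>
  proof (rule a.automorphism_permutes[OF F span h_lin _ _ _ _ that])
   show "h (s.m0 x y) = s.m0 (h x) (h y)" for x y by (simp add: s.m0_def eqv_h[OF pi(1)] m_h)
   show "h (\<pi> x) = \<pi> (h x)" for x by (simp add: eqv_h[OF pi(1)])
   show "\<exists>x. h x = y" for y using h_hi by blast
   show "x = 0" if "h x = 0" for x using that by (metis hi_h hi_props(3))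
  qed
  have "\<pi> (m \<xi> \<xi>') = s.m0 \<xi> \<xi>'" if "\<xi> \<in> F" "\<xi>' \<in> F" for \<xi> \<xi>'
   using F that by (simp add: s.m0_def a.idem_family_def)
  moreover note F[unfolded a.idem_family_def, unfolded s.u0_def]
  ultimately show ?thesis using pi span hF
   by (intro exI[of _ \<pi>] exI[of _ F]) auto
 qed
qed

end

section \<open>Finite-dimensional modules in coordinates\<close>

section \<open>Modules and coordinates\<close>

abbreviation kmod :: "('k::field, 'a, 'y) module_scheme => bool" where
 "kmod M \<equiv> Module.module (ring_of_type_algebra :: 'k ring) M"

lemma ring_of_type_algebra_simps [simp]:
 "carrier (ring_of_type_algebra :: 'k::field ring) = UNIV"
 "monoid.mult (ring_of_type_algebra :: 'k ring) = (*)"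
 "one (ring_of_type_algebra :: 'k ring) = 1"
 "ring.zero (ring_of_type_algebra :: 'k ring) = 0"
 "add (ring_of_type_algebra :: 'k ring) = (+)"
 by (auto simp: ring_of_type_algebra_def)

lemma kmod_facts:
 fixes M :: "('k::field, 'a, 'y) module_scheme" (structure)
 assumes "kmod M"
 shows kmod_ag: "abelian_group M"
  and kmod_am: "abelian_monoid M"
  and kmod_add: "!!x y. x \<in> carrier M ==> y \<in> carrier M ==> x \<oplus> y \<in> carrier M"
  and kmod_zero: "\<zero> \<in> carrier M"
  and kmod_scale: "!!c x. x \<in> carrier M ==> c \<odot> x \<in> carrier M"
  and kmod_neg: "!!x. x \<in> carrier M ==> \<ominus> x \<in> carrier M"
  and kmod_ldistr: "!!a b x. x \<in> carrier M ==> (a + b) \<odot> x = a \<odot> x \<oplus> b \<odot> x"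
  and kmod_rdistr: "!!a x y. x \<in> carrier M ==> y \<in> carrier M ==> a \<odot> (x \<oplus> y) = a \<odot> x \<oplus> a \<odot> y"
  and kmod_assoc: "!!a b x. x \<in> carrier M ==> (a * b) \<odot> x = a \<odot> (b \<odot> x)"
  and kmod_one: "!!x. x \<in> carrier M ==> 1 \<odot> x = x"
  and kmod_zero_scale: "!!x. x \<in> carrier M ==> 0 \<odot> x = \<zero>"
  and kmod_scale_zero: "!!c. c \<odot> \<zero> = \<zero>"
  and kmod_neg_scale: "!!x. x \<in> carrier M ==> \<ominus> x = (-1) \<odot> x"
proof -
 interpret Module.module "ring_of_type_algebra :: 'k ring" M by fact
 show "abelian_group M" "abelian_monoid M" by (simp_all add: M.abelian_group_axioms M.abelian_monoid_axioms)
 show "!!x y. x \<in> carrier M ==> y \<in> carrier M ==> x \<oplus> y \<in> carrier M" "\<zero> \<in> carrier M"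
  "!!c x. x \<in> carrier M ==> c \<odot> x \<in> carrier M" "!!x. x \<in> carrier M ==> \<ominus> x \<in> carrier M"
  by simp_all
 show "!!a b x. x \<in> carrier M ==> (a + b) \<odot> x = a \<odot> x \<oplus> b \<odot> x" using smult_l_distr by simp
 show "!!a x y. x \<in> carrier M ==> y \<in> carrier M ==> a \<odot> (x \<oplus> y) = a \<odot> x \<oplus> a \<odot> y"
  using smult_r_distr by simp
 show "!!a b x. x \<in> carrier M ==> (a * b) \<odot> x = a \<odot> (b \<odot> x)" using smult_assoc1 by simp
 show one: "!!x. x \<in> carrier M ==> 1 \<odot> x = x" using smult_one by simp
 show z: "!!x. x \<in> carrier M ==> 0 \<odot> x = \<zero>" using smult_l_null by simp
 show "!!c. c \<odot> \<zero> = \<zero>" using smult_r_null by simp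
 show "\<ominus> x = (-1) \<odot> x" if "x \<in> carrier M" for x
 proof -
  have "(-1) \<odot> x \<oplus> x = ((-1) + 1) \<odot> x"
   using smult_l_distr[of "-1" 1 x] that one[OF that] by simp
  also have "... = \<zero>" using z that by simp
  finally show ?thesis using that by (intro M.minus_equality) simp_all
 qed
qed

lemma kmodI:
 fixes M :: "('k::field, 'a, 'y) module_scheme" (structure)
 assumes "!!x y. x \<in> carrier M ==> y \<in> carrier M ==> x \<oplus> y \<in> carrier M"
  and "\<zero> \<in> carrier M"
  and "!!x y z. x \<in> carrier M ==> y \<in> carrier M ==> z \<in> carrier M ==> (x \<oplus> y) \<oplus> z = x \<oplus> (y \<oplus> z)"
  and "!!x y. x \<in> carrier M ==> y \<in> carrier M ==> x \<oplus> y = y \<oplus> x"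
  and "!!x. x \<in> carrier M ==> \<zero> \<oplus> x = x"
  and "!!c x. x \<in> carrier M ==> c \<odot> x \<in> carrier M"
  and "!!a b x. x \<in> carrier M ==> (a + b) \<odot> x = a \<odot> x \<oplus> b \<odot> x"
  and "!!a x y. x \<in> carrier M ==> y \<in> carrier M ==> a \<odot> (x \<oplus> y) = a \<odot> x \<oplus> a \<odot> y"
  and "!!a b x. x \<in> carrier M ==> (a * b) \<odot> x = a \<odot> (b \<odot> x)"
  and "!!x. x \<in> carrier M ==> 1 \<odot> x = x"
  and "!!x. x \<in> carrier M ==> 0 \<odot> x = \<zero>"
 shows "kmod M"
proof (rule moduleI)
 show "cring (ring_of_type_algebra :: 'k ring)" by (rule cring_from_type_algebra)
 show "abelian_group M"
 proof (rule abelian_groupI)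
  fix x assume x: "x \<in> carrier M"
  have "(-1) \<odot> x \<oplus> x = ((-1) + 1) \<odot> x" using assms(7)[OF x, of "-1" 1] assms(10)[OF x] by simp
  then show "\<exists>y\<in>carrier M. y \<oplus> x = \<zero>" using assms(6)[OF x] assms(11)[OF x] by auto
 qed (use assms in auto)
qed (use assms in auto)

text \<open>Linearity over the field relative to carriers. Equivariance and extensionality are left
  out because the maps that are transferred are in general not equivariant.\<close>

definition klin :: "('k::field, 'a, 'y) module_scheme => ('k, 'b, 'z) module_scheme => ('a => 'b) => bool" where
 "klin M N f \<longleftrightarrow> (\<forall>x\<in>carrier M. f x \<in> carrier N) \<and>
   (\<forall>x\<in>carrier M. \<forall>y\<in>carrier M. f (x \<oplus>\<^bsub>M\<^esub> y) = f x \<oplus>\<^bsub>N\<^esub> f y) \<and>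
   (\<forall>c. \<forall>x\<in>carrier M. f (c \<odot>\<^bsub>M\<^esub> x) = c \<odot>\<^bsub>N\<^esub> f x)"

lemma klinI:
 assumes "!!x. x \<in> carrier M ==> f x \<in> carrier N"
  and "!!x y. x \<in> carrier M ==> y \<in> carrier M ==> f (x \<oplus>\<^bsub>M\<^esub> y) = f x \<oplus>\<^bsub>N\<^esub> f y"
  and "!!c x. x \<in> carrier M ==> f (c \<odot>\<^bsub>M\<^esub> x) = c \<odot>\<^bsub>N\<^esub> f x"
 shows "klin M N f"
 using assms unfolding klin_def by blast

lemma klinD:
 assumes "klin M N f"
 shows klin_closed: "!!x. x \<in> carrier M ==> f x \<in> carrier N"
  and klin_addD: "!!x y. x \<in> carrier M ==> y \<in> carrier M ==> f (x \<oplus>\<^bsub>M\<^esub> y) = f x \<oplus>\<^bsub>N\<^esub> f y"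
  and klin_scaleD: "!!c x. x \<in> carrier M ==> f (c \<odot>\<^bsub>M\<^esub> x) = c \<odot>\<^bsub>N\<^esub> f x"
 using assms unfolding klin_def by auto

lemma klin_cong:
 assumes "klin M N f" "kmod M" "!!x. x \<in> carrier M ==> g x = f x"
 shows "klin M N g"
 by (rule klinI) (use assms(3) klinD[OF assms(1)] kmod_add[OF assms(2)] kmod_scale[OF assms(2)] in auto)

lemma klin_zeroD:
 assumes "klin M N f" "kmod M" "kmod N"
 shows "f \<zero>\<^bsub>M\<^esub> = \<zero>\<^bsub>N\<^esub>"
 using klin_scaleD[OF assms(1) kmod_zero[OF assms(2)], of 0] klin_closed[OF assms(1) kmod_zero[OF assms(2)]]
  kmod_zero_scale[OF assms(2)] kmod_zero_scale[OF assms(3)] kmod_zero[OF assms(2)] by metis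

lemma klin_negD:
 assumes "klin M N f" "kmod M" "kmod N" "x \<in> carrier M"
 shows "f (\<ominus>\<^bsub>M\<^esub> x) = \<ominus>\<^bsub>N\<^esub> f x"
 by (simp add: kmod_neg_scale[OF assms(2,4)] kmod_neg_scale[OF assms(3) klin_closed[OF assms(1,4)]]
   klin_scaleD[OF assms(1,4)])

lemma klin_minusD:
 assumes "klin M N f" "kmod M" "kmod N" "x \<in> carrier M" "y \<in> carrier M"
 shows "f (x \<ominus>\<^bsub>M\<^esub> y) = f x \<ominus>\<^bsub>N\<^esub> f y"
 by (simp add: a_minus_def klin_addD[OF assms(1,4) kmod_neg[OF assms(2,5)]] klin_negD[OF assms(1-3,5)])

lemma klin_comp:
 assumes "klin M N f" "klin N P g" shows "klin M P (%x. g (f x))"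
 by (rule klinI) (auto simp: klinD[OF assms(1)] klinD[OF assms(2)])

lemma klin_ident: "klin M M (%x. x)" by (rule klinI) auto

lemma finsum_closed':
 assumes "kmod M" "!!i. i \<in> I ==> f i \<in> carrier M"
 shows "finsum M f I \<in> carrier M"
 by (rule abelian_monoid.finsum_closed[OF kmod_am[OF assms(1)]]) (use assms(2) in auto)

lemma finsum_cong_simple:
 assumes "kmod M" "!!i. i \<in> I ==> g i \<in> carrier M" "!!i. i \<in> I ==> f i = g i"
 shows "finsum M f I = finsum M g I"
 by (rule abelian_monoid.finsum_cong'[OF kmod_am[OF assms(1)]]) (use assms in auto)

lemma klin_finsumD:
 assumes "klin M N f" "kmod M" "kmod N" "finite I" "!!i. i \<in> I ==> x i \<in> carrier M"
 shows "f (finsum M x I) = finsum N (%i. f (x i)) I"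
 using assms(4,5)
proof (induction I rule: finite_induct)
 case empty
 then show ?case
  using klin_zeroD[OF assms(1-3)] abelian_monoid.finsum_empty[OF kmod_am[OF assms(2)]]
   abelian_monoid.finsum_empty[OF kmod_am[OF assms(3)]] by metis
next
 case (insert i I)
 have "f (finsum M x (insert i I)) = f (x i \<oplus>\<^bsub>M\<^esub> finsum M x I)"
  using insert abelian_monoid.finsum_insert[OF kmod_am[OF assms(2)], of I i x] by auto
 also have "... = f (x i) \<oplus>\<^bsub>N\<^esub> finsum N (%i. f (x i)) I"
  using insert klin_addD[OF assms(1)] finsum_closed'[OF assms(2), of I x] by auto
 also have "... = finsum N (%i. f (x i)) (insert i I)"
  using insert abelian_monoid.finsum_insert[OF kmod_am[OF assms(3)], of I i "%i. f (x i)"]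
   klin_closed[OF assms(1)] by auto
 finally show ?case .
qed

lemma klin_add_fun:
 assumes "klin M N f" "klin M N g" "kmod N"
 shows "klin M N (%x. f x \<oplus>\<^bsub>N\<^esub> g x)"
proof -
 interpret N: abelian_group N by (rule kmod_ag[OF assms(3)])
 show ?thesis
  by (rule klinI)
   (auto simp: klinD[OF assms(1)] klinD[OF assms(2)] kmod_add[OF assms(3)] kmod_rdistr[OF assms(3)] N.a_ac)
qed

lemma klin_scale_fun:
 assumes "klin M N f" "kmod N"
 shows "klin M N (%x. c \<odot>\<^bsub>N\<^esub> f x)"
 by (rule klinI)
  (auto simp: klinD[OF assms(1)] kmod_scale[OF assms(2)] kmod_rdistr[OF assms(2)]
   kmod_assoc[OF assms(2), symmetric] mult.commute)

lemma klin_zero_fun: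
 assumes "kmod N"
 shows "klin M N (%x. \<zero>\<^bsub>N\<^esub>)"
proof -
 interpret N: abelian_group N by (rule kmod_ag[OF assms])
 show ?thesis by (rule klinI) (simp_all add: kmod_scale_zero[OF assms])
qed

lemma klin_neg_fun:
 assumes "klin M N f" "kmod N" "kmod M"
 shows "klin M N (%x. \<ominus>\<^bsub>N\<^esub> f x)"
 by (rule klin_cong[OF klin_scale_fun[OF assms(1,2), of "-1"] assms(3)])
  (simp add: kmod_neg_scale[OF assms(2) klin_closed[OF assms(1)]])

lemma klin_finsum_fun:
 assumes "finite I" "!!i. i \<in> I ==> klin M N (f i)" "kmod N" "kmod M"
 shows "klin M N (%x. finsum N (%i. f i x) I)"
 using assms(1,2)
proof (induction I rule: finite_induct)
 case empty
 show ?case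
  unfolding abelian_monoid.finsum_empty[OF kmod_am[OF assms(3)]] by (rule klin_zero_fun[OF assms(3)])
next
 case (insert i I)
 show ?case
  by (rule klin_cong[OF klin_add_fun[where f = "f i" and g = "%x. finsum N (%i. f i x) I", OF _ _ assms(3)] assms(4)])
   (use insert in \<open>auto intro!: abelian_monoid.finsum_insert[OF kmod_am[OF assms(3)]] simp: klin_def\<close>)
qed

lemma kmod_type:
 fixes M :: "('k::field, 'a::ab_group_add, 'y) module_scheme"
 assumes "vector_space s" "module.subspace s (carrier M)"
  and "add M = (+)" "ring.zero M = 0" "module.smult M = s"
 shows "kmod M"
proof -
 interpret v: vector_space s by fact
 show ?thesis
  by (rule kmodI)
   (use assms v.subspace_add v.subspace_0 v.subspace_scale in
    \<open>auto simp: v.scale_left_distrib v.scale_right_distrib add.assoc add.commute\<close>)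
qed

lemma finsum_type:
 fixes M :: "('k::field, 'a::ab_group_add, 'y) module_scheme"
 assumes "kmod M" "add M = (+)" "ring.zero M = 0" "finite I" "!!i. i \<in> I ==> f i \<in> carrier M"
 shows "finsum M f I = (\<Sum>i\<in>I. f i)"
 using assms(4,5)
proof (induction I rule: finite_induct)
 case empty
 interpret M: abelian_group M by (rule kmod_ag[OF assms(1)])
 show ?case by (simp add: assms(3))
next
 case (insert i I)
 interpret M: abelian_group M by (rule kmod_ag[OF assms(1)])
 show ?case using insert by (subst M.finsum_insert) (auto simp: assms(2))
qed

lemma subspace_free_on: "module.subspace pm_scale (free_on S :: ('x \<Rightarrow>\<^sub>0 'k::field) set)"
 unfolding pm.subspace_def free_on_def
 by (auto simp: in_keys_iff subset_iff lookup_add, metis add_0)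

definition pmod :: "'x set => ('k::field, 'x \<Rightarrow>\<^sub>0 'k) module" where
 "pmod S = \<lparr>carrier = free_on S, monoid.mult = undefined, one = undefined,
   ring.zero = 0, add = (+), module.smult = pm_scale\<rparr>"

lemma pmod_simps [simp]:
 "carrier (pmod S) = free_on S" "add (pmod S) = (+)" "ring.zero (pmod S) = 0" "module.smult (pmod S) = pm_scale"
 by (simp_all add: pmod_def)

lemma kmod_pmod [simp]: "kmod (pmod S)"
 by (rule kmod_type[OF vs_pm]) (auto simp: subspace_free_on)

lemma free_on_UNIV [simp]: "free_on UNIV = UNIV"
 by (simp add: free_on_def)

text \<open>\<open>vec\<close> is defined on all vectors and ignores everything beyond the first
  \<open>d\<close> coordinates; this is why \<open>co\<close> after \<open>vec\<close> is
  \<open>cut d\<close> and not the identity.\<close>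

definition coords :: "('k::field, 'a, 'y) module_scheme => nat => ('a => 'k fvec) => ('k fvec => 'a) => bool"
 where "coords M d co vec \<longleftrightarrow> klin (pmod UNIV) M vec \<and> (\<forall>\<phi>. co (vec \<phi>) = cut d \<phi>) \<and> (\<forall>x\<in>carrier M. vec (co x) = x)"

lemma coordsD:
 assumes "coords M d co vec"
 shows coords_vec: "klin (pmod UNIV) M vec"
  and vec_closed: "!!\<phi>. vec \<phi> \<in> carrier M"
  and vec_add: "!!\<phi> \<psi>. vec (\<phi> + \<psi>) = vec \<phi> \<oplus>\<^bsub>M\<^esub> vec \<psi>"
  and vec_scale: "!!c \<phi>. vec (pm_scale c \<phi>) = c \<odot>\<^bsub>M\<^esub> vec \<phi>"
  and co_vec: "!!\<phi>. co (vec \<phi>) = cut d \<phi>"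
  and vec_co: "!!x. x \<in> carrier M ==> vec (co x) = x"
  and cut_co: "!!x. x \<in> carrier M ==> cut d (co x) = co x"
  and vec_cut: "!!\<phi>. vec (cut d \<phi>) = vec \<phi>"
proof -
 show 1: "klin (pmod UNIV) M vec" and 2: "!!\<phi>. co (vec \<phi>) = cut d \<phi>"
  and 3: "!!x. x \<in> carrier M ==> vec (co x) = x"
  using assms unfolding coords_def by auto
 show 4: "!!\<phi>. vec \<phi> \<in> carrier M" "!!\<phi> \<psi>. vec (\<phi> + \<psi>) = vec \<phi> \<oplus>\<^bsub>M\<^esub> vec \<psi>"
  "!!c \<phi>. vec (pm_scale c \<phi>) = c \<odot>\<^bsub>M\<^esub> vec \<phi>" using klinD[OF 1] by auto
 show "!!x. x \<in> carrier M ==> cut d (co x) = co x" using 2 3 by metis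
 show "!!\<phi>. vec (cut d \<phi>) = vec \<phi>" using 2 3 4(1) by metis
qed

lemma coords_co:
 assumes "coords M d co vec" "kmod M" shows "klin M (pmod UNIV) co"
proof (rule klinI)
 note c = coordsD[OF assms(1)]
 show "co (x \<oplus>\<^bsub>M\<^esub> y) = co x \<oplus>\<^bsub>pmod UNIV\<^esub> co y" if "x \<in> carrier M" "y \<in> carrier M" for x y
 proof -
  have "co (x \<oplus>\<^bsub>M\<^esub> y) = co (vec (co x + co y))" using that c by simp
  then show ?thesis using that by (simp add: c(5,7) lin_props[OF cut_lin])
 qed
 show "co (a \<odot>\<^bsub>M\<^esub> x) = a \<odot>\<^bsub>pmod UNIV\<^esub> co x" if "x \<in> carrier M" for a x
 proof -
  have "co (a \<odot>\<^bsub>M\<^esub> x) = co (vec (pm_scale a (co x)))" using that c by simp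
  then show ?thesis using that by (simp add: c(5,7) lin_props[OF cut_lin])
 qed
qed simp

lemma vec_expand:
 assumes "coords M d co vec" "kmod M"
 shows "vec \<phi> = (\<Oplus>\<^bsub>M\<^esub>i\<in>{..<d}. lookup \<phi> i \<odot>\<^bsub>M\<^esub> vec (pm_basis i))"
proof -
 note c = coordsD[OF assms(1)]
 have "cut d \<phi> = (\<Sum>i<d. pm_scale (lookup \<phi> i) (pm_basis i))"
  by (rule poly_mapping_eqI) (simp add: lookup_cut lookup_sum lookup_single when_def)
 then have "vec \<phi> = vec (finsum (pmod UNIV) (%i. pm_scale (lookup \<phi> i) (pm_basis i)) {..<d})"
  using c(8)[of \<phi>] finsum_type[OF kmod_pmod, of UNIV "{..<d}" "%i. pm_scale (lookup \<phi> i) (pm_basis i)"] by simp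
 then show ?thesis
  using klin_finsumD[OF c(1) kmod_pmod assms(2), of "{..<d}" "%i. pm_scale (lookup \<phi> i) (pm_basis i)"]
  by (simp add: c(4)[symmetric] del: pm_scale_single)
qed

definition spanned :: "('k::field, 'a, 'y) module_scheme => nat => ('k fvec => 'a) => bool" where
 "spanned M n vec \<longleftrightarrow> klin (pmod UNIV) M vec \<and> (\<forall>\<phi>. vec (cut n \<phi>) = vec \<phi>)"

lemma spanned_finite:
 assumes "kmod M" "finite T" "T \<subseteq> carrier M"
 shows "\<exists>n vec. spanned M n vec \<and> T \<subseteq> range vec"
 using assms(2,3)
proof (induction T rule: finite_induct)
 case empty
 show ?case
  by (rule exI[of _ 0], rule exI[of _ "%_. \<zero>\<^bsub>M\<^esub>"])
   (auto simp: spanned_def klin_zero_fun[OF assms(1)])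
next
 case (insert v T)
 interpret M: abelian_group M by (rule kmod_ag[OF assms(1)])
 obtain n vec where vec: "klin (pmod UNIV) M vec" "!!\<phi>. vec (cut n \<phi>) = vec \<phi>" "T \<subseteq> range vec"
  using insert by (auto simp: spanned_def)
 have v: "v \<in> carrier M" using insert by simp
 define vec' where "vec' \<phi> = vec (cut n \<phi>) \<oplus>\<^bsub>M\<^esub> lookup \<phi> n \<odot>\<^bsub>M\<^esub> v" for \<phi>
 have "klin (pmod UNIV) M (%\<phi>. lookup \<phi> n \<odot>\<^bsub>M\<^esub> v)"
  by (rule klinI) (simp_all add: kmod_scale[OF assms(1) v] lookup_add kmod_ldistr[OF assms(1) v] kmod_assoc[OF assms(1) v])
 then have k: "klin (pmod UNIV) M vec'"
  using klin_add_fun[OF vec(1) _ assms(1)] unfolding vec'_def vec(2) by blast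
 have c: "vec' (cut (Suc n) \<phi>) = vec' \<phi>" for \<phi>
 proof -
  have "cut n (cut (Suc n) \<phi>) = cut n \<phi>" by (rule poly_mapping_eqI) (auto simp: lookup_cut)
  then show ?thesis by (simp add: vec'_def lookup_cut)
 qed
 have "x \<in> range vec'" if "x \<in> T" for x
 proof -
  obtain \<phi> where "x = vec \<phi>" using vec(3) \<open>x \<in> T\<close> by blast
  then have "x = vec' (cut n \<phi>)"
   using klin_closed[OF vec(1)] by (simp add: vec'_def vec(2) lookup_cut kmod_zero_scale[OF assms(1) v])
  then show ?thesis by blast
 qed
 moreover have "v = vec' (pm_basis n)"
 proof -
  have "cut n (pm_basis n) = (0 :: nat \<Rightarrow>\<^sub>0 'a)" by (rule poly_mapping_eqI) (auto simp: lookup_cut lookup_single when_def)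
  then show ?thesis using klin_zeroD[OF vec(1) kmod_pmod assms(1)] v
   by (simp add: vec'_def kmod_one[OF assms(1)])
 qed
 ultimately have "insert v T \<subseteq> range vec'" by blast
 with k c show ?case by (auto simp: spanned_def)
qed

text \<open>Takes the least number of coordinates that still spans. A nonzero relation would allow
  one more coordinate to be eliminated, so at the minimum \<open>vec\<close> is injective on the
  first \<open>n\<close> coordinates.\<close>

lemma spanned_coords:
 assumes "kmod M" "spanned M n0 vec0" "carrier M \<subseteq> range vec0"
 shows "\<exists>d co vec. coords M d co vec"
proof -
 define P where "P n \<longleftrightarrow> (\<exists>vec. spanned M n vec \<and> carrier M \<subseteq> range vec)" for n
 define n where "n = (LEAST n. P n)"
 have "P n0" using assms unfolding P_def by blast
 then have "P n" unfolding n_def by (rule LeastI)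
 have least: "\<not> P k" if "k < n" for k using that not_less_Least unfolding n_def by blast
 obtain vec where vec: "klin (pmod UNIV) M vec" "!!\<phi>. vec (cut n \<phi>) = vec \<phi>" "carrier M \<subseteq> range vec"
  using \<open>P n\<close> unfolding P_def spanned_def by blast
 interpret M: abelian_group M by (rule kmod_ag[OF assms(1)])
 have va: "vec (\<phi> + \<psi>) = vec \<phi> \<oplus>\<^bsub>M\<^esub> vec \<psi>" "vec (pm_scale c \<phi>) = c \<odot>\<^bsub>M\<^esub> vec \<phi>" "vec \<phi> \<in> carrier M" for \<phi> \<psi> c
  using klinD[OF vec(1)] by auto
 have inj: "cut n \<phi> = 0" if z: "vec \<phi> = \<zero>\<^bsub>M\<^esub>" for \<phi>
 proof (rule ccontr)
  assume "cut n \<phi> \<noteq> 0"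
  then obtain j where "lookup (cut n \<phi>) j \<noteq> 0" by (metis poly_mapping_eqI lookup_zero)
  then have j: "j < n" "lookup \<phi> j \<noteq> 0" by (auto simp: lookup_cut split: if_splits)
  \<comment> \<open>\<open>A\<close> moves coordinate \<open>j\<close> into the last slot. Once a
    multiple of the relation \<open>\<phi>\<close> has cleared coordinate \<open>j\<close>, the
    remaining \<open>n - 1\<close> coordinates reach every vector.\<close>
  define A :: "(nat \<Rightarrow>\<^sub>0 'a) => (nat \<Rightarrow>\<^sub>0 'a)" where
   "A \<psi> = cut (n - 1) \<psi> + pm_scale (lookup (cut (n - 1) \<psi>) j) (pm_basis (n - 1) - pm_basis j)" for \<psi>
  have lA: "linV A" unfolding A_def
   by (intro lin_add lin_scale_left lin_comp[OF cut_lin lin_lookup] cut_lin vs_pm)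
  have "klin (pmod UNIV) M (%\<psi>. vec (A \<psi>))"
   by (rule klinI) (simp_all add: va lin_props[OF lA])
  then have s: "spanned M (n - 1) (%\<psi>. vec (A \<psi>))" by (simp add: spanned_def A_def)
  have "x \<in> range (%\<psi>. vec (A \<psi>))" if "x \<in> carrier M" for x
  proof -
   obtain \<psi> where x: "x = vec \<psi>" using vec(3) \<open>x \<in> carrier M\<close> by blast
   define c where "c = - lookup \<psi> j / lookup \<phi> j"
   define \<psi>1 where "\<psi>1 = cut n (\<psi> + pm_scale c \<phi>)"
   have x1: "x = vec \<psi>1" by (simp add: \<psi>1_def vec(2) va z x kmod_scale_zero[OF assms(1)])
   have l1: "lookup \<psi>1 j = 0" using j by (simp add: \<psi>1_def lookup_cut lookup_add lookup_minus c_def)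
   have l2: "lookup \<psi>1 i = 0" if "i \<ge> n" for i using that by (simp add: \<psi>1_def lookup_cut)
   have "\<psi>1 = A (\<psi>1 - pm_scale (lookup \<psi>1 (n - 1)) (pm_basis (n - 1) - pm_basis j))"
   proof (rule poly_mapping_eqI)
    fix i
    show "lookup \<psi>1 i = lookup (A (\<psi>1 - pm_scale (lookup \<psi>1 (n - 1)) (pm_basis (n - 1) - pm_basis j))) i"
     using l1 l2 j(1)
     by (cases "j = n - 1"; cases "i = j"; cases "i = n - 1")
       (auto simp: A_def lookup_add lookup_cut lookup_minus lookup_single when_def)
   qed
   then show ?thesis using x1 by (metis rangeI)
  qed
  then have "P (n - 1)" using s unfolding P_def by blast
  then show False using least[of "n - 1"] j(1) by simp
 qed
 have inj2: "cut n \<phi> = cut n \<psi>" if "vec \<phi> = vec \<psi>" for \<phi> \<psi>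
 proof -
  have "vec (\<phi> - \<psi>) = \<zero>\<^bsub>M\<^esub>"
   using M.add.r_cancel_one'[OF va(3) va(3), of \<psi> "\<phi> - \<psi>"] va(1)[of "\<phi> - \<psi>" \<psi>] that by simp
  then have "cut n (\<phi> - \<psi>) = 0" by (rule inj)
  then show ?thesis by (simp add: lin_props[OF cut_lin])
 qed
 define co where "co x = cut n (SOME \<phi>. vec \<phi> = x)" for x
 have s: "vec (SOME \<phi>. vec \<phi> = x) = x" if "x \<in> carrier M" for x
  using vec(3) that by (intro someI_ex[of "%\<phi>. vec \<phi> = x"]) auto
 have "coords M n co vec"
  unfolding coords_def
 proof (intro conjI allI ballI)
  show "co (vec \<phi>) = cut n \<phi>" for \<phi> unfolding co_def by (rule inj2[OF s[OF va(3)]])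
  show "vec (co x) = x" if "x \<in> carrier M" for x unfolding co_def vec(2) by (rule s[OF that])
 qed (rule vec(1))
 then show ?thesis by blast
qed

lemma kG_moduleD:
 assumes "kG_module G M"
 shows "group G" "kmod M"
  and act_closed: "!!g x. g \<in> carrier G ==> x \<in> carrier M ==> act M g x \<in> carrier M"
  and act_add: "!!g x y. g \<in> carrier G ==> x \<in> carrier M ==> y \<in> carrier M ==> act M g (x \<oplus>\<^bsub>M\<^esub> y) = act M g x \<oplus>\<^bsub>M\<^esub> act M g y"
  and act_scale: "!!g c x. g \<in> carrier G ==> x \<in> carrier M ==> act M g (c \<odot>\<^bsub>M\<^esub> x) = c \<odot>\<^bsub>M\<^esub> act M g x"
  and act_one: "!!x. x \<in> carrier M ==> act M \<one>\<^bsub>G\<^esub> x = x"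
  and act_mult: "!!g h x. g \<in> carrier G ==> h \<in> carrier G ==> x \<in> carrier M ==> act M (g \<otimes>\<^bsub>G\<^esub> h) x = act M g (act M h x)"
 using assms unfolding kG_module_def by auto

lemma klin_act: "kG_module G M ==> g \<in> carrier G ==> klin M M (act M g)"
 by (rule klinI) (auto simp: kG_moduleD)

lemma act_inv_act:
 assumes "kG_module G M" "g \<in> carrier G" "x \<in> carrier M"
 shows "act M (inv\<^bsub>G\<^esub> g) (act M g x) = x" "act M g (act M (inv\<^bsub>G\<^esub> g) x) = x"
proof -
 interpret group G by (rule kG_moduleD[OF assms(1)])
 note k = kG_moduleD[OF assms(1)]
 show "act M (inv\<^bsub>G\<^esub> g) (act M g x) = x" "act M g (act M (inv\<^bsub>G\<^esub> g) x) = x"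
  using k(7)[of "inv\<^bsub>G\<^esub> g" g x] k(7)[of g "inv\<^bsub>G\<^esub> g" x] k(6)[of x] assms by simp_all
qed

lemma kG_submoduleI:
 assumes "kG_module G M" "N \<subseteq> carrier M" "\<zero>\<^bsub>M\<^esub> \<in> N"
  and "!!x y. x \<in> N ==> y \<in> N ==> x \<oplus>\<^bsub>M\<^esub> y \<in> N"
  and "!!c x. x \<in> N ==> c \<odot>\<^bsub>M\<^esub> x \<in> N"
  and "!!g x. g \<in> carrier G ==> x \<in> N ==> act M g x \<in> N"
 shows "kG_submodule G N M"
 unfolding kG_submodule_def
proof
 have k: "kmod M" by (rule kG_moduleD[OF assms(1)])
 have "\<ominus>\<^bsub>M\<^esub> x \<in> N" if "x \<in> N" for x
  using assms(5)[OF that, of "-1"] kmod_neg_scale[OF k, of x] that assms(2) by auto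
 then show "submodule N ring_of_type_algebra M"
  using assms by (intro module.submoduleI[OF k]) auto
qed (use assms in auto)

text \<open>As the group is finite, the translates of finitely many generators span over the field:
  the vectors all of whose translates lie in that span form a submodule containing the
  generators.\<close>

lemma fg_coords:
 assumes "fg_kG_module G M" "finite (carrier G)"
 shows "\<exists>d co vec. coords M d co vec"
proof -
 have kg: "kG_module G M" using assms by (simp add: fg_kG_module_def)
 note k = kG_moduleD[OF kg]
 interpret M: abelian_group M by (rule kmod_ag[OF k(2)])
 obtain S where S: "finite S" "S \<subseteq> carrier M" "!!N. kG_submodule G N M ==> S \<subseteq> N ==> N = carrier M"
  using assms(1) unfolding fg_kG_module_def by blast
 have "finite ((%(g, x). act M g x) ` (carrier G \<times> S))" "(%(g, x). act M g x) ` (carrier G \<times> S) \<subseteq> carrier M"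
  using S assms(2) k(3) by auto
 from spanned_finite[OF k(2) this] obtain n vec where
  sp: "spanned M n vec" and T: "(%(g, x). act M g x) ` (carrier G \<times> S) \<subseteq> range vec" by blast
 have vl: "klin (pmod UNIV) M vec" using sp by (simp add: spanned_def)
 define N where "N = {x \<in> carrier M. \<forall>g\<in>carrier G. act M g x \<in> range vec}"
 have r: "x \<oplus>\<^bsub>M\<^esub> y \<in> range vec" if "x \<in> range vec" "y \<in> range vec" for x y
  using that klinD[OF vl] by (auto, metis rangeI)
 have r2: "c \<odot>\<^bsub>M\<^esub> x \<in> range vec" if "x \<in> range vec" for x c
  using that klinD[OF vl] by (auto, metis rangeI)
 have z: "\<zero>\<^bsub>M\<^esub> \<in> range vec" using klin_zeroD[OF vl kmod_pmod k(2)] by (metis rangeI)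
 have "kG_submodule G N M"
 proof (rule kG_submoduleI[OF kg])
  show "\<zero>\<^bsub>M\<^esub> \<in> N" using z klin_zeroD[OF klin_act[OF kg] k(2) k(2)] by (auto simp: N_def)
  show "x \<oplus>\<^bsub>M\<^esub> y \<in> N" if "x \<in> N" "y \<in> N" for x y using that r by (auto simp: N_def k)
  show "c \<odot>\<^bsub>M\<^esub> x \<in> N" if "x \<in> N" for x c using that r2 by (auto simp: N_def k kmod_scale[OF k(2)])
  show "act M g x \<in> N" if "g \<in> carrier G" "x \<in> N" for g x
   using that group.is_monoid[OF k(1)] by (auto simp: N_def k(3) k(7)[symmetric] monoid.m_closed)
 qed (auto simp: N_def)
 moreover have "S \<subseteq> N" using S(2) T by (auto simp: N_def)
 ultimately have "N = carrier M" by (rule S(3))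
 have "carrier M \<subseteq> range vec"
 proof
  fix x assume "x \<in> carrier M"
  then have "x \<in> N" using \<open>N = carrier M\<close> by simp
  then show "x \<in> range vec"
   using k(6) monoid.one_closed[OF group.is_monoid[OF k(1)]] unfolding N_def by (metis (lifting) mem_Collect_eq)
 qed
 then show ?thesis using spanned_coords[OF k(2) sp] by blast
qed

lemma coords_fg:
 assumes "kG_module G M" "coords M d co vec"
 shows "fg_kG_module G M"
 unfolding fg_kG_module_def
proof (intro conjI exI)
 show "kG_module G M" by fact
 note k = kG_moduleD[OF assms(1)]
 show "finite ((%i. vec (pm_basis i)) ` {..<d})" by simp
 show "(%i. vec (pm_basis i)) ` {..<d} \<subseteq> carrier M" using vec_closed[OF assms(2)] by auto
 interpret M: abelian_group M by (rule kmod_ag[OF k(2)])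
 show "\<forall>N. kG_submodule G N M \<and> (%i. vec (pm_basis i)) ` {..<d} \<subseteq> N \<longrightarrow> N = carrier M"
 proof (intro allI impI, elim conjE)
  fix N assume N: "kG_submodule G N M" "(%i. vec (pm_basis i)) ` {..<d} \<subseteq> N"
  have s: "submodule N ring_of_type_algebra M" using N by (simp add: kG_submodule_def)
  note e = module.submoduleE[OF k(2) s]
  obtain y where y: "y \<in> N" "y \<in> carrier M" using e(1,2) by auto
  have z: "\<zero>\<^bsub>M\<^esub> \<in> N" using e(4)[of 0 y] kmod_zero_scale[OF k(2) y(2)] y(1) by simp
  have fs: "finsum M f I \<in> N" if "finite I" "!!i. i \<in> I ==> f i \<in> N" for f and I :: "nat set"
   using that
  proof (induction I rule: finite_induct)
   case empty then show ?case using z by simp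
  next
   case (insert i I)
   then have "finsum M f (insert i I) = f i \<oplus>\<^bsub>M\<^esub> finsum M f I"
    using e(1) by (intro M.finsum_insert) auto
   then show ?case using insert e(5) by simp
  qed
  have "x \<in> N" if "x \<in> carrier M" for x
  proof -
   have "(\<Oplus>\<^bsub>M\<^esub>i\<in>{..<d}. lookup (co x) i \<odot>\<^bsub>M\<^esub> vec (pm_basis i)) \<in> N"
    using N(2) by (intro fs e(4)) auto
   then show ?thesis using vec_expand[OF assms(2) k(2), of "co x"] vec_co[OF assms(2) that] by simp
  qed
  then show "N = carrier M" using e(1) by auto
 qed
qed

section \<open>The universal property of the tensor product\<close>

section \<open>Tensor products\<close>

definition kbil :: "('k::field, 'a, 'y) module_scheme => ('k, 'b, 'z) module_scheme => ('k, 'c, 'w) module_scheme => ('a => 'b => 'c) => bool" where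
 "kbil M N P b \<longleftrightarrow> (\<forall>y\<in>carrier N. klin M P (%x. b x y)) \<and> (\<forall>x\<in>carrier M. klin N P (b x))"

lemma kbilI:
 assumes "!!y. y \<in> carrier N ==> klin M P (%x. b x y)" "!!x. x \<in> carrier M ==> klin N P (b x)"
 shows "kbil M N P b"
 using assms by (simp add: kbil_def)

lemma kbilD:
 assumes "kbil M N P b"
 shows "!!y. y \<in> carrier N ==> klin M P (%x. b x y)" "!!x. x \<in> carrier M ==> klin N P (b x)"
  and kbil_closed: "!!x y. x \<in> carrier M ==> y \<in> carrier N ==> b x y \<in> carrier P"
 using assms by (auto simp: kbil_def klin_def)

lemma kbil_comp:
 assumes "kbil M' N' P b" "klin M M' f" "klin N N' g" "klin P Q h"
 shows "kbil M N Q (%x y. h (b (f x) (g y)))"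
proof (rule kbilI)
 show "klin M Q (%x. h (b (f x) (g y)))" if "y \<in> carrier N" for y
  using klin_comp[OF klin_comp[OF assms(2) kbilD(1)[OF assms(1) klin_closed[OF assms(3) that]]] assms(4)] .
 show "klin N Q (%y. h (b (f x) (g y)))" if "x \<in> carrier M" for x
  using klin_comp[OF klin_comp[OF assms(3) kbilD(2)[OF assms(1) klin_closed[OF assms(2) that]]] assms(4)] .
qed

lemma kbil_swap: "kbil M N P b ==> kbil N M P (%y x. b x y)"
 by (auto simp: kbil_def)

locale tens =
 fixes M :: "('k::field, 'a, 'y) module_scheme" and N :: "('k, 'b, 'z) module_scheme"
 assumes kM: "kmod M" and kN: "kmod N"
begin

definition F :: "('a \<times> 'b \<Rightarrow>\<^sub>0 'k) set" where "F = free_on (carrier M \<times> carrier N)"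
definition cl :: "('a \<times> 'b \<Rightarrow>\<^sub>0 'k) => ('a \<times> 'b \<Rightarrow>\<^sub>0 'k) set" where "cl \<phi> = tensor_rel M N `` {\<phi>}"
abbreviation BR where "BR \<equiv> bilinear_relations M N"

lemma F_subspace: "pm.subspace F" unfolding F_def by (rule subspace_free_on)
lemmas F_add = pm.subspace_add[OF F_subspace]
lemmas F_diff = pm.subspace_diff[OF F_subspace]
lemmas F_scale = pm.subspace_scale[OF F_subspace]
lemmas F_0 = pm.subspace_0[OF F_subspace]
lemma F_single: "x \<in> carrier M ==> y \<in> carrier N ==> single (x, y) c \<in> F"
 by (auto simp: F_def free_on_def)

lemma BR_subspace: "pm.subspace BR"
 by (rule pm.subspaceI) (auto intro: bilinear_relations.intros)
lemmas BR_add = pm.subspace_add[OF BR_subspace]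
lemmas BR_scale = pm.subspace_scale[OF BR_subspace]
lemmas BR_neg = pm.subspace_neg[OF BR_subspace]
lemmas BR_0 = pm.subspace_0[OF BR_subspace]

lemma equiv_rel: "equiv F (tensor_rel M N)"
proof (rule equivI)
 show "tensor_rel M N \<subseteq> F \<times> F" by (auto simp: tensor_rel_def F_def)
 show "refl_on F (tensor_rel M N)" by (rule refl_onI) (auto simp: tensor_rel_def F_def BR_0)
 show "sym (tensor_rel M N)"
 proof (rule symI)
  fix \<phi> \<psi> assume "(\<phi>, \<psi>) \<in> tensor_rel M N"
  then show "(\<psi>, \<phi>) \<in> tensor_rel M N" using BR_neg[of "\<phi> - \<psi>"] by (auto simp: tensor_rel_def)
 qed
 show "trans (tensor_rel M N)"
 proof (rule transI)
  fix \<phi> \<psi> \<chi> assume "(\<phi>, \<psi>) \<in> tensor_rel M N" "(\<psi>, \<chi>) \<in> tensor_rel M N"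
  then show "(\<phi>, \<chi>) \<in> tensor_rel M N" using BR_add[of "\<phi> - \<psi>" "\<psi> - \<chi>"] by (auto simp: tensor_rel_def)
 qed
qed

lemma cl_eq: "\<phi> \<in> F ==> \<psi> \<in> F ==> cl \<phi> = cl \<psi> \<longleftrightarrow> \<phi> - \<psi> \<in> BR"
 unfolding cl_def using eq_equiv_class_iff[OF equiv_rel, of \<phi> \<psi>] by (auto simp: tensor_rel_def F_def)

lemma mem_cl: "\<psi> \<in> cl \<phi> \<longleftrightarrow> \<phi> \<in> F \<and> \<psi> \<in> F \<and> \<phi> - \<psi> \<in> BR"
 by (auto simp: cl_def tensor_rel_def F_def)

lemma self_cl: "\<phi> \<in> F ==> \<phi> \<in> cl \<phi>" by (simp add: mem_cl BR_0)

abbreviation T where "T \<equiv> tensor_module M N"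

lemma carrier_T: "carrier T = cl ` F"
 by (auto simp: tensor_module_def quotient_def cl_def F_def)

lemma T_zero: "\<zero>\<^bsub>T\<^esub> = cl 0" by (simp add: tensor_module_def cl_def)

lemma T_add: assumes "\<phi> \<in> F" "\<psi> \<in> F" shows "cl \<phi> \<oplus>\<^bsub>T\<^esub> cl \<psi> = cl (\<phi> + \<psi>)"
proof -
 have "cl (\<phi>' + \<psi>') = cl (\<phi> + \<psi>)" if "\<phi>' \<in> cl \<phi>" "\<psi>' \<in> cl \<psi>" for \<phi>' \<psi>'
 proof -
  have "(\<phi> + \<psi>) - (\<phi>' + \<psi>') = (\<phi> - \<phi>') + (\<psi> - \<psi>')" by (simp add: algebra_simps)
  then have "(\<phi> + \<psi>) - (\<phi>' + \<psi>') \<in> BR" using that BR_add[of "\<phi> - \<phi>'" "\<psi> - \<psi>'"] by (simp only: mem_cl)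
  then show ?thesis using that assms cl_eq[of "\<phi> + \<psi>" "\<phi>' + \<psi>'"] F_add by (simp add: mem_cl)
 qed
 then have "(\<Union>\<phi>'\<in>cl \<phi>. \<Union>\<psi>'\<in>cl \<psi>. cl (\<phi>' + \<psi>')) = cl (\<phi> + \<psi>)"
  using self_cl[OF assms(1)] self_cl[OF assms(2)] by blast
 then show ?thesis by (simp add: tensor_module_def cl_def)
qed

lemma T_scale: assumes "\<phi> \<in> F" shows "c \<odot>\<^bsub>T\<^esub> cl \<phi> = cl (pm_scale c \<phi>)"
proof -
 have "cl (pm_scale c \<phi>') = cl (pm_scale c \<phi>)" if "\<phi>' \<in> cl \<phi>" for \<phi>'
 proof -
  have "pm_scale c \<phi> - pm_scale c \<phi>' \<in> BR"
   using that BR_scale[of "\<phi> - \<phi>'" c] by (simp add: mem_cl pm.scale_right_diff_distrib)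
  then show ?thesis using that assms cl_eq[of "pm_scale c \<phi>" "pm_scale c \<phi>'"] F_scale by (simp add: mem_cl)
 qed
 then have "(\<Union>\<phi>'\<in>cl \<phi>. cl (pm_scale c \<phi>')) = cl (pm_scale c \<phi>)"
  using self_cl[OF assms] by blast
 then show ?thesis by (simp add: tensor_module_def cl_def)
qed

lemma kmod_T: "kmod T"
 by (rule kmodI)
  (auto simp: carrier_T T_zero T_add T_scale F_0 F_add F_scale pm.scale_left_distrib pm.scale_right_distrib
   add_ac)

lemma pure_cl: "pure_tensor M N x y = cl (pm_basis (x, y))" by (simp add: pure_tensor_def cl_def)

lemma pure_closed: "x \<in> carrier M ==> y \<in> carrier N ==> pure_tensor M N x y \<in> carrier T"
 by (simp add: pure_cl carrier_T F_single)

lemma cl_BR: "\<phi> \<in> F ==> \<psi> \<in> F ==> \<phi> - \<psi> \<in> BR ==> cl \<phi> = cl \<psi>" by (simp add: cl_eq)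

lemma pure_kbil: "kbil M N T (pure_tensor M N)"
proof (rule kbilI)
 fix y assume y: "y \<in> carrier N"
 show "klin M T (%x. pure_tensor M N x y)"
 proof (rule klinI)
  fix x assume x: "x \<in> carrier M"
  show "pure_tensor M N x y \<in> carrier T" using x y by (rule pure_closed)
  show "pure_tensor M N (c \<odot>\<^bsub>M\<^esub> x) y = c \<odot>\<^bsub>T\<^esub> pure_tensor M N x y" for c
   unfolding pure_cl T_scale[OF F_single[OF x y]]
   by (rule cl_BR) (auto intro: F_single F_scale bilinear_relations.intros x y kmod_scale[OF kM] simp del: pm_scale_single)
  fix x' assume x': "x' \<in> carrier M"
  have "pm_basis (x \<oplus>\<^bsub>M\<^esub> x', y) - (pm_basis (x, y) + pm_basis (x', y)) \<in> BR"
   using bilinear_relations.add_left[OF x x' y] by (simp add: algebra_simps)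
  then show "pure_tensor M N (x \<oplus>\<^bsub>M\<^esub> x') y = pure_tensor M N x y \<oplus>\<^bsub>T\<^esub> pure_tensor M N x' y"
   unfolding pure_cl T_add[OF F_single[OF x y] F_single[OF x' y]]
   by (intro cl_BR F_single F_add x x' y kmod_add[OF kM])
 qed
next
 fix x assume x: "x \<in> carrier M"
 show "klin N T (pure_tensor M N x)"
 proof (rule klinI)
  fix y assume y: "y \<in> carrier N"
  show "pure_tensor M N x y \<in> carrier T" using x y by (rule pure_closed)
  show "pure_tensor M N x (c \<odot>\<^bsub>N\<^esub> y) = c \<odot>\<^bsub>T\<^esub> pure_tensor M N x y" for c
   unfolding pure_cl T_scale[OF F_single[OF x y]]
   by (rule cl_BR) (auto intro: F_single F_scale bilinear_relations.intros x y kmod_scale[OF kN] simp del: pm_scale_single)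
  fix y' assume y': "y' \<in> carrier N"
  have "pm_basis (x, y \<oplus>\<^bsub>N\<^esub> y') - (pm_basis (x, y) + pm_basis (x, y')) \<in> BR"
   using bilinear_relations.add_right[OF x y y'] by (simp add: algebra_simps)
  then show "pure_tensor M N x (y \<oplus>\<^bsub>N\<^esub> y') = pure_tensor M N x y \<oplus>\<^bsub>T\<^esub> pure_tensor M N x y'"
   unfolding pure_cl T_add[OF F_single[OF x y] F_single[OF x y']]
   by (intro cl_BR F_single F_add x y y' kmod_add[OF kN])
 qed
qed

lemma tensor_induct [consumes 1, case_names pure add scale]:
 assumes "t \<in> carrier T"
  and pure: "!!x y. x \<in> carrier M ==> y \<in> carrier N ==> P (pure_tensor M N x y)"
  and add: "!!s t. s \<in> carrier T ==> t \<in> carrier T ==> P s ==> P t ==> P (s \<oplus>\<^bsub>T\<^esub> t)"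
  and scale: "!!c t. t \<in> carrier T ==> P t ==> P (c \<odot>\<^bsub>T\<^esub> t)"
 shows "P t"
proof -
 obtain \<phi> where \<phi>: "\<phi> \<in> F" "t = cl \<phi>" using assms(1) by (auto simp: carrier_T)
 have "(\<Sum>z\<in>K. single z (lookup \<phi> z)) \<in> F \<and> P (cl (\<Sum>z\<in>K. single z (lookup \<phi> z)))"
  if "finite K" "K \<subseteq> carrier M \<times> carrier N" for K
  using that
 proof (induction K rule: finite_induct)
  case empty
  have "P (0 \<odot>\<^bsub>T\<^esub> pure_tensor M N \<zero>\<^bsub>M\<^esub> \<zero>\<^bsub>N\<^esub>)"
   by (intro scale pure pure_closed kmod_zero[OF kM] kmod_zero[OF kN])
  then show ?case
   using kmod_zero_scale[OF kmod_T pure_closed[OF kmod_zero[OF kM] kmod_zero[OF kN]]] by (simp add: T_zero F_0)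
 next
  case (insert z K)
  obtain x y where z: "z = (x, y)" "x \<in> carrier M" "y \<in> carrier N" using insert by auto
  have "cl (single z (lookup \<phi> z)) = lookup \<phi> z \<odot>\<^bsub>T\<^esub> pure_tensor M N x y"
   using z by (simp add: pure_cl T_scale F_single)
  then have 1: "P (cl (single z (lookup \<phi> z)))" using z by (simp add: scale pure pure_closed)
  have 2: "single z (lookup \<phi> z) \<in> F" using z by (simp add: F_single)
  have 3: "(\<Sum>z\<in>K. single z (lookup \<phi> z)) \<in> F" "P (cl (\<Sum>z\<in>K. single z (lookup \<phi> z)))"
   using insert by auto
  show ?case
   using add[of "cl (single z (lookup \<phi> z))" "cl (\<Sum>z\<in>K. single z (lookup \<phi> z))"] 1 2 3 insert
   by (simp add: T_add carrier_T F_add)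
 qed
 moreover have "(\<Sum>z\<in>keys \<phi>. single z (lookup \<phi> z)) = \<phi>"
  by (rule poly_mapping_eqI) (simp add: lookup_sum lookup_single when_def in_keys_iff)
 ultimately show ?thesis
  using \<phi> by (metis (no_types, lifting) F_def free_on_def finite_keys mem_Collect_eq)
qed

text \<open>The linear extension of \<open>b\<close> to the free module, whose common value on a
  class is what \<open>tensor_lift\<close> selects.\<close>

definition ev :: "('k, 'c, 'w) module_scheme => ('a => 'b => 'c) => ('a \<times> 'b \<Rightarrow>\<^sub>0 'k) => 'c" where
 "ev P b \<phi> = (\<Oplus>\<^bsub>P\<^esub>z\<in>keys \<phi>. lookup \<phi> z \<odot>\<^bsub>P\<^esub> b (fst z) (snd z))"

context
 fixes P :: "('k, 'c, 'w) module_scheme" and b :: "'a => 'b => 'c"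
 assumes kP: "kmod P" and b: "kbil M N P b"
begin

lemma b_closed: "z \<in> carrier M \<times> carrier N ==> b (fst z) (snd z) \<in> carrier P"
 using kbil_closed[OF b] by auto

lemma ev_superset:
 assumes "finite K" "keys \<phi> \<subseteq> K" "K \<subseteq> carrier M \<times> carrier N"
 shows "ev P b \<phi> = (\<Oplus>\<^bsub>P\<^esub>z\<in>K. lookup \<phi> z \<odot>\<^bsub>P\<^esub> b (fst z) (snd z))"
proof -
 interpret P: abelian_group P by (rule kmod_ag[OF kP])
 show ?thesis unfolding ev_def
 proof (rule P.add.finprod_mono_neutral_cong_left[OF assms(1,2)])
  show "(%z. lookup \<phi> z \<odot>\<^bsub>P\<^esub> b (fst z) (snd z)) \<in> K \<rightarrow> carrier P"
   using assms(3) by (auto intro!: kmod_scale[OF kP] kbil_closed[OF b])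
  show "lookup \<phi> z \<odot>\<^bsub>P\<^esub> b (fst z) (snd z) = \<zero>\<^bsub>P\<^esub>" if "z \<in> K - keys \<phi>" for z
   using that kmod_zero_scale[OF kP b_closed] assms(3) by (auto simp: in_keys_iff)
 qed simp
qed

lemma ev_klin: "klin (pmod (carrier M \<times> carrier N)) P (ev P b)"
proof (rule klinI)
 interpret P: abelian_group P by (rule kmod_ag[OF kP])
 fix \<phi> :: "('a \<times> 'b \<Rightarrow>\<^sub>0 'k)" assume "\<phi> \<in> carrier (pmod (carrier M \<times> carrier N))"
 then have p: "keys \<phi> \<subseteq> carrier M \<times> carrier N" by (simp add: free_on_def)
 note bc = kmod_scale[OF kP b_closed]
 show "ev P b \<phi> \<in> carrier P" unfolding ev_def using p by (intro finsum_closed'[OF kP] bc) auto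
 show "ev P b (c \<odot>\<^bsub>pmod (carrier M \<times> carrier N)\<^esub> \<phi>) = c \<odot>\<^bsub>P\<^esub> ev P b \<phi>" for c
 proof -
  have "ev P b (pm_scale c \<phi>) = (\<Oplus>\<^bsub>P\<^esub>z\<in>keys \<phi>. lookup (pm_scale c \<phi>) z \<odot>\<^bsub>P\<^esub> b (fst z) (snd z))"
   using p by (intro ev_superset) (auto simp: in_keys_iff)
  also have "... = (\<Oplus>\<^bsub>P\<^esub>z\<in>keys \<phi>. c \<odot>\<^bsub>P\<^esub> (lookup \<phi> z \<odot>\<^bsub>P\<^esub> b (fst z) (snd z)))"
   using p by (intro finsum_cong_simple[OF kP]) (auto intro!: kmod_scale[OF kP] kbil_closed[OF b] kmod_assoc[OF kP])
  also have "... = c \<odot>\<^bsub>P\<^esub> ev P b \<phi>"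
   unfolding ev_def using p bc by (intro module.finsum_smult_ldistr[OF kP, symmetric]) auto
  finally show ?thesis by simp
 qed
 fix \<psi> :: "('a \<times> 'b \<Rightarrow>\<^sub>0 'k)" assume "\<psi> \<in> carrier (pmod (carrier M \<times> carrier N))"
 then have q: "keys \<psi> \<subseteq> carrier M \<times> carrier N" by (simp add: free_on_def)
 let ?K = "keys \<phi> \<union> keys \<psi>"
 have K: "finite ?K" "?K \<subseteq> carrier M \<times> carrier N" using p q by auto
 have "ev P b (\<phi> + \<psi>) = (\<Oplus>\<^bsub>P\<^esub>z\<in>?K. lookup (\<phi> + \<psi>) z \<odot>\<^bsub>P\<^esub> b (fst z) (snd z))"
  using K by (intro ev_superset keys_add) auto
 also have "... = (\<Oplus>\<^bsub>P\<^esub>z\<in>?K. lookup \<phi> z \<odot>\<^bsub>P\<^esub> b (fst z) (snd z) \<oplus>\<^bsub>P\<^esub> lookup \<psi> z \<odot>\<^bsub>P\<^esub> b (fst z) (snd z))"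
  using K by (intro finsum_cong_simple[OF kP])
   (auto intro!: P.a_closed kmod_scale[OF kP] kbil_closed[OF b] kmod_ldistr[OF kP] simp: lookup_add)
 also have "... = (\<Oplus>\<^bsub>P\<^esub>z\<in>?K. lookup \<phi> z \<odot>\<^bsub>P\<^esub> b (fst z) (snd z)) \<oplus>\<^bsub>P\<^esub> (\<Oplus>\<^bsub>P\<^esub>z\<in>?K. lookup \<psi> z \<odot>\<^bsub>P\<^esub> b (fst z) (snd z))"
  using K bc by (intro P.finsum_addf) auto
 also have "... = ev P b \<phi> \<oplus>\<^bsub>P\<^esub> ev P b \<psi>"
  using ev_superset[of ?K \<phi>] ev_superset[of ?K \<psi>] K by simp
 finally show "ev P b (\<phi> \<oplus>\<^bsub>pmod (carrier M \<times> carrier N)\<^esub> \<psi>) = ev P b \<phi> \<oplus>\<^bsub>P\<^esub> ev P b \<psi>" by simp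
qed

lemma ev_basis: "x \<in> carrier M ==> y \<in> carrier N ==> ev P b (pm_basis (x, y)) = b x y"
proof -
 assume xy: "x \<in> carrier M" "y \<in> carrier N"
 interpret P: abelian_group P by (rule kmod_ag[OF kP])
 show ?thesis using b_closed[of "(x, y)"] xy
  by (simp add: ev_def P.finsum_insert[of "{}"] kmod_one[OF kP])
qed

lemma ev_scale: "\<phi> \<in> F ==> ev P b (pm_scale c \<phi>) = c \<odot>\<^bsub>P\<^esub> ev P b \<phi>"
 using klin_scaleD[OF ev_klin, of \<phi> c] by (simp add: F_def)

lemma ev_add: "\<phi> \<in> F ==> \<psi> \<in> F ==> ev P b (\<phi> + \<psi>) = ev P b \<phi> \<oplus>\<^bsub>P\<^esub> ev P b \<psi>"
 using klin_addD[OF ev_klin, of \<phi> \<psi>] by (simp add: F_def)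

lemma ev_closed: "\<phi> \<in> F ==> ev P b \<phi> \<in> carrier P"
 using klin_closed[OF ev_klin, of \<phi>] by (simp add: F_def)

lemma ev_diff: "\<phi> \<in> F ==> \<psi> \<in> F ==> ev P b (\<phi> - \<psi>) = ev P b \<phi> \<ominus>\<^bsub>P\<^esub> ev P b \<psi>"
proof -
 assume f: "\<phi> \<in> F" "\<psi> \<in> F"
 interpret P: abelian_group P by (rule kmod_ag[OF kP])
 have "ev P b \<phi> = ev P b (\<phi> - \<psi>) \<oplus>\<^bsub>P\<^esub> ev P b \<psi>"
  using ev_add[of "\<phi> - \<psi>" \<psi>] f F_diff by simp
 then show ?thesis
  using ev_closed[OF f(2)] ev_closed[OF F_diff[OF f]]
  by (simp add: a_minus_def P.a_assoc P.r_neg)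
qed

lemma BR_F_ev: "\<phi> \<in> BR ==> \<phi> \<in> F \<and> ev P b \<phi> = \<zero>\<^bsub>P\<^esub>"
proof (induction rule: bilinear_relations.induct)
 interpret P: abelian_group P by (rule kmod_ag[OF kP])
 note bb = kbilD[OF b]
 {
  case (add_left x x' y)
  note c = bb(3)[OF add_left(1,3)] bb(3)[OF add_left(2,3)] and f = F_single[OF add_left(1,3), of 1] F_single[OF add_left(2,3), of 1]
   and g = F_single[OF kmod_add[OF kM add_left(1,2)] add_left(3), of 1]
  have "(b x y \<oplus>\<^bsub>P\<^esub> b x' y) \<ominus>\<^bsub>P\<^esub> b x y \<ominus>\<^bsub>P\<^esub> b x' y = \<zero>\<^bsub>P\<^esub>"
   using c by (simp add: a_minus_def P.a_ac P.r_neg P.r_neg1 P.r_neg2)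
  then show ?case
   using klin_addD[OF bb(1)] add_left f g by (simp add: F_diff ev_diff ev_basis kmod_add[OF kM])
 next
  case (add_right x y y')
  note c = bb(3)[OF add_right(1,2)] bb(3)[OF add_right(1,3)] and f = F_single[OF add_right(1,2), of 1] F_single[OF add_right(1,3), of 1]
   and g = F_single[OF add_right(1) kmod_add[OF kN add_right(2,3)], of 1]
  have "(b x y \<oplus>\<^bsub>P\<^esub> b x y') \<ominus>\<^bsub>P\<^esub> b x y \<ominus>\<^bsub>P\<^esub> b x y' = \<zero>\<^bsub>P\<^esub>"
   using c by (simp add: a_minus_def P.a_ac P.r_neg P.r_neg1 P.r_neg2)
  then show ?case
   using klin_addD[OF bb(2)] add_right f g by (simp add: F_diff ev_diff ev_basis kmod_add[OF kN])
 next
  case (smult_left x y c)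
  then show ?case
   using klin_scaleD[OF bb(1)]
   by (simp add: F_single F_diff F_scale ev_diff ev_scale ev_basis kmod_scale[OF kM] kmod_scale[OF kP] bb(3) a_minus_def P.r_neg del: pm_scale_single)
 next
  case (smult_right x y c)
  then show ?case
   using klin_scaleD[OF bb(2)]
   by (simp add: F_single F_diff F_scale ev_diff ev_scale ev_basis kmod_scale[OF kN] kmod_scale[OF kP] bb(3) a_minus_def P.r_neg del: pm_scale_single)
 next
  case zero
  then show ?case by (simp add: F_0 ev_def)
 next
  case (plus \<phi> \<psi>)
  then show ?case by (simp add: F_add ev_add)
 next
  case (scale \<phi> c)
  then show ?case by (simp add: F_scale ev_scale kmod_scale_zero[OF kP])
 }
qed

lemma lift_cl: assumes "\<phi> \<in> F" shows "tensor_lift M N P b (cl \<phi>) = ev P b \<phi>"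
proof -
 interpret P: abelian_group P by (rule kmod_ag[OF kP])
 have "ev P b \<psi> = ev P b \<phi>" if "\<psi> \<in> cl \<phi>" for \<psi>
 proof -
  have m: "\<psi> \<in> F" "\<phi> - \<psi> \<in> BR" using that by (auto simp: mem_cl)
  have "ev P b (\<phi> - \<psi>) = \<zero>\<^bsub>P\<^esub>" using BR_F_ev[OF m(2)] by simp
  then show ?thesis
   using ev_add[OF F_diff[OF assms m(1)] m(1)] ev_closed[OF m(1)] by simp
 qed
 then have "ev P b ` cl \<phi> = {ev P b \<phi>}" using self_cl[OF assms] by blast
 then have "the_elem (ev P b ` cl \<phi>) = ev P b \<phi>" by simp
 then show ?thesis using assms by (simp add: tensor_lift_def carrier_T ev_def)
qed

lemma lift_klin: "klin T P (tensor_lift M N P b)"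
 by (rule klinI) (auto simp: carrier_T T_add T_scale lift_cl F_add F_scale ev_add ev_scale ev_closed)

lemma lift_pure: "x \<in> carrier M ==> y \<in> carrier N ==> tensor_lift M N P b (pure_tensor M N x y) = b x y"
 by (simp add: pure_cl lift_cl F_single ev_basis)

end

lemma klin_eq_pure:
 assumes "klin T P f" "klin T P g" "t \<in> carrier T"
  and "!!x y. x \<in> carrier M ==> y \<in> carrier N ==> f (pure_tensor M N x y) = g (pure_tensor M N x y)"
 shows "f t = g t"
 using assms(3)
 by (induction rule: tensor_induct) (simp_all add: assms(4) klinD[OF assms(1)] klinD[OF assms(2)])

text \<open>Prepares the associator, a lift whose values are themselves lifts: linearity in the
  outer variable is checked on pure tensors and propagated by induction on the tensor.\<close>

lemma lift_param_klin:
 fixes P :: "('k, 'c, 'w) module_scheme" and L :: "('k, 'd, 'v) module_scheme"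
 assumes "kmod P" "kmod L" "!!z. z \<in> carrier L ==> kbil M N P (b z)"
  and "!!x y. x \<in> carrier M ==> y \<in> carrier N ==> klin L P (%z. b z x y)"
  and "t \<in> carrier T"
 shows "klin L P (%z. tensor_lift M N P (b z) t)"
 using assms(5)
proof (induction rule: tensor_induct)
 case (pure x y)
 show ?case by (rule klin_cong[OF assms(4)[OF pure] assms(2)]) (simp add: lift_pure[OF assms(1,3)] pure)
next
 case (add s t)
 show ?case
  by (rule klin_cong[OF klin_add_fun[OF add(3,4) assms(1)] assms(2)])
   (simp add: klin_addD[OF lift_klin[OF assms(1,3)]] add(1,2))
next
 case (scale c t)
 show ?case
  by (rule klin_cong[OF klin_scale_fun[OF scale(2) assms(1)] assms(2)])
   (simp add: klin_scaleD[OF lift_klin[OF assms(1,3)]] scale(1))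
qed

end

section \<open>Higman's criterion: morphisms through projectives are transfers\<close>

section \<open>Projective maps are transfers\<close>

lemma kG_hom_iff:
 "f \<in> kG_hom G M N \<longleftrightarrow> f \<in> extensional (carrier M) \<and> klin M N f \<and>
   (\<forall>g\<in>carrier G. \<forall>x\<in>carrier M. f (act M g x) = act N g (f x))"
 unfolding kG_hom_def klin_def PiE_def by auto

lemma kG_homD:
 assumes "f \<in> kG_hom G M N"
 shows kG_hom_klin: "klin M N f"
  and kG_hom_act: "!!g x. g \<in> carrier G ==> x \<in> carrier M ==> f (act M g x) = act N g (f x)"
  and kG_hom_ext: "f \<in> extensional (carrier M)"
  and kG_hom_closed: "!!x. x \<in> carrier M ==> f x \<in> carrier N"
 using assms by (auto simp: kG_hom_iff klin_def)

lemma kG_hom_restrictI: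
 assumes "kG_module G M" "klin M N f"
  and "!!g x. g \<in> carrier G ==> x \<in> carrier M ==> f (act M g x) = act N g (f x)"
 shows "restrict f (carrier M) \<in> kG_hom G M N"
 unfolding kG_hom_iff
proof (intro conjI ballI)
 note k = kG_moduleD[OF assms(1)]
 show "klin M N (restrict f (carrier M))"
  by (rule klin_cong[OF assms(2) k(2)]) simp
qed (simp_all add: assms(3) kG_moduleD[OF assms(1)])

lemma kG_hom_eqI:
 assumes "f \<in> kG_hom G M N" "g \<in> kG_hom G M N" "!!x. x \<in> carrier M ==> f x = g x"
 shows "f = g"
 by (rule extensionalityI[OF kG_hom_ext[OF assms(1)] kG_hom_ext[OF assms(2)] assms(3)])

lemma kG_hom_compose:
 assumes "kG_module G M" "f \<in> kG_hom G M N" "g \<in> kG_hom G N P"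
 shows "compose (carrier M) g f \<in> kG_hom G M P"
 unfolding compose_def
 by (rule kG_hom_restrictI[OF assms(1) klin_comp[OF kG_homD(1)[OF assms(2)] kG_homD(1)[OF assms(3)]]])
  (simp add: kG_homD[OF assms(2)] kG_homD[OF assms(3)])

locale finite_group = group G for G (structure) + assumes finite_G: "finite (carrier G)"
begin

lemma finsum_translate:
 assumes "kmod M" "s \<in> carrier G" "!!t. t \<in> carrier G ==> f t \<in> carrier M"
 shows "finsum M (%t. f (s \<otimes> t)) (carrier G) = finsum M f (carrier G)"
proof -
 interpret M: abelian_group M by (rule kmod_ag[OF assms(1)])
 have im: "(\<otimes>) s ` carrier G = carrier G"
 proof -
  have "t \<in> (\<otimes>) s ` carrier G" if "t \<in> carrier G" for t
   using that assms(2) by (intro image_eqI[of _ _ "inv s \<otimes> t"]) (simp_all add: m_assoc[symmetric])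
  then show ?thesis using assms(2) by auto
 qed
 have "finsum M f ((\<otimes>) s ` carrier G) = finsum M (%t. f (s \<otimes> t)) (carrier G)"
  by (rule M.finsum_reindex) (use assms im in \<open>auto intro!: inj_onI\<close>)
 then show ?thesis by (simp add: im)
qed

text \<open>Transfer from the trivial subgroup; \<open>SZ1\<close> is its counterpart after a choice
  of coordinates and of a generator.\<close>

definition tr :: "('a, 'k::field, 'm) rep => ('a, 'k, 'n) rep => ('m => 'n) => 'm => 'n"
 where "tr M N \<theta> x = (\<Oplus>\<^bsub>N\<^esub>t\<in>carrier G. act N t (\<theta> (act M (inv t) x)))"

lemma tr_term_closed:
 assumes "kG_module G M" "kG_module G N" "klin M N \<theta>" "x \<in> carrier M" "t \<in> carrier G"
 shows "act N t (\<theta> (act M (inv t) x)) \<in> carrier N"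
 using kG_moduleD(3)[OF assms(1)] kG_moduleD(3)[OF assms(2)] klin_closed[OF assms(3)] assms(4,5) by simp

lemma tr_cong:
 assumes "kG_module G M" "kG_module G N" "klin M N \<theta>" "x \<in> carrier M" "!!y. y \<in> carrier M ==> \<theta>' y = \<theta> y"
 shows "tr M N \<theta>' x = tr M N \<theta> x"
 unfolding tr_def
 by (rule finsum_cong_simple[OF kG_moduleD(2)[OF assms(2)] tr_term_closed[OF assms(1-4)]])
  (simp_all add: assms(4,5) kG_moduleD(3)[OF assms(1)])

lemma tr_klin:
 assumes "kG_module G M" "kG_module G N" "klin M N \<theta>"
 shows "klin M N (tr M N \<theta>)"
 unfolding tr_def[abs_def]
proof (rule klin_finsum_fun[OF finite_G])
 show "klin M N (%x. act N t (\<theta> (act M (inv t) x)))" if "t \<in> carrier G" for t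
  using klin_comp[OF klin_comp[OF klin_act[OF assms(1)] assms(3)] klin_act[OF assms(2) that]] that by simp
qed (simp_all add: kG_moduleD(2)[OF assms(1)] kG_moduleD(2)[OF assms(2)])

lemma tr_comp_left:
 assumes "kG_module G M" "kG_module G N" "kG_module G P" "klin M N \<theta>" "x \<in> carrier M" "g \<in> kG_hom G N P"
 shows "g (tr M N \<theta> x) = tr M P (%y. g (\<theta> y)) x"
 unfolding tr_def
 by (subst klin_finsumD[OF kG_homD(1)[OF assms(6)] kG_moduleD(2)[OF assms(2)] kG_moduleD(2)[OF assms(3)] finite_G tr_term_closed[OF assms(1,2,4,5)]])
  (auto intro!: finsum_cong_simple[OF kG_moduleD(2)[OF assms(3)]] tr_term_closed[OF assms(1,3) _ assms(5)]
   klin_comp[OF assms(4) kG_homD(1)[OF assms(6)]]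
   simp: kG_homD(2)[OF assms(6)] klin_closed[OF assms(4)] kG_moduleD(3)[OF assms(1)] assms(5))

lemma tr_comp_right:
 assumes "kG_module G L" "kG_module G M" "kG_module G N" "klin M N \<theta>" "x \<in> carrier L" "g \<in> kG_hom G L M"
 shows "tr M N \<theta> (g x) = tr L N (%y. \<theta> (g y)) x"
 unfolding tr_def
 by (auto intro!: finsum_cong_simple[OF kG_moduleD(2)[OF assms(3)]] tr_term_closed[OF assms(1,3) _ assms(5)]
   klin_comp[OF kG_homD(1)[OF assms(6)] assms(4)] simp: kG_homD(2)[OF assms(6)] assms(5))

lemma tr_add:
 assumes "kG_module G M" "kG_module G N" "klin M N \<theta>" "klin M N \<eta>" "x \<in> carrier M"
 shows "tr M N \<theta> x \<oplus>\<^bsub>N\<^esub> tr M N \<eta> x = tr M N (%y. \<theta> y \<oplus>\<^bsub>N\<^esub> \<eta> y) x"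
proof -
 interpret N: abelian_group N by (rule kmod_ag[OF kG_moduleD(2)[OF assms(2)]])
 note c = tr_term_closed[OF assms(1,2,3,5)] tr_term_closed[OF assms(1,2,4,5)]
 show ?thesis
  unfolding tr_def
  by (subst N.finsum_addf[symmetric])
   (auto intro!: finsum_cong_simple[OF kG_moduleD(2)[OF assms(2)]] kG_moduleD(3)[OF assms(2)] c N.a_closed
   simp: kG_moduleD(4)[OF assms(2)] klin_closed[OF assms(3)] klin_closed[OF assms(4)] kG_moduleD(3)[OF assms(1)] assms(5))
qed

text \<open>The free module on \<open>d\<close> generators; \<open>enc t i\<close> is the coordinate of the \<open>t\<close>-translate of generator \<open>i\<close>.\<close>

definition idx :: "'a => nat" where "idx = (SOME f. inj_on f (carrier G))"
definition enc :: "'a => nat => nat" where "enc t i = prod_encode (idx t, i)"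
definition gpart :: "nat => 'a" where "gpart j = inv_into (carrier G) idx (fst (prod_decode j))"
definition ipart :: "nat => nat" where "ipart j = snd (prod_decode j)"
definition slots :: "nat => nat set" where "slots d = (%(t, i). enc t i) ` (carrier G \<times> {..<d})"

lemma idx_inj: "inj_on idx (carrier G)"
proof -
 obtain n and f :: "'a => nat" where "inj_on f (carrier G)"
  using finite_imp_inj_to_nat_seg[OF finite_G] by blast
 then show ?thesis unfolding idx_def by (rule someI[of "%f. inj_on f (carrier G)"])
qed

lemma gpart_enc [simp]: "t \<in> carrier G ==> gpart (enc t i) = t"
 by (simp add: gpart_def enc_def idx_inj)
lemma ipart_enc [simp]: "ipart (enc t i) = i" by (simp add: ipart_def enc_def)
lemma enc_slots [simp]: "t \<in> carrier G ==> i < d ==> enc t i \<in> slots d" by (auto simp: slots_def)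
lemma slotsE: assumes "j \<in> slots d" obtains t i where "j = enc t i" "t \<in> carrier G" "i < d"
 using assms by (auto simp: slots_def)
lemma finite_slots: "finite (slots d)" unfolding slots_def using finite_G by auto

text \<open>Carried by coordinate functions, since \<open>kG_phom\<close> asks for factorizations
  through modules on that type.\<close>

definition free_rep :: "nat => ('a, 'k::field) coord_rep" where
 "free_rep d = \<lparr>carrier = {v. \<forall>j. j \<notin> slots d \<longrightarrow> v j = 0}, monoid.mult = undefined, one = undefined,
   ring.zero = (%_. 0), add = (%v w j. v j + w j), module.smult = (%c v j. c * v j),
   act = (%s v j. if j \<in> slots d then v (enc (inv s \<otimes> gpart j) (ipart j)) else 0)\<rparr>"

lemma free_rep_simps [simp]:
 "carrier (free_rep d :: ('a, 'k::field) coord_rep) = {v. \<forall>j. j \<notin> slots d \<longrightarrow> v j = 0}"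
 "ring.zero (free_rep d :: ('a, 'k) coord_rep) = (%_. 0)"
 "add (free_rep d :: ('a, 'k) coord_rep) = (%v w j. v j + w j)"
 "module.smult (free_rep d :: ('a, 'k) coord_rep) = (%c v j. c * v j)"
 "act (free_rep d :: ('a, 'k) coord_rep) = (%s v j. if j \<in> slots d then v (enc (inv s \<otimes> gpart j) (ipart j)) else 0)"
 by (simp_all add: free_rep_def)

lemma free_rep_eqI:
 assumes "v \<in> carrier (free_rep d)" "w \<in> carrier (free_rep d)"
  "!!t i. t \<in> carrier G ==> i < d ==> v (enc t i) = w (enc t i)"
 shows "v = w"
proof
 fix j show "v j = w j" using assms by (cases "j \<in> slots d") (auto elim!: slotsE)
qed

lemma kmod_free_rep: "kmod (free_rep d :: ('a, 'k::field) coord_rep)"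
proof (rule kmodI, goal_cases)
 case (3 x y z) then show ?case by (simp add: add.assoc)
next
 case (4 x y) then show ?case by (simp add: add.commute)
next
 case (1 x y) then show ?case by simp
next
 case 2 then show ?case by simp
next
 case (5 x) show ?case by simp
next
 case (6 c x) then show ?case by simp
next
 case (7 a b x) show ?case by (simp add: distrib_right)
next
 case (8 a x y) show ?case by (simp add: distrib_left)
next
 case (9 a b x) show ?case unfolding free_rep_simps by (rule ext) (rule semigroup_mult_class.mult.assoc)
next
 case (10 x) show ?case by simp
next
 case (11 x) show ?case by simp
qed

lemma kG_free_rep: "kG_module G (free_rep d :: ('a, 'k::field) coord_rep)"
 unfolding kG_module_def
proof (intro conjI ballI allI)
 show "group G" by (rule group_axioms)
 show "kmod (free_rep d)" by (rule kmod_free_rep)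
next
 fix x :: "nat => 'k" assume x: "x \<in> carrier (free_rep d)"
 show "act (free_rep d) \<one> x = x"
 proof (rule free_rep_eqI[OF _ x])
  show "act (free_rep d) \<one> x (enc t i) = x (enc t i)" if "t \<in> carrier G" "i < d" for t i
   using that by simp
 qed simp
 fix g h assume gh: "g \<in> carrier G" "h \<in> carrier G"
 show "act (free_rep d) (g \<otimes> h) x = act (free_rep d) g (act (free_rep d) h x)"
 proof (rule free_rep_eqI)
  show "act (free_rep d) (g \<otimes> h) x (enc t i) = act (free_rep d) g (act (free_rep d) h x) (enc t i)"
   if "t \<in> carrier G" "i < d" for t i
   using that gh by (simp add: inv_mult_group m_assoc)
 qed simp_all
qed auto

lemma coords_free_rep: "\<exists>n co vec. coords (free_rep d :: ('a, 'k::field) coord_rep) n co vec"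
proof -
 define B where "B = Suc (Max (slots d \<union> {0}))"
 have B: "j < B" if "j \<in> slots d" for j
  using that finite_slots[of d] by (simp add: B_def less_Suc_eq_le)
 define vec :: "'k fvec => nat => 'k" where "vec \<phi> j = (if j \<in> slots d then lookup \<phi> j else 0)" for \<phi> j
 have "klin (pmod UNIV) (free_rep d) vec"
  by (rule klinI) (auto simp: vec_def lookup_add)
 moreover have "vec (cut B \<phi>) = vec \<phi>" for \<phi> using B by (auto simp: vec_def lookup_cut)
 ultimately have s: "spanned (free_rep d) B vec" by (simp add: spanned_def)
 have "x \<in> range vec" if "x \<in> carrier (free_rep d)" for x
 proof -
  have "x = vec (\<Sum>j\<in>slots d. single j (x j))"
   using that finite_slots[of d] by (auto simp: vec_def lookup_sum lookup_single when_def fun_eq_iff)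
  then show ?thesis by blast
 qed
 then show ?thesis using spanned_coords[OF kmod_free_rep s] by blast
qed

text \<open>The homomorphism from the free module that sends the generator \<open>i\<close> to
  \<open>m i\<close>.\<close>

definition frmap :: "nat => ('a, 'k::field, 'm) rep => (nat => 'm) => (nat => 'k) => 'm" where
 "frmap d M m v = (\<Oplus>\<^bsub>M\<^esub>t\<in>carrier G. act M t (\<Oplus>\<^bsub>M\<^esub>i\<in>{..<d}. v (enc t i) \<odot>\<^bsub>M\<^esub> m i))"

context
 fixes d :: nat and M :: "('a, 'k::field, 'm) rep" and m :: "nat => 'm"
 assumes M: "kG_module G M" and m: "!!i. i < d ==> m i \<in> carrier M"
begin

lemmas Mk = kG_moduleD[OF M]

lemma inner_closed: "(\<Oplus>\<^bsub>M\<^esub>i\<in>{..<d}. c i \<odot>\<^bsub>M\<^esub> m i) \<in> carrier M"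
 by (intro finsum_closed'[OF Mk(2)] kmod_scale[OF Mk(2)] m) simp

lemma inner_klin: "klin (free_rep d) M (%v. \<Oplus>\<^bsub>M\<^esub>i\<in>{..<d}. v (enc t i) \<odot>\<^bsub>M\<^esub> m i)"
proof (rule klin_finsum_fun)
 show "klin (free_rep d) M (%v. v (enc t i) \<odot>\<^bsub>M\<^esub> m i)" if "i \<in> {..<d}" for i
  by (rule klinI)
   (use that m in \<open>auto simp: kmod_scale[OF Mk(2)] kmod_ldistr[OF Mk(2)] kmod_assoc[OF Mk(2)]\<close>)
qed (auto simp: kmod_free_rep Mk(2))

lemma frmap_hom: "restrict (frmap d M m) (carrier (free_rep d)) \<in> kG_hom G (free_rep d) M"
proof (rule kG_hom_restrictI[OF kG_free_rep])
 show "klin (free_rep d) M (frmap d M m)"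
  unfolding frmap_def[abs_def]
  by (rule klin_finsum_fun[OF finite_G klin_comp[OF inner_klin klin_act[OF M]] Mk(2) kmod_free_rep])
 fix s and v :: "nat => 'k" assume s: "s \<in> carrier G" and v: "v \<in> carrier (free_rep d)"
 let ?w = "%t. act M t (\<Oplus>\<^bsub>M\<^esub>i\<in>{..<d}. act (free_rep d) s v (enc t i) \<odot>\<^bsub>M\<^esub> m i)"
 have "frmap d M m (act (free_rep d) s v) = finsum M (%t. ?w (s \<otimes> t)) (carrier G)"
  unfolding frmap_def by (rule finsum_translate[OF Mk(2) s Mk(3)[OF _ inner_closed], symmetric])
 also have "... = finsum M (%t. act M s (act M t (\<Oplus>\<^bsub>M\<^esub>i\<in>{..<d}. v (enc t i) \<odot>\<^bsub>M\<^esub> m i))) (carrier G)"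
 proof (rule finsum_cong_simple[OF Mk(2)])
  fix t assume t: "t \<in> carrier G"
  show "act M s (act M t (\<Oplus>\<^bsub>M\<^esub>i\<in>{..<d}. v (enc t i) \<odot>\<^bsub>M\<^esub> m i)) \<in> carrier M"
   using s t inner_closed by (intro Mk(3)) auto
  have "(\<Oplus>\<^bsub>M\<^esub>i\<in>{..<d}. act (free_rep d) s v (enc (s \<otimes> t) i) \<odot>\<^bsub>M\<^esub> m i) = (\<Oplus>\<^bsub>M\<^esub>i\<in>{..<d}. v (enc t i) \<odot>\<^bsub>M\<^esub> m i)"
   by (rule finsum_cong_simple[OF Mk(2)]) (use s t m in \<open>auto simp: kmod_scale[OF Mk(2)] m_assoc[symmetric]\<close>)
  then show "?w (s \<otimes> t) = act M s (act M t (\<Oplus>\<^bsub>M\<^esub>i\<in>{..<d}. v (enc t i) \<odot>\<^bsub>M\<^esub> m i))"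
   using s t inner_closed by (simp only: Mk(7))
 qed
 also have "... = act M s (frmap d M m v)"
  unfolding frmap_def
  by (rule klin_finsumD[OF klin_act[OF M s] Mk(2) Mk(2) finite_G Mk(3)[OF _ inner_closed], symmetric])
 finally show "frmap d M m (act (free_rep d) s v) = act M s (frmap d M m v)" .
qed

text \<open>A coordinate vector placed over the identity element maps to the corresponding
  combination, which makes the free cover of a module surjective.\<close>

lemma frmap_single_orbit:
 assumes "!!t i. t \<in> carrier G ==> i < d ==> v (enc t i) = (if \<one> = t then c i else 0)"
 shows "frmap d M m v = (\<Oplus>\<^bsub>M\<^esub>i\<in>{..<d}. c i \<odot>\<^bsub>M\<^esub> m i)"
proof -
 interpret M: abelian_group M by (rule kmod_ag[OF Mk(2)])
 have "act M t (\<Oplus>\<^bsub>M\<^esub>i\<in>{..<d}. v (enc t i) \<odot>\<^bsub>M\<^esub> m i) = (if \<one> = t then (\<Oplus>\<^bsub>M\<^esub>i\<in>{..<d}. c i \<odot>\<^bsub>M\<^esub> m i) else \<zero>\<^bsub>M\<^esub>)"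
  if t: "t \<in> carrier G" for t
 proof -
  have "(\<Oplus>\<^bsub>M\<^esub>i\<in>{..<d}. v (enc t i) \<odot>\<^bsub>M\<^esub> m i) = (\<Oplus>\<^bsub>M\<^esub>i\<in>{..<d}. (if \<one> = t then c i else 0) \<odot>\<^bsub>M\<^esub> m i)"
   by (rule finsum_cong_simple[OF Mk(2)]) (use t m assms kmod_scale[OF Mk(2)] in auto)
  moreover have "(\<Oplus>\<^bsub>M\<^esub>i\<in>{..<d}. 0 \<odot>\<^bsub>M\<^esub> m i) = (\<Oplus>\<^bsub>M\<^esub>i\<in>{..<d}. \<zero>\<^bsub>M\<^esub>)"
   by (rule finsum_cong_simple[OF Mk(2)]) (auto simp: kmod_zero_scale[OF Mk(2) m])
  ultimately show ?thesis
   using Mk(6)[OF inner_closed] klin_zeroD[OF klin_act[OF M t] Mk(2) Mk(2)] by auto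
 qed
 then have "frmap d M m v = finsum M (%t. if \<one> = t then (\<Oplus>\<^bsub>M\<^esub>i\<in>{..<d}. c i \<odot>\<^bsub>M\<^esub> m i) else \<zero>\<^bsub>M\<^esub>) (carrier G)"
  unfolding frmap_def by (intro finsum_cong_simple[OF Mk(2)]) (use inner_closed in auto)
 also have "... = (\<Oplus>\<^bsub>M\<^esub>i\<in>{..<d}. c i \<odot>\<^bsub>M\<^esub> m i)"
  by (rule M.finsum_singleton[OF one_closed finite_G, where f = "%_. \<Oplus>\<^bsub>M\<^esub>i\<in>{..<d}. c i \<odot>\<^bsub>M\<^esub> m i"])
   (use inner_closed in auto)
 finally show ?thesis .
qed

end

lemma frmap_comp:
 assumes "kG_module G M" "kG_module G N" "e \<in> kG_hom G M N" "!!i. i < d ==> m i \<in> carrier M"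
 shows "e (frmap d M m v) = frmap d N (%i. e (m i)) v"
proof -
 note a = kG_moduleD[OF assms(1)] and b = kG_moduleD[OF assms(2)] and e = kG_homD[OF assms(3)]
 note ic = inner_closed[OF assms(1,4)]
 have em: "e (m i) \<in> carrier N" if "i < d" for i using e(4) assms(4) that by simp
 have "e (frmap d M m v) = (\<Oplus>\<^bsub>N\<^esub>t\<in>carrier G. e (act M t (\<Oplus>\<^bsub>M\<^esub>i\<in>{..<d}. v (enc t i) \<odot>\<^bsub>M\<^esub> m i)))"
  unfolding frmap_def by (rule klin_finsumD[OF e(1) a(2) b(2) finite_G a(3)[OF _ ic]])
 also have "... = frmap d N (%i. e (m i)) v"
  unfolding frmap_def
 proof (rule finsum_cong_simple[OF b(2)])
  fix t assume t: "t \<in> carrier G"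
  have "e (\<Oplus>\<^bsub>M\<^esub>i\<in>{..<d}. v (enc t i) \<odot>\<^bsub>M\<^esub> m i) = (\<Oplus>\<^bsub>N\<^esub>i\<in>{..<d}. e (v (enc t i) \<odot>\<^bsub>M\<^esub> m i))"
   by (rule klin_finsumD[OF e(1) a(2) b(2)]) (auto intro!: kmod_scale[OF a(2)] assms(4))
  also have "... = (\<Oplus>\<^bsub>N\<^esub>i\<in>{..<d}. v (enc t i) \<odot>\<^bsub>N\<^esub> e (m i))"
   by (rule finsum_cong_simple[OF b(2)]) (auto intro!: kmod_scale[OF b(2)] em klin_scaleD[OF e(1)] assms(4))
  finally show "e (act M t (\<Oplus>\<^bsub>M\<^esub>i\<in>{..<d}. v (enc t i) \<odot>\<^bsub>M\<^esub> m i)) = act N t (\<Oplus>\<^bsub>N\<^esub>i\<in>{..<d}. v (enc t i) \<odot>\<^bsub>N\<^esub> e (m i))"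
   using e(2)[OF t ic] by simp
  show "act N t (\<Oplus>\<^bsub>N\<^esub>i\<in>{..<d}. v (enc t i) \<odot>\<^bsub>N\<^esub> e (m i)) \<in> carrier N"
   by (rule b(3)[OF t inner_closed[OF assms(2) em]])
 qed
 finally show ?thesis .
qed

definition gen :: "nat => nat => 'k::field" where "gen i j = (if j = enc \<one> i then 1 else 0)"

lemma enc_eq: "t \<in> carrier G ==> s \<in> carrier G ==> enc t i = enc s j \<longleftrightarrow> t = s \<and> i = j"
 by (metis gpart_enc ipart_enc)

lemma frmap_gen:
 assumes v: "v \<in> carrier (free_rep d)"
 shows "frmap d (free_rep d) gen v = (v :: nat => 'k::field)"
proof -
 have fs: "finsum (free_rep d) f I = (%j. \<Sum>i\<in>I. f i j)" if "finite I" "!!i. i \<in> I ==> f i \<in> carrier (free_rep d)"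
  for f :: "'i => nat => 'k" and I
  using that
 proof (induction I rule: finite_induct)
  case empty
  interpret A: abelian_group "free_rep d :: ('a, 'k) coord_rep" by (rule kmod_ag[OF kmod_free_rep])
  show ?case by (simp del: free_rep_simps(1))
 next
  case (insert i I)
  interpret A: abelian_group "free_rep d :: ('a, 'k) coord_rep" by (rule kmod_ag[OF kmod_free_rep])
  have "finsum (free_rep d) f (insert i I) = f i \<oplus>\<^bsub>free_rep d\<^esub> finsum (free_rep d) f I"
   using insert by (intro A.finsum_insert) auto
  then show ?case using insert by (simp add: fun_eq_iff)
 qed
 have g: "gen i \<in> carrier (free_rep d :: ('a, 'k) coord_rep)" if "i < d" for i using that by (auto simp: gen_def)
 have inn: "(\<Oplus>\<^bsub>free_rep d\<^esub>i\<in>{..<d}. v (enc t i) \<odot>\<^bsub>free_rep d\<^esub> gen i) = (%j. \<Sum>i<d. v (enc t i) * gen i j)" for t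
  using g by (subst fs) auto
 have cl: "frmap d (free_rep d) gen v \<in> carrier (free_rep d)"
  using kG_homD(4)[OF frmap_hom[OF kG_free_rep g] v] v by simp
 have "frmap d (free_rep d) gen v = (%j. \<Sum>t\<in>carrier G. act (free_rep d) t (%j. \<Sum>i<d. v (enc t i) * gen i j) j)"
  unfolding frmap_def inn using finite_G by (subst fs) auto
 then have "frmap d (free_rep d) gen v (enc s k) = v (enc s k)" if sk: "s \<in> carrier G" "k < d" for s k
 proof -
  have "frmap d (free_rep d) gen v (enc s k) = (\<Sum>t\<in>carrier G. \<Sum>i<d. v (enc t i) * gen i (enc (inv t \<otimes> s) k))"
   using \<open>frmap d (free_rep d) gen v = _\<close> sk by simp
  also have "... = (\<Sum>t\<in>carrier G. if t = s then v (enc s k) else 0)"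
  proof (rule sum.cong[OF refl])
   fix t assume t: "t \<in> carrier G"
   have "inv t \<otimes> s = \<one> \<longleftrightarrow> t = s" using t sk by (metis inv_closed inv_equality inv_inv r_inv l_inv)
   then have "gen i (enc (inv t \<otimes> s) k) = (if i = k \<and> t = s then 1 else 0 :: 'k)" for i
    using t sk by (auto simp: gen_def enc_eq)
   then have "(\<Sum>i<d. v (enc t i) * gen i (enc (inv t \<otimes> s) k)) =
     (\<Sum>i<d. if i = k then (if t = s then v (enc t i) else 0) else 0)"
    by (intro sum.cong refl) (auto simp del: split_paired_All)
   also have "... = (if t = s then v (enc s k) else 0)" using sk by simp
   finally show "(\<Sum>i<d. v (enc t i) * gen i (enc (inv t \<otimes> s) k)) = (if t = s then v (enc s k) else 0)" .
  qed
  also have "... = v (enc s k)" using sk finite_G by simp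
  finally show ?thesis .
 qed
 then show ?thesis by (intro free_rep_eqI[OF cl v]) simp
qed

lemma projective_free_rep: "projective_kG G (free_rep d :: ('a, 'k::field) coord_rep)"
 unfolding projective_kG_def
proof (intro conjI allI impI)
 obtain n co vec where "coords (free_rep d :: ('a, 'k) coord_rep) n co vec" using coords_free_rep by blast
 then show "fg_kG_module G (free_rep d :: ('a, 'k) coord_rep)" by (rule coords_fg[OF kG_free_rep])
 fix M N :: "('a, 'k) coord_rep" and e f
 assume "fg_kG_module G M \<and> fg_kG_module G N \<and> e \<in> kG_hom G M N \<and> e ` carrier M = carrier N \<and> f \<in> kG_hom G (free_rep d) N"
 then have e: "e \<in> kG_hom G M N" "e ` carrier M = carrier N" and f: "f \<in> kG_hom G (free_rep d) N"
  and "fg_kG_module G M" "fg_kG_module G N" by auto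
 then have M: "kG_module G M" and N: "kG_module G N" by (auto simp: fg_kG_module_def)
 have g: "gen i \<in> carrier (free_rep d :: ('a, 'k) coord_rep)" if "i < d" for i using that by (auto simp: gen_def)
 have "\<exists>m\<in>carrier M. e m = f (gen i)" if "i < d" for i
  using kG_homD(4)[OF f g[OF that]] e(2) by (metis imageE)
 then obtain m where m: "!!i. i < d ==> m i \<in> carrier M" "!!i. i < d ==> e (m i) = f (gen i)" by metis
 define h where "h = restrict (frmap d M m) (carrier (free_rep d))"
 have h: "h \<in> kG_hom G (free_rep d) M" unfolding h_def by (rule frmap_hom[OF M m(1)])
 have "compose (carrier (free_rep d)) e h = f"
 proof (rule kG_hom_eqI[OF kG_hom_compose[OF kG_free_rep h e(1)] f])
  fix v :: "nat => 'k" assume v: "v \<in> carrier (free_rep d)"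
  have "compose (carrier (free_rep d)) e h v = e (frmap d M m v)" using v by (simp add: compose_def h_def)
  also have "... = frmap d N (%i. e (m i)) v" by (rule frmap_comp[OF M N e(1) m(1)])
  also have "... = frmap d N (%i. f (gen i)) v"
  proof -
   have k: "kmod N" by (rule kG_moduleD[OF N])
   have fg: "f (gen i) \<in> carrier N" if "i < d" for i using kG_homD(4)[OF f g[OF that]] .
   have "(\<Oplus>\<^bsub>N\<^esub>i\<in>{..<d}. v (enc t i) \<odot>\<^bsub>N\<^esub> e (m i)) = (\<Oplus>\<^bsub>N\<^esub>i\<in>{..<d}. v (enc t i) \<odot>\<^bsub>N\<^esub> f (gen i))" for t
    by (rule finsum_cong_simple[OF k]) (simp_all add: m fg kmod_scale[OF k])
   then show ?thesis by (simp only: frmap_def)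
  qed
  also have "... = f (frmap d (free_rep d) gen v)" by (rule frmap_comp[OF kG_free_rep N f g, symmetric])
  also have "... = f v" by (simp only: frmap_gen[OF v])
  finally show "compose (carrier (free_rep d)) e h v = f v" .
 qed
 with h show "\<exists>h\<in>kG_hom G (free_rep d) M. compose (carrier (free_rep d)) e h = f" by blast
qed

text \<open>Projectivity splits the free cover. Reading the section at the identity element and
  mapping the result back gives \<open>\<theta>\<close>; by equivariance its translates recover the
  whole section.\<close>

lemma projective_id_tr:
 assumes "projective_kG G (P :: ('a, 'k::field) coord_rep)"
 shows "\<exists>\<theta>. klin P P \<theta> \<and> (\<forall>x\<in>carrier P. x = tr P P \<theta> x)"
proof -
 have fgP: "fg_kG_module G P" using assms by (simp add: projective_kG_def)
 then have P: "kG_module G P" by (simp add: fg_kG_module_def)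
 note p = kG_moduleD[OF P]
 obtain d co vec where c: "coords P d co vec" using fg_coords[OF fgP finite_G] by blast
 define m where "m i = vec (pm_basis i)" for i
 have m: "m i \<in> carrier P" for i unfolding m_def by (rule vec_closed[OF c])
 define e where "e = restrict (frmap d P m) (carrier (free_rep d))"
 have e: "e \<in> kG_hom G (free_rep d) P" unfolding e_def by (rule frmap_hom[OF P m])
 have "e ` carrier (free_rep d) = carrier P"
 proof (intro subset_antisym subsetI)
  fix x assume x: "x \<in> carrier P"
  define v where "v j = (if j \<in> slots d \<and> gpart j = \<one> then lookup (co x) (ipart j) else 0)" for j
  have v: "v \<in> carrier (free_rep d)" by (simp add: v_def)
  have "e v = (\<Oplus>\<^bsub>P\<^esub>i\<in>{..<d}. lookup (co x) i \<odot>\<^bsub>P\<^esub> m i)"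
   using v by (simp add: e_def del: free_rep_simps, intro frmap_single_orbit[OF P m]) (auto simp: v_def)
  also have "... = vec (co x)" unfolding m_def by (rule vec_expand[OF c p(2), symmetric])
  finally have "e v = x" using vec_co[OF c x] by simp
  then show "x \<in> e ` carrier (free_rep d)" using v by blast
 qed (use kG_homD(4)[OF e] in auto)
 moreover have "id_hom P \<in> kG_hom G P P" unfolding id_hom_def by (rule kG_hom_restrictI[OF P klin_ident]) simp
 moreover have "fg_kG_module G (free_rep d :: ('a, 'k) coord_rep)" using projective_free_rep projective_kG_def by blast
 ultimately obtain h where h: "h \<in> kG_hom G P (free_rep d)" "compose (carrier P) e h = id_hom P"
  using assms fgP e unfolding projective_kG_def by metis
 define \<theta> where "\<theta> x = (\<Oplus>\<^bsub>P\<^esub>i\<in>{..<d}. h x (enc \<one> i) \<odot>\<^bsub>P\<^esub> m i)" for x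
 have \<theta>: "klin P P \<theta>" unfolding \<theta>_def by (rule klin_comp[OF kG_homD(1)[OF h(1)] inner_klin[OF P m]])
 have "x = tr P P \<theta> x" if x: "x \<in> carrier P" for x
 proof -
  have "x = e (h x)" using fun_cong[OF h(2), of x] x by (simp add: compose_def id_hom_def)
  also have "... = frmap d P m (h x)" using kG_homD(4)[OF h(1) x] by (simp add: e_def)
  also have "... = tr P P \<theta> x"
   unfolding frmap_def tr_def
  proof (rule finsum_cong_simple[OF p(2) tr_term_closed[OF P P \<theta> x]])
   fix t assume t: "t \<in> carrier G"
   have "h (act P (inv t) x) (enc \<one> i) = h x (enc t i)" if "i < d" for i
    using kG_homD(2)[OF h(1), of "inv t" x] t x that by simp
   then have "(\<Oplus>\<^bsub>P\<^esub>i\<in>{..<d}. h x (enc t i) \<odot>\<^bsub>P\<^esub> m i) = \<theta> (act P (inv t) x)"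
    unfolding \<theta>_def by (intro finsum_cong_simple[OF p(2)]) (auto simp: kmod_scale[OF p(2) m])
   then show "act P t (\<Oplus>\<^bsub>P\<^esub>i\<in>{..<d}. h x (enc t i) \<odot>\<^bsub>P\<^esub> m i) = act P t (\<theta> (act P (inv t) x))" by simp
  qed
  finally show ?thesis .
 qed
 with \<theta> show ?thesis by blast
qed

text \<open>One direction transports the identity of the projective module, a transfer by
  \<open>projective_id_tr\<close>, through the factorization. Conversely a transfer factors through
  the free module on a basis of the target: \<open>x\<close> is sent to the family of all
  \<open>\<theta> (t^-1 x)\<close>, and the second map sums the translates.\<close>

theorem phom_iff_tr:
 fixes M :: "('a, 'k::field, 'm) rep" and N :: "('a, 'k, 'n) rep"
 assumes "kG_module G M" "fg_kG_module G N"
 shows "f \<in> kG_phom G M N \<longleftrightarrow> f \<in> kG_hom G M N \<and> (\<exists>\<theta>. klin M N \<theta> \<and> (\<forall>x\<in>carrier M. f x = tr M N \<theta> x))"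
  (is "_ \<longleftrightarrow> ?R")
proof
 have N: "kG_module G N" using assms by (simp add: fg_kG_module_def)
 note m = kG_moduleD[OF assms(1)] and n = kG_moduleD[OF N]
 {
  assume f: "f \<in> kG_phom G M N"
  then obtain P :: "('a, 'k) coord_rep" and a b where P: "projective_kG G P" and a: "a \<in> kG_hom G M P"
   and b: "b \<in> kG_hom G P N" and fab: "f = compose (carrier M) b a" and fh: "f \<in> kG_hom G M N"
   unfolding kG_phom_def by blast
  have kP: "kG_module G P" using P by (simp add: projective_kG_def fg_kG_module_def)
  obtain \<theta> where th: "klin P P \<theta>" "!!x. x \<in> carrier P ==> x = tr P P \<theta> x" using projective_id_tr[OF P] by blast
  have "f x = tr M N (%y. b (\<theta> (a y))) x" if x: "x \<in> carrier M" for x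
  proof -
   have ax: "a x \<in> carrier P" by (rule kG_homD(4)[OF a x])
   have "f x = b (tr P P \<theta> (a x))" using x th(2)[OF ax] by (simp add: fab compose_def)
   also have "... = tr P N (%y. b (\<theta> y)) (a x)" by (rule tr_comp_left[OF kP kP N th(1) ax b])
   also have "... = tr M N (%y. b (\<theta> (a y))) x"
    by (rule tr_comp_right[OF assms(1) kP N klin_comp[OF th(1) kG_homD(1)[OF b]] x a])
   finally show ?thesis .
  qed
  then show ?R
   using fh klin_comp[OF kG_homD(1)[OF a] klin_comp[OF th(1) kG_homD(1)[OF b]]] by blast
 }
 assume R: ?R
 then obtain \<theta> where fh: "f \<in> kG_hom G M N" and th: "klin M N \<theta>" "!!x. x \<in> carrier M ==> f x = tr M N \<theta> x" by blast
 obtain d co vec where c: "coords N d co vec" using fg_coords[OF assms(2) finite_G] by blast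
 define e where "e = restrict (frmap d N (%i. vec (pm_basis i))) (carrier (free_rep d))"
 have e: "e \<in> kG_hom G (free_rep d) N" unfolding e_def by (rule frmap_hom[OF N vec_closed[OF c]])
 define a where "a = restrict (%x j. if j \<in> slots d then lookup (co (\<theta> (act M (inv (gpart j)) x))) (ipart j) else 0) (carrier M)"
 note co = klinD[OF klin_comp[OF th(1) coords_co[OF c n(2)]]]
 have gp: "gpart j \<in> carrier G" if "j \<in> slots d" for j using that by (auto elim: slotsE)
 have a: "a \<in> kG_hom G M (free_rep d)" unfolding a_def
 proof (rule kG_hom_restrictI[OF assms(1)])
  show "klin M (free_rep d) (%x j. if j \<in> slots d then lookup (co (\<theta> (act M (inv (gpart j)) x))) (ipart j) else 0)"
   by (rule klinI) (auto simp: fun_eq_iff gp m co lookup_add)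
  show "(%j. if j \<in> slots d then lookup (co (\<theta> (act M (inv (gpart j)) (act M g x)))) (ipart j) else 0) =
    act (free_rep d) g (%j. if j \<in> slots d then lookup (co (\<theta> (act M (inv (gpart j)) x))) (ipart j) else 0)"
   if "g \<in> carrier G" "x \<in> carrier M" for g x
   using that by (auto simp: fun_eq_iff gp m(7)[symmetric] inv_mult_group elim!: slotsE)
 qed
 have "f = compose (carrier M) e a"
 proof (rule kG_hom_eqI[OF fh kG_hom_compose[OF assms(1) a e]])
  fix x assume x: "x \<in> carrier M"
  have "f x = tr M N \<theta> x" by (rule th(2)[OF x])
  also have "... = frmap d N (%i. vec (pm_basis i)) (a x)"
   unfolding tr_def frmap_def
  proof (rule finsum_cong_simple[OF n(2) n(3)[OF _ inner_closed[OF N vec_closed[OF c]]]])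
   fix t assume t: "t \<in> carrier G"
   have y: "\<theta> (act M (inv t) x) \<in> carrier N" using klin_closed[OF th(1)] m(3) t x by simp
   have "\<theta> (act M (inv t) x) = (\<Oplus>\<^bsub>N\<^esub>i\<in>{..<d}. lookup (co (\<theta> (act M (inv t) x))) i \<odot>\<^bsub>N\<^esub> vec (pm_basis i))"
    using vec_expand[OF c n(2), of "co (\<theta> (act M (inv t) x))"] vec_co[OF c y] by simp
   also have "... = (\<Oplus>\<^bsub>N\<^esub>i\<in>{..<d}. a x (enc t i) \<odot>\<^bsub>N\<^esub> vec (pm_basis i))"
    by (rule finsum_cong_simple[OF n(2)]) (use t x in \<open>auto simp: a_def intro!: kmod_scale[OF n(2)] vec_closed[OF c]\<close>)
   finally show "act N t (\<theta> (act M (inv t) x)) = act N t (\<Oplus>\<^bsub>N\<^esub>i\<in>{..<d}. a x (enc t i) \<odot>\<^bsub>N\<^esub> vec (pm_basis i))"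
    by simp
  qed
  also have "... = compose (carrier M) e a x"
   using kG_homD(4)[OF a x] x by (simp add: e_def compose_def)
  finally show "f x = compose (carrier M) e a x" .
 qed
 then show "f \<in> kG_phom G M N"
  unfolding kG_phom_def using fh a e projective_free_rep by blast
qed

end

section \<open>The group action on tensor products and the monoidal structure maps\<close>

lemma tensor_simps [simp]:
 "carrier (M \<otimes>\<^sub>k N) = carrier (tensor_module M N)"
 "add (M \<otimes>\<^sub>k N) = add (tensor_module M N)"
 "ring.zero (M \<otimes>\<^sub>k N) = ring.zero (tensor_module M N)"
 "module.smult (M \<otimes>\<^sub>k N) = module.smult (tensor_module M N)"
 "act (M \<otimes>\<^sub>k N) = (%g. tensor_lift M N (tensor_module M N) (%x y. pure_tensor M N (act M g x) (act N g y)))"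
 by (simp_all add: tensor_def module.extend_def rep.fields_def tensor_module_def)

lemma klin_tensor:
 "klin (M \<otimes>\<^sub>k N) P f \<longleftrightarrow> klin (tensor_module M N) P f"
 "klin L (M \<otimes>\<^sub>k N) h \<longleftrightarrow> klin L (tensor_module M N) h"
 by (simp_all add: klin_def)

lemma kbil_tensor: "kbil K L (M \<otimes>\<^sub>k N) b \<longleftrightarrow> kbil K L (tensor_module M N) b"
 by (simp add: kbil_def klin_tensor)

lemma kmod_tensor:
 assumes "kmod M" "kmod N" shows "kmod (M \<otimes>\<^sub>k N)"
proof -
 interpret tens M N by (rule tens.intro[OF assms])
 interpret T: abelian_group T by (rule kmod_ag[OF kmod_T])
 show ?thesis
  by (rule kmodI)
   (simp_all add: T.a_ac kmod_scale[OF kmod_T] kmod_ldistr[OF kmod_T] kmod_rdistr[OF kmod_T]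
    kmod_assoc[OF kmod_T] kmod_one[OF kmod_T] kmod_zero_scale[OF kmod_T])
qed

lemma pure_closed:
 assumes "kmod M" "kmod N" "x \<in> carrier M" "y \<in> carrier N"
 shows "pure_tensor M N x y \<in> carrier (M \<otimes>\<^sub>k N)"
 using tens.pure_closed[OF tens.intro[OF assms(1,2)] assms(3,4)] by simp

lemma pure_kbil: "kmod M ==> kmod N ==> kbil M N (M \<otimes>\<^sub>k N) (pure_tensor M N)"
 using tens.pure_kbil[OF tens.intro] by (simp add: kbil_tensor)

lemma lift_klin:
 assumes "kmod M" "kmod N" "kmod P" "kbil M N P b"
 shows "klin (M \<otimes>\<^sub>k N) P (tensor_lift M N P b)"
 using tens.lift_klin[OF tens.intro[OF assms(1,2)] assms(3,4)] by (simp add: klin_tensor)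

lemma lift_pure:
 assumes "kmod M" "kmod N" "kmod P" "kbil M N P b" "x \<in> carrier M" "y \<in> carrier N"
 shows "tensor_lift M N P b (pure_tensor M N x y) = b x y"
 by (rule tens.lift_pure[OF tens.intro[OF assms(1,2)] assms(3-6)])

lemma lift_param_klin:
 assumes "kmod M" "kmod N" "kmod P" "kmod L" "!!z. z \<in> carrier L ==> kbil M N P (b z)"
  and "!!x y. x \<in> carrier M ==> y \<in> carrier N ==> klin L P (%z. b z x y)" and "t \<in> carrier (M \<otimes>\<^sub>k N)"
 shows "klin L P (%z. tensor_lift M N P (b z) t)"
 using tens.lift_param_klin[OF tens.intro[OF assms(1,2)] assms(3-6) assms(7)[unfolded tensor_simps]] .

lemma klin_eq_pure:
 assumes "kmod M" "kmod N" "klin (M \<otimes>\<^sub>k N) P f" "klin (M \<otimes>\<^sub>k N) P g" "t \<in> carrier (M \<otimes>\<^sub>k N)"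
  and "!!x y. x \<in> carrier M ==> y \<in> carrier N ==> f (pure_tensor M N x y) = g (pure_tensor M N x y)"
 shows "f t = g t"
 using tens.klin_eq_pure[OF tens.intro[OF assms(1,2)] assms(3,4)[unfolded klin_tensor] assms(5)[unfolded tensor_simps] assms(6)] .

lemma lift_ext: "tensor_lift M N P b \<in> extensional (carrier (M \<otimes>\<^sub>k N))"
 by (simp add: tensor_lift_def)

lemma act_kbil:
 assumes "kG_module G M" "kG_module G N" "g \<in> carrier G"
 shows "kbil M N (M \<otimes>\<^sub>k N) (%x y. pure_tensor M N (act M g x) (act N g y))"
 by (rule kbil_comp[OF pure_kbil klin_act[OF assms(1,3)] klin_act[OF assms(2,3)] klin_ident])
  (simp_all add: kG_moduleD(2)[OF assms(1)] kG_moduleD(2)[OF assms(2)])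

lemma act_tensor:
 assumes "kG_module G M" "kG_module G N" "g \<in> carrier G"
 shows act_tensor_klin: "klin (M \<otimes>\<^sub>k N) (M \<otimes>\<^sub>k N) (act (M \<otimes>\<^sub>k N) g)"
  and act_pure: "!!x y. x \<in> carrier M ==> y \<in> carrier N ==>
   act (M \<otimes>\<^sub>k N) g (pure_tensor M N x y) = pure_tensor M N (act M g x) (act N g y)"
proof -
 interpret tens M N by (rule tens.intro[OF kG_moduleD(2)[OF assms(1)] kG_moduleD(2)[OF assms(2)]])
 have b: "kbil M N T (%x y. pure_tensor M N (act M g x) (act N g y))"
  using act_kbil[OF assms] by (simp add: kbil_tensor)
 show "klin (M \<otimes>\<^sub>k N) (M \<otimes>\<^sub>k N) (act (M \<otimes>\<^sub>k N) g)"
  using lift_klin[OF kmod_T b] by (simp add: klin_tensor)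
 show "!!x y. x \<in> carrier M ==> y \<in> carrier N ==>
   act (M \<otimes>\<^sub>k N) g (pure_tensor M N x y) = pure_tensor M N (act M g x) (act N g y)"
  using lift_pure[OF kmod_T b] by simp
qed

lemma kG_tensor:
 assumes "kG_module G M" "kG_module G N" shows "kG_module G (M \<otimes>\<^sub>k N)"
 unfolding kG_module_def
proof (intro conjI ballI allI)
 note m = kG_moduleD[OF assms(1)] and n = kG_moduleD[OF assms(2)]
 interpret group G by (rule m(1))
 note at = klinD[OF act_tensor_klin[OF assms]]
 show "group G" by (rule m(1))
 show "kmod (M \<otimes>\<^sub>k N)" by (rule kmod_tensor[OF m(2) n(2)])
 fix x assume x: "x \<in> carrier (M \<otimes>\<^sub>k N)"
 show "act (M \<otimes>\<^sub>k N) \<one>\<^bsub>G\<^esub> x = x"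
  by (rule klin_eq_pure[OF m(2) n(2) act_tensor_klin[OF assms one_closed] klin_ident x])
   (simp del: tensor_simps add: act_pure[OF assms one_closed] m(6) n(6))
 fix g assume g: "g \<in> carrier G"
 show "act (M \<otimes>\<^sub>k N) g x \<in> carrier (M \<otimes>\<^sub>k N)" by (rule at(1)[OF g x])
 show "act (M \<otimes>\<^sub>k N) g (c \<odot>\<^bsub>M \<otimes>\<^sub>k N\<^esub> x) = c \<odot>\<^bsub>M \<otimes>\<^sub>k N\<^esub> act (M \<otimes>\<^sub>k N) g x" for c by (rule at(3)[OF g x])
 show "act (M \<otimes>\<^sub>k N) g (x \<oplus>\<^bsub>M \<otimes>\<^sub>k N\<^esub> y) = act (M \<otimes>\<^sub>k N) g x \<oplus>\<^bsub>M \<otimes>\<^sub>k N\<^esub> act (M \<otimes>\<^sub>k N) g y"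
  if "y \<in> carrier (M \<otimes>\<^sub>k N)" for y by (rule at(2)[OF g x that])
 fix h assume h: "h \<in> carrier G"
 show "act (M \<otimes>\<^sub>k N) (g \<otimes>\<^bsub>G\<^esub> h) x = act (M \<otimes>\<^sub>k N) g (act (M \<otimes>\<^sub>k N) h x)"
  by (rule klin_eq_pure[OF m(2) n(2) act_tensor_klin[OF assms m_closed[OF g h]]
    klin_comp[OF act_tensor_klin[OF assms h] act_tensor_klin[OF assms g]] x])
   (simp del: tensor_simps add: act_pure[OF assms] g h m(3,7) n(3,7))
qed

lemma lift_hom:
 assumes "kG_module G M" "kG_module G N" "kG_module G P" "kbil M N P b"
  and "!!g x y. g \<in> carrier G ==> x \<in> carrier M ==> y \<in> carrier N ==> b (act M g x) (act N g y) = act P g (b x y)"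
 shows "tensor_lift M N P b \<in> kG_hom G (M \<otimes>\<^sub>k N) P"
 unfolding kG_hom_iff
proof (intro conjI ballI)
 note m = kG_moduleD[OF assms(1)] and n = kG_moduleD[OF assms(2)] and p = kG_moduleD[OF assms(3)]
 show k: "klin (M \<otimes>\<^sub>k N) P (tensor_lift M N P b)" by (rule lift_klin[OF m(2) n(2) p(2) assms(4)])
 fix g t assume g: "g \<in> carrier G" and t: "t \<in> carrier (M \<otimes>\<^sub>k N)"
 show "tensor_lift M N P b (act (M \<otimes>\<^sub>k N) g t) = act P g (tensor_lift M N P b t)"
  by (rule klin_eq_pure[OF m(2) n(2) klin_comp[OF act_tensor_klin[OF assms(1,2) g] k] klin_comp[OF k klin_act[OF assms(3) g]] t])
   (simp del: tensor_simps add: act_pure[OF assms(1,2) g] lift_pure[OF m(2) n(2) p(2) assms(4)] m(3)[OF g] n(3)[OF g] assms(5)[OF g])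
qed (rule lift_ext)

lemma tensor_hom_kbil:
 assumes "kmod M'" "kmod N'" "klin M M' f" "klin N N' g"
 shows "kbil M N (M' \<otimes>\<^sub>k N') (%x y. pure_tensor M' N' (f x) (g y))"
 by (rule kbil_comp[OF pure_kbil[OF assms(1,2)] assms(3,4) klin_ident])

lemma tensor_hom_klin:
 assumes "kmod M" "kmod N" "kmod M'" "kmod N'" "klin M M' f" "klin N N' g"
 shows "klin (M \<otimes>\<^sub>k N) (M' \<otimes>\<^sub>k N') (tensor_hom M N M' N' f g)"
  and tensor_hom_pure: "!!x y. x \<in> carrier M ==> y \<in> carrier N ==>
   tensor_hom M N M' N' f g (pure_tensor M N x y) = pure_tensor M' N' (f x) (g y)"
 unfolding tensor_hom_def
 using lift_klin[OF assms(1,2) kmod_tensor[OF assms(3,4)] tensor_hom_kbil[OF assms(3-6)]]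
  lift_pure[OF assms(1,2) kmod_tensor[OF assms(3,4)] tensor_hom_kbil[OF assms(3-6)]] by auto

lemma tensor_hom_hom:
 assumes "kG_module G M" "kG_module G N" "kG_module G M'" "kG_module G N'" "f \<in> kG_hom G M M'" "g \<in> kG_hom G N N'"
 shows "tensor_hom M N M' N' f g \<in> kG_hom G (M \<otimes>\<^sub>k N) (M' \<otimes>\<^sub>k N')"
 unfolding tensor_hom_def
 by (rule lift_hom[OF assms(1,2) kG_tensor[OF assms(3,4)]
    tensor_hom_kbil[OF kG_moduleD(2)[OF assms(3)] kG_moduleD(2)[OF assms(4)] kG_homD(1)[OF assms(5)] kG_homD(1)[OF assms(6)]]])
  (simp del: tensor_simps add: act_pure[OF assms(3,4)] kG_homD[OF assms(5)] kG_homD[OF assms(6)])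

lemma tensor_hom_hom_pure:
 assumes "kG_module G M" "kG_module G N" "kG_module G M'" "kG_module G N'" "f \<in> kG_hom G M M'" "g \<in> kG_hom G N N'"
  "x \<in> carrier M" "y \<in> carrier N"
 shows "tensor_hom M N M' N' f g (pure_tensor M N x y) = pure_tensor M' N' (f x) (g y)"
 by (rule tensor_hom_pure) (use assms in \<open>auto intro: kG_moduleD kG_homD\<close>)

lemma swap_hom:
 assumes "kG_module G M" "kG_module G N"
 shows swap_hom_hom: "swap_hom M N \<in> kG_hom G (M \<otimes>\<^sub>k N) (N \<otimes>\<^sub>k M)"
  and swap_pure: "!!x y. x \<in> carrier M ==> y \<in> carrier N ==> swap_hom M N (pure_tensor M N x y) = pure_tensor N M y x"
proof -
 note m = kG_moduleD[OF assms(1)] and n = kG_moduleD[OF assms(2)]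
 have b: "kbil M N (N \<otimes>\<^sub>k M) (%x y. pure_tensor N M y x)" by (rule kbil_swap[OF pure_kbil[OF n(2) m(2)]])
 show "swap_hom M N \<in> kG_hom G (M \<otimes>\<^sub>k N) (N \<otimes>\<^sub>k M)" unfolding swap_hom_def
  by (rule lift_hom[OF assms kG_tensor[OF assms(2,1)] b]) (simp del: tensor_simps add: act_pure[OF assms(2,1)])
 show "!!x y. x \<in> carrier M ==> y \<in> carrier N ==> swap_hom M N (pure_tensor M N x y) = pure_tensor N M y x"
  unfolding swap_hom_def by (rule lift_pure[OF m(2) n(2) kmod_tensor[OF n(2) m(2)] b])
qed

lemma assoc_hom:
 assumes "kG_module G L" "kG_module G M" "kG_module G N"
 shows assoc_hom_hom: "assoc_hom L M N \<in> kG_hom G ((L \<otimes>\<^sub>k M) \<otimes>\<^sub>k N) (L \<otimes>\<^sub>k (M \<otimes>\<^sub>k N))"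
  and assoc_pure: "!!x y z. x \<in> carrier L ==> y \<in> carrier M ==> z \<in> carrier N ==>
   assoc_hom L M N (pure_tensor (L \<otimes>\<^sub>k M) N (pure_tensor L M x y) z) = pure_tensor L (M \<otimes>\<^sub>k N) x (pure_tensor M N y z)"
proof -
 note l = kG_moduleD(2)[OF assms(1)] and m = kG_moduleD(2)[OF assms(2)] and n = kG_moduleD(2)[OF assms(3)]
 let ?P = "L \<otimes>\<^sub>k (M \<otimes>\<^sub>k N)"
 let ?b = "%z x y. pure_tensor L (M \<otimes>\<^sub>k N) x (pure_tensor M N y z)"
 note kp = kmod_tensor[OF l kmod_tensor[OF m n]]
 note p1 = kbilD[OF pure_kbil[OF m n]] and p2 = kbilD[OF pure_kbil[OF l kmod_tensor[OF m n]]]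
 have b: "kbil L M ?P (?b z)" if "z \<in> carrier N" for z
  by (rule kbil_comp[OF pure_kbil[OF l kmod_tensor[OF m n]] klin_ident p1(1)[OF that] klin_ident])
 have c: "klin N ?P (%z. ?b z x y)" if "x \<in> carrier L" "y \<in> carrier M" for x y
  by (rule klin_comp[OF p1(2)[OF that(2)] p2(2)[OF that(1)]])
 have B: "kbil (L \<otimes>\<^sub>k M) N ?P (%t z. tensor_lift L M ?P (?b z) t)"
  by (rule kbilI[OF lift_klin[OF l m kp b] lift_param_klin[OF l m kp n b c]])
 show pure: "assoc_hom L M N (pure_tensor (L \<otimes>\<^sub>k M) N (pure_tensor L M x y) z) = pure_tensor L (M \<otimes>\<^sub>k N) x (pure_tensor M N y z)"
  if "x \<in> carrier L" "y \<in> carrier M" "z \<in> carrier N" for x y z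
  unfolding assoc_hom_def
  by (simp only: lift_pure[OF kmod_tensor[OF l m] n kp B pure_closed[OF l m that(1,2)] that(3)] lift_pure[OF l m kp b[OF that(3)] that(1,2)])
 show "assoc_hom L M N \<in> kG_hom G ((L \<otimes>\<^sub>k M) \<otimes>\<^sub>k N) ?P"
  unfolding assoc_hom_def
 proof (rule lift_hom[OF kG_tensor[OF assms(1,2)] assms(3) kG_tensor[OF assms(1) kG_tensor[OF assms(2,3)]] B])
  fix g t z assume g: "g \<in> carrier G" and t: "t \<in> carrier (L \<otimes>\<^sub>k M)" and z: "z \<in> carrier N"
  have gz: "act N g z \<in> carrier N" by (rule kG_moduleD(3)[OF assms(3) g z])
  show "tensor_lift L M ?P (?b (act N g z)) (act (L \<otimes>\<^sub>k M) g t) = act ?P g (tensor_lift L M ?P (?b z) t)"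
   by (rule klin_eq_pure[OF l m klin_comp[OF act_tensor_klin[OF assms(1,2) g] lift_klin[OF l m kp b[OF gz]]]
      klin_comp[OF lift_klin[OF l m kp b[OF z]] klin_act[OF kG_tensor[OF assms(1) kG_tensor[OF assms(2,3)]] g]] t])
    (simp del: tensor_simps add: act_pure[OF assms(1,2) g] lift_pure[OF l m kp b[OF gz]] lift_pure[OF l m kp b[OF z]]
     kG_moduleD(3)[OF assms(1) g] kG_moduleD(3)[OF assms(2) g] act_pure[OF assms(1) kG_tensor[OF assms(2,3)] g]
     pure_closed[OF m n] act_pure[OF assms(2,3) g] z)
 qed
qed

lemma assoc_inv_hom:
 assumes "kG_module G L" "kG_module G M" "kG_module G N"
 shows assoc_inv_hom_hom: "assoc_inv_hom L M N \<in> kG_hom G (L \<otimes>\<^sub>k (M \<otimes>\<^sub>k N)) ((L \<otimes>\<^sub>k M) \<otimes>\<^sub>k N)"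
  and assoc_inv_pure: "!!x y z. x \<in> carrier L ==> y \<in> carrier M ==> z \<in> carrier N ==>
   assoc_inv_hom L M N (pure_tensor L (M \<otimes>\<^sub>k N) x (pure_tensor M N y z)) = pure_tensor (L \<otimes>\<^sub>k M) N (pure_tensor L M x y) z"
proof -
 note l = kG_moduleD(2)[OF assms(1)] and m = kG_moduleD(2)[OF assms(2)] and n = kG_moduleD(2)[OF assms(3)]
 let ?P = "(L \<otimes>\<^sub>k M) \<otimes>\<^sub>k N"
 let ?b = "%x y z. pure_tensor (L \<otimes>\<^sub>k M) N (pure_tensor L M x y) z"
 note kp = kmod_tensor[OF kmod_tensor[OF l m] n]
 note p1 = kbilD[OF pure_kbil[OF l m]] and p2 = kbilD[OF pure_kbil[OF kmod_tensor[OF l m] n]]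
 have b: "kbil M N ?P (?b x)" if "x \<in> carrier L" for x
  by (rule kbil_comp[OF pure_kbil[OF kmod_tensor[OF l m] n] p1(2)[OF that] klin_ident klin_ident])
 have c: "klin L ?P (%x. ?b x y z)" if "y \<in> carrier M" "z \<in> carrier N" for y z
  by (rule klin_comp[OF p1(1)[OF that(1)] p2(1)[OF that(2)]])
 have B: "kbil L (M \<otimes>\<^sub>k N) ?P (%x t. tensor_lift M N ?P (?b x) t)"
  by (rule kbilI[OF lift_param_klin[OF m n kp l b c] lift_klin[OF m n kp b]])
 show pure: "assoc_inv_hom L M N (pure_tensor L (M \<otimes>\<^sub>k N) x (pure_tensor M N y z)) = pure_tensor (L \<otimes>\<^sub>k M) N (pure_tensor L M x y) z"
  if "x \<in> carrier L" "y \<in> carrier M" "z \<in> carrier N" for x y z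
  unfolding assoc_inv_hom_def
  by (simp only: lift_pure[OF l kmod_tensor[OF m n] kp B that(1) pure_closed[OF m n that(2,3)]] lift_pure[OF m n kp b[OF that(1)] that(2,3)])
 show "assoc_inv_hom L M N \<in> kG_hom G (L \<otimes>\<^sub>k (M \<otimes>\<^sub>k N)) ?P"
  unfolding assoc_inv_hom_def
 proof (rule lift_hom[OF assms(1) kG_tensor[OF assms(2,3)] kG_tensor[OF kG_tensor[OF assms(1,2)] assms(3)] B])
  fix g t x assume g: "g \<in> carrier G" and t: "t \<in> carrier (M \<otimes>\<^sub>k N)" and x: "x \<in> carrier L"
  have gx: "act L g x \<in> carrier L" by (rule kG_moduleD(3)[OF assms(1) g x])
  show "tensor_lift M N ?P (?b (act L g x)) (act (M \<otimes>\<^sub>k N) g t) = act ?P g (tensor_lift M N ?P (?b x) t)"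
   by (rule klin_eq_pure[OF m n klin_comp[OF act_tensor_klin[OF assms(2,3) g] lift_klin[OF m n kp b[OF gx]]]
      klin_comp[OF lift_klin[OF m n kp b[OF x]] klin_act[OF kG_tensor[OF kG_tensor[OF assms(1,2)] assms(3)] g]] t])
    (simp del: tensor_simps add: act_pure[OF assms(2,3) g] lift_pure[OF m n kp b[OF gx]] lift_pure[OF m n kp b[OF x]]
     kG_moduleD(3)[OF assms(3) g] kG_moduleD(3)[OF assms(2) g] act_pure[OF kG_tensor[OF assms(1,2)] assms(3) g]
     pure_closed[OF l m] act_pure[OF assms(1,2) g] x)
 qed
qed

lemma unit_simps [simp]:
 "carrier (\<one>\<^sub>k :: ('g, 'k::field, 'k) rep) = UNIV" "add (\<one>\<^sub>k :: ('g, 'k, 'k) rep) = (+)"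
 "ring.zero (\<one>\<^sub>k :: ('g, 'k, 'k) rep) = 0" "module.smult (\<one>\<^sub>k :: ('g, 'k, 'k) rep) = (*)"
 "act (\<one>\<^sub>k :: ('g, 'k, 'k) rep) = (%g x. x)"
 by (simp_all add: unit_rep_def)

lemma kmod_unit: "kmod (\<one>\<^sub>k :: ('g, 'k::field, 'k) rep)"
 by (rule kmod_type[OF vs_fs]) auto

lemma kG_unit: "group G ==> kG_module G (\<one>\<^sub>k :: ('g, 'k::field, 'k) rep)"
 by (simp add: kG_module_def kmod_unit)

lemma unit_hom:
 fixes M :: "('g, 'k::field, 'm) rep"
 assumes "kG_module G M"
 shows left_unit_hom_hom: "left_unit_hom M \<in> kG_hom G (\<one>\<^sub>k \<otimes>\<^sub>k M) M"
  and left_unit_pure: "!!c x. x \<in> carrier M ==> left_unit_hom M (pure_tensor (\<one>\<^sub>k :: ('g, 'k, 'k) rep) M c x) = c \<odot>\<^bsub>M\<^esub> x"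
  and right_unit_hom_hom: "right_unit_hom M \<in> kG_hom G (M \<otimes>\<^sub>k \<one>\<^sub>k) M"
  and right_unit_pure: "!!c x. x \<in> carrier M ==> right_unit_hom M (pure_tensor M (\<one>\<^sub>k :: ('g, 'k, 'k) rep) x c) = c \<odot>\<^bsub>M\<^esub> x"
proof -
 note m = kG_moduleD[OF assms]
 let ?I = "\<one>\<^sub>k :: ('g, 'k, 'k) rep"
 have b: "kbil ?I M M (%c x. c \<odot>\<^bsub>M\<^esub> x)"
 proof (rule kbilI)
  show "klin ?I M (%c. c \<odot>\<^bsub>M\<^esub> y)" if "y \<in> carrier M" for y
   by (rule klinI) (simp_all add: kmod_scale[OF m(2) that] kmod_ldistr[OF m(2) that] kmod_assoc[OF m(2) that])
  show "klin M M (%x. c \<odot>\<^bsub>M\<^esub> x)" for c by (rule klin_scale_fun[OF klin_ident m(2)])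
 qed
 note b' = kbil_swap[OF b]
 have gI: "kG_module G ?I" by (rule kG_unit[OF m(1)])
 show "left_unit_hom M \<in> kG_hom G (?I \<otimes>\<^sub>k M) M" unfolding left_unit_hom_def
  by (rule lift_hom[OF gI assms assms b]) (simp add: m)
 show "right_unit_hom M \<in> kG_hom G (M \<otimes>\<^sub>k ?I) M" unfolding right_unit_hom_def
  by (rule lift_hom[OF assms gI assms b']) (simp add: m)
 show "!!c x. x \<in> carrier M ==> left_unit_hom M (pure_tensor ?I M c x) = c \<odot>\<^bsub>M\<^esub> x"
  unfolding left_unit_hom_def by (rule lift_pure[OF kmod_unit m(2) m(2) b]) auto
 show "!!c x. x \<in> carrier M ==> right_unit_hom M (pure_tensor M ?I x c) = c \<odot>\<^bsub>M\<^esub> x"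
  unfolding right_unit_hom_def by (rule lift_pure[OF m(2) kmod_unit m(2) b']) auto
qed

lemma klin_range_finsum:
 assumes "klin V M vec" "kmod V" "kmod M" "finite I" "!!i. i \<in> I ==> f i \<in> vec ` carrier V"
 shows "finsum M f I \<in> vec ` carrier V"
proof -
 have "\<forall>i\<in>I. \<exists>w. w \<in> carrier V \<and> f i = vec w" using assms(5) by blast
 from bchoice[OF this] obtain w where w: "!!i. i \<in> I ==> w i \<in> carrier V \<and> f i = vec (w i)" by blast
 have "finsum M f I = finsum M (%i. vec (w i)) I"
  using w klin_closed[OF assms(1)] by (intro finsum_cong_simple[OF assms(3)]) auto
 also have "... = vec (finsum V w I)" using klin_finsumD[OF assms(1-4), of w] w by simp
 finally show ?thesis using finsum_closed'[OF assms(2), of I w] w by auto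
qed

lemma coords_tensor:
 assumes "kmod M" "kmod N" "coords M d co vec" "coords N d' co' vec'"
 shows "\<exists>n c v. coords (M \<otimes>\<^sub>k N) n c v"
proof -
 let ?T = "M \<otimes>\<^sub>k N"
 note kt = kmod_tensor[OF assms(1,2)]
 define S where "S = (%(i, j). pure_tensor M N (vec (pm_basis i)) (vec' (pm_basis j))) ` ({..<d} \<times> {..<d'})"
 have "finite S" "S \<subseteq> carrier ?T" unfolding S_def
  using pure_closed[OF assms(1,2) vec_closed[OF assms(3)] vec_closed[OF assms(4)]] by auto
 from spanned_finite[OF kt this] obtain n v where v: "spanned ?T n v" "S \<subseteq> range v" by blast
 then have vl: "klin (pmod UNIV) ?T v" by (simp add: spanned_def)
 note kp = kmod_pmod[where S = UNIV]
 have sc: "c \<odot>\<^bsub>?T\<^esub> t \<in> range v" if tr: "t \<in> range v" for c t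
 proof -
  obtain \<phi> where "t = v \<phi>" using tr by blast
  then have "c \<odot>\<^bsub>?T\<^esub> t = v (pm_scale c \<phi>)" using klin_scaleD[OF vl, of \<phi> c] by simp
  then show ?thesis by blast
 qed
 have fs: "finsum ?T f I \<in> range v" if "finite I" "!!i. i \<in> I ==> f i \<in> range v" for f and I :: "nat set"
  using klin_range_finsum[OF vl kp kt that(1), of f] that(2) by simp
 have "pure_tensor M N x y \<in> range v" if x: "x \<in> carrier M" and y: "y \<in> carrier N" for x y
 proof -
  have 1: "pure_tensor M N (vec (pm_basis i)) y \<in> range v" if i: "i < d" for i
  proof -
   note kl = kbilD(2)[OF pure_kbil[OF assms(1,2)] vec_closed[OF assms(3), of "pm_basis i"]]
   have "pure_tensor M N (vec (pm_basis i)) y =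
     finsum ?T (%j. pure_tensor M N (vec (pm_basis i)) (lookup (co' y) j \<odot>\<^bsub>N\<^esub> vec' (pm_basis j))) {..<d'}"
    by (subst vec_co[OF assms(4) y, symmetric], subst vec_expand[OF assms(4,2)])
     (rule klin_finsumD[OF kl assms(2) kt], auto intro!: kmod_scale[OF assms(2)] vec_closed[OF assms(4)])
   also have "... \<in> range v"
    by (rule fs, simp) (use i v(2) in \<open>auto simp: klin_scaleD[OF kl vec_closed[OF assms(4)]] S_def simp del: tensor_simps intro!: sc\<close>)
   finally show ?thesis .
  qed
  note kl = kbilD(1)[OF pure_kbil[OF assms(1,2)] y]
  have "pure_tensor M N x y = finsum ?T (%i. pure_tensor M N (lookup (co x) i \<odot>\<^bsub>M\<^esub> vec (pm_basis i)) y) {..<d}"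
   by (subst vec_co[OF assms(3) x, symmetric], subst vec_expand[OF assms(3,1)])
    (rule klin_finsumD[OF kl assms(1) kt], auto intro!: kmod_scale[OF assms(1)] vec_closed[OF assms(3)])
  also have "... \<in> range v"
   by (rule fs, simp) (use 1 in \<open>auto simp: klin_scaleD[OF kl vec_closed[OF assms(3)]] simp del: tensor_simps intro!: sc\<close>)
  finally show ?thesis .
 qed
 moreover have "s \<oplus>\<^bsub>?T\<^esub> t \<in> range v" if tr: "s \<in> range v" "t \<in> range v" for s t
 proof -
  obtain \<phi> \<psi> where "s = v \<phi>" "t = v \<psi>" using tr by blast
  then have "s \<oplus>\<^bsub>?T\<^esub> t = v (\<phi> + \<psi>)" using klin_addD[OF vl, of \<phi> \<psi>] by simp
  then show ?thesis by blast
 qed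
 ultimately have "t \<in> range v" if "t \<in> carrier ?T" for t
  using that sc unfolding tensor_simps
  by (intro tens.tensor_induct[OF tens.intro[OF assms(1,2)], of t "%t. t \<in> range v"]) auto
 then show ?thesis using spanned_coords[OF kt v(1)] by blast
qed

section \<open>Stable equality as equality up to a transfer\<close>

section \<open>Stable morphisms\<close>

context finite_group
begin

lemma fg_tensor:
 assumes "fg_kG_module G M" "fg_kG_module G N" shows "fg_kG_module G (M \<otimes>\<^sub>k N)"
proof -
 have k: "kG_module G M" "kG_module G N" using assms by (auto simp: fg_kG_module_def)
 obtain d co vec where c: "coords M d co vec" using fg_coords[OF assms(1) finite_G] by blast
 obtain d' co' vec' where c': "coords N d' co' vec'" using fg_coords[OF assms(2) finite_G] by blast
 obtain n c v where "coords (M \<otimes>\<^sub>k N) n c v"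
  using coords_tensor[OF kG_moduleD(2)[OF k(1)] kG_moduleD(2)[OF k(2)] c c'] by blast
 then show ?thesis by (rule coords_fg[OF kG_tensor[OF k]])
qed

lemma tr_zero:
 assumes "kG_module G N" shows "tr M N (%_. \<zero>\<^bsub>N\<^esub>) x = \<zero>\<^bsub>N\<^esub>"
proof -
 note n = kG_moduleD[OF assms]
 interpret N: abelian_group N by (rule kmod_ag[OF n(2)])
 have "tr M N (%_. \<zero>\<^bsub>N\<^esub>) x = finsum N (%_. \<zero>\<^bsub>N\<^esub>) (carrier G)"
  unfolding tr_def by (rule finsum_cong_simple[OF n(2)]) (simp_all add: klin_zeroD[OF klin_act[OF assms] n(2) n(2)])
 then show ?thesis by simp
qed

lemma tr_closed:
 assumes "kG_module G M" "kG_module G N" "klin M N \<theta>" "x \<in> carrier M"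
 shows "tr M N \<theta> x \<in> carrier N"
 by (rule klin_closed[OF tr_klin[OF assms(1-3)] assms(4)])

lemma tr_neg:
 assumes "kG_module G M" "kG_module G N" "klin M N \<theta>" "x \<in> carrier M"
 shows "tr M N \<theta> x \<oplus>\<^bsub>N\<^esub> tr M N (%y. \<ominus>\<^bsub>N\<^esub> \<theta> y) x = \<zero>\<^bsub>N\<^esub>"
proof -
 note n = kG_moduleD[OF assms(2)] and m = kG_moduleD[OF assms(1)]
 interpret N: abelian_group N by (rule kmod_ag[OF n(2)])
 have "tr M N \<theta> x \<oplus>\<^bsub>N\<^esub> tr M N (%y. \<ominus>\<^bsub>N\<^esub> \<theta> y) x = tr M N (%y. \<theta> y \<oplus>\<^bsub>N\<^esub> \<ominus>\<^bsub>N\<^esub> \<theta> y) x"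
  by (rule tr_add[OF assms(1-3) klin_neg_fun[OF assms(3) n(2) m(2)] assms(4)])
 also have "... = tr M N (%_. \<zero>\<^bsub>N\<^esub>) x"
  by (rule tr_cong[OF assms(1,2) klin_zero_fun[OF n(2)] assms(4)]) (simp add: klin_closed[OF assms(3)] N.r_neg)
 finally show ?thesis by (simp add: tr_zero[OF assms(2)])
qed

text \<open>Stable equality on representatives, with the factorization through a projective replaced
  by a transfer. Identities between stable classes are translated into this relation before any
  computation.\<close>

definition stq :: "('a, 'k::field, 'm) rep => ('a, 'k, 'n) rep => ('m => 'n) => ('m => 'n) => bool" where
 "stq M N f g \<longleftrightarrow> f \<in> kG_hom G M N \<and> g \<in> kG_hom G M N \<and>
   (\<exists>\<theta>. klin M N \<theta> \<and> (\<forall>x\<in>carrier M. g x = f x \<oplus>\<^bsub>N\<^esub> tr M N \<theta> x))"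

lemma stqI:
 assumes "f \<in> kG_hom G M N" "g \<in> kG_hom G M N" "klin M N \<theta>"
  "!!x. x \<in> carrier M ==> g x = f x \<oplus>\<^bsub>N\<^esub> tr M N \<theta> x"
 shows "stq M N f g"
 using assms unfolding stq_def by blast

lemma stqE:
 assumes "stq M N f g"
 obtains \<theta> where "f \<in> kG_hom G M N" "g \<in> kG_hom G M N" "klin M N \<theta>"
  "!!x. x \<in> carrier M ==> g x = f x \<oplus>\<^bsub>N\<^esub> tr M N \<theta> x"
 using assms unfolding stq_def by blast

lemma stq_refl:
 assumes "kG_module G M" "kG_module G N" "f \<in> kG_hom G M N" shows "stq M N f f"
proof -
 interpret N: abelian_group N by (rule kmod_ag[OF kG_moduleD(2)[OF assms(2)]])
 show ?thesis
  by (rule stqI[OF assms(3,3) klin_zero_fun[OF kG_moduleD(2)[OF assms(2)]]])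
   (simp add: tr_zero[OF assms(2)] kG_homD(4)[OF assms(3)])
qed

lemma stq_sym:
 assumes "kG_module G M" "kG_module G N" "stq M N f g" shows "stq M N g f"
proof -
 note n = kG_moduleD[OF assms(2)] and m = kG_moduleD[OF assms(1)]
 interpret N: abelian_group N by (rule kmod_ag[OF n(2)])
 obtain \<theta> where th: "f \<in> kG_hom G M N" "g \<in> kG_hom G M N" "klin M N \<theta>"
  "!!x. x \<in> carrier M ==> g x = f x \<oplus>\<^bsub>N\<^esub> tr M N \<theta> x" using assms(3) by (rule stqE) blast
 note nn = klin_neg_fun[OF th(3) n(2) m(2)]
 show ?thesis
 proof (rule stqI[OF th(2,1) nn])
  fix x assume x: "x \<in> carrier M"
  show "f x = g x \<oplus>\<^bsub>N\<^esub> tr M N (%y. \<ominus>\<^bsub>N\<^esub> \<theta> y) x"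
   using th(4)[OF x] tr_neg[OF assms(1,2) th(3) x] kG_homD(4)[OF th(1) x]
    tr_closed[OF assms(1,2) th(3) x] tr_closed[OF assms(1,2) nn x]
   by (simp add: N.a_assoc)
 qed
qed

lemma stq_trans:
 assumes "kG_module G M" "kG_module G N" "stq M N f g" "stq M N g h" shows "stq M N f h"
proof -
 note n = kG_moduleD[OF assms(2)]
 interpret N: abelian_group N by (rule kmod_ag[OF n(2)])
 obtain \<theta> where th: "f \<in> kG_hom G M N" "g \<in> kG_hom G M N" "klin M N \<theta>"
  "!!x. x \<in> carrier M ==> g x = f x \<oplus>\<^bsub>N\<^esub> tr M N \<theta> x" using assms(3) by (rule stqE) blast
 obtain \<eta> where et: "g \<in> kG_hom G M N" "h \<in> kG_hom G M N" "klin M N \<eta>"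
  "!!x. x \<in> carrier M ==> h x = g x \<oplus>\<^bsub>N\<^esub> tr M N \<eta> x" using assms(4) by (rule stqE) blast
 show ?thesis
 proof (rule stqI[OF th(1) et(2) klin_add_fun[OF th(3) et(3) n(2)]])
  fix x assume x: "x \<in> carrier M"
  show "h x = f x \<oplus>\<^bsub>N\<^esub> tr M N (%y. \<theta> y \<oplus>\<^bsub>N\<^esub> \<eta> y) x"
   using th(4)[OF x] et(4)[OF x] kG_homD(4)[OF th(1) x] tr_closed[OF assms(1,2) th(3) x] tr_closed[OF assms(1,2) et(3) x]
   by (simp add: tr_add[OF assms(1,2) th(3) et(3) x, symmetric] N.a_assoc)
 qed
qed

lemma st_rel_iff:
 assumes "kG_module G M" "fg_kG_module G N"
 shows "(f, g) \<in> st_rel G M N \<longleftrightarrow> stq M N f g"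
proof -
 have N: "kG_module G N" using assms by (simp add: fg_kG_module_def)
 note n = kG_moduleD[OF N] and m = kG_moduleD[OF assms(1)]
 interpret N: abelian_group N by (rule kmod_ag[OF n(2)])
 let ?d = "\<lambda>x\<in>carrier M. f x \<ominus>\<^bsub>N\<^esub> g x"
 have "?d \<in> kG_hom G M N" if fg: "f \<in> kG_hom G M N" "g \<in> kG_hom G M N"
 proof (rule kG_hom_restrictI[OF assms(1)])
  note f = kG_homD[OF fg(1)] and g = kG_homD[OF fg(2)]
  show "klin M N (%x. f x \<ominus>\<^bsub>N\<^esub> g x)"
   unfolding a_minus_def by (rule klin_add_fun[OF f(1) klin_neg_fun[OF g(1) n(2) m(2)] n(2)])
  show "f (act M t x) \<ominus>\<^bsub>N\<^esub> g (act M t x) = act N t (f x \<ominus>\<^bsub>N\<^esub> g x)" if "t \<in> carrier G" "x \<in> carrier M" for t x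
   using that by (simp add: f g klin_minusD[OF klin_act[OF N] n(2) n(2)])
 qed
 then have 1: "(f, g) \<in> st_rel G M N \<longleftrightarrow> f \<in> kG_hom G M N \<and> g \<in> kG_hom G M N \<and>
   (\<exists>\<theta>. klin M N \<theta> \<and> (\<forall>x\<in>carrier M. f x \<ominus>\<^bsub>N\<^esub> g x = tr M N \<theta> x))"
  unfolding st_rel_def mem_Collect_eq prod.case phom_iff_tr[OF assms] by auto
 have 2: "f x \<ominus>\<^bsub>N\<^esub> g x = tr M N \<theta> x \<longleftrightarrow> f x = g x \<oplus>\<^bsub>N\<^esub> tr M N \<theta> x"
  if "f \<in> kG_hom G M N" "g \<in> kG_hom G M N" "klin M N \<theta>" "x \<in> carrier M" for \<theta> x
 proof -
  note c = kG_homD(4)[OF that(1,4)] kG_homD(4)[OF that(2,4)] tr_closed[OF assms(1) N that(3,4)]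
  show ?thesis
  proof
   assume "f x \<ominus>\<^bsub>N\<^esub> g x = tr M N \<theta> x"
   moreover have "g x \<oplus>\<^bsub>N\<^esub> (f x \<ominus>\<^bsub>N\<^esub> g x) = f x"
    using c by (simp add: a_minus_def N.a_ac N.r_neg N.r_neg1 N.r_neg2)
   ultimately show "f x = g x \<oplus>\<^bsub>N\<^esub> tr M N \<theta> x" by simp
  next
   assume "f x = g x \<oplus>\<^bsub>N\<^esub> tr M N \<theta> x"
   moreover have "(g x \<oplus>\<^bsub>N\<^esub> tr M N \<theta> x) \<ominus>\<^bsub>N\<^esub> g x = tr M N \<theta> x"
    using c by (simp add: a_minus_def N.a_ac N.r_neg N.r_neg1 N.r_neg2)
   ultimately show "f x \<ominus>\<^bsub>N\<^esub> g x = tr M N \<theta> x" by simp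
  qed
 qed
 have "(f, g) \<in> st_rel G M N \<longleftrightarrow> stq M N g f" unfolding 1 stq_def using 2 by blast
 then show ?thesis using stq_sym[OF assms(1) N] by blast
qed

lemma mem_st_class:
 assumes "kG_module G M" "fg_kG_module G N"
 shows "g \<in> st_class G M N f \<longleftrightarrow> stq M N f g"
 using st_rel_iff[OF assms] by (simp add: st_class_def)

lemma st_class_eq:
 assumes "kG_module G M" "fg_kG_module G N" "f \<in> kG_hom G M N"
 shows "st_class G M N f = st_class G M N g \<longleftrightarrow> stq M N f g"
proof
 have N: "kG_module G N" using assms by (simp add: fg_kG_module_def)
 show "stq M N f g" if "st_class G M N f = st_class G M N g"
  using stq_refl[OF assms(1) N assms(3)] mem_st_class[OF assms(1,2)] that stq_sym[OF assms(1) N] by blast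
 show "st_class G M N f = st_class G M N g" if "stq M N f g"
  using that mem_st_class[OF assms(1,2)] stq_sym[OF assms(1) N] stq_trans[OF assms(1) N] by blast
qed

lemma st_homE:
 assumes "\<alpha> \<in> st_hom G M N"
 obtains f where "f \<in> kG_hom G M N" "\<alpha> = st_class G M N f"
 using assms unfolding st_hom_def quotient_def st_class_def by blast

lemma st_class_hom: "f \<in> kG_hom G M N ==> st_class G M N f \<in> st_hom G M N"
 unfolding st_hom_def quotient_def st_class_def by blast

lemma stq_compose:
 assumes "kG_module G M" "kG_module G N" "kG_module G P" "stq M N f f'" "stq N P g g'"
 shows "stq M P (compose (carrier M) g f) (compose (carrier M) g' f')"
proof -
 note m = kG_moduleD[OF assms(1)] and n = kG_moduleD[OF assms(2)] and p = kG_moduleD[OF assms(3)]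
 interpret P: abelian_group P by (rule kmod_ag[OF p(2)])
 obtain \<theta> where th: "f \<in> kG_hom G M N" "f' \<in> kG_hom G M N" "klin M N \<theta>"
  "!!x. x \<in> carrier M ==> f' x = f x \<oplus>\<^bsub>N\<^esub> tr M N \<theta> x" using assms(4) by (rule stqE) blast
 obtain \<eta> where et: "g \<in> kG_hom G N P" "g' \<in> kG_hom G N P" "klin N P \<eta>"
  "!!x. x \<in> carrier N ==> g' x = g x \<oplus>\<^bsub>P\<^esub> tr N P \<eta> x" using assms(5) by (rule stqE) blast
 note k1 = klin_comp[OF th(3) kG_homD(1)[OF et(1)]] and k2 = klin_comp[OF kG_homD(1)[OF th(2)] et(3)]
 show ?thesis
 proof (rule stqI[OF kG_hom_compose[OF assms(1) th(1) et(1)] kG_hom_compose[OF assms(1) th(2) et(2)] klin_add_fun[OF k1 k2 p(2)]])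
  fix x assume x: "x \<in> carrier M"
  note c = kG_homD(4)[OF th(1) x] kG_homD(4)[OF th(2) x] tr_closed[OF assms(1,2) th(3) x]
  have "g' (f' x) = g (f' x) \<oplus>\<^bsub>P\<^esub> tr N P \<eta> (f' x)" by (rule et(4)[OF c(2)])
  also have "g (f' x) = g (f x) \<oplus>\<^bsub>P\<^esub> tr M P (%y. g (\<theta> y)) x"
   using klin_addD[OF kG_homD(1)[OF et(1)] c(1,3)] tr_comp_left[OF assms(1-3) th(3) x et(1)] th(4)[OF x] by simp
  also have "tr N P \<eta> (f' x) = tr M P (%y. \<eta> (f' y)) x" by (rule tr_comp_right[OF assms(1-3) et(3) x th(2)])
  finally show "compose (carrier M) g' f' x = compose (carrier M) g f x \<oplus>\<^bsub>P\<^esub> tr M P (%y. g (\<theta> y) \<oplus>\<^bsub>P\<^esub> \<eta> (f' y)) x"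
   using x tr_closed[OF assms(1,3) k1 x] tr_closed[OF assms(1,3) k2 x] kG_homD(4)[OF et(1) c(1)]
   by (simp add: compose_def tr_add[OF assms(1,3) k1 k2 x, symmetric] P.a_assoc)
 qed
qed

lemma st_comp_class:
 assumes "kG_module G M" "fg_kG_module G N" "fg_kG_module G P" "f \<in> kG_hom G M N" "g \<in> kG_hom G N P"
 shows "st_comp G M P (st_class G N P g) (st_class G M N f) = st_class G M P (compose (carrier M) g f)"
proof -
 have N: "kG_module G N" and P: "kG_module G P" using assms by (auto simp: fg_kG_module_def)
 have "st_class G M P (compose (carrier M) g f) = st_class G M P (compose (carrier M) g' f')"
  if "g' \<in> st_class G N P g" "f' \<in> st_class G M N f" for f' g'
  using stq_compose[OF assms(1) N P, of f f' g g'] that mem_st_class[OF N assms(3)] mem_st_class[OF assms(1,2)]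
   st_class_eq[OF assms(1,3) kG_hom_compose[OF assms(1,4,5)]] by simp
 moreover have "g \<in> st_class G N P g" "f \<in> st_class G M N f"
  using stq_refl[OF N P assms(5)] stq_refl[OF assms(1) N assms(4)] mem_st_class[OF N assms(3)] mem_st_class[OF assms(1,2)] by auto
 ultimately show ?thesis unfolding st_comp_def by blast
qed

text \<open>Projection formula: since \<open>g\<close> is equivariant, the two translations in the
  second factor cancel.\<close>

lemma tr_tensor_left:
 assumes "kG_module G M" "kG_module G N" "kG_module G M'" "kG_module G N'" "klin M M' \<theta>" "g \<in> kG_hom G N N'"
  "x \<in> carrier M" "y \<in> carrier N"
 shows "tr (M \<otimes>\<^sub>k N) (M' \<otimes>\<^sub>k N') (tensor_hom M N M' N' \<theta> g) (pure_tensor M N x y) = pure_tensor M' N' (tr M M' \<theta> x) (g y)"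
proof -
 note m = kG_moduleD[OF assms(1)] and n = kG_moduleD[OF assms(2)] and m' = kG_moduleD[OF assms(3)] and n' = kG_moduleD[OF assms(4)]
 note gy = kG_homD(4)[OF assms(6,8)]
 note kl = kbilD(1)[OF pure_kbil[OF m'(2) n'(2)] gy]
 have "pure_tensor M' N' (tr M M' \<theta> x) (g y) = finsum (M' \<otimes>\<^sub>k N') (%t. pure_tensor M' N' (act M' t (\<theta> (act M (inv t) x))) (g y)) (carrier G)"
  unfolding tr_def by (rule klin_finsumD[OF kl m'(2) kmod_tensor[OF m'(2) n'(2)] finite_G tr_term_closed[OF assms(1,3,5,7)]])
 also have "... = tr (M \<otimes>\<^sub>k N) (M' \<otimes>\<^sub>k N') (tensor_hom M N M' N' \<theta> g) (pure_tensor M N x y)"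
  unfolding tr_def
 proof (rule finsum_cong_simple[OF kmod_tensor[OF m'(2) n'(2)]])
  fix t assume t: "t \<in> carrier G"
  note ti = inv_closed[OF t]
  note cl = m(3)[OF ti assms(7)] n(3)[OF ti assms(8)]
  have e: "act (M' \<otimes>\<^sub>k N') t (tensor_hom M N M' N' \<theta> g (act (M \<otimes>\<^sub>k N) (inv t) (pure_tensor M N x y))) =
    pure_tensor M' N' (act M' t (\<theta> (act M (inv t) x))) (act N' t (g (act N (inv t) y)))"
   by (simp only: act_pure[OF assms(1,2) ti assms(7,8)] tensor_hom_pure[OF m(2) n(2) m'(2) n'(2) assms(5) kG_homD(1)[OF assms(6)] cl]
     act_pure[OF assms(3,4) t klin_closed[OF assms(5) cl(1)] kG_homD(4)[OF assms(6) cl(2)]])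
  have "act N' t (g (act N (inv t) y)) = g y"
   by (simp only: kG_homD(2)[OF assms(6) t cl(2), symmetric] act_inv_act(2)[OF assms(2) t assms(8)])
  with e show "pure_tensor M' N' (act M' t (\<theta> (act M (inv t) x))) (g y) =
    act (M' \<otimes>\<^sub>k N') t (tensor_hom M N M' N' \<theta> g (act (M \<otimes>\<^sub>k N) (inv t) (pure_tensor M N x y)))" by simp
  then show "act (M' \<otimes>\<^sub>k N') t (tensor_hom M N M' N' \<theta> g (act (M \<otimes>\<^sub>k N) (inv t) (pure_tensor M N x y))) \<in> carrier (M' \<otimes>\<^sub>k N')"
   using klin_closed[OF kl tr_term_closed[OF assms(1,3,5,7) t]] by simp
 qed
 finally show ?thesis by simp
qed

lemma stq_tensor_left:
 assumes "kG_module G M" "kG_module G N" "kG_module G M'" "kG_module G N'" "stq M M' f f'" "g \<in> kG_hom G N N'"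
 shows "stq (M \<otimes>\<^sub>k N) (M' \<otimes>\<^sub>k N') (tensor_hom M N M' N' f g) (tensor_hom M N M' N' f' g)"
proof -
 note m = kG_moduleD[OF assms(1)] and n = kG_moduleD[OF assms(2)] and m' = kG_moduleD[OF assms(3)] and n' = kG_moduleD[OF assms(4)]
 obtain \<theta> where th: "f \<in> kG_hom G M M'" "f' \<in> kG_hom G M M'" "klin M M' \<theta>"
  "!!x. x \<in> carrier M ==> f' x = f x \<oplus>\<^bsub>M'\<^esub> tr M M' \<theta> x" using assms(5) by (rule stqE) blast
 note et = assms(6)
 note kt = kG_tensor[OF assms(1,2)] kG_tensor[OF assms(3,4)]
 note km = kG_moduleD(2)[OF kt(1)] kG_moduleD(2)[OF kt(2)]
 show ?thesis
 proof (rule stqI)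
  show h: "tensor_hom M N M' N' f g \<in> kG_hom G (M \<otimes>\<^sub>k N) (M' \<otimes>\<^sub>k N')" "tensor_hom M N M' N' f' g \<in> kG_hom G (M \<otimes>\<^sub>k N) (M' \<otimes>\<^sub>k N')"
   by (rule tensor_hom_hom[OF assms(1-4)], rule th, rule et)+
  show k: "klin (M \<otimes>\<^sub>k N) (M' \<otimes>\<^sub>k N') (tensor_hom M N M' N' \<theta> g)"
   by (rule tensor_hom_klin[OF m(2) n(2) m'(2) n'(2) th(3) kG_homD(1)[OF et]])
  show "tensor_hom M N M' N' f' g t = tensor_hom M N M' N' f g t \<oplus>\<^bsub>M' \<otimes>\<^sub>k N'\<^esub> tr (M \<otimes>\<^sub>k N) (M' \<otimes>\<^sub>k N') (tensor_hom M N M' N' \<theta> g) t"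
   if t: "t \<in> carrier (M \<otimes>\<^sub>k N)" for t
  proof (rule klin_eq_pure[OF m(2) n(2) kG_homD(1)[OF h(2)] klin_add_fun[OF kG_homD(1)[OF h(1)] tr_klin[OF kt k] km(2)] t])
   fix x y assume x: "x \<in> carrier M" and y: "y \<in> carrier N"
   show "tensor_hom M N M' N' f' g (pure_tensor M N x y) = tensor_hom M N M' N' f g (pure_tensor M N x y) \<oplus>\<^bsub>M' \<otimes>\<^sub>k N'\<^esub>
     tr (M \<otimes>\<^sub>k N) (M' \<otimes>\<^sub>k N') (tensor_hom M N M' N' \<theta> g) (pure_tensor M N x y)"
    unfolding tensor_hom_hom_pure[OF assms(1-4) th(2) et x y] tensor_hom_hom_pure[OF assms(1-4) th(1) et x y]
     tr_tensor_left[OF assms(1-4) th(3) et x y] th(4)[OF x]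
    by (rule klin_addD[OF kbilD(1)[OF pure_kbil[OF m'(2) n'(2)] kG_homD(4)[OF et y]] kG_homD(4)[OF th(1) x] tr_closed[OF assms(1,3) th(3) x]])
  qed
 qed
qed

text \<open>Conjugation by the swap reduces compatibility in the second tensor factor to
  compatibility in the first.\<close>

lemma tensor_hom_swap:
 assumes "kG_module G M" "kG_module G N" "kG_module G M'" "kG_module G N'" "f \<in> kG_hom G M M'" "g \<in> kG_hom G N N'"
 shows "compose (carrier (M \<otimes>\<^sub>k N)) (swap_hom N' M') (compose (carrier (M \<otimes>\<^sub>k N)) (tensor_hom N M N' M' g f) (swap_hom M N)) =
  tensor_hom M N M' N' f g"
proof -
 note kt = kG_tensor[OF assms(1,2)] and sw = swap_hom_hom[OF assms(1,2)] and sw' = swap_hom_hom[OF assms(4,3)]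
 note th = tensor_hom_hom[OF assms(2,1,4,3,6,5)] and th' = tensor_hom_hom[OF assms]
 note kc = kG_hom_compose[OF kt kG_hom_compose[OF kt sw th] sw']
 note m = kG_moduleD(2)[OF assms(1)] kG_moduleD(2)[OF assms(2)]
 show ?thesis
 proof (rule kG_hom_eqI[OF kc th'], rule klin_eq_pure[OF m kG_homD(1)[OF kc] kG_homD(1)[OF th']], assumption)
  fix x y assume x: "x \<in> carrier M" and y: "y \<in> carrier N"
  show "compose (carrier (M \<otimes>\<^sub>k N)) (swap_hom N' M') (compose (carrier (M \<otimes>\<^sub>k N)) (tensor_hom N M N' M' g f) (swap_hom M N)) (pure_tensor M N x y) =
    tensor_hom M N M' N' f g (pure_tensor M N x y)"
   by (simp only: compose_eq[OF pure_closed[OF m x y]] swap_pure[OF assms(1,2) x y] tensor_hom_hom_pure[OF assms(2,1,4,3,6,5) y x]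
     swap_pure[OF assms(4,3) kG_homD(4)[OF assms(6) y] kG_homD(4)[OF assms(5) x]] tensor_hom_hom_pure[OF assms x y])
 qed
qed

lemma stq_tensor:
 assumes "kG_module G M" "kG_module G N" "kG_module G M'" "kG_module G N'" "stq M M' f f'" "stq N N' g g'"
 shows "stq (M \<otimes>\<^sub>k N) (M' \<otimes>\<^sub>k N') (tensor_hom M N M' N' f g) (tensor_hom M N M' N' f' g')"
proof -
 have h: "f' \<in> kG_hom G M M'" "g \<in> kG_hom G N N'" "g' \<in> kG_hom G N N'" using assms(5,6) by (auto simp: stq_def)
 note kt = kG_tensor[OF assms(1,2)] kG_tensor[OF assms(2,1)] kG_tensor[OF assms(4,3)] kG_tensor[OF assms(3,4)]
 note sw = stq_refl[OF kt(1,2) swap_hom_hom[OF assms(1,2)]] and sw' = stq_refl[OF kt(3,4) swap_hom_hom[OF assms(4,3)]]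
 have "stq (M \<otimes>\<^sub>k N) (M' \<otimes>\<^sub>k N') (tensor_hom M N M' N' f' g) (tensor_hom M N M' N' f' g')"
  using stq_compose[OF kt(1,3,4) stq_compose[OF kt(1-3) sw stq_tensor_left[OF assms(2,1,4,3,6) h(1)]] sw']
  unfolding tensor_hom_swap[OF assms(1-4) h(1,2)] tensor_hom_swap[OF assms(1-4) h(1,3)] .
 then show ?thesis by (rule stq_trans[OF kt(1,4) stq_tensor_left[OF assms(1-5) h(2)]])
qed

lemma st_tensor_class:
 assumes "kG_module G M" "kG_module G N" "fg_kG_module G M'" "fg_kG_module G N'" "f \<in> kG_hom G M M'" "g \<in> kG_hom G N N'"
 shows "st_tensor G M N M' N' (st_class G M M' f) (st_class G N N' g) =
  st_class G (M \<otimes>\<^sub>k N) (M' \<otimes>\<^sub>k N') (tensor_hom M N M' N' f g)"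
proof -
 have k: "kG_module G M'" "kG_module G N'" using assms by (auto simp: fg_kG_module_def)
 have "st_class G (M \<otimes>\<^sub>k N) (M' \<otimes>\<^sub>k N') (tensor_hom M N M' N' f g) = st_class G (M \<otimes>\<^sub>k N) (M' \<otimes>\<^sub>k N') (tensor_hom M N M' N' f' g')"
  if "f' \<in> st_class G M M' f" "g' \<in> st_class G N N' g" for f' g'
  using stq_tensor[OF assms(1,2) k, of f f' g g'] that mem_st_class[OF assms(1,3)] mem_st_class[OF assms(2,4)]
   st_class_eq[OF kG_tensor[OF assms(1,2)] fg_tensor[OF assms(3,4)] tensor_hom_hom[OF assms(1,2) k assms(5,6)]] by simp
 moreover have "f \<in> st_class G M M' f" "g \<in> st_class G N N' g"
  using stq_refl[OF assms(1) k(1) assms(5)] stq_refl[OF assms(2) k(2) assms(6)] mem_st_class[OF assms(1,3)] mem_st_class[OF assms(2,4)] by auto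
 ultimately show ?thesis unfolding st_tensor_def by blast
qed

lemma fg_unit: "fg_kG_module G (\<one>\<^sub>k :: ('a, 'k::field, 'k) rep)"
proof (rule coords_fg[OF kG_unit[OF group_axioms]])
 have "klin (pmod UNIV) (\<one>\<^sub>k :: ('a, 'k, 'k) rep) (%\<phi>. lookup \<phi> 0)" by (rule klinI) (auto simp: lookup_add)
 then show "coords (\<one>\<^sub>k :: ('a, 'k, 'k) rep) 1 (single 0) (%\<phi>. lookup \<phi> 0)"
  unfolding coords_def by (auto intro!: poly_mapping_eqI simp: lookup_cut lookup_single when_def)
qed

lemma id_hom_hom: "kG_module G M ==> id_hom M \<in> kG_hom G M M"
 unfolding id_hom_def by (rule kG_hom_restrictI[OF _ klin_ident]) simp_all

end

section \<open>From ring-objects to stable algebras in coordinates\<close>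

section \<open>From ring-objects to stable algebras\<close>

lemma klin_lin:
 assumes "klin (pmod UNIV) P f" "vector_space s" "add P = (+)" "module.smult P = s"
 shows "lin pm_scale s f"
 unfolding lin_def using klinD(2,3)[OF assms(1)] assms(2-4) by simp

lemma lin_klin: "linV f ==> klin (pmod UNIV) (pmod UNIV) f"
 by (rule klinI) (auto simp: lin_props)

text \<open>A module over a cyclic group with a chosen generator and chosen coordinates. By
  \<open>pow_bij\<close> sums over the group become sums over exponents, the form used by the
  coordinate theory.\<close>

locale crep = finite_group G for G :: "('a, 'b) monoid_scheme" (structure) +
 fixes g :: 'a and q :: nat and A :: "('a, 'k::field, 'm) rep" and d co vec
 assumes g_carrier: "g \<in> carrier G" and pow_bij: "bij_betw (%s::nat. g [^] s) {..<q} (carrier G)"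
  and pow_q: "g [^] q = \<one>" and A: "kG_module G A" and coords: "coords A d co vec"
begin

lemmas Ak = kG_moduleD[OF A]
lemmas cv = coordsD[OF coords]
lemmas co_klin = coords_co[OF coords Ak(2)]
lemma co_add: "x \<in> carrier A ==> y \<in> carrier A ==> co (x \<oplus>\<^bsub>A\<^esub> y) = co x + co y" using klin_addD[OF co_klin] by simp
lemma co_scale: "x \<in> carrier A ==> co (c \<odot>\<^bsub>A\<^esub> x) = pm_scale c (co x)" using klin_scaleD[OF co_klin] by simp

lemma gs_carrier: "g [^] (s::nat) \<in> carrier G" using g_carrier by simp

text \<open>The action of the generator in coordinates; the second summand extends it by the
  identity beyond the first \<open>d\<close> coordinates, as the locale \<open>cyc\<close>
  demands.\<close>

definition h where "h x = co (act A g (vec x)) + (x - cut d x)"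
definition hi where "hi x = co (act A (inv g) (vec x)) + (x - cut d x)"

lemma cut_sum: "y \<in> carrier A ==> cut d (co y + (x - cut d x)) = co y"
 by (simp add: lin_props[OF cut_lin] cv)

lemma vec_sum: "y \<in> carrier A ==> vec (co y + (x - cut d x)) = y"
 using cut_sum[of y x] cv(6,8) by metis

lemma g_vec: "act A g (vec x) \<in> carrier A" "act A (inv g) (vec x) \<in> carrier A"
 using Ak(3) g_carrier cv(2) by auto

lemma vec_h: "vec (h x) = act A g (vec x)" unfolding h_def by (rule vec_sum[OF g_vec(1)])
lemma vec_hi: "vec (hi x) = act A (inv g) (vec x)" unfolding hi_def by (rule vec_sum[OF g_vec(2)])
lemma cut_h: "cut d (h x) = co (act A g (vec x))" unfolding h_def by (rule cut_sum[OF g_vec(1)])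
lemma cut_hi: "cut d (hi x) = co (act A (inv g) (vec x))" unfolding hi_def by (rule cut_sum[OF g_vec(2)])

lemma h_pow: "(h ^^ s) x = co (act A (g [^] s) (vec x)) + (x - cut d x) \<and> vec ((h ^^ s) x) = act A (g [^] s) (vec x)"
proof (induction s)
 case 0 then show ?case by (simp add: Ak(6) cv)
next
 case (Suc s)
 have e: "act A (g [^] Suc s) (vec x) = act A g (act A (g [^] s) (vec x))"
  unfolding nat_pow_Suc2[OF g_carrier] by (rule Ak(7)[OF g_carrier gs_carrier cv(2)])
 have m: "act A (g [^] s) (vec x) \<in> carrier A" using Ak(3) gs_carrier cv(2) by simp
 have "cut d ((h ^^ s) x) = co (act A (g [^] s) (vec x))" using Suc cut_sum[OF m] by simp
 then have 2: "(h ^^ s) x - cut d ((h ^^ s) x) = x - cut d x" using Suc by simp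
 have "(h ^^ Suc s) x = co (act A (g [^] Suc s) (vec x)) + (x - cut d x)"
  unfolding e funpow.simps o_apply h_def[of "(h ^^ s) x"] 2 Suc[THEN conjunct2] ..
 moreover have "vec ((h ^^ Suc s) x) = act A (g [^] Suc s) (vec x)"
  unfolding e funpow.simps o_apply vec_h Suc[THEN conjunct2] ..
 ultimately show ?case by blast
qed

lemma hi_pow: "(hi ^^ s) x = co (act A (inv (g [^] s)) (vec x)) + (x - cut d x) \<and> vec ((hi ^^ s) x) = act A (inv (g [^] s)) (vec x)"
proof (induction s)
 case 0 then show ?case by (simp add: Ak(6) cv)
next
 case (Suc s)
 have e: "act A (inv (g [^] Suc s)) (vec x) = act A (inv g) (act A (inv (g [^] s)) (vec x))"
  using g_carrier gs_carrier by (simp add: inv_mult_group Ak(7) cv(2))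
 have m: "act A (inv (g [^] s)) (vec x) \<in> carrier A" using Ak(3) gs_carrier cv(2) by simp
 have "cut d ((hi ^^ s) x) = co (act A (inv (g [^] s)) (vec x))" using Suc cut_sum[OF m] by simp
 then have 2: "(hi ^^ s) x - cut d ((hi ^^ s) x) = x - cut d x" using Suc by simp
 have "(hi ^^ Suc s) x = co (act A (inv (g [^] Suc s)) (vec x)) + (x - cut d x)"
  unfolding e funpow.simps o_apply hi_def[of "(hi ^^ s) x"] 2 Suc[THEN conjunct2] ..
 moreover have "vec ((hi ^^ Suc s) x) = act A (inv (g [^] Suc s)) (vec x)"
  unfolding e funpow.simps o_apply vec_hi Suc[THEN conjunct2] ..
 ultimately show ?case by blast
qed

lemmas vec_h_pow = h_pow[THEN conjunct2]
lemmas vec_hi_pow = hi_pow[THEN conjunct2]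

lemma h_pow_co: "y \<in> carrier A ==> (h ^^ s) (co y) = co (act A (g [^] s) y)"
 using h_pow[of s "co y"] by (simp add: cv)

lemma twist_lin:
 assumes "t \<in> carrier G" shows "linV (%x. co (act A t (vec x)) + (x - cut d x))"
 by (intro lin_add lin_diff lin_id cut_lin vs_pm klin_lin[OF klin_comp[OF klin_comp[OF cv(1) klin_act[OF A assms]] co_klin]]) auto

sublocale cyc d q h hi
proof (rule cyc.intro)
 show "linV h" unfolding h_def[abs_def] by (rule twist_lin[OF g_carrier])
 show "linV hi" unfolding hi_def[abs_def] by (rule twist_lin) (use g_carrier in simp)
 show "h (hi x) = x" for x
  using cut_hi[of x] vec_hi[of x] act_inv_act(2)[OF A g_carrier cv(2)]
  unfolding h_def by (simp add: hi_def cv)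
 show "hi (h x) = x" for x
  using cut_h[of x] vec_h[of x] act_inv_act(1)[OF A g_carrier cv(2)]
  unfolding hi_def by (simp add: h_def cv)
 show "(h ^^ q) x = x" for x using h_pow[of q x] by (simp add: pow_q Ak(6) cv)
 show "h (cut d x) = cut d (h x)" for x unfolding cut_h by (simp add: h_def cv)
 show "cut d (h x - x) = h x - x" for x by (simp add: lin_props[OF cut_lin] cut_h) (simp add: h_def)
qed

lemma co_tr:
 assumes "kG_module G L" "klin L A \<theta>" "t \<in> carrier L"
 shows "co (tr L A \<theta> t) = (\<Sum>s<q. (h ^^ s) (co (\<theta> (act L (inv (g [^] s)) t))))"
proof -
 note c = tr_term_closed[OF assms(1) A assms(2,3)]
 have "co (tr L A \<theta> t) = finsum (pmod UNIV) (%s. co (act A s (\<theta> (act L (inv s) t)))) (carrier G)"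
  unfolding tr_def by (rule klin_finsumD[OF co_klin Ak(2) kmod_pmod finite_G c])
 also have "... = (\<Sum>s\<in>carrier G. co (act A s (\<theta> (act L (inv s) t))))"
  by (rule finsum_type[OF kmod_pmod]) (auto simp: finite_G)
 also have "... = (\<Sum>s<q. co (act A (g [^] s) (\<theta> (act L (inv (g [^] s)) t))))"
  by (rule sum.reindex_bij_betw[OF pow_bij, symmetric])
 also have "... = (\<Sum>s<q. (h ^^ s) (co (\<theta> (act L (inv (g [^] s)) t))))"
  by (rule sum.cong[OF refl], rule h_pow_co[symmetric], rule klin_closed[OF assms(2)])
   (use kG_moduleD(3)[OF assms(1)] assms(3) gs_carrier in simp)
 finally show ?thesis .
qed

lemma stq_co:
 assumes "kG_module G L" "stq L A f f'"
 shows "\<exists>\<theta>. klin L A \<theta> \<and> (\<forall>t\<in>carrier L. co (f' t) - co (f t) = (\<Sum>s<q. (h ^^ s) (co (\<theta> (act L (inv (g [^] s)) t)))))"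
proof -
 obtain \<theta> where th: "f \<in> kG_hom G L A" "f' \<in> kG_hom G L A" "klin L A \<theta>"
  "!!x. x \<in> carrier L ==> f' x = f x \<oplus>\<^bsub>A\<^esub> tr L A \<theta> x" using assms(2) by (rule stqE) blast
 show ?thesis
  by (intro exI[of _ \<theta>] conjI ballI th(3))
   (simp add: th(4) co_add kG_homD(4)[OF th(1)] tr_closed[OF assms(1) A th(3)] co_tr[OF assms(1) th(3)])
qed

lemma stq_SZ1:
 assumes "stq A A f f'" shows "SZ1 (%x. co (f' (vec x)) - co (f (vec x)))"
proof -
 obtain \<theta> where th: "klin A A \<theta>"
  "!!t. t \<in> carrier A ==> co (f' t) - co (f t) = (\<Sum>s<q. (h ^^ s) (co (\<theta> (act A (inv (g [^] s)) t))))"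
  using stq_co[OF A assms] by blast
 show ?thesis
  by (rule SZ1I[OF klin_lin[OF klin_comp[OF klin_comp[OF cv(1) th(1)] co_klin] vs_pm]])
   (simp_all add: th(2) cv(2) vec_hi_pow)
qed

lemma inv_gs_carrier: "inv (g [^] (s::nat)) \<in> carrier G" using gs_carrier by simp

lemma bil_kbil:
 assumes "kbil A A (pmod UNIV) b" shows "bil (%x y. b (vec x) (vec y))"
proof (intro conjI allI)
 show "linV (%y. b (vec x) (vec y))" for x
  by (rule klin_lin[OF klin_comp[OF cv(1) kbilD(2)[OF assms cv(2)]]]) simp_all
 show "linV (%x. b (vec x) (vec y))" for y
  by (rule klin_lin[OF klin_comp[OF cv(1) kbilD(1)[OF assms cv(2)]]]) simp_all
qed

abbreviation AA where "AA \<equiv> A \<otimes>\<^sub>k A"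
lemmas kAA = kG_tensor[OF A A]
lemmas kAA_mod = kmod_tensor[OF Ak(2) Ak(2)]
abbreviation pt where "pt \<equiv> pure_tensor A A"

lemma kbil_klin: "klin AA P f ==> kbil A A P (%x y. f (pt x y))"
 by (rule kbil_comp[OF pure_kbil[OF Ak(2) Ak(2)] klin_ident klin_ident])

lemma pt_closed: "x \<in> carrier A ==> y \<in> carrier A ==> pt x y \<in> carrier AA"
 by (rule pure_closed[OF Ak(2) Ak(2)])

lemma stq_SZ2:
 assumes "stq AA A f f'" shows "SZ2 (%x y. co (f' (pt (vec x) (vec y))) - co (f (pt (vec x) (vec y))))"
proof -
 obtain \<theta> where th: "klin AA A \<theta>"
  "!!t. t \<in> carrier AA ==> co (f' t) - co (f t) = (\<Sum>s<q. (h ^^ s) (co (\<theta> (act AA (inv (g [^] s)) t))))"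
  using stq_co[OF kAA assms] by blast
 show ?thesis
  by (rule SZ2I[OF bil_kbil[OF kbil_klin[OF klin_comp[OF th(1) co_klin]]]])
   (simp add: th(2)[OF pt_closed] cv(2) vec_hi_pow act_pure[OF A A inv_gs_carrier] del: tensor_simps)
qed

lemma stq_SZ3:
 assumes "stq (AA \<otimes>\<^sub>k A) A f f'"
 shows "SZ3 (%x y z. co (f' (pure_tensor AA A (pt (vec x) (vec y)) (vec z))) - co (f (pure_tensor AA A (pt (vec x) (vec y)) (vec z))))"
proof -
 obtain \<theta> where th: "klin (AA \<otimes>\<^sub>k A) A \<theta>"
  "!!t. t \<in> carrier (AA \<otimes>\<^sub>k A) ==> co (f' t) - co (f t) = (\<Sum>s<q. (h ^^ s) (co (\<theta> (act (AA \<otimes>\<^sub>k A) (inv (g [^] s)) t))))"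
  using stq_co[OF kG_tensor[OF kAA A] assms] by blast
 note k = klin_comp[OF th(1) co_klin]
 note b = kbilD[OF kbil_comp[OF pure_kbil[OF kAA_mod Ak(2)] klin_ident klin_ident k]]
 note b2 = kbilD[OF pure_kbil[OF Ak(2) Ak(2)]]
 have "tri (%x y z. co (\<theta> (pure_tensor AA A (pt (vec x) (vec y)) (vec z))))"
 proof (intro conjI allI)
  show "linV (%x. co (\<theta> (pure_tensor AA A (pt (vec x) (vec y)) (vec z))))" for y z
   by (rule klin_lin[OF klin_comp[OF cv(1) klin_comp[OF b2(1)[OF cv(2)] b(1)[OF cv(2)]]]]) simp_all
  show "linV (%y. co (\<theta> (pure_tensor AA A (pt (vec x) (vec y)) (vec z))))" for x z
   by (rule klin_lin[OF klin_comp[OF cv(1) klin_comp[OF b2(2)[OF cv(2)] b(1)[OF cv(2)]]]]) simp_all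
  show "linV (%z. co (\<theta> (pure_tensor AA A (pt (vec x) (vec y)) (vec z))))" for x y
   by (rule klin_lin[OF klin_comp[OF cv(1) b(2)[OF pt_closed[OF cv(2) cv(2)]]]]) simp_all
 qed
 then show ?thesis
 proof (rule SZ3I)
  fix x y z
  have "act (AA \<otimes>\<^sub>k A) (inv (g [^] s)) (pure_tensor AA A (pt (vec x) (vec y)) (vec z)) =
    pure_tensor AA A (pt (vec ((hi ^^ s) x)) (vec ((hi ^^ s) y))) (vec ((hi ^^ s) z))" for s :: nat
   unfolding act_pure[OF kAA A inv_gs_carrier pt_closed[OF cv(2) cv(2)] cv(2)] act_pure[OF A A inv_gs_carrier cv(2) cv(2)]
   by (simp only: vec_hi_pow)
  then show "co (f' (pure_tensor AA A (pt (vec x) (vec y)) (vec z))) - co (f (pure_tensor AA A (pt (vec x) (vec y)) (vec z))) =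
    (\<Sum>s<q. (h ^^ s) (co (\<theta> (pure_tensor AA A (pt (vec ((hi ^^ s) x)) (vec ((hi ^^ s) y))) (vec ((hi ^^ s) z))))))"
   by (simp only: th(2)[OF pure_closed[OF kAA_mod Ak(2) pt_closed[OF cv(2) cv(2)] cv(2)]])
 qed
qed

abbreviation (input) II where "II \<equiv> (\<one>\<^sub>k :: ('a, 'k, 'k) rep)"

text \<open>Coordinates of a tensor in the basis of pure tensors of basis vectors; they supply
  \<open>ee\<close> as well as \<open>\<Theta>\<close>.\<close>

definition W :: "nat => nat => ('m \<times> 'm \<Rightarrow>\<^sub>0 'k) set => 'k" where
 "W i j = tensor_lift A A II (%x y. lookup (co x) i * lookup (co y) j)"

lemma kbil_bilS:
 fixes P :: "('k, 'w::ab_group_add, 'z) module_scheme"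
 assumes "bilS s \<beta>" "add P = (+)" "carrier P = UNIV" "module.smult P = s"
 shows "kbil A A P (%x y. \<beta> (co x) (co y))"
proof (rule kbilI)
 show "klin A P (%x. \<beta> (co x) (co y))" for y
  using lin_props[of pm_scale s "%x. \<beta> x (co y)"] assms by (intro klinI) (simp_all add: co_add co_scale)
 show "klin A P (%y. \<beta> (co x) (co y))" for x
  using lin_props[of pm_scale s "\<beta> (co x)"] assms by (intro klinI) (simp_all add: co_add co_scale)
qed

lemma W_kbil: "kbil A A II (%x y. lookup (co x) i * lookup (co y) j)"
 by (rule kbil_bilS) (auto intro: lin_scale lin_scale_left)

lemma W_klin: "klin AA II (W i j)" unfolding W_def by (rule lift_klin[OF Ak(2) Ak(2) kmod_unit W_kbil])

lemma W_pure: "x \<in> carrier A ==> y \<in> carrier A ==> W i j (pt x y) = lookup (co x) i * lookup (co y) j"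
 unfolding W_def by (rule lift_pure[OF Ak(2) Ak(2) kmod_unit W_kbil])

abbreviation bv where "bv i \<equiv> vec (pm_basis i)"

lemma tens_expand:
 assumes "kmod P" "klin AA P f" "t \<in> carrier AA"
 shows "f t = finsum P (%i. finsum P (%j. W i j t \<odot>\<^bsub>P\<^esub> f (pt (bv i) (bv j))) {..<d}) {..<d}"
proof (rule klin_eq_pure[OF Ak(2) Ak(2) assms(2) _ assms(3)])
 have fc: "f (pt x y) \<in> carrier P" if "x \<in> carrier A" "y \<in> carrier A" for x y
  by (rule klin_closed[OF assms(2) pt_closed[OF that]])
 have W1: "klin AA P (%t. W i j t \<odot>\<^bsub>P\<^esub> f (pt (bv i) (bv j)))" for i j
  using klinD[OF W_klin[of i j]] fc[OF cv(2) cv(2)]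
  by (intro klinI) (simp_all add: kmod_scale[OF assms(1)] kmod_ldistr[OF assms(1)] kmod_assoc[OF assms(1)])
 show "klin AA P (%t. finsum P (%i. finsum P (%j. W i j t \<odot>\<^bsub>P\<^esub> f (pt (bv i) (bv j))) {..<d}) {..<d})"
  by (intro klin_finsum_fun W1 assms(1) kAA_mod) auto
 fix x y assume x: "x \<in> carrier A" and y: "y \<in> carrier A"
 note b = kbilD[OF kbil_klin[OF assms(2)]]
 have ex: "F x = finsum P (%i. lookup (co x) i \<odot>\<^bsub>P\<^esub> F (bv i)) {..<d}" if F: "klin A P F" and x: "x \<in> carrier A" for F x
 proof -
  have "F x = F (finsum A (%i. lookup (co x) i \<odot>\<^bsub>A\<^esub> bv i) {..<d})"
   using vec_expand[OF coords Ak(2), of "co x"] cv(6)[OF x] by simp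
  also have "... = finsum P (%i. F (lookup (co x) i \<odot>\<^bsub>A\<^esub> bv i)) {..<d}"
   by (rule klin_finsumD[OF F Ak(2) assms(1)]) (auto intro!: kmod_scale[OF Ak(2)] cv(2))
  also have "... = finsum P (%i. lookup (co x) i \<odot>\<^bsub>P\<^esub> F (bv i)) {..<d}"
   by (rule finsum_cong_simple[OF assms(1)])
    (auto intro!: kmod_scale[OF assms(1)] klin_closed[OF F] cv(2) klin_scaleD[OF F])
  finally show ?thesis .
 qed
 have "f (pt x y) = finsum P (%i. lookup (co x) i \<odot>\<^bsub>P\<^esub> f (pt (bv i) y)) {..<d}"
  by (rule ex[OF b(1)[OF y] x])
 also have "... = finsum P (%i. finsum P (%j. W i j (pt x y) \<odot>\<^bsub>P\<^esub> f (pt (bv i) (bv j))) {..<d}) {..<d}"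
 proof (rule finsum_cong_simple[OF assms(1)])
  fix i
  have k: "klin A P (%y. lookup (co x) i \<odot>\<^bsub>P\<^esub> f (pt (bv i) y))"
   by (rule klin_scale_fun[OF b(2)[OF cv(2)] assms(1)])
  have "lookup (co x) i \<odot>\<^bsub>P\<^esub> f (pt (bv i) y) = finsum P (%j. lookup (co y) j \<odot>\<^bsub>P\<^esub> (lookup (co x) i \<odot>\<^bsub>P\<^esub> f (pt (bv i) (bv j)))) {..<d}"
   by (rule ex[OF k y])
  also have "... = finsum P (%j. W i j (pt x y) \<odot>\<^bsub>P\<^esub> f (pt (bv i) (bv j))) {..<d}"
   by (rule finsum_cong_simple[OF assms(1)])
    (simp_all add: W_pure x y kmod_assoc[OF assms(1) fc[OF cv(2) cv(2)], symmetric] mult.commute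
     kmod_scale[OF assms(1) fc[OF cv(2) cv(2)]])
  finally show "lookup (co x) i \<odot>\<^bsub>P\<^esub> f (pt (bv i) y) = finsum P (%j. W i j (pt x y) \<odot>\<^bsub>P\<^esub> f (pt (bv i) (bv j))) {..<d}" .
 qed (auto intro!: finsum_closed'[OF assms(1)] kmod_scale[OF assms(1)] fc cv(2))
 finally show "f (pt x y) = finsum P (%i. finsum P (%j. W i j (pt x y) \<odot>\<^bsub>P\<^esub> f (pt (bv i) (bv j))) {..<d}) {..<d}" .
qed

lemma tens_expand_sum:
 fixes P :: "('k, 'w::ab_group_add, 'z) module_scheme"
 assumes "kmod P" "add P = (+)" "ring.zero P = 0" "carrier P = UNIV" "klin AA P f" "t \<in> carrier AA"
 shows "f t = (\<Sum>i<d. \<Sum>j<d. module.smult P (W i j t) (f (pt (bv i) (bv j))))"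
 by (subst tens_expand[OF assms(1,5,6)]) (simp add: finsum_type[OF assms(1-3)] assms(4))

lemma co_bv: "i < d ==> co (bv i) = pm_basis i" by (simp add: cv)

text \<open>Pairing of a tensor with a bilinear form given in coordinates. On the distinguished
  tensor of a ring-object it becomes the contraction \<open>E\<close>.\<close>

definition tev :: "('k fvec => 'k fvec => 'k) => ('m \<times> 'm \<Rightarrow>\<^sub>0 'k) set => 'k" where
 "tev \<beta> = tensor_lift A A II (%x y. \<beta> (co x) (co y))"

lemma tev:
 assumes "bilS (*) \<beta>"
 shows tev_klin: "klin AA II (tev \<beta>)"
  and tev_pure: "!!x y. x \<in> carrier A ==> y \<in> carrier A ==> tev \<beta> (pt x y) = \<beta> (co x) (co y)"
  and tev_expand: "!!t. t \<in> carrier AA ==> tev \<beta> t = (\<Sum>i<d. \<Sum>j<d. W i j t * \<beta> (pm_basis i) (pm_basis j))"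
proof -
 have b: "kbil A A II (%x y. \<beta> (co x) (co y))" by (rule kbil_bilS[OF assms]) simp_all
 show k: "klin AA II (tev \<beta>)" unfolding tev_def by (rule lift_klin[OF Ak(2) Ak(2) kmod_unit b])
 show p: "!!x y. x \<in> carrier A ==> y \<in> carrier A ==> tev \<beta> (pt x y) = \<beta> (co x) (co y)"
  unfolding tev_def by (rule lift_pure[OF Ak(2) Ak(2) kmod_unit b])
 show "!!t. t \<in> carrier AA ==> tev \<beta> t = (\<Sum>i<d. \<Sum>j<d. W i j t * \<beta> (pm_basis i) (pm_basis j))"
  by (subst tens_expand_sum[OF kmod_unit _ _ _ k]) (simp_all add: p cv(2) co_bv)
qed

end

context crep
begin

lemma h_co: "x \<in> carrier A ==> h (co x) = co (act A g x)"
 by (simp add: h_def cv)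

lemma tev_act:
 assumes "bilS (*) \<beta>" "t \<in> carrier AA"
 shows "tev \<beta> (act AA (g [^] (s::nat)) t) = tev (%a b. \<beta> ((h ^^ s) a) ((h ^^ s) b)) t"
proof -
 have b: "bilS (*) (%a b. \<beta> ((h ^^ s) a) ((h ^^ s) b))"
  using assms(1) by (auto intro: lin_comp[OF H_lin])
 show ?thesis
 proof (rule klin_eq_pure[OF Ak(2) Ak(2) klin_comp[OF klin_act[OF kAA gs_carrier] tev_klin[OF assms(1)]] tev_klin[OF b] assms(2)])
  fix x y assume x: "x \<in> carrier A" and y: "y \<in> carrier A"
  note c = Ak(3)[OF gs_carrier x] Ak(3)[OF gs_carrier y]
  show "tev \<beta> (act AA (g [^] s) (pt x y)) = tev (%a b. \<beta> ((h ^^ s) a) ((h ^^ s) b)) (pt x y)"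
   by (simp only: act_pure[OF A A gs_carrier x y] tev_pure[OF assms(1) c] tev_pure[OF b x y] h_pow_co x y)
 qed
qed

text \<open>The origin of the right-hand side of \<open>sep\<close>: in the pairing of a transfer
  with a bilinear form, each translate passes to the two arguments of the form.\<close>

lemma tev_tr:
 assumes "bilS (*) \<beta>" "klin A AA \<theta>"
 shows "tev \<beta> (tr A AA \<theta> (vec x)) =
  (\<Sum>s<q. \<Sum>i<d. \<Sum>j<d. W i j (\<theta> (vec ((hi ^^ s) x))) * \<beta> ((h ^^ s) (pm_basis i)) ((h ^^ s) (pm_basis j)))"
proof -
 note c = tr_term_closed[OF A kAA assms(2) cv(2)]
 have "tev \<beta> (tr A AA \<theta> (vec x)) = finsum II (%s. tev \<beta> (act AA s (\<theta> (act A (inv s) (vec x))))) (carrier G)"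
  unfolding tr_def by (rule klin_finsumD[OF tev_klin[OF assms(1)] kAA_mod kmod_unit finite_G c])
 also have "... = (\<Sum>s\<in>carrier G. tev \<beta> (act AA s (\<theta> (act A (inv s) (vec x)))))"
  by (rule finsum_type[OF kmod_unit]) (auto simp: finite_G)
 also have "... = (\<Sum>s<q. tev \<beta> (act AA (g [^] s) (\<theta> (act A (inv (g [^] s)) (vec x)))))"
  by (rule sum.reindex_bij_betw[OF pow_bij, symmetric])
 also have "... = (\<Sum>s<q. \<Sum>i<d. \<Sum>j<d. W i j (\<theta> (vec ((hi ^^ s) x))) * \<beta> ((h ^^ s) (pm_basis i)) ((h ^^ s) (pm_basis j)))"
 proof (rule sum.cong[OF refl])
  fix s
  have b: "bilS (*) (%a b. \<beta> ((h ^^ s) a) ((h ^^ s) b))"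
   using assms(1) by (auto intro: lin_comp[OF H_lin])
  show "tev \<beta> (act AA (g [^] s) (\<theta> (act A (inv (g [^] s)) (vec x)))) =
    (\<Sum>i<d. \<Sum>j<d. W i j (\<theta> (vec ((hi ^^ s) x))) * \<beta> ((h ^^ s) (pm_basis i)) ((h ^^ s) (pm_basis j)))"
   unfolding vec_hi_pow[symmetric] tev_act[OF assms(1) klin_closed[OF assms(2) cv(2)]]
   by (rule tev_expand[OF b klin_closed[OF assms(2) cv(2)]])
 qed
 finally show ?thesis .
qed

lemma stq_diff_comp:
 assumes "kG_module G L" "kG_module G N" "j \<in> kG_hom G A L" "stq L N f f'"
 shows "stq A N (compose (carrier A) f j) (compose (carrier A) f' j)"
 by (rule stq_compose[OF A assms(1,2) stq_refl[OF A assms(1,3)] assms(4)])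

lemma fg_A: "fg_kG_module G A" by (rule coords_fg[OF A coords])

text \<open>The tensor is the value at the unit of a representative of the separability morphism.
  Evaluating the two expressions for that morphism after the product, one at \<open>x\<close> tensor
  unit and one at unit tensor \<open>x\<close>, gives \<open>x e\<close> and \<open>e x\<close>. By
  the unit laws both are stably the value of the separability morphism at \<open>x\<close>, and this
  is \<open>sep\<close>.\<close>

lemma salg_of_ring_object:
 assumes f: "f \<in> kG_hom G AA A" and u0: "u0 \<in> kG_hom G II A"
  and ro: "st_ring_object G A (st_class G AA A f) (st_class G II A u0)"
  and cm: "st_commutative G A (st_class G AA A f)" and sp: "st_separable G A (st_class G AA A f)"
 shows "\<exists>ee. salg d q h hi ee (%x y. co (f (pt (vec x) (vec y)))) (co (u0 1))"
proof -
 let ?m = "st_class G AA A f"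
 note ro = ro[unfolded st_ring_object_def]
 obtain \<sigma> where s: "\<sigma> \<in> st_hom G A AA"
  and ms: "st_comp G A A ?m \<sigma> = st_id G A"
  and s1: "st_comp G AA AA \<sigma> ?m = st_comp G AA AA (st_tensor G AA A A A ?m (st_id G A))
      (st_comp G AA (AA \<otimes>\<^sub>k A) (st_class G (A \<otimes>\<^sub>k AA) (AA \<otimes>\<^sub>k A) (assoc_inv_hom A A A)) (st_tensor G A A A AA (st_id G A) \<sigma>))"
  and s2: "st_comp G AA AA \<sigma> ?m = st_comp G AA AA (st_tensor G A AA A A (st_id G A) ?m)
      (st_comp G AA (A \<otimes>\<^sub>k AA) (st_class G (AA \<otimes>\<^sub>k A) (A \<otimes>\<^sub>k AA) (assoc_hom A A A)) (st_tensor G A A AA A \<sigma> (st_id G A)))"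
  using sp unfolding st_separable_def by blast
 obtain \<sigma>0 where s0: "\<sigma>0 \<in> kG_hom G A AA" and sg: "\<sigma> = st_class G A AA \<sigma>0" using s by (rule st_homE)
 note kI = kG_unit[OF group_axioms]
 note fgI = fg_unit
 note idA = id_hom_hom[OF A]
 note fgAA = fg_tensor[OF fg_A fg_A]
 note kL = kG_tensor[OF kAA A] and kR = kG_tensor[OF A kAA]
 note fgL = fg_tensor[OF fgAA fg_A] and fgR = fg_tensor[OF fg_A fgAA]
 note t1 = tensor_hom_hom[OF kAA A A A f idA] and t2 = tensor_hom_hom[OF A kAA A A idA f]
 note t3 = tensor_hom_hom[OF kI A A A u0 idA] and t4 = tensor_hom_hom[OF A kI A A idA u0]
 note t5 = tensor_hom_hom[OF A A A kAA idA s0] and t6 = tensor_hom_hom[OF A A kAA A s0 idA]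
 note ah = assoc_hom_hom[OF A A A] and aih = assoc_inv_hom_hom[OF A A A]
 note T1 = st_tensor_class[OF kAA A fg_A fg_A f idA] and T2 = st_tensor_class[OF A kAA fg_A fg_A idA f]
 note T3 = st_tensor_class[OF kI A fg_A fg_A u0 idA] and T4 = st_tensor_class[OF A kI fg_A fg_A idA u0]
 note T5 = st_tensor_class[OF A A fg_A fgAA idA s0] and T6 = st_tensor_class[OF A A fgAA fg_A s0 idA]
 have asc: "stq (AA \<otimes>\<^sub>k A) A (compose (carrier (AA \<otimes>\<^sub>k A)) f (tensor_hom AA A A A f (id_hom A)))
    (compose (carrier (AA \<otimes>\<^sub>k A)) f (compose (carrier (AA \<otimes>\<^sub>k A)) (tensor_hom A AA A A (id_hom A) f) (assoc_hom A A A)))"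
  using ro unfolding st_id_def T1 T2 st_comp_class[OF kL fgAA fg_A t1 f] st_comp_class[OF kL fgR fgAA ah t2]
   st_comp_class[OF kL fgAA fg_A kG_hom_compose[OF kL ah t2] f] st_class_eq[OF kL fg_A kG_hom_compose[OF kL t1 f]]
  by blast
 have lu: "stq (II \<otimes>\<^sub>k A) A (compose (carrier (II \<otimes>\<^sub>k A)) f (tensor_hom II A A A u0 (id_hom A))) (left_unit_hom A)"
  using ro unfolding st_id_def T3 st_comp_class[OF kG_tensor[OF kI A] fgAA fg_A t3 f]
   st_class_eq[OF kG_tensor[OF kI A] fg_A kG_hom_compose[OF kG_tensor[OF kI A] t3 f]] by blast
 have ru: "stq (A \<otimes>\<^sub>k II) A (compose (carrier (A \<otimes>\<^sub>k II)) f (tensor_hom A II A A (id_hom A) u0)) (right_unit_hom A)"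
  using ro unfolding st_id_def T4 st_comp_class[OF kG_tensor[OF A kI] fgAA fg_A t4 f]
   st_class_eq[OF kG_tensor[OF A kI] fg_A kG_hom_compose[OF kG_tensor[OF A kI] t4 f]] by blast
 note sw = swap_hom_hom[OF A A]
 have cm: "stq AA A (compose (carrier AA) f (swap_hom A A)) f"
  using cm unfolding st_commutative_def st_comp_class[OF kAA fgAA fg_A sw f]
   st_class_eq[OF kAA fg_A kG_hom_compose[OF kAA sw f]] .
 have ms: "stq A A (compose (carrier A) f \<sigma>0) (id_hom A)"
  using ms unfolding sg st_id_def st_comp_class[OF A fgAA fg_A s0 f] st_class_eq[OF A fg_A kG_hom_compose[OF A s0 f]] .
 have s1: "stq AA AA (compose (carrier AA) \<sigma>0 f) (compose (carrier AA) (tensor_hom AA A A A f (id_hom A))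
    (compose (carrier AA) (assoc_inv_hom A A A) (tensor_hom A A A AA (id_hom A) \<sigma>0)))"
  using s1 unfolding sg st_id_def T1 T5 st_comp_class[OF kAA fg_A fgAA f s0] st_comp_class[OF kAA fgR fgL t5 aih]
   st_comp_class[OF kAA fgL fgAA kG_hom_compose[OF kAA t5 aih] t1] st_class_eq[OF kAA fgAA kG_hom_compose[OF kAA f s0]] .
 have s2: "stq AA AA (compose (carrier AA) \<sigma>0 f) (compose (carrier AA) (tensor_hom A AA A A (id_hom A) f)
    (compose (carrier AA) (assoc_hom A A A) (tensor_hom A A AA A \<sigma>0 (id_hom A))))"
  using s2 unfolding sg st_id_def T2 T6 st_comp_class[OF kAA fg_A fgAA f s0] st_comp_class[OF kAA fgL fgR t6 ah]
   st_comp_class[OF kAA fgR fgAA kG_hom_compose[OF kAA t6 ah] t2] st_class_eq[OF kAA fgAA kG_hom_compose[OF kAA f s0]] .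
 define m where "m x y = co (f (pt (vec x) (vec y)))" for x y
 define u1 where "u1 = u0 1"
 define u where "u = co u1"
 define e where "e = \<sigma>0 u1"
 note fD = kG_homD[OF f] and sD = kG_homD[OF s0]
 have u1: "u1 \<in> carrier A" unfolding u1_def using kG_homD(4)[OF u0] by simp
 have u1_act: "act A t u1 = u1" if "t \<in> carrier G" for t
  using kG_homD(2)[OF u0 that, of 1] by (simp add: u1_def)
 have e: "e \<in> carrier AA" unfolding e_def by (rule sD(4)[OF u1])
 have e_act: "act AA t e = e" if "t \<in> carrier G" for t
  unfolding e_def using sD(2)[OF that u1] u1_act[OF that] by simp
 define ee where "ee i j = W i j e" for i j
 have idx: "id_hom A x = x" if "x \<in> carrier A" for x using that by (simp add: id_hom_def)
 note ptc = pt_closed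
 have fc: "f (pt x y) \<in> carrier A" if "x \<in> carrier A" "y \<in> carrier A" for x y by (rule fD(4)[OF ptc[OF that]])
 have mco: "m (co x) y = co (f (pt x (vec y)))" "m y (co x) = co (f (pt (vec y) x))" if "x \<in> carrier A" for x y
  using that by (simp_all add: m_def cv)
 have mcc: "m (co x) (co y) = co (f (pt x y))" if "x \<in> carrier A" "y \<in> carrier A" for x y
  using that by (simp add: m_def cv)
 interpret ct: cyc_tensor d q h hi ee
 proof (intro cyc_tensor.intro cyc_axioms cyc_tensor_axioms.intro)
  fix \<beta> :: "'k fvec => 'k fvec => 'k" assume b: "bilS (*) \<beta>"
  have b': "bilS (*) (%a b. \<beta> ((h ^^ 1) a) ((h ^^ 1) b))" using b by (auto intro: lin_comp[OF h_lin])
  have "tev (%a b. \<beta> ((h ^^ 1) a) ((h ^^ 1) b)) e = tev \<beta> e"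
   using tev_act[OF b e, of 1] e_act[OF gs_carrier, of 1] by simp
  then show "(\<Sum>i<d. \<Sum>j<d. ee i j * \<beta> (h (pm_basis i)) (h (pm_basis j))) = (\<Sum>i<d. \<Sum>j<d. ee i j * \<beta> (pm_basis i) (pm_basis j))"
   unfolding tev_expand[OF b e] tev_expand[OF b' e] ee_def by simp
 qed
 have m_eqv2: "eqv2 m" unfolding eqv2_def
 proof (rule conjI)
  show "bil m" unfolding m_def[abs_def] by (rule bil_kbil[OF kbil_klin[OF klin_comp[OF fD(1) co_klin]]])
  have "m (h x) (h y) = h (m x y)" for x y
   unfolding m_def vec_h h_co[OF fc[OF cv(2) cv(2)]] act_pure[OF A A g_carrier cv(2) cv(2), symmetric]
    fD(2)[OF g_carrier ptc[OF cv(2) cv(2)]] ..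
  then show "\<forall>x y. m (h x) (h y) = h (m x y)" by blast
 qed
 have h_u: "h u = u" unfolding u_def h_co[OF u1] u1_act[OF g_carrier] ..
 have hi_u: "hi u = u" using h_u hi_h by metis
 have hi_pow_u: "(hi ^^ s) u = u" for s by (induction s) (auto simp: hi_u)
 have assoc: "eq3 (%x y z. m (m x y) z) (%x y z. m x (m y z))" unfolding eq3_def
 proof -
  have 1: "compose (carrier (AA \<otimes>\<^sub>k A)) f (tensor_hom AA A A A f (id_hom A)) (pure_tensor AA A (pt x y) z) = f (pt (f (pt x y)) z)"
   and 2: "compose (carrier (AA \<otimes>\<^sub>k A)) f (compose (carrier (AA \<otimes>\<^sub>k A)) (tensor_hom A AA A A (id_hom A) f) (assoc_hom A A A)) (pure_tensor AA A (pt x y) z) = f (pt x (f (pt y z)))"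
   if x: "x \<in> carrier A" and y: "y \<in> carrier A" and z: "z \<in> carrier A" for x y z
  proof -
   have p: "pure_tensor AA A (pt x y) z \<in> carrier (AA \<otimes>\<^sub>k A)" by (rule pure_closed[OF kAA_mod Ak(2) ptc[OF x y] z])
   show "compose (carrier (AA \<otimes>\<^sub>k A)) f (tensor_hom AA A A A f (id_hom A)) (pure_tensor AA A (pt x y) z) = f (pt (f (pt x y)) z)"
    by (simp only: compose_eq[OF p] tensor_hom_hom_pure[OF kAA A A A f idA ptc[OF x y] z] idx[OF z])
   show "compose (carrier (AA \<otimes>\<^sub>k A)) f (compose (carrier (AA \<otimes>\<^sub>k A)) (tensor_hom A AA A A (id_hom A) f) (assoc_hom A A A)) (pure_tensor AA A (pt x y) z) = f (pt x (f (pt y z)))"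
    by (simp only: compose_eq[OF p] assoc_pure[OF A A A x y z] tensor_hom_hom_pure[OF A kAA A A idA f x ptc[OF y z]] idx[OF x])
  qed
  show "SZ3 (%x y z. m (m x y) z - m x (m y z))"
   using stq_SZ3[OF stq_sym[OF kG_tensor[OF kAA A] A asc]]
   unfolding 1[OF cv(2) cv(2) cv(2)] 2[OF cv(2) cv(2) cv(2)] m_def cv(6)[OF fc[OF cv(2) cv(2)]] .
 qed
 have comm: "SZ2 (%x y. m x y - m y x)"
  using stq_SZ2[OF cm] unfolding m_def compose_eq[OF ptc[OF cv(2) cv(2)]] swap_pure[OF A A cv(2) cv(2)] .
 \<comment> \<open>Inserting the scalar 1 turns the unit laws, which concern maps from a tensor
   product with the unit object, into statements about maps from \<open>A\<close>.\<close>
 define jl where "jl = restrict (%x. pure_tensor II A 1 x) (carrier A)"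
 define jr where "jr = restrict (%x. pure_tensor A II x 1) (carrier A)"
 have jl: "jl \<in> kG_hom G A (II \<otimes>\<^sub>k A)" unfolding jl_def
  by (rule kG_hom_restrictI[OF A kbilD(2)[OF pure_kbil[OF kmod_unit Ak(2)]]])
   (simp_all del: tensor_simps add: act_pure[OF kI A])
 have jr: "jr \<in> kG_hom G A (A \<otimes>\<^sub>k II)" unfolding jr_def
  by (rule kG_hom_restrictI[OF A kbilD(1)[OF pure_kbil[OF Ak(2) kmod_unit]]])
   (simp_all del: tensor_simps add: act_pure[OF A kI])
 define rl where "rl = restrict (%x. pt u1 x) (carrier A)"
 define rr where "rr = restrict (%x. pt x u1) (carrier A)"
 have rl: "rl \<in> kG_hom G A AA" unfolding rl_def
  by (rule kG_hom_restrictI[OF A kbilD(2)[OF pure_kbil[OF Ak(2) Ak(2)] u1]])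
   (simp del: tensor_simps add: act_pure[OF A A] u1 u1_act)
 have rr: "rr \<in> kG_hom G A AA" unfolding rr_def
  by (rule kG_hom_restrictI[OF A kbilD(1)[OF pure_kbil[OF Ak(2) Ak(2)] u1]])
   (simp del: tensor_simps add: act_pure[OF A A] u1 u1_act)
 have L: "stq A A (compose (carrier A) f rl) (id_hom A)"
 proof -
  have "compose (carrier A) (compose (carrier (II \<otimes>\<^sub>k A)) f (tensor_hom II A A A u0 (id_hom A))) jl = compose (carrier A) f rl"
  proof (rule extensionalityI[of _ "carrier A"])
   fix x assume x: "x \<in> carrier A"
   have p: "pure_tensor II A 1 x \<in> carrier (II \<otimes>\<^sub>k A)" by (rule pure_closed[OF kmod_unit Ak(2) _ x]) simp
   have "tensor_hom II A A A u0 (id_hom A) (pure_tensor II A 1 x) = pt u1 x"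
    using tensor_hom_hom_pure[OF kI A A A u0 idA _ x, of 1] idx[OF x] by (simp add: u1_def)
   then show "compose (carrier A) (compose (carrier (II \<otimes>\<^sub>k A)) f (tensor_hom II A A A u0 (id_hom A))) jl x = compose (carrier A) f rl x"
    using x by (simp only: compose_eq[OF x] jl_def rl_def restrict_apply' compose_eq[OF p])
  qed (simp_all add: compose_def)
  moreover have "compose (carrier A) (left_unit_hom A) jl = id_hom A"
   by (rule extensionalityI[of _ "carrier A"])
    (simp_all add: compose_def id_hom_def jl_def left_unit_pure[OF A] kmod_one[OF Ak(2)])
  ultimately show ?thesis using stq_diff_comp[OF kG_tensor[OF kI A] A jl lu] by simp
 qed
 have R: "stq A A (compose (carrier A) f rr) (id_hom A)"
 proof -
  have "compose (carrier A) (compose (carrier (A \<otimes>\<^sub>k II)) f (tensor_hom A II A A (id_hom A) u0)) jr = compose (carrier A) f rr"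
  proof (rule extensionalityI[of _ "carrier A"])
   fix x assume x: "x \<in> carrier A"
   have p: "pure_tensor A II x 1 \<in> carrier (A \<otimes>\<^sub>k II)" by (rule pure_closed[OF Ak(2) kmod_unit x]) simp
   have "tensor_hom A II A A (id_hom A) u0 (pure_tensor A II x 1) = pt x u1"
    using tensor_hom_hom_pure[OF A kI A A idA u0 x, of 1] idx[OF x] by (simp add: u1_def)
   then show "compose (carrier A) (compose (carrier (A \<otimes>\<^sub>k II)) f (tensor_hom A II A A (id_hom A) u0)) jr x = compose (carrier A) f rr x"
    using x by (simp only: compose_eq[OF x] jr_def rr_def restrict_apply' compose_eq[OF p])
  qed (simp_all add: compose_def)
  moreover have "compose (carrier A) (right_unit_hom A) jr = id_hom A"
   by (rule extensionalityI[of _ "carrier A"])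
    (simp_all add: compose_def id_hom_def jr_def right_unit_pure[OF A] kmod_one[OF Ak(2)])
  ultimately show ?thesis using stq_diff_comp[OF kG_tensor[OF A kI] A jr ru] by simp
 qed
 have unit: "eq1 (m u) (cut d)" unfolding eq1_def
 proof -
  have "co (compose (carrier A) f rl (vec x)) = m u x" for x
   by (simp only: compose_eq[OF cv(2)] rl_def restrict_apply'[OF cv(2)] u_def mco(1)[OF u1])
  moreover have "co (id_hom A (vec x)) = cut d x" for x by (simp only: idx[OF cv(2)] cv(5))
  ultimately show "SZ1 (%x. m u x - cut d x)" using stq_SZ1[OF stq_sym[OF A A L]] by simp
 qed
 have mE: "SZ0 (ct.E pm_scale m - u)"
 proof -
  have "ct.E pm_scale m = co (f e)"
   using tens_expand_sum[OF kmod_pmod _ _ _ klin_comp[OF fD(1) co_klin] e] by (simp add: ct.E_def ee_def m_def)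
  moreover have "SZ1 (%x. co (f (\<sigma>0 (vec x))) - cut d x)"
   using stq_SZ1[OF stq_sym[OF A A ms]] by (simp only: compose_eq[OF cv(2)] idx[OF cv(2)] cv(5))
  then obtain \<theta> where "!!x. co (f (\<sigma>0 (vec x))) - cut d x = (\<Sum>s<q. (h ^^ s) (\<theta> ((hi ^^ s) x)))"
   unfolding SZ1_def by blast
  from this[of u, unfolded hi_pow_u] have "co (f e) - u = (\<Sum>s<q. (h ^^ s) (\<theta> u))"
   by (simp add: u_def cv u1 e_def)
  ultimately show ?thesis unfolding SZ0_def by auto
 qed
 \<comment> \<open>\<open>R1 x e\<close> and \<open>R2 x e\<close> are the products
   \<open>x e\<close> and \<open>e x\<close>, written through the structure maps so that the
   separability axioms apply to them directly.\<close>
 define R1 where "R1 x t = tensor_hom AA A A A f (id_hom A) (assoc_inv_hom A A A (pure_tensor A AA x t))" for x t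
 define R2 where "R2 x t = tensor_hom A AA A A (id_hom A) f (assoc_hom A A A (pure_tensor AA A t x))" for x t
 have R1k: "klin AA AA (R1 x)" if "x \<in> carrier A" for x unfolding R1_def
  by (rule klin_comp[OF klin_comp[OF kbilD(2)[OF pure_kbil[OF Ak(2) kAA_mod] that] kG_homD(1)[OF assoc_inv_hom_hom[OF A A A]]]
     kG_homD(1)[OF tensor_hom_hom[OF kAA A A A f idA]]])
 have R2k: "klin AA AA (R2 x)" if "x \<in> carrier A" for x unfolding R2_def
  by (rule klin_comp[OF klin_comp[OF kbilD(1)[OF pure_kbil[OF kAA_mod Ak(2)] that] kG_homD(1)[OF assoc_hom_hom[OF A A A]]]
     kG_homD(1)[OF tensor_hom_hom[OF A kAA A A idA f]]])
 have R1p: "R1 x (pt a b) = pt (f (pt x a)) b" if x: "x \<in> carrier A" and a: "a \<in> carrier A" and b: "b \<in> carrier A" for x a b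
  by (simp only: R1_def assoc_inv_pure[OF A A A x a b] tensor_hom_hom_pure[OF kAA A A A f idA ptc[OF x a] b] idx[OF b])
 have R2p: "R2 x (pt a b) = pt a (f (pt b x))" if x: "x \<in> carrier A" and a: "a \<in> carrier A" and b: "b \<in> carrier A" for x a b
  by (simp only: R2_def assoc_pure[OF A A A a b x] tensor_hom_hom_pure[OF A kAA A A idA f a ptc[OF b x]] idx[OF a])
 have "\<exists>\<theta>. klin A AA \<theta> \<and> (\<forall>x\<in>carrier A. R1 x e = R2 x e \<oplus>\<^bsub>AA\<^esub> tr A AA \<theta> x)"
 proof -
  let ?S1 = "compose (carrier AA) (tensor_hom AA A A A f (id_hom A))
    (compose (carrier AA) (assoc_inv_hom A A A) (tensor_hom A A A AA (id_hom A) \<sigma>0))"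
  let ?S2 = "compose (carrier AA) (tensor_hom A AA A A (id_hom A) f)
    (compose (carrier AA) (assoc_hom A A A) (tensor_hom A A AA A \<sigma>0 (id_hom A)))"
  have a1: "stq A AA (compose (carrier A) (compose (carrier AA) \<sigma>0 f) rr) (compose (carrier A) ?S1 rr)"
   by (rule stq_diff_comp[OF kAA kAA rr s1])
  have a2: "stq A AA (compose (carrier A) (compose (carrier AA) \<sigma>0 f) rl) (compose (carrier A) ?S2 rl)"
   by (rule stq_diff_comp[OF kAA kAA rl s2])
  have b1: "stq A AA (compose (carrier A) \<sigma>0 (compose (carrier A) f rr)) (compose (carrier A) \<sigma>0 (id_hom A))"
   by (rule stq_compose[OF A A kAA R stq_refl[OF A kAA s0]])
  have b2: "stq A AA (compose (carrier A) \<sigma>0 (compose (carrier A) f rl)) (compose (carrier A) \<sigma>0 (id_hom A))"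
   by (rule stq_compose[OF A A kAA L stq_refl[OF A kAA s0]])
  have c: "compose (carrier A) (compose (carrier AA) \<sigma>0 f) r = compose (carrier A) \<sigma>0 (compose (carrier A) f r)"
   if "r \<in> kG_hom G A AA" for r
   by (rule compose_assoc[symmetric]) (use kG_homD(4)[OF that] in auto)
  have "stq A AA (compose (carrier A) ?S2 rl) (compose (carrier A) ?S1 rr)"
   using stq_trans[OF A kAA stq_sym[OF A kAA a2] stq_trans[OF A kAA b2[folded c[OF rl]]
     stq_trans[OF A kAA stq_sym[OF A kAA b1[folded c[OF rr]]] a1]]] .
  then obtain \<theta> where th: "klin A AA \<theta>"
   "!!x. x \<in> carrier A ==> compose (carrier A) ?S1 rr x = compose (carrier A) ?S2 rl x \<oplus>\<^bsub>AA\<^esub> tr A AA \<theta> x"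
   by (rule stqE) blast
  have "compose (carrier A) ?S1 rr x = R1 x e" "compose (carrier A) ?S2 rl x = R2 x e" if x: "x \<in> carrier A" for x
   using x by (simp_all only: compose_eq[OF x] rr_def rl_def restrict_apply' compose_eq[OF ptc[OF x u1]] compose_eq[OF ptc[OF u1 x]]
     R1_def R2_def e_def tensor_hom_hom_pure[OF A A A kAA idA s0 x u1] tensor_hom_hom_pure[OF A A kAA A s0 idA u1 x] idx[OF x])
  with th show ?thesis by auto
 qed
 then obtain \<theta> where th: "klin A AA \<theta>" "!!x. x \<in> carrier A ==> R1 x e = R2 x e \<oplus>\<^bsub>AA\<^esub> tr A AA \<theta> x" by blast
 have sep: "\<exists>\<Theta>. (\<forall>i j. linF (\<Theta> i j)) \<and> (\<forall>x \<phi> \<psi>. linF \<phi> \<longrightarrow> linF \<psi> \<longrightarrow>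
    ct.E (*) (%a b. \<phi> (m x a) * \<psi> b) - ct.E (*) (%a b. \<phi> a * \<psi> (m b x)) =
    (\<Sum>s<q. \<Sum>i<d. \<Sum>j<d. \<Theta> i j ((hi ^^ s) x) * (\<phi> ((h ^^ s) (pm_basis i)) * \<psi> ((h ^^ s) (pm_basis j)))))"
 proof (intro exI[of _ "%i j x. W i j (\<theta> (vec x))"] conjI allI impI)
  show "linF (%x. W i j (\<theta> (vec x)))" for i j
   by (rule klin_lin[OF klin_comp[OF klin_comp[OF cv(1) th(1)] W_klin]]) simp_all
  fix x :: "'k fvec" and \<phi> \<psi> :: "'k fvec => 'k" assume lf: "linF \<phi>" "linF \<psi>"
  let ?\<beta> = "%a b. \<phi> a * \<psi> b"
  have b: "bilS (*) ?\<beta>" using lf by (auto intro: lin_scale lin_scale_left)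
  have 1: "tev ?\<beta> (R1 (vec x) e) = ct.E (*) (%a b. \<phi> (m x a) * \<psi> b)"
   using tens_expand_sum[OF kmod_unit _ _ _ klin_comp[OF R1k[OF cv(2)] tev_klin[OF b]] e, of x]
   by (simp add: ct.E_def ee_def R1p cv(2) tev_pure[OF b] fc co_bv m_def)
  have 2: "tev ?\<beta> (R2 (vec x) e) = ct.E (*) (%a b. \<phi> a * \<psi> (m b x))"
   using tens_expand_sum[OF kmod_unit _ _ _ klin_comp[OF R2k[OF cv(2)] tev_klin[OF b]] e, of x]
   by (simp add: ct.E_def ee_def R2p cv(2) tev_pure[OF b] fc co_bv m_def)
  have "tev ?\<beta> (R1 (vec x) e) = tev ?\<beta> (R2 (vec x) e) + tev ?\<beta> (tr A AA \<theta> (vec x))"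
   unfolding th(2)[OF cv(2)]
   using klin_addD[OF tev_klin[OF b] klin_closed[OF R2k[OF cv(2)] e] tr_closed[OF A kAA th(1) cv(2)]] by simp
  then show "ct.E (*) (%a b. \<phi> (m x a) * \<psi> b) - ct.E (*) (%a b. \<phi> a * \<psi> (m b x)) =
    (\<Sum>s<q. \<Sum>i<d. \<Sum>j<d. W i j (\<theta> (vec ((hi ^^ s) x))) * (\<phi> ((h ^^ s) (pm_basis i)) * \<psi> ((h ^^ s) (pm_basis j))))"
   unfolding 1 2 tev_tr[OF b th(1)] by simp
 qed
 have "salg d q h hi ee m u"
 proof (intro salg.intro ct.cyc_tensor_axioms salg_axioms.intro m_eqv2 h_u assoc comm unit mE sep)
  show "m (cut d x) (cut d y) = m x y" for x y by (simp add: m_def cv)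
  show "cut d (m x y) = m x y" for x y unfolding m_def by (rule cv(7)[OF fc[OF cv(2) cv(2)]])
  show "cut d u = u" unfolding u_def by (rule cv(7)[OF u1])
 qed
 then show ?thesis unfolding m_def[abs_def] u_def u1_def by blast
qed

end

section \<open>Permutation modules and their products\<close>

section \<open>Permutation modules\<close>

context finite_group
begin

lemma lcosetE:
 assumes "S \<in> lcosets H" obtains a where "a \<in> carrier G" "S = a <# H"
 using assms unfolding LCOSETS_def by blast

lemma translate_lcoset:
 assumes "H \<subseteq> carrier G" "S \<in> lcosets H" "t \<in> carrier G"
 shows "t <# S \<in> lcosets H" and "inv t <# (t <# S) = S" and "t <# (inv t <# S) = S" and "\<one> <# S = S"
  and "s \<in> carrier G ==> (s \<otimes> t) <# S = s <# (t <# S)"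
proof -
 obtain a where a: "a \<in> carrier G" "S = a <# H" using assms(2) by (rule lcosetE)
 have e: "t <# (a <# H) = (t \<otimes> a) <# H" if "t \<in> carrier G" "a \<in> carrier G" for t a
  by (rule lcos_m_assoc[OF assms(1) that])
 show "t <# S \<in> lcosets H" unfolding a e[OF assms(3) a(1)] LCOSETS_def using a assms(3) by blast
 show "inv t <# (t <# S) = S" "t <# (inv t <# S) = S" "\<one> <# S = S"
  using a assms(3) by (simp_all add: e m_assoc[symmetric])
 show "s \<in> carrier G ==> (s \<otimes> t) <# S = s <# (t <# S)" using a assms(3) by (simp add: e m_assoc)
qed

lemma finite_lcosets: "finite (lcosets H)"
 unfolding LCOSETS_def using finite_G by auto

text \<open>A base point is chosen in each orbit. Its stabilizer is \<open>H i\<close>, and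
  \<open>e i S\<close> is the translate of the base point by any element of the coset
  \<open>S\<close>.\<close>

lemma orbit_decomposition:
 assumes "finite F" and ta: "!!t x. t \<in> carrier G ==> x \<in> F ==> ta t x \<in> F"
  and ta1: "!!x. x \<in> F ==> ta \<one> x = x"
  and tam: "!!s t x. s \<in> carrier G ==> t \<in> carrier G ==> x \<in> F ==> ta (s \<otimes> t) x = ta s (ta t x)"
 shows "\<exists>(r::nat) H e. (\<forall>i<r. subgroup (H i) G) \<and>
  bij_betw (%(i, S). e i S) (Sigma {..<r} (%i. lcosets (H i))) F \<and>
  (\<forall>i<r. \<forall>S\<in>lcosets (H i). \<forall>t\<in>carrier G. e i (t <# S) = ta t (e i S))"
proof -
 define orb where "orb x = (%t. ta t x) ` carrier G" for x
 have inv_ta: "ta (inv t) (ta t x) = x" if "t \<in> carrier G" "x \<in> F" for t x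
  using tam[of "inv t" t x] ta1[of x] that by simp
 have orb_ta: "orb (ta t x) = orb x" if t: "t \<in> carrier G" and x: "x \<in> F" for t x
 proof -
  have 1: "ta s (ta t x) \<in> orb x" if "s \<in> carrier G" for s
   unfolding orb_def using that t x tam[OF that t x] by (intro image_eqI[of _ _ "s \<otimes> t"]) simp_all
  have 2: "ta s x \<in> orb (ta t x)" if "s \<in> carrier G" for s
   unfolding orb_def using that t x tam[of "s \<otimes> inv t" t x]
   by (intro image_eqI[of _ _ "s \<otimes> inv t"]) (simp_all add: m_assoc)
  show ?thesis
  proof (rule subset_antisym; rule subsetI)
   show "y \<in> orb x" if "y \<in> orb (ta t x)" for y using that 1 unfolding orb_def[of "ta t x"] by blast
   show "y \<in> orb (ta t x)" if "y \<in> orb x" for y using that 2 unfolding orb_def[of x] by blast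
  qed
 qed
 obtain b and r :: nat where b: "bij_betw b {..<r} (orb ` F)"
  using ex_bij_betw_nat_finite[of "orb ` F"] assms(1) by (auto simp: atLeast0LessThan)
 have "\<exists>x. x \<in> F \<and> orb x = b i" if "i < r" for i using bij_betwE[OF b] that by (metis (no_types, lifting) imageE lessThan_iff)
 then obtain x where x: "!!i. i < r ==> x i \<in> F" "!!i. i < r ==> orb (x i) = b i" by metis
 define H where "H i = {t \<in> carrier G. ta t (x i) = x i}" for i
 have Hs: "subgroup (H i) G" if i: "i < r" for i
 proof (rule subgroupI)
  show "H i \<noteq> {}" using ta1[OF x(1)[OF i]] by (auto simp: H_def)
  show "inv t \<in> H i" if "t \<in> H i" for t using that inv_ta[of t "x i"] x(1)[OF i] by (auto simp: H_def)
  show "s \<otimes> t \<in> H i" if "s \<in> H i" "t \<in> H i" for s t using that tam x(1)[OF i] by (auto simp: H_def)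
 qed (auto simp: H_def)
 define e where "e i S = ta (SOME t. t \<in> S) (x i)" for i S
 have e: "e i (a <# H i) = ta a (x i)" if i: "i < r" and a: "a \<in> carrier G" for i a
 proof -
  have "a \<in> a <# H i" using subgroup.one_closed[OF Hs[OF i]] a unfolding l_coset_def by force
  then have "(SOME t. t \<in> a <# H i) \<in> a <# H i" by (rule someI)
  then obtain k where "k \<in> H i" "(SOME t. t \<in> a <# H i) = a \<otimes> k" unfolding l_coset_def by blast
  then show ?thesis using tam[of a k "x i"] a x(1)[OF i] by (simp add: e_def H_def)
 qed
 have 1: "inj_on (%(i, S). e i S) (Sigma {..<r} (%i. lcosets (H i)))"
 proof (rule inj_onI, clarify)
  fix i S j T assume i: "i < r" "S \<in> lcosets (H i)" and j: "j < r" "T \<in> lcosets (H j)" and eq: "e i S = e j T"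
  obtain a where a: "a \<in> carrier G" "S = a <# H i" using i(2) by (rule lcosetE)
  obtain c where c: "c \<in> carrier G" "T = c <# H j" using j(2) by (rule lcosetE)
  have eq': "ta a (x i) = ta c (x j)" using eq e[OF i(1) a(1)] e[OF j(1) c(1)] a c by simp
  have "b i = b j"
   using orb_ta[OF a(1) x(1)[OF i(1)]] orb_ta[OF c(1) x(1)[OF j(1)]] x(2)[OF i(1)] x(2)[OF j(1)] eq' by simp
  then have ij: "i = j" using bij_betw_imp_inj_on[OF b] i(1) j(1) by (auto dest: inj_onD)
  have "ta (inv c \<otimes> a) (x i) = x i"
   using tam[of "inv c" a "x i"] inv_ta[OF c(1) x(1)[OF i(1)]] eq' a c x(1)[OF i(1)] ij by simp
  then have k: "inv c \<otimes> a \<in> H i" using a c by (simp add: H_def)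
  have "a = c \<otimes> (inv c \<otimes> a)" using a c by (simp add: m_assoc[symmetric])
  then have "a \<in> c <# H i" using k unfolding l_coset_def by blast
  then have "c <# H i = a <# H i" by (rule l_repr_independence[OF _ c(1) Hs[OF i(1)]])
  then show "i = j \<and> S = T" using ij a c by simp
 qed
 have 2: "(%(i, S). e i S) ` Sigma {..<r} (%i. lcosets (H i)) = F"
 proof (intro subset_antisym subsetI)
  fix y assume "y \<in> (%(i, S). e i S) ` Sigma {..<r} (%i. lcosets (H i))"
  then obtain i S where i: "i < r" "S \<in> lcosets (H i)" "y = e i S" by auto
  obtain a where a: "a \<in> carrier G" "S = a <# H i" using i(2) by (rule lcosetE)
  show "y \<in> F" using e[OF i(1) a(1)] a i ta[OF a(1) x(1)[OF i(1)]] by simp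
 next
  fix y assume y: "y \<in> F"
  then obtain i where i: "i < r" "b i = orb y" using bij_betw_imp_surj_on[OF b] by (metis imageE imageI lessThan_iff)
  have "y \<in> orb y" using ta1[OF y] unfolding orb_def by (metis imageI one_closed)
  then obtain a where a: "a \<in> carrier G" "y = ta a (x i)" using x(2)[OF i(1)] i(2) unfolding orb_def by auto
  have "a <# H i \<in> lcosets (H i)" using a unfolding LCOSETS_def by blast
  then show "y \<in> (%(i, S). e i S) ` Sigma {..<r} (%i. lcosets (H i))"
   using i a e[OF i(1) a(1)] by (intro image_eqI[of _ _ "(i, a <# H i)"]) auto
 qed
 have 3: "e i (t <# S) = ta t (e i S)" if i: "i < r" and S: "S \<in> lcosets (H i)" and t: "t \<in> carrier G" for i S t
 proof -
  obtain a where a: "a \<in> carrier G" "S = a <# H i" using S by (rule lcosetE)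
  have "t <# S = (t \<otimes> a) <# H i" unfolding a by (rule lcos_m_assoc[OF subgroup.subset[OF Hs[OF i]] t a(1)])
  then show ?thesis using e[OF i a(1)] e[OF i m_closed[OF t a(1)]] tam[OF t a(1) x(1)[OF i]] a by simp
 qed
 show ?thesis using Hs 1 2 3 unfolding bij_betw_def by blast
qed

lemma perm_simps [simp]:
 "carrier (perm_rep G H) = free_on (lcosets H)" "ring.zero (perm_rep G H) = 0"
 "add (perm_rep G H) = (+)" "module.smult (perm_rep G H) = pm_scale"
 by (simp_all add: perm_rep_def)

lemma kmod_perm: "kmod (perm_rep G H)"
 by (rule kmod_type[OF vs_pm]) (simp_all add: subspace_free_on)

context
 fixes H assumes H: "subgroup H G"
begin

lemma H_sub: "H \<subseteq> carrier G" by (rule subgroup.subset[OF H])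
lemmas tl = translate_lcoset[OF H_sub]

lemma lookup_perm_act:
 fixes \<phi> :: "'a set \<Rightarrow>\<^sub>0 'k::field"
 assumes "\<phi> \<in> free_on (lcosets H)" "t \<in> carrier G"
 shows "lookup (act (perm_rep G H) t \<phi>) T = (if T \<in> lcosets H then lookup \<phi> (inv t <# T) else 0)"
proof -
 have k: "S \<in> lcosets H" if "S \<in> keys \<phi>" for S using assms(1) that by (auto simp: free_on_def)
 have "lookup (act (perm_rep G H) t \<phi>) T = (\<Sum>S\<in>keys \<phi>. if t <# S = T then lookup \<phi> S else 0)"
  by (simp add: perm_rep_def lookup_sum lookup_single when_def)
 also have "... = (if T \<in> lcosets H then lookup \<phi> (inv t <# T) else 0)"
 proof (cases "T \<in> lcosets H")
  case True
  have "(\<Sum>S\<in>keys \<phi>. if t <# S = T then lookup \<phi> S else 0) =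
    (\<Sum>S\<in>keys \<phi>. if S = inv t <# T then lookup \<phi> (inv t <# T) else 0)"
   by (rule sum.cong[OF refl]) (use tl(2,3) k True assms(2) in auto)
  then show ?thesis using True by (simp add: in_keys_iff)
 next
  case False
  have "(\<Sum>S\<in>keys \<phi>. if t <# S = T then lookup \<phi> S else 0) = 0"
   by (rule sum.neutral) (use False tl(1) k assms(2) in auto)
  then show ?thesis using False by simp
 qed
 finally show ?thesis .
qed

lemma lookup_free: "\<phi> \<in> free_on (lcosets H) ==> T \<notin> lcosets H ==> lookup \<phi> T = 0"
 by (auto simp: free_on_def in_keys_iff)

lemma free_onI: "(!!T. T \<notin> lcosets H ==> lookup \<phi> T = 0) ==> \<phi> \<in> free_on (lcosets H)"
 by (auto simp: free_on_def in_keys_iff)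

lemma kG_perm: "kG_module G (perm_rep G H :: ('a, 'k::field, _) rep)"
 unfolding kG_module_def
proof (intro conjI ballI allI)
 show "group G" by (rule group_axioms)
 show "kmod (perm_rep G H)" by (rule kmod_perm)
 fix \<phi> :: "'a set \<Rightarrow>\<^sub>0 'k" assume p: "\<phi> \<in> carrier (perm_rep G H)"
 then have p': "\<phi> \<in> free_on (lcosets H)" by simp
 show "act (perm_rep G H) \<one> \<phi> = \<phi>"
  by (rule poly_mapping_eqI) (simp add: lookup_perm_act[OF p' one_closed] tl(4)[OF _ one_closed] lookup_free[OF p'])
 fix t assume t: "t \<in> carrier G"
 show c: "act (perm_rep G H) t \<phi> \<in> carrier (perm_rep G H)"
  unfolding perm_simps by (rule free_onI) (simp add: lookup_perm_act[OF p' t])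
 have sc: "pm_scale c \<phi> \<in> free_on (lcosets H)" for c by (rule pm.subspace_scale[OF subspace_free_on p'])
 show "act (perm_rep G H) t (c \<odot>\<^bsub>perm_rep G H\<^esub> \<phi>) = c \<odot>\<^bsub>perm_rep G H\<^esub> act (perm_rep G H) t \<phi>" for c
  by (rule poly_mapping_eqI) (simp add: lookup_perm_act[OF p' t] lookup_perm_act[OF sc t])
 {
  fix \<psi> :: "'a set \<Rightarrow>\<^sub>0 'k" assume "\<psi> \<in> carrier (perm_rep G H)"
  then have q: "\<psi> \<in> free_on (lcosets H)" by simp
  have pq: "\<phi> + \<psi> \<in> free_on (lcosets H)" by (rule pm.subspace_add[OF subspace_free_on p' q])
  show "act (perm_rep G H) t (\<phi> \<oplus>\<^bsub>perm_rep G H\<^esub> \<psi>) = act (perm_rep G H) t \<phi> \<oplus>\<^bsub>perm_rep G H\<^esub> act (perm_rep G H) t \<psi>"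
   by (rule poly_mapping_eqI)
    (simp add: lookup_add lookup_perm_act[OF p' t] lookup_perm_act[OF q t] lookup_perm_act[OF pq t])
 }
 fix s assume s: "s \<in> carrier G"
 have sp: "act (perm_rep G H) s \<phi> \<in> free_on (lcosets H)"
  by (rule free_onI) (simp add: lookup_perm_act[OF p' s])
 show "act (perm_rep G H) (t \<otimes> s) \<phi> = act (perm_rep G H) t (act (perm_rep G H) s \<phi>)"
 proof (rule poly_mapping_eqI)
  fix T
  have "inv (t \<otimes> s) <# T = inv s <# (inv t <# T)" if "T \<in> lcosets H"
   using tl(5)[OF that inv_closed[OF t] inv_closed[OF s]] s t by (simp add: inv_mult_group)
  then show "lookup (act (perm_rep G H) (t \<otimes> s) \<phi>) T = lookup (act (perm_rep G H) t (act (perm_rep G H) s \<phi>)) T"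
   using tl(1)[OF _ inv_closed[OF t], of T] s t
   by (simp add: lookup_perm_act[OF p'] lookup_perm_act[OF sp])
 qed
qed

text \<open>Pointwise multiplication of functions on the cosets, in the shape in which
  \<open>perm_mult\<close> spells it out.\<close>

definition pmul :: "('a set \<Rightarrow>\<^sub>0 'k::field) => ('a set \<Rightarrow>\<^sub>0 'k) => ('a set \<Rightarrow>\<^sub>0 'k)" where
 "pmul \<phi> \<psi> = (\<Sum>S\<in>keys \<phi>. \<Sum>T\<in>keys \<psi>.
     pm_scale (lookup \<phi> S * lookup \<psi> T) (if S = T then pm_basis S else 0))"

lemma lookup_pmul: "lookup (pmul \<phi> \<psi>) R = lookup \<phi> R * lookup \<psi> R"
proof -
 have "lookup (pmul \<phi> \<psi>) R = (\<Sum>S\<in>keys \<phi>. \<Sum>T\<in>keys \<psi>. if T = R then (if S = R then lookup \<phi> R * lookup \<psi> R else 0) else 0)"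
  unfolding pmul_def lookup_sum
  by (intro sum.cong refl) (auto simp: lookup_single when_def)
 then show ?thesis by (cases "lookup \<psi> R = 0") (auto simp: in_keys_iff)
qed

lemma pmul_kbil: "kbil (perm_rep G H) (perm_rep G H) (perm_rep G H) (pmul :: _ => _ => 'a set \<Rightarrow>\<^sub>0 'k::field)"
proof (rule kbilI; rule klinI)
 fix \<phi> \<psi> \<chi> :: "'a set \<Rightarrow>\<^sub>0 'k" and c
 assume p: "\<phi> \<in> carrier (perm_rep G H)"
 show "pmul \<psi> \<phi> \<in> carrier (perm_rep G H)" "pmul \<phi> \<psi> \<in> carrier (perm_rep G H)"
  using p unfolding perm_simps by (auto intro!: free_onI simp: lookup_pmul lookup_free)
 show "pmul (\<psi> \<oplus>\<^bsub>perm_rep G H\<^esub> \<chi>) \<phi> = pmul \<psi> \<phi> \<oplus>\<^bsub>perm_rep G H\<^esub> pmul \<chi> \<phi>"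
  "pmul \<phi> (\<psi> \<oplus>\<^bsub>perm_rep G H\<^esub> \<chi>) = pmul \<phi> \<psi> \<oplus>\<^bsub>perm_rep G H\<^esub> pmul \<phi> \<chi>"
  by (rule poly_mapping_eqI; simp add: lookup_pmul lookup_add distrib_left distrib_right)+
 show "pmul (c \<odot>\<^bsub>perm_rep G H\<^esub> \<psi>) \<phi> = c \<odot>\<^bsub>perm_rep G H\<^esub> pmul \<psi> \<phi>"
  "pmul \<phi> (c \<odot>\<^bsub>perm_rep G H\<^esub> \<psi>) = c \<odot>\<^bsub>perm_rep G H\<^esub> pmul \<phi> \<psi>"
  by (rule poly_mapping_eqI; simp add: lookup_pmul)+
qed

lemma perm_mult:
 fixes \<phi> \<psi> :: "'a set \<Rightarrow>\<^sub>0 'k::field"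
 shows perm_mult_hom: "perm_mult G H \<in> kG_hom G (perm_rep G H \<otimes>\<^sub>k perm_rep G H) (perm_rep G H :: ('a, 'k, _) rep)"
  and perm_mult_pure: "\<phi> \<in> free_on (lcosets H) ==> \<psi> \<in> free_on (lcosets H) ==>
   perm_mult G H (pure_tensor (perm_rep G H :: ('a, 'k, _) rep) (perm_rep G H :: ('a, 'k, _) rep) \<phi> \<psi>) = pmul \<phi> \<psi>"
proof -
 have e: "perm_mult G H = tensor_lift (perm_rep G H :: ('a, 'k, _) rep) (perm_rep G H :: ('a, 'k, _) rep) (perm_rep G H :: ('a, 'k, _) rep) pmul"
  unfolding perm_mult_def pmul_def[abs_def] ..
 show "perm_mult G H \<in> kG_hom G (perm_rep G H \<otimes>\<^sub>k perm_rep G H) (perm_rep G H :: ('a, 'k, _) rep)"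
  unfolding e
 proof (rule lift_hom[OF kG_perm kG_perm kG_perm pmul_kbil])
  fix t and \<phi> \<psi> :: "'a set \<Rightarrow>\<^sub>0 'k" assume t: "t \<in> carrier G" and p: "\<phi> \<in> carrier (perm_rep G H)" "\<psi> \<in> carrier (perm_rep G H)"
  have pm: "pmul \<phi> \<psi> \<in> free_on (lcosets H)" using kbil_closed[OF pmul_kbil p] by simp
  show "pmul (act (perm_rep G H) t \<phi>) (act (perm_rep G H) t \<psi>) = act (perm_rep G H) t (pmul \<phi> \<psi>)"
   by (rule poly_mapping_eqI)
    (simp add: lookup_pmul lookup_perm_act[OF pm t] lookup_perm_act[OF p(1)[unfolded perm_simps] t] lookup_perm_act[OF p(2)[unfolded perm_simps] t])
 qed
 show "\<phi> \<in> free_on (lcosets H) ==> \<psi> \<in> free_on (lcosets H) ==>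
   perm_mult G H (pure_tensor (perm_rep G H :: ('a, 'k, _) rep) (perm_rep G H :: ('a, 'k, _) rep) \<phi> \<psi>) = pmul \<phi> \<psi>"
  unfolding e by (rule lift_pure[OF kmod_perm kmod_perm kmod_perm pmul_kbil]) simp_all
qed

end

lemma prod_simps [simp]:
 "carrier (prod_rep I M) = (\<Pi>\<^sub>E i\<in>I. carrier (M i))" "ring.zero (prod_rep I M) = (\<lambda>i\<in>I. \<zero>\<^bsub>M i\<^esub>)"
 "add (prod_rep I M) = (%x y. \<lambda>i\<in>I. x i \<oplus>\<^bsub>M i\<^esub> y i)"
 "module.smult (prod_rep I M) = (%c x. \<lambda>i\<in>I. c \<odot>\<^bsub>M i\<^esub> x i)"
 "act (prod_rep I M) = (%g x. \<lambda>i\<in>I. act (M i) g (x i))"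
 by (simp_all add: prod_rep_def)

lemma kmod_prod:
 assumes "!!i. i \<in> I ==> kmod (M i)" shows "kmod (prod_rep I M)"
proof -
 have ag: "abelian_group (M i)" if "i \<in> I" for i by (rule kmod_ag[OF assms[OF that]])
 show ?thesis
  by (rule kmodI)
   (auto intro!: restrict_ext extensionalityI[of _ I] simp: PiE_iff kmod_facts(3-13)[OF assms] abelian_groupE(1-6)[OF ag]
    abelian_monoid.a_lcomm[OF kmod_am[OF assms]] abelian_monoid.r_zero[OF kmod_am[OF assms]])
qed

lemma kG_prod:
 assumes "!!i. i \<in> I ==> kG_module G (M i)" shows "kG_module G (prod_rep I M)"
 unfolding kG_module_def
proof (intro conjI)
 show "group G" by (rule group_axioms)
 show "kmod (prod_rep I M)" by (rule kmod_prod) (rule kG_moduleD(2)[OF assms])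
qed (auto intro!: extensionalityI[of _ I] restrict_ext simp: PiE_iff kG_moduleD(3-7)[OF assms])

lemma proj_hom_hom:
 assumes "!!i. i \<in> I ==> kG_module G (M i)" "i \<in> I"
 shows "proj_hom I M i \<in> kG_hom G (prod_rep I M) (M i)"
 unfolding proj_hom_def
 by (rule kG_hom_restrictI[OF kG_prod[OF assms(1)]]) (use assms(2) in \<open>auto intro!: klinI simp: PiE_iff\<close>)

lemma prod_mult:
 assumes "!!i. i \<in> I ==> kG_module G (M i)" "!!i. i \<in> I ==> m i \<in> kG_hom G (M i \<otimes>\<^sub>k M i) (M i)"
 shows prod_mult_hom: "prod_mult I M m \<in> kG_hom G (prod_rep I M \<otimes>\<^sub>k prod_rep I M) (prod_rep I M)"
  and prod_mult_pure: "!!x y. x \<in> carrier (prod_rep I M) ==> y \<in> carrier (prod_rep I M) ==>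
   prod_mult I M m (pure_tensor (prod_rep I M) (prod_rep I M) x y) = (\<lambda>i\<in>I. m i (pure_tensor (M i) (M i) (x i) (y i)))"
proof -
 let ?B = "prod_rep I M"
 note kB = kG_prod[OF assms(1)]
 let ?c = "%i t. m i (tensor_hom ?B ?B (M i) (M i) (proj_hom I M i) (proj_hom I M i) t)"
 have th: "tensor_hom ?B ?B (M i) (M i) (proj_hom I M i) (proj_hom I M i) \<in> kG_hom G (?B \<otimes>\<^sub>k ?B) (M i \<otimes>\<^sub>k M i)" if "i \<in> I" for i
  using that assms(1) by (intro tensor_hom_hom kB proj_hom_hom) auto
 have c: "klin (?B \<otimes>\<^sub>k ?B) (M i) (?c i)" if "i \<in> I" for i
  by (rule klin_comp[OF kG_homD(1)[OF th] kG_homD(1)[OF assms(2)]]) (use that in auto)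
 have ca: "?c i (act (?B \<otimes>\<^sub>k ?B) g t) = act (M i) g (?c i t)" if i: "i \<in> I" and g: "g \<in> carrier G" and t: "t \<in> carrier (?B \<otimes>\<^sub>k ?B)" for i g t
  unfolding kG_homD(2)[OF th[OF i] g t] by (rule kG_homD(2)[OF assms(2)[OF i] g kG_homD(4)[OF th[OF i] t]])
 show "prod_mult I M m \<in> kG_hom G (?B \<otimes>\<^sub>k ?B) ?B"
  unfolding prod_mult_def
 proof (rule kG_hom_restrictI[OF kG_tensor[OF kB kB]])
  show "klin (?B \<otimes>\<^sub>k ?B) ?B (%t. \<lambda>i\<in>I. ?c i t)"
   by (rule klinI) (auto simp del: tensor_simps intro!: restrict_ext simp: PiE_iff klinD[OF c])
  show "(\<lambda>i\<in>I. ?c i (act (?B \<otimes>\<^sub>k ?B) g t)) = act ?B g (\<lambda>i\<in>I. ?c i t)"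
   if "g \<in> carrier G" "t \<in> carrier (?B \<otimes>\<^sub>k ?B)" for g t
   using that by (auto simp del: tensor_simps intro!: restrict_ext simp: ca)
 qed
 fix x y assume x: "x \<in> carrier ?B" and y: "y \<in> carrier ?B"
 have "?c i (pure_tensor ?B ?B x y) = m i (pure_tensor (M i) (M i) (x i) (y i))" if i: "i \<in> I" for i
  using tensor_hom_hom_pure[OF kB kB assms(1)[OF i] assms(1)[OF i] proj_hom_hom[OF assms(1) i] proj_hom_hom[OF assms(1) i] x y] x y
  by (simp add: proj_hom_def)
 then show "prod_mult I M m (pure_tensor ?B ?B x y) = (\<lambda>i\<in>I. m i (pure_tensor (M i) (M i) (x i) (y i)))"
  using pure_closed[OF kG_moduleD(2)[OF kB] kG_moduleD(2)[OF kB] x y]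
  by (auto simp: prod_mult_def intro!: restrict_ext simp del: prod_simps)
qed

end

section \<open>The isomorphism with a product of permutation modules\<close>

section \<open>The isomorphism\<close>

context crep
begin

lemma carrier_pow: assumes "t \<in> carrier G" obtains s :: nat where "t = g [^] s"
 using pow_bij assms unfolding bij_betw_def by blast

lemma hi_pow_co: "y \<in> carrier A ==> (hi ^^ s) (co y) = co (act A (inv (g [^] s)) y)"
 using hi_pow[of s "co y"] by (simp add: cv)

abbreviation split_iso where
 "split_iso \<mu> v \<equiv> \<exists>(r::nat) (H :: nat => 'a set). (\<forall>i<r. subgroup (H i) G) \<and>
  st_ring_isomorphic G A \<mu> v
   (prod_rep {..<r} (%i. perm_rep G (H i) :: ('a, 'k, 'a set \<Rightarrow>\<^sub>0 'k) rep))
   (st_class G (prod_rep {..<r} (%i. perm_rep G (H i)) \<otimes>\<^sub>k prod_rep {..<r} (%i. perm_rep G (H i)))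
     (prod_rep {..<r} (%i. perm_rep G (H i)))
     (prod_mult {..<r} (%i. perm_rep G (H i)) (%i. perm_mult G (H i))))
   (st_class G II (prod_rep {..<r} (%i. perm_rep G (H i))) (prod_unit {..<r} (%i. perm_unit G (H i))))"

text \<open>Coordinates with respect to the permuted idempotents map \<open>A\<close> to functions
  on \<open>F\<close>, that is to a product of permutation modules. One composite with the
  reconstruction map is exactly the identity; the other is the projection onto the core and hence
  only stably the identity. Multiplicativity is exact once the projection is applied to both
  factors.\<close>

lemma ring_iso:
 assumes f: "f \<in> kG_hom G AA A" and u0: "u0 \<in> kG_hom G II A"
  and pi: "eqv \<pi>" "!!x. \<pi> (\<pi> x) = \<pi> x" "!!x. cut d (\<pi> x) = \<pi> x" "!!x. \<pi> (cut d x) = \<pi> x"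
  and sz: "SZ1 (%x. cut d x - \<pi> x)"
  and F: "finite F" "!!\<xi>. \<xi> \<in> F ==> \<xi> \<noteq> 0" "!!\<xi>. \<xi> \<in> F ==> \<pi> \<xi> = \<xi>" "!!\<xi>. \<xi> \<in> F ==> h \<xi> \<in> F"
  and mult: "!!\<xi> \<xi>'. \<xi> \<in> F ==> \<xi>' \<in> F ==> \<pi> (co (f (pt (vec \<xi>) (vec \<xi>')))) = (if \<xi> = \<xi>' then \<xi> else 0)"
  and one: "(\<Sum>\<xi>\<in>F. \<xi>) = \<pi> (co (u0 1))"
  and span: "!!x. \<exists>c. \<pi> x = (\<Sum>\<xi>\<in>F. pm_scale (c \<xi>) \<xi>)"
 shows "split_iso (st_class G AA A f) (st_class G II A u0)"
proof -
 define m where "m x y = co (f (pt (vec x) (vec y)))" for x y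
 have mb: "bil m" unfolding m_def[abs_def] by (rule bil_kbil[OF kbil_klin[OF klin_comp[OF kG_homD(1)[OF f] co_klin]]])
 note pl = eqv_lin[OF pi(1)]
 note pp = lin_props[OF pl]
 define \<chi> where "\<chi> x = (SOME c. \<pi> x = (\<Sum>\<xi>\<in>F. pm_scale (c \<xi>) \<xi>))" for x
 have chi: "\<pi> x = (\<Sum>\<xi>\<in>F. pm_scale (\<chi> x \<xi>) \<xi>)" for x
  unfolding \<chi>_def by (rule someI_ex[OF span])
 have lm: "linV (%y. \<pi> (m x y))" for x using mb by (intro lin_comp[OF _ pl]) auto
 \<comment> \<open>Orthogonality makes multiplication by \<open>\<xi>\<close> extract its
   coefficient, so coordinates with respect to \<open>F\<close> are unique.\<close>
 have pick: "\<pi> (m \<xi> (\<Sum>\<xi>\<in>F. pm_scale (c \<xi>) \<xi>)) = pm_scale (c \<xi>) \<xi>" if e: "\<xi> \<in> F" for c \<xi>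
 proof -
  have "\<pi> (m \<xi> (\<Sum>\<xi>\<in>F. pm_scale (c \<xi>) \<xi>)) = (\<Sum>\<xi>'\<in>F. pm_scale (c \<xi>') (\<pi> (m \<xi> \<xi>')))"
   by (simp add: lin_props(6)[OF lm] lin_props(2)[OF lm])
  also have "... = (\<Sum>\<xi>'\<in>F. if \<xi>' = \<xi> then pm_scale (c \<xi>) \<xi> else 0)"
   by (rule sum.cong[OF refl]) (use e in \<open>auto simp: m_def mult\<close>)
  finally show ?thesis using e F(1) by simp
 qed
 have uniq: "c \<xi> = c' \<xi>" if "(\<Sum>\<xi>\<in>F. pm_scale (c \<xi>) \<xi>) = (\<Sum>\<xi>\<in>F. pm_scale (c' \<xi>) \<xi>)" "\<xi> \<in> F" for c c' \<xi>
  using pick[OF that(2), of c] pick[OF that(2), of c'] that F(2)[OF that(2)] pm.scale_cancel_right by metis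
 have chiI: "\<chi> x \<xi> = c \<xi>" if "\<pi> x = (\<Sum>\<xi>\<in>F. pm_scale (c \<xi>) \<xi>)" "\<xi> \<in> F" for x c \<xi>
  by (rule uniq[OF _ that(2)]) (use chi[of x] that(1) in simp)
 have chi_add: "\<chi> (x + y) \<xi> = \<chi> x \<xi> + \<chi> y \<xi>" if "\<xi> \<in> F" for x y \<xi>
  by (rule chiI[OF _ that]) (simp add: pp(1) chi[of x] chi[of y] pm.scale_left_distrib sum.distrib)
 have chi_scale: "\<chi> (pm_scale a x) \<xi> = a * \<chi> x \<xi>" if "\<xi> \<in> F" for x a \<xi>
  by (rule chiI[OF _ that]) (simp add: pp(2) chi[of x] pm.scale_sum_right)
 have chi_cut: "\<chi> (cut d x) = \<chi> x" for x unfolding \<chi>_def pi(4) ..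
 have chi_span: "\<chi> (\<Sum>\<xi>\<in>F. pm_scale (c \<xi>) \<xi>) \<xi> = c \<xi>" if "\<xi> \<in> F" for c \<xi>
  by (rule chiI[OF _ that]) (simp add: pp(6) pp(2) F(3))
 have chi_mult: "\<chi> (m (\<pi> x) (\<pi> y)) \<xi> = \<chi> x \<xi> * \<chi> y \<xi>" if "\<xi> \<in> F" for x y \<xi>
 proof (rule chiI[OF _ that])
  have lm': "linV (%z. \<pi> (m z (\<pi> y)))" using mb by (intro lin_comp[OF _ pl]) auto
  have "\<pi> (m (\<pi> x) (\<pi> y)) = (\<Sum>\<xi>\<in>F. pm_scale (\<chi> x \<xi>) (\<pi> (m \<xi> (\<pi> y))))"
   by (subst chi[of x]) (simp add: lin_props(6)[OF lm'] lin_props(2)[OF lm'])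
  also have "... = (\<Sum>\<xi>\<in>F. pm_scale (\<chi> x \<xi> * \<chi> y \<xi>) \<xi>)"
   by (rule sum.cong[OF refl]) (simp add: chi[of y] pick)
  finally show "\<pi> (m (\<pi> x) (\<pi> y)) = (\<Sum>\<xi>\<in>F. pm_scale (\<chi> x \<xi> * \<chi> y \<xi>) \<xi>)" .
 qed
 have cutF: "cut d \<xi> = \<xi>" if "\<xi> \<in> F" for \<xi> using pi(3)[of \<xi>] F(3)[OF that] by simp
 have HF: "(h ^^ s) \<xi> \<in> F" if "\<xi> \<in> F" for s \<xi> using that by (induction s) (auto simp: F(4))
 define ta where "ta t x = co (act A t (vec x))" for t x
 have ta_pow: "ta (g [^] s) x = cut d ((h ^^ s) x)" for s :: nat and x
  using h_pow[of s x] cut_sum[OF Ak(3)[OF gs_carrier[of s] cv(2)], of x x] by (simp add: ta_def)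
 have ta_F: "ta (g [^] s) \<xi> = (h ^^ s) \<xi>" if "\<xi> \<in> F" for s :: nat and \<xi>
  unfolding ta_pow by (rule cutF[OF HF[OF that]])
 have vec_ta: "vec (ta t x) = act A t (vec x)" if "t \<in> carrier G" for t x
  unfolding ta_def by (rule cv(6)[OF Ak(3)[OF that cv(2)]])
 have taF: "ta t \<xi> \<in> F" if t: "t \<in> carrier G" and e: "\<xi> \<in> F" for t \<xi>
 proof -
  obtain s :: nat where "t = g [^] s" using t by (rule carrier_pow)
  then show ?thesis using ta_F[OF e] HF[OF e] by simp
 qed
 have chi_ta: "\<chi> (ta t x) (ta t \<xi>) = \<chi> x \<xi>" if t: "t \<in> carrier G" and e: "\<xi> \<in> F" for t x \<xi>
 proof -
  obtain s :: nat where s: "t = g [^] s" using t by (rule carrier_pow)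
  have inj: "inj_on (h ^^ s) F" by (rule inj_on_inverseI[of _ "hi ^^ s"]) simp
  have "bij_betw (h ^^ s) F F"
   unfolding bij_betw_def using inj endo_inj_surj[OF F(1) _ inj] HF by auto
  from sum.reindex_bij_betw[OF this, of "%\<xi>. pm_scale (\<chi> x ((hi ^^ s) \<xi>)) \<xi>"]
  have "(\<Sum>\<xi>\<in>F. pm_scale (\<chi> x \<xi>) ((h ^^ s) \<xi>)) = (\<Sum>\<xi>\<in>F. pm_scale (\<chi> x ((hi ^^ s) \<xi>)) \<xi>)" by simp
  moreover have "\<pi> (ta t x) = (\<Sum>\<xi>\<in>F. pm_scale (\<chi> x \<xi>) ((h ^^ s) \<xi>))"
   unfolding s ta_pow pi(4) eqv_H[OF pi(1)] chi[of x] by (simp add: H_props)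
  ultimately have "\<pi> (ta t x) = (\<Sum>\<xi>\<in>F. pm_scale (\<chi> x ((hi ^^ s) \<xi>)) \<xi>)" by simp
  from chiI[OF this HF[OF e, of s]] show ?thesis unfolding s ta_F[OF e] by simp
 qed
 have "\<exists>(r::nat) H e. (\<forall>i<r. subgroup (H i) G) \<and>
  bij_betw (%(i, S). e i S) (Sigma {..<r} (%i. lcosets (H i))) F \<and>
  (\<forall>i<r. \<forall>S\<in>lcosets (H i). \<forall>t\<in>carrier G. e i (t <# S) = ta t (e i S))"
 proof (rule orbit_decomposition[OF F(1) taF])
  show "ta \<one> x = x" if "x \<in> F" for x unfolding ta_def Ak(6)[OF cv(2)] cv(5) by (rule cutF[OF that])
  show "ta (s \<otimes> t) x = ta s (ta t x)" if "s \<in> carrier G" "t \<in> carrier G" for s t x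
   using Ak(7)[OF that cv(2)] vec_ta[OF that(2)] by (simp add: ta_def)
 qed
 then obtain r :: nat and H e where H: "!!i. i < r ==> subgroup (H i) G"
  and bij: "bij_betw (%(i, S). e i S) (Sigma {..<r} (%i. lcosets (H i))) F"
  and e_act: "!!i S t. i < r ==> S \<in> lcosets (H i) ==> t \<in> carrier G ==> e i (t <# S) = ta t (e i S)"
  by blast
 have eF: "e i S \<in> F" if "i < r" "S \<in> lcosets (H i)" for i S
  using bij_betwE[OF bij] that by auto
 have reidx: "(\<Sum>i<r. \<Sum>S\<in>lcosets (H i). pm_scale (c (e i S)) (e i S)) = (\<Sum>\<xi>\<in>F. pm_scale (c \<xi>) \<xi>)" for c
  using sum.reindex_bij_betw[OF bij, of "%\<xi>. pm_scale (c \<xi>) \<xi>"] finite_lcosets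
  by (simp add: sum.Sigma case_prod_beta)
 define M where "M i = (perm_rep G (H i) :: ('a, 'k, 'a set \<Rightarrow>\<^sub>0 'k) rep)" for i
 define B where "B = prod_rep {..<r} M"
 have kM: "kG_module G (M i)" if "i \<in> {..<r}" for i unfolding M_def by (rule kG_perm[OF H]) (use that in simp)
 have kB: "kG_module G B" unfolding B_def by (rule kG_prod[OF kM])
 have carB: "b \<in> carrier B \<longleftrightarrow> b \<in> extensional {..<r} \<and> (\<forall>i<r. \<forall>S. S \<notin> lcosets (H i) \<longrightarrow> lookup (b i) S = 0)" for b
  unfolding B_def M_def by (auto simp: PiE_iff free_on_def in_keys_iff subset_iff)
 have eqB: "b = b'" if "b \<in> carrier B" "b' \<in> carrier B" "!!i S. i < r ==> S \<in> lcosets (H i) ==> lookup (b i) S = lookup (b' i) S" for b b'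
 proof (rule extensionalityI[of _ "{..<r}"])
  fix i assume i: "i \<in> {..<r}"
  show "b i = b' i"
  proof (rule poly_mapping_eqI)
   fix S show "lookup (b i) S = lookup (b' i) S"
    using that i by (cases "S \<in> lcosets (H i)") (auto simp: carB)
  qed
 qed (use that carB in auto)
 define fw where "fw a = (\<lambda>i\<in>{..<r}. \<Sum>S\<in>lcosets (H i). single S (\<chi> (co a) (e i S)))" for a
 have lfw: "lookup (fw a i) S = (if S \<in> lcosets (H i) then \<chi> (co a) (e i S) else 0)" if "i < r" for a i S
  using that finite_lcosets by (simp add: fw_def lookup_sum lookup_single when_def)
 have fwB: "fw a \<in> carrier B" for a by (auto simp: carB lfw) (simp add: fw_def)
 have addB: "lookup ((b \<oplus>\<^bsub>B\<^esub> b') i) S = lookup (b i) S + lookup (b' i) S"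
  and scaleB: "lookup ((c \<odot>\<^bsub>B\<^esub> b) i) S = c * lookup (b i) S" if "i < r" for b b' c i S
  using that by (simp_all add: B_def M_def lookup_add)
 have kBm: "kmod B" by (rule kG_moduleD(2)[OF kB])
 have actB: "lookup (act B t b i) S = lookup (b i) (inv t <# S)"
  if "b \<in> carrier B" "t \<in> carrier G" "i < r" "S \<in> lcosets (H i)" for b t i S
 proof -
  have "b i \<in> free_on (lcosets (H i))" using that(1,3) by (auto simp: B_def M_def PiE_iff)
  then show ?thesis using lookup_perm_act[OF H[OF that(3)] _ that(2), of "b i" S] that by (simp add: B_def M_def)
 qed
 have fw_klin: "klin A B fw"
 proof (rule klinI[OF fwB])
  show "fw (x \<oplus>\<^bsub>A\<^esub> y) = fw x \<oplus>\<^bsub>B\<^esub> fw y" if "x \<in> carrier A" "y \<in> carrier A" for x y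
   by (rule eqB[OF fwB kmod_add[OF kBm fwB fwB]]) (simp add: addB lfw co_add that chi_add eF)
  show "fw (c \<odot>\<^bsub>A\<^esub> x) = c \<odot>\<^bsub>B\<^esub> fw x" if "x \<in> carrier A" for x c
   by (rule eqB[OF fwB kmod_scale[OF kBm fwB]]) (simp add: scaleB lfw co_scale that chi_scale eF)
 qed
 have fw_act: "fw (act A t x) = act B t (fw x)" if t: "t \<in> carrier G" and x: "x \<in> carrier A" for t x
 proof (rule eqB[OF fwB kG_moduleD(3)[OF kB t fwB]])
  fix i S assume i: "i < r" and S: "S \<in> lcosets (H i)"
  note tl = translate_lcoset[OF subgroup.subset[OF H[OF i]] S]
  have S': "inv t <# S \<in> lcosets (H i)" by (rule tl(1)[OF inv_closed[OF t]])
  have "e i S = ta t (e i (inv t <# S))" using e_act[OF i S' t] tl(3)[OF t] by simp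
  moreover have "co (act A t x) = ta t (co x)" by (simp add: ta_def cv(6)[OF x])
  ultimately show "lookup (fw (act A t x) i) S = lookup (act B t (fw x) i) S"
   using chi_ta[OF t eF[OF i S']] by (simp add: actB[OF fwB t i S] lfw i S S')
 qed
 define fwd where "fwd = restrict fw (carrier A)"
 have fwda: "fwd a = fw a" if "a \<in> carrier A" for a using that by (simp add: fwd_def)
 have fwd: "fwd \<in> kG_hom G A B" unfolding fwd_def by (rule kG_hom_restrictI[OF A fw_klin fw_act])
 define y where "y b = (\<Sum>i<r. \<Sum>S\<in>lcosets (H i). pm_scale (lookup (b i) S) (e i S))" for b
 have chi_y: "\<chi> (y b) (e i S) = lookup (b i) S" if i: "i < r" and S: "S \<in> lcosets (H i)" for b i S
 proof -
  let ?D = "Sigma {..<r} (%i. lcosets (H i))"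
  define c where "c \<xi> = (case inv_into ?D (%(i, S). e i S) \<xi> of (i, S) => lookup (b i) S)" for \<xi>
  have c: "c (e i S) = lookup (b i) S" if "i < r" "S \<in> lcosets (H i)" for i S
   using inv_into_f_f[OF bij_betw_imp_inj_on[OF bij], of "(i, S)"] that by (simp add: c_def)
  have "y b = (\<Sum>\<xi>\<in>F. pm_scale (c \<xi>) \<xi>)"
   unfolding y_def reidx[symmetric] by (intro sum.cong refl) (simp add: c)
  then show ?thesis using chi_span[OF eF[OF i S], of c] c[OF i S] by simp
 qed
 have fw_y: "fw (vec (y b)) = b" if b: "b \<in> carrier B" for b
  by (rule eqB[OF fwB b]) (simp add: lfw cv(5) chi_cut chi_y)
 have y_fw: "y (fw a) = \<pi> (co a)" for a
  unfolding y_def chi[of "co a"] reidx[symmetric] by (intro sum.cong refl) (simp add: lfw)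
 have y_add: "y (b \<oplus>\<^bsub>B\<^esub> b') = y b + y b'" and y_scale: "y (c \<odot>\<^bsub>B\<^esub> b) = pm_scale c (y b)" for b b' c
  by (simp_all add: y_def addB scaleB pm.scale_left_distrib sum.distrib pm.scale_sum_right)
 define bwd where "bwd = restrict (%b. vec (y b)) (carrier B)"
 have bf_act: "vec (\<pi> (co (act A t a))) = act A t (vec (\<pi> (co a)))" if t: "t \<in> carrier G" and a: "a \<in> carrier A" for t a
 proof -
  obtain s :: nat where s: "t = g [^] s" using t by (rule carrier_pow)
  show ?thesis unfolding s h_pow_co[OF a, symmetric] eqv_H[OF pi(1)] vec_h_pow ..
 qed
 have bwd: "bwd \<in> kG_hom G B A" unfolding bwd_def
 proof (rule kG_hom_restrictI[OF kB])
  show "klin B A (%b. vec (y b))" by (rule klinI) (simp_all add: cv(2) y_add y_scale cv(3,4))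
  show "vec (y (act B t b)) = act A t (vec (y b))" if t: "t \<in> carrier G" and b: "b \<in> carrier B" for t b
  proof -
   have "vec (y (act B t b)) = vec (y (fw (act A t (vec (y b)))))"
    unfolding fw_act[OF t cv(2)] fw_y[OF b] ..
   also have "... = act A t (vec (\<pi> (co (vec (y b)))))" unfolding y_fw by (rule bf_act[OF t cv(2)])
   also have "\<pi> (co (vec (y b))) = y b" unfolding y_fw[symmetric] fw_y[OF b] ..
   finally show ?thesis .
  qed
 qed
 have fb: "compose (carrier B) fwd bwd = id_hom B"
  by (rule kG_hom_eqI[OF kG_hom_compose[OF kB bwd fwd] id_hom_hom[OF kB]])
   (simp add: compose_eq fwd_def bwd_def cv(2) fw_y id_hom_def)
 define BF where "BF = compose (carrier A) bwd fwd"
 have BFh: "BF \<in> kG_hom G A A" unfolding BF_def by (rule kG_hom_compose[OF A fwd bwd])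
 have BF: "BF a = vec (\<pi> (co a))" if "a \<in> carrier A" for a
  using that fwB by (simp add: BF_def compose_eq fwd_def bwd_def y_fw)
 have idA: "id_hom A \<in> kG_hom G A A" by (rule id_hom_hom[OF A])
 have idx: "id_hom A a = a" if "a \<in> carrier A" for a using that by (simp add: id_hom_def)
 have BF_id: "stq A A BF (id_hom A)"
 proof -
  obtain \<theta> where th: "linV \<theta>" "!!x. cut d x - \<pi> x = (\<Sum>s<q. (h ^^ s) (\<theta> ((hi ^^ s) x)))"
   using sz unfolding SZ1_def by blast
  have k: "klin A A (%a. vec (\<theta> (co a)))"
   by (rule klin_comp[OF klin_comp[OF co_klin lin_klin[OF th(1)]] cv(1)])
  show ?thesis
  proof (rule stqI[OF BFh idA k])
   fix a assume a: "a \<in> carrier A"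
   have tc: "tr A A (%a. vec (\<theta> (co a))) a \<in> carrier A" by (rule tr_closed[OF A A k a])
   have "co (tr A A (%a. vec (\<theta> (co a))) a) = cut d (\<Sum>s<q. (h ^^ s) (\<theta> ((hi ^^ s) (co a))))"
    unfolding co_tr[OF A k a] by (simp add: cv(5) hi_pow_co a lin_props(6)[OF cut_lin] H_cut)
   then have "tr A A (%a. vec (\<theta> (co a))) a = vec (cut d (co a) - \<pi> (co a))"
    using cv(6)[OF tc] cv(8) th(2)[of "co a"] by metis
   then have "BF a \<oplus>\<^bsub>A\<^esub> tr A A (%a. vec (\<theta> (co a))) a = vec (\<pi> (co a) + (cut d (co a) - \<pi> (co a)))"
    by (simp only: BF[OF a] cv(3))
   also have "... = id_hom A a" using a by (simp add: cv(6,8) id_hom_def)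
   finally show "id_hom A a = BF a \<oplus>\<^bsub>A\<^esub> tr A A (%a. vec (\<theta> (co a))) a" by simp
  qed
 qed
 have fgB: "fg_kG_module G B"
 proof -
  have "spanned B d (%\<phi>. fw (vec \<phi>))" unfolding spanned_def cv(8) using klin_comp[OF cv(1) fw_klin] by simp
  moreover have "carrier B \<subseteq> range (%\<phi>. fw (vec \<phi>))" using fw_y by (metis rangeI subsetI)
  ultimately show ?thesis using spanned_coords[OF kBm] coords_fg[OF kB] by blast
 qed
 define \<nu> where "\<nu> = prod_mult {..<r} M (%i. perm_mult G (H i))"
 have pm: "perm_mult G (H i) \<in> kG_hom G (M i \<otimes>\<^sub>k M i) (M i)" if "i \<in> {..<r}" for i
  unfolding M_def by (rule perm_mult_hom[OF H]) (use that in simp)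
 have nu: "\<nu> \<in> kG_hom G (B \<otimes>\<^sub>k B) B" unfolding \<nu>_def B_def by (rule prod_mult_hom[OF kM pm])
 have nu_pure: "lookup (\<nu> (pure_tensor B B b b') i) S = lookup (b i) S * lookup (b' i) S"
  if "b \<in> carrier B" "b' \<in> carrier B" "i < r" for b b' i S
 proof -
  have "b i \<in> free_on (lcosets (H i))" "b' i \<in> free_on (lcosets (H i))"
   using that by (auto simp: B_def M_def PiE_iff)
  then show ?thesis
   using that prod_mult_pure[OF kM pm that(1,2)[unfolded B_def]] perm_mult_pure[OF H[OF that(3)], of "b i" "b' i"]
   by (simp add: \<nu>_def B_def M_def lookup_pmul[OF H[OF that(3)]])
 qed
 have th_fwd: "tensor_hom A A B B fwd fwd \<in> kG_hom G AA (B \<otimes>\<^sub>k B)" by (rule tensor_hom_hom[OF A A kB kB fwd fwd])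
 have th_BF: "tensor_hom A A A A BF BF \<in> kG_hom G AA AA" by (rule tensor_hom_hom[OF A A A A BFh BFh])
 have th_id: "tensor_hom A A A A (id_hom A) (id_hom A) \<in> kG_hom G AA AA" by (rule tensor_hom_hom[OF A A A A idA idA])
 have ff: "compose (carrier AA) fwd f \<in> kG_hom G AA B" by (rule kG_hom_compose[OF kAA f fwd])
 \<comment> \<open>With \<open>BF\<close> applied to both arguments the product is formed from core
   elements, where \<open>fwd\<close> is exactly multiplicative. \<open>BF\<close> is then removed
   in the stable category, being stably the identity.\<close>
 have mul1: "compose (carrier AA) (compose (carrier AA) fwd f) (tensor_hom A A A A BF BF) = compose (carrier AA) \<nu> (tensor_hom A A B B fwd fwd)"
 proof (rule kG_hom_eqI[OF kG_hom_compose[OF kAA th_BF ff] kG_hom_compose[OF kAA th_fwd nu]])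
  fix t assume t: "t \<in> carrier AA"
  show "compose (carrier AA) (compose (carrier AA) fwd f) (tensor_hom A A A A BF BF) t = compose (carrier AA) \<nu> (tensor_hom A A B B fwd fwd) t"
  proof (rule klin_eq_pure[OF Ak(2) Ak(2) kG_homD(1)[OF kG_hom_compose[OF kAA th_BF ff]] kG_homD(1)[OF kG_hom_compose[OF kAA th_fwd nu]] t])
   fix a b assume a: "a \<in> carrier A" and b: "b \<in> carrier A"
   have fc: "f (pt (BF a) (BF b)) \<in> carrier A"
    by (rule kG_homD(4)[OF f pt_closed[OF kG_homD(4)[OF BFh a] kG_homD(4)[OF BFh b]]])
   have L: "compose (carrier AA) (compose (carrier AA) fwd f) (tensor_hom A A A A BF BF) (pt a b) = fw (f (pt (BF a) (BF b)))"
    by (simp only: compose_eq[OF pt_closed[OF a b]] tensor_hom_hom_pure[OF A A A A BFh BFh a b]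
      compose_eq[OF pt_closed[OF kG_homD(4)[OF BFh a] kG_homD(4)[OF BFh b]]] fwda[OF fc])
   have R: "compose (carrier AA) \<nu> (tensor_hom A A B B fwd fwd) (pt a b) = \<nu> (pure_tensor B B (fw a) (fw b))"
    by (simp only: compose_eq[OF pt_closed[OF a b]] tensor_hom_hom_pure[OF A A kB kB fwd fwd a b] fwda[OF a] fwda[OF b])
   have "fw (f (pt (BF a) (BF b))) = \<nu> (pure_tensor B B (fw a) (fw b))"
   proof (rule eqB[OF fwB kG_homD(4)[OF nu pure_closed[OF kBm kBm fwB fwB]]])
    fix i S assume i: "i < r" and S: "S \<in> lcosets (H i)"
    have "co (f (pt (BF a) (BF b))) = m (\<pi> (co a)) (\<pi> (co b))" by (simp add: m_def BF a b)
    then show "lookup (fw (f (pt (BF a) (BF b))) i) S = lookup (\<nu> (pure_tensor B B (fw a) (fw b)) i) S"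
     using chi_mult[OF eF[OF i S]] by (simp add: nu_pure[OF fwB fwB i] lfw i S)
   qed
   then show "compose (carrier AA) (compose (carrier AA) fwd f) (tensor_hom A A A A BF BF) (pt a b) = compose (carrier AA) \<nu> (tensor_hom A A B B fwd fwd) (pt a b)"
    unfolding L R .
  qed
 qed
 have mul2: "compose (carrier AA) (compose (carrier AA) fwd f) (tensor_hom A A A A (id_hom A) (id_hom A)) = compose (carrier AA) fwd f"
 proof (rule kG_hom_eqI[OF kG_hom_compose[OF kAA th_id ff] ff])
  fix t assume t: "t \<in> carrier AA"
  have "tensor_hom A A A A (id_hom A) (id_hom A) t = t"
   by (rule klin_eq_pure[OF Ak(2) Ak(2) kG_homD(1)[OF th_id] klin_ident t])
    (simp add: tensor_hom_hom_pure[OF A A A A idA idA] idx)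
  then show "compose (carrier AA) (compose (carrier AA) fwd f) (tensor_hom A A A A (id_hom A) (id_hom A)) t = compose (carrier AA) fwd f t"
   by (simp only: compose_eq[OF t])
 qed
 have mul: "stq AA B (compose (carrier AA) \<nu> (tensor_hom A A B B fwd fwd)) (compose (carrier AA) fwd f)"
  using stq_compose[OF kAA kAA kB stq_tensor[OF A A A A BF_id BF_id] stq_refl[OF kAA kB ff]] unfolding mul1 mul2 .
 have kI: "kG_module G II" by (rule kG_unit[OF group_axioms])
 have unit: "compose (carrier II) fwd u0 = prod_unit {..<r} (%i. perm_unit G (H i))"
 proof
  fix c
  have u1: "u0 1 \<in> carrier A" using kG_homD(4)[OF u0] by simp
  have uc: "u0 c = c \<odot>\<^bsub>A\<^esub> u0 1" using klin_scaleD[OF kG_homD(1)[OF u0], of 1 c] by simp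
  have "\<chi> (co (u0 1)) \<xi> = 1" if "\<xi> \<in> F" for \<xi>
   by (rule chiI[OF _ that]) (simp add: one)
  then have ch: "\<chi> (co (u0 c)) \<xi> = c" if "\<xi> \<in> F" for \<xi>
   using that by (simp add: uc co_scale u1 chi_scale)
  have "fw (u0 c) = prod_unit {..<r} (%i. perm_unit G (H i)) c"
   unfolding fw_def prod_unit_def
   by (intro restrict_ext) (auto simp: perm_unit_def ch eF intro!: sum.cong)
  then show "compose (carrier II) fwd u0 c = prod_unit {..<r} (%i. perm_unit G (H i)) c"
   using kG_homD(4)[OF u0, of c] by (simp add: compose_def fwd_def)
 qed
 have "st_ring_isomorphic G A (st_class G AA A f) (st_class G II A u0) B (st_class G (B \<otimes>\<^sub>k B) B \<nu>)
   (st_class G II B (prod_unit {..<r} (%i. perm_unit G (H i))))"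
  unfolding st_ring_isomorphic_def
 proof (intro bexI[of _ "st_class G A B fwd"] bexI[of _ "st_class G B A bwd"] conjI)
  show "st_comp G A A (st_class G B A bwd) (st_class G A B fwd) = st_id G A"
   unfolding st_comp_class[OF A fgB fg_A fwd bwd] st_id_def BF_def[symmetric] st_class_eq[OF A fg_A BFh] by (rule BF_id)
  show "st_comp G B B (st_class G A B fwd) (st_class G B A bwd) = st_id G B"
   unfolding st_comp_class[OF kB fg_A fgB bwd fwd] fb st_id_def ..
  show "st_comp G AA B (st_class G A B fwd) (st_class G AA A f) =
    st_comp G AA B (st_class G (B \<otimes>\<^sub>k B) B \<nu>) (st_tensor G A A B B (st_class G A B fwd) (st_class G A B fwd))"
   unfolding st_tensor_class[OF A A fgB fgB fwd fwd] st_comp_class[OF kAA fg_A fgB f fwd]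
    st_comp_class[OF kAA fg_tensor[OF fgB fgB] fgB th_fwd nu]
   by (rule sym) (simp only: st_class_eq[OF kAA fgB kG_hom_compose[OF kAA th_fwd nu]] mul)
  show "st_comp G II B (st_class G A B fwd) (st_class G II A u0) = st_class G II B (prod_unit {..<r} (%i. perm_unit G (H i)))"
   unfolding st_comp_class[OF kI fg_A fgB u0 fwd] unit ..
 qed (rule st_class_hom[OF fwd] st_class_hom[OF bwd])+
 then show ?thesis using H unfolding B_def \<nu>_def M_def[abs_def] by blast
qed

theorem stable_ring_object_split:
 assumes sc: "separably_closed TYPE('k)" and p: "prime p" "CHAR('k) = p" and q: "q = p ^ n"
  and ro: "st_ring_object G A \<mu> v" and cm: "st_commutative G A \<mu>" and sp: "st_separable G A \<mu>"
 shows "split_iso \<mu> v"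
proof -
 have st: "\<mu> \<in> st_hom G AA A" "v \<in> st_hom G II A" using ro unfolding st_ring_object_def by auto
 obtain f where f: "f \<in> kG_hom G AA A" and mu: "\<mu> = st_class G AA A f" using st(1) by (rule st_homE)
 obtain u0 where u0: "u0 \<in> kG_hom G II A" and v: "v = st_class G II A u0" using st(2) by (rule st_homE)
 obtain ee where "salg d q h hi ee (%x y. co (f (pt (vec x) (vec y)))) (co (u0 1))"
  using salg_of_ring_object[OF f u0 ro[unfolded mu v] cm[unfolded mu] sp[unfolded mu]] by blast
 from salg.permuted_idempotents[OF this sc p q] obtain \<pi> F where
  pF: "eqv \<pi>" "\<forall>x. \<pi> (\<pi> x) = \<pi> x \<and> cut d (\<pi> x) = \<pi> x \<and> \<pi> (cut d x) = \<pi> x"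
  "SZ1 (%x. cut d x - \<pi> x)" "finite F" "\<forall>\<xi>\<in>F. \<xi> \<noteq> 0 \<and> \<pi> \<xi> = \<xi> \<and> h \<xi> \<in> F"
  "\<forall>\<xi>\<in>F. \<forall>\<xi>'\<in>F. \<pi> (co (f (pt (vec \<xi>) (vec \<xi>')))) = (if \<xi> = \<xi>' then \<xi> else 0)"
  "(\<Sum>\<xi>\<in>F. \<xi>) = \<pi> (co (u0 1))" "\<forall>x. \<exists>c. \<pi> x = (\<Sum>\<xi>\<in>F. pm_scale (c \<xi>) \<xi>)"
  by blast
 show ?thesis unfolding mu v
  by (rule ring_iso[OF f u0 pF(1) _ _ _ pF(3,4) _ _ _ _ pF(7)]) (use pF(2,5,6,8) in blast)+
qed

end

theorem mainTheorem1:
  fixes G :: "('g, 'z) monoid_scheme"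
    and A :: "('g, 'k::field, 'a) rep"
    and \<mu> :: "(('a \<times> 'a \<Rightarrow>\<^sub>0 'k) set \<Rightarrow> 'a) set"
    and u :: "('k \<Rightarrow> 'a) set"
    and p n :: nat
  assumes "separably_closed TYPE('k)"
    and "CHAR('k) = p" and "p > 0"
    and "group G" and "cyclic_group G" and "Coset.order G = p ^ n"
    and "st_ring_object G A \<mu> u"
    and "st_commutative G A \<mu>"
    and "st_separable G A \<mu>"
  shows "\<exists>(r::nat) (H :: nat \<Rightarrow> 'g set).
    (\<forall>i<r. subgroup (H i) G) \<and>
    (let M = (\<lambda>i. perm_rep G (H i) :: ('g, 'k, 'g set \<Rightarrow>\<^sub>0 'k) rep);
         B = prod_rep {..<r} M
     in st_ring_isomorphic G A \<mu> u
          B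
          (st_class G (B \<otimes>\<^sub>k B) B (prod_mult {..<r} M (\<lambda>i. perm_mult G (H i))))
          (st_class G \<one>\<^sub>k B (prod_unit {..<r} (\<lambda>i. perm_unit G (H i)))))"
proof -
 interpret group G by fact
 have p: "prime p" using assms(2,3) prime_CHAR_semidom[where 'a = 'k] by simp
 have fin: "finite (carrier G)"
  using assms(3,6) unfolding Coset.order_def by (metis card.infinite less_irrefl zero_less_power)
 interpret finite_group G by unfold_locales (rule fin)
 obtain g where g: "g \<in> carrier G" "carrier G = range (%n::int. g [^]\<^bsub>G\<^esub> n)"
  using assms(5) cyclic_group by blast
 define q where "q = p ^ n"
 have q: "q > 0" using assms(3) by (simp add: q_def)
 have card: "card (carrier G) = q" using assms(6) by (simp add: Coset.order_def q_def)
 have gq: "g [^]\<^bsub>G\<^esub> q = \<one>\<^bsub>G\<^esub>" using pow_order_eq_1[OF g(1)] assms(6) by (simp add: q_def)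
 \<comment> \<open>The generator is given with integer exponents, whereas \<open>crep\<close>
   enumerates the group by exponents below \<open>q\<close>; reduction modulo \<open>q\<close> gives
   surjectivity, and counting gives injectivity.\<close>
 have "carrier G \<subseteq> (%s::nat. g [^]\<^bsub>G\<^esub> s) ` {..<q}"
 proof
  fix t assume "t \<in> carrier G"
  then obtain k :: int where k: "t = g [^]\<^bsub>G\<^esub> k" using g(2) by blast
  have "g [^]\<^bsub>G\<^esub> k = g [^]\<^bsub>G\<^esub> (int q * (k div int q) + int (nat (k mod int q)))"
   using q by simp
  also have "... = g [^]\<^bsub>G\<^esub> (int q * (k div int q)) \<otimes>\<^bsub>G\<^esub> g [^]\<^bsub>G\<^esub> (nat (k mod int q))"
   by (simp only: int_pow_mult[OF g(1)] int_pow_int)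
  also have "g [^]\<^bsub>G\<^esub> (int q * (k div int q)) = (g [^]\<^bsub>G\<^esub> int q) [^]\<^bsub>G\<^esub> (k div int q)"
   using int_pow_pow[OF g(1)] by simp
  also have "... = \<one>\<^bsub>G\<^esub>" by (simp add: int_pow_int gq)
  finally have "t = g [^]\<^bsub>G\<^esub> (nat (k mod int q))" using k g(1) by simp
  moreover have "nat (k mod int q) < q" using q by (simp add: nat_less_iff)
  ultimately show "t \<in> (%s::nat. g [^]\<^bsub>G\<^esub> s) ` {..<q}" by blast
 qed
 then have im: "(%s::nat. g [^]\<^bsub>G\<^esub> s) ` {..<q} = carrier G" using g(1) by auto
 have bij: "bij_betw (%s::nat. g [^]\<^bsub>G\<^esub> s) {..<q} (carrier G)"
  unfolding bij_betw_def using im eq_card_imp_inj_on[of "{..<q}" "%s::nat. g [^]\<^bsub>G\<^esub> s"] card by simp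
 have fgA: "fg_kG_module G A" using assms(7) by (simp add: st_ring_object_def)
 then have A: "kG_module G A" by (simp add: fg_kG_module_def)
 obtain d co vec where c: "coords A d co vec" using fg_coords[OF fgA fin] by blast
 interpret crep G g q A d co vec by unfold_locales (rule g(1) bij gq A c)+
 show ?thesis
  unfolding Let_def by (rule stable_ring_object_split[OF assms(1) p assms(2) q_def assms(7-9)])
qed

end
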